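(* Let $\Omega\subset\mathbb{R}^n$ be an open set. If $s\in\mathbb{R}$ and $\{a,b,c\}\in\mathcal C^{s-1}_+(\overline\Omega)$, then the bilinear form $$\mathcal E(u,v):=\sum_{i,j=1}^n\langle a_{ij}\partial_ju,\partial_iv\rangle_\Omega+\sum_{j=1}^n\langle b_j\partial_ju,v\rangle_\Omega+\langle cu,v\rangle_\Omega,\qquad \mathcal E:\{H^s(\Omega),\widetilde H^{2-s}(\Omega)\}\to\mathbb{C},$$ is bounded, while the expressions $$\langle Au,v\rangle_\Omega:=\mathcal E(u,v)\quad\forall\,v\in\widetilde H^{2-s}(\Omega),\qquad\langle A^*v,u\rangle_\Omega:=\mathcal E^*(v,u):=\overline{\mathcal E(\bar u,\bar v)}\quad\forall\,u\in\widetilde H^s(\Omega)$$ define bounded linear operators $A:H^s(\Omega)\to H^{s-2}(\Omega)$ and $A^*:H^{2-s}(\Omega)\to H^{-s}(\Omega)$, respectively.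
   Context: All function spaces are for $\mathbb{C}^m$-valued functions, $m\ge1$; $a_{ij},b_j,c$ are $m\times m$ complex matrix functions on $\Omega$. $H^s(\Omega)$ is the space of restrictions to $\Omega$ of elements of the $L_2$-based Bessel potential space $H^s(\mathbb{R}^n)$ (quotient norm); $\widetilde H^s(\Omega)$ is the closure of $C^\infty_{comp}(\Omega)$ in $H^s(\mathbb{R}^n)$; $\langle\cdot,\cdot\rangle_\Omega$ is the bilinear dual product between $H^s(\Omega)$ and $\widetilde H^{-s}(\Omega)$ extending $\int_\Omega u\cdot v\,dx$, so that $H^{-s}(\Omega)=[\widetilde H^s(\Omega)]^*$. Coefficient classes. $W^\mu_\infty(\mathbb{R}^n)$, $\mu\ge0$, is the $L_\infty$-based Sobolev–Slobodetski space: for integer $\mu$ the norm is $\sum_{|\alpha|\le\mu}\|\partial^\alpha g\|_{L_\infty}$; for non-integer $\mu$ it is $\|g\|_{W^{\lfloor\mu\rfloor}_\infty}+\sum_{|\alpha|=\lfloor\mu\rfloor}\operatorname{ess\,sup}_{x,y}\frac{|\partial^\alpha g(x)-\partial^\alpha g(y)|}{|x-y|^{\mu-\lfloor\mu\rfloor}}$. $\bar C^\mu(\overline\Omega)$ is the set of restrictions to $\Omega$ of functions from $W^\mu_\infty(\mathbb{R}^n)$, with the norm $\inf_{G|_\Omega=g}\|G\|_{W^\mu_\infty(\mathbb{R}^n)}$. $\bar C^\mu_+(\overline\Omega):=\bar C^\mu(\overline\Omega)$ for integer $\mu\ge0$, and $\bar C^\mu_+(\overline\Omega):=\bigcup_{\nu>\mu}\bar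 C^\nu(\overline\Omega)$ for non-integer $\mu\geq 0$. For $\sigma\in\mathbb{R}$, $\{a,b,c\}\in\mathcal C^\sigma_+(\overline\Omega)$ means $a\in\bar C^{|\sigma|}_+(\overline\Omega)$, $b\in\bar C^{\mu_b(\sigma)}_+(\overline\Omega)$ with $\mu_b(\sigma)=\max(0,|\sigma-\frac12|-\frac12)$, and $c\in\bar C^{\mu_c(\sigma)}_+(\overline\Omega)$ with $\mu_c(\sigma)=\max(0,|\sigma|-1)$. *)

theory Defs
  imports "HOL-Analysis.Analysis"
begin

section \<open>Test functions\<close>

definition partial :: "'n \<Rightarrow> (real^'n \<Rightarrow> 'a::real_normed_vector) \<Rightarrow> real^'n \<Rightarrow> 'a" where
  "partial j f x = frechet_derivative f (at x) (axis j 1)"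

text \<open>Higher derivatives are indexed by lists of coordinate directions instead of multi-indices;
  the length of the list is the order of the derivative.\<close>

definition partials :: "'n list \<Rightarrow> (real^'n \<Rightarrow> 'a::real_normed_vector) \<Rightarrow> real^'n \<Rightarrow> 'a" where
  "partials js f = foldr partial js f"

definition smooth :: "(real^'n \<Rightarrow> 'a::real_normed_vector) \<Rightarrow> bool" where
  "smooth f \<longleftrightarrow> (\<forall>js x. partials js f differentiable (at x))"

definition test_functions :: "(real^'n) set \<Rightarrow> (real^'n \<Rightarrow> 'a::real_normed_vector) set" where
  "test_functions \<Omega> = {\<phi>. smooth \<phi> \<and> compact (closure {x. \<phi> x \<noteq> 0}) \<and> closure {x. \<phi> x \<noteq> 0} \<subseteq> \<Omega>}"

definition schwartz :: "(real^'n \<Rightarrow> 'a::real_normed_vector) set" where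
  "schwartz = {\<phi>. smooth \<phi> \<and> (\<forall>js k. bounded (range (\<lambda>x. (1 + norm x)^k *\<^sub>R partials js \<phi> x)))}"


section \<open>Vector-valued distributions\<close>

text \<open>A $C^m$-valued distribution is a complex-linear functional on $C^m$-valued test functions;
  a function $f$ corresponds to the functional mapping a test function to the integral of the
  bilinear (not sesquilinear) product with $f$. Distributions on $R^n$ act on Schwartz functions,
  distributions on $\Omega$ on the smooth functions with compact support in $\Omega$. Functionals
  take the value 0 outside their space of test functions, so that equality of distributions is
  equality of HOL functions.\<close>

type_synonym ('n, 'm) vfun = "real^'n \<Rightarrow> complex^'m"
type_synonym ('n, 'm) mfun = "real^'n \<Rightarrow> complex^'m^'m"
type_synonym ('n, 'm) vdist = "('n, 'm) vfun \<Rightarrow> complex"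

definition cdot :: "complex^'m \<Rightarrow> complex^'m \<Rightarrow> complex" where
  "cdot z w = (\<Sum>k\<in>UNIV. z $ k * w $ k)"

definition on_tests :: "('n::finite, 'm::finite) vfun set \<Rightarrow> ('n, 'm) vdist \<Rightarrow> ('n, 'm) vdist" where
  "on_tests X u = (\<lambda>\<phi>. if \<phi> \<in> X then u \<phi> else 0)"

definition add_dist :: "('n::finite, 'm::finite) vdist \<Rightarrow> ('n, 'm) vdist \<Rightarrow> ('n, 'm) vdist" where
  "add_dist u v = (\<lambda>\<phi>. u \<phi> + v \<phi>)"

definition scale_dist :: "complex \<Rightarrow> ('n::finite, 'm::finite) vdist \<Rightarrow> ('n, 'm) vdist" where
  "scale_dist z u = (\<lambda>\<phi>. z * u \<phi>)"

definition diff_dist :: "('n::finite, 'm::finite) vdist \<Rightarrow> ('n, 'm) vdist \<Rightarrow> ('n, 'm) vdist" where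
  "diff_dist u v = (\<lambda>\<phi>. u \<phi> - v \<phi>)"

definition conj_vec :: "complex^'m \<Rightarrow> complex^'m" where
  "conj_vec z = (\<chi> k. cnj (z $ k))"

definition conj_dist :: "('n::finite, 'm::finite) vdist \<Rightarrow> ('n, 'm) vdist" where
  "conj_dist u = (\<lambda>\<phi>. cnj (u (\<lambda>x. conj_vec (\<phi> x))))"

definition partial_dist :: "('n::finite, 'm::finite) vfun set \<Rightarrow> 'n \<Rightarrow> ('n, 'm) vdist \<Rightarrow> ('n, 'm) vdist" where
  "partial_dist X j u = on_tests X (\<lambda>\<phi>. - u (partial j \<phi>))"

definition regular_dist :: "('n::finite, 'm::finite) vfun set \<Rightarrow> ('n, 'm) vfun \<Rightarrow> ('n, 'm) vdist" where
  "regular_dist X f = on_tests X (\<lambda>\<phi>. \<integral>x. cdot (f x) (\<phi> x) \<partial>lebesgue)"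

definition tempered :: "('n::finite, 'm::finite) vdist set" where
  "tempered = {u. u = on_tests schwartz u \<and>
     (\<forall>\<phi>\<in>schwartz. \<forall>\<psi>\<in>schwartz. u (\<lambda>x. \<phi> x + \<psi> x) = u \<phi> + u \<psi>) \<and>
     (\<forall>z. \<forall>\<phi>\<in>schwartz. u (\<lambda>x. z *s \<phi> x) = z * u \<phi>) \<and>
     (\<exists>C N. \<forall>\<phi>\<in>schwartz. \<forall>M.
        (\<forall>js x. length js \<le> N \<longrightarrow> (1 + norm x)^N * norm (partials js \<phi> x) \<le> M) \<longrightarrow>
        cmod (u \<phi>) \<le> C * M)}"


section \<open>Bessel potential spaces\<close>

definition fourier :: "('n::finite, 'm::finite) vfun \<Rightarrow> ('n, 'm) vfun" where
  "fourier \<phi> \<xi> =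
     ((2 * pi) powr (- real CARD('n) / 2)) *\<^sub>R (\<integral>x. cis (- (x \<bullet> \<xi>)) *s \<phi> x \<partial>lebesgue)"

text \<open>The Fourier transform of the tempered distribution \<open>u\<close> is the function \<open>g\<close>.\<close>

definition fourier_rep :: "('n::finite, 'm::finite) vdist \<Rightarrow> ('n, 'm) vfun \<Rightarrow> bool" where
  "fourier_rep u g \<longleftrightarrow> g \<in> borel_measurable lebesgue \<and>
     (\<forall>\<phi>\<in>schwartz. integrable lebesgue (\<lambda>\<xi>. cdot (g \<xi>) (\<phi> \<xi>)) \<and>
        u (fourier \<phi>) = (\<integral>\<xi>. cdot (g \<xi>) (\<phi> \<xi>) \<partial>lebesgue))"

definition Hs :: "real \<Rightarrow> ('n::finite, 'm::finite) vdist set" where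
  "Hs s = {u \<in> tempered. \<exists>g. fourier_rep u g \<and>
     integrable lebesgue (\<lambda>\<xi>. (1 + (norm \<xi>)\<^sup>2) powr s * (norm (g \<xi>))\<^sup>2)}"

text \<open>The representing function is unique up to null sets, so the choice does not matter.\<close>

definition Hs_norm :: "real \<Rightarrow> ('n::finite, 'm::finite) vdist \<Rightarrow> real" where
  "Hs_norm s u =
     sqrt (\<integral>\<xi>. (1 + (norm \<xi>)\<^sup>2) powr s * (norm ((SOME g. fourier_rep u g) \<xi>))\<^sup>2 \<partial>lebesgue)"

definition Hs_on :: "(real^'n) set \<Rightarrow> real \<Rightarrow> ('n::finite, 'm::finite) vdist set" where
  "Hs_on \<Omega> s = on_tests (test_functions \<Omega>) ` Hs s"

definition Hs_on_norm :: "(real^'n) set \<Rightarrow> real \<Rightarrow> ('n::finite, 'm::finite) vdist \<Rightarrow> real" where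
  "Hs_on_norm \<Omega> s u = Inf (Hs_norm s ` {U \<in> Hs s. on_tests (test_functions \<Omega>) U = u})"

definition Hs_tilde :: "(real^'n) set \<Rightarrow> real \<Rightarrow> ('n::finite, 'm::finite) vdist set" where
  "Hs_tilde \<Omega> s = {v \<in> Hs s. \<forall>\<epsilon>>0. \<exists>\<phi>\<in>test_functions \<Omega>.
     Hs_norm s (diff_dist v (regular_dist schwartz \<phi>)) < \<epsilon>}"

text \<open>The dual product of $u \in H^s(\Omega)$ and $v \in \tilde H^{-s}(\Omega)$: the extension by
  continuity, in the second argument, of the action of \<open>u\<close> on test functions.\<close>

definition dual_prod ::
    "(real^'n) set \<Rightarrow> real \<Rightarrow> ('n::finite, 'm::finite) vdist \<Rightarrow> ('n, 'm) vdist \<Rightarrow> complex" where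
  "dual_prod \<Omega> s u v = (THE z. \<forall>\<phi>. (\<forall>k::nat. \<phi> k \<in> test_functions \<Omega>) \<and>
     (\<lambda>k. Hs_norm (- s) (diff_dist v (regular_dist schwartz (\<phi> k)))) \<longlonglongrightarrow> 0 \<longrightarrow>
     (\<lambda>k. u (\<phi> k)) \<longlonglongrightarrow> z)"


section \<open>Coefficient classes\<close>

definition Linfty :: "(real^'n \<Rightarrow> 'a::euclidean_space) set" where
  "Linfty = {g. g \<in> borel_measurable lebesgue \<and> (\<exists>C. AE x in lebesgue. norm (g x) \<le> C)}"

definition weak_partials ::
    "'n list \<Rightarrow> (real^'n \<Rightarrow> 'a::euclidean_space) \<Rightarrow> (real^'n \<Rightarrow> 'a) \<Rightarrow> bool" where
  "weak_partials js g h \<longleftrightarrow> (\<forall>\<phi> :: real^'n \<Rightarrow> real. \<phi> \<in> test_functions UNIV \<longrightarrow>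
     (\<integral>x. partials js \<phi> x *\<^sub>R g x \<partial>lebesgue) = (-1)^length js *\<^sub>R (\<integral>x. \<phi> x *\<^sub>R h x \<partial>lebesgue))"

definition Winfty :: "real \<Rightarrow> (real^'n \<Rightarrow> 'a::euclidean_space) set" where
  "Winfty \<mu> = {g \<in> Linfty. \<forall>js. int (length js) \<le> \<lfloor>\<mu>\<rfloor> \<longrightarrow> (\<exists>h\<in>Linfty. weak_partials js g h \<and>
     (\<mu> \<notin> \<int> \<and> int (length js) = \<lfloor>\<mu>\<rfloor> \<longrightarrow>
        (\<exists>C. AE p in lebesgue. case p of (x, y) \<Rightarrow>
           norm (h x - h y) \<le> C * norm (x - y) powr (\<mu> - \<lfloor>\<mu>\<rfloor>))))}"

text \<open>Only the values on \<open>\<Omega>\<close> of an element of this class matter, up to null sets.\<close>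

definition Cbar :: "(real^'n) set \<Rightarrow> real \<Rightarrow> (real^'n \<Rightarrow> 'a::euclidean_space) set" where
  "Cbar \<Omega> \<mu> = {g. \<exists>G\<in>Winfty \<mu>. AE x in lebesgue. x \<in> \<Omega> \<longrightarrow> g x = G x}"

definition Cbar_plus :: "(real^'n) set \<Rightarrow> real \<Rightarrow> (real^'n \<Rightarrow> 'a::euclidean_space) set" where
  "Cbar_plus \<Omega> \<mu> = (if \<mu> \<in> \<int> then Cbar \<Omega> \<mu> else (\<Union>\<nu>\<in>{\<mu><..}. Cbar \<Omega> \<nu>))"

definition coeff_class :: "(real^'n) set \<Rightarrow> real \<Rightarrow>
    ('n \<Rightarrow> 'n \<Rightarrow> ('n::finite, 'm::finite) mfun) \<Rightarrow> ('n \<Rightarrow> ('n, 'm) mfun) \<Rightarrow> ('n, 'm) mfun \<Rightarrow> bool" where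
  "coeff_class \<Omega> \<sigma> a b c \<longleftrightarrow>
     (\<forall>i j. a i j \<in> Cbar_plus \<Omega> \<bar>\<sigma>\<bar>) \<and>
     (\<forall>j. b j \<in> Cbar_plus \<Omega> (max 0 (\<bar>\<sigma> - 1/2\<bar> - 1/2))) \<and>
     c \<in> Cbar_plus \<Omega> (max 0 (\<bar>\<sigma>\<bar> - 1))"


section \<open>Multiplication by coefficients\<close>

text \<open>The product \<open>g w\<close> for $w \in H^t(\Omega)$ is given by transposition. For $t \ge 0$ the
  element \<open>w\<close> is in $L_2(\Omega)$, the product at order 0 is the integral of the pointwise
  product, and \<open>g w\<close> is the pointwise product; hence the order \<open>min t 0\<close>. As the test function
  \<open>\<phi>\<close> vanishes outside \<open>\<Omega>\<close>, the values of \<open>g\<close> there are irrelevant.\<close>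

definition mult_on ::
    "(real^'n) set \<Rightarrow> real \<Rightarrow> ('n::finite, 'm::finite) mfun \<Rightarrow> ('n, 'm) vdist \<Rightarrow> ('n, 'm) vdist" where
  "mult_on \<Omega> t g w = on_tests (test_functions \<Omega>)
     (\<lambda>\<phi>. dual_prod \<Omega> (min t 0) w (regular_dist schwartz (\<lambda>x. transpose (g x) *v \<phi> x)))"

text \<open>For $w \in \tilde H^t(\Omega)$, a distribution on $R^n$, the transposed coefficient times the
  Schwartz function is restricted to \<open>\<Omega>\<close> and tested against \<open>w\<close>. This is the continuous extension
  of multiplication, followed by extension by zero, from test functions on \<open>\<Omega>\<close>.\<close>

definition mult_tilde ::
    "(real^'n) set \<Rightarrow> real \<Rightarrow> ('n::finite, 'm::finite) mfun \<Rightarrow> ('n, 'm) vdist \<Rightarrow> ('n, 'm) vdist" where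
  "mult_tilde \<Omega> t g w = on_tests schwartz
     (\<lambda>\<phi>. dual_prod \<Omega> (- min t 0)
       (regular_dist (test_functions \<Omega>) (\<lambda>x. transpose (g x) *v \<phi> x)) w)"


section \<open>The bilinear form and its adjoint\<close>

abbreviation partial_on :: "(real^'n) set \<Rightarrow> 'n \<Rightarrow> ('n::finite, 'm::finite) vdist \<Rightarrow> ('n, 'm) vdist" where
  "partial_on \<Omega> \<equiv> partial_dist (test_functions \<Omega>)"

abbreviation partial_Rn :: "'n \<Rightarrow> ('n::finite, 'm::finite) vdist \<Rightarrow> ('n, 'm) vdist" where
  "partial_Rn \<equiv> partial_dist schwartz"

text \<open>For $u \in H^s(\Omega)$ and $v \in \tilde H^{2-s}(\Omega)$.\<close>

definition form_E :: "(real^'n) set \<Rightarrow> real \<Rightarrow>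
    ('n \<Rightarrow> 'n \<Rightarrow> ('n::finite, 'm::finite) mfun) \<Rightarrow> ('n \<Rightarrow> ('n, 'm) mfun) \<Rightarrow> ('n, 'm) mfun \<Rightarrow>
    ('n, 'm) vdist \<Rightarrow> ('n, 'm) vdist \<Rightarrow> complex" where
  "form_E \<Omega> s a b c u v =
     (\<Sum>i\<in>UNIV. \<Sum>j\<in>UNIV.
        dual_prod \<Omega> (s - 1) (mult_on \<Omega> (s - 1) (a i j) (partial_on \<Omega> j u)) (partial_Rn i v)) +
     (\<Sum>j\<in>UNIV. dual_prod \<Omega> (s - 2) (mult_on \<Omega> (s - 1) (b j) (partial_on \<Omega> j u)) v) +
     dual_prod \<Omega> (s - 2) (mult_on \<Omega> s c u) v"

text \<open>All factors in the dual products of \<open>form_E\<close> are in the required spaces.\<close>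

definition form_E_defined :: "(real^'n) set \<Rightarrow> real \<Rightarrow>
    ('n \<Rightarrow> 'n \<Rightarrow> ('n::finite, 'm::finite) mfun) \<Rightarrow> ('n \<Rightarrow> ('n, 'm) mfun) \<Rightarrow> ('n, 'm) mfun \<Rightarrow>
    ('n, 'm) vdist \<Rightarrow> ('n, 'm) vdist \<Rightarrow> bool" where
  "form_E_defined \<Omega> s a b c u v \<longleftrightarrow>
     (\<forall>i j. mult_on \<Omega> (s - 1) (a i j) (partial_on \<Omega> j u) \<in> Hs_on \<Omega> (s - 1)) \<and>
     (\<forall>i. partial_Rn i v \<in> Hs_tilde \<Omega> (1 - s)) \<and>
     (\<forall>j. mult_on \<Omega> (s - 1) (b j) (partial_on \<Omega> j u) \<in> Hs_on \<Omega> (s - 2)) \<and>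
     mult_on \<Omega> s c u \<in> Hs_on \<Omega> (s - 2)"

text \<open>The same form for $u \in \tilde H^s(\Omega)$ and $v \in H^{2-s}(\Omega)$, as needed for the
  adjoint. Here the first factor of each dual product is in a space $\tilde H^t(\Omega)$ and the
  second one in $H^{-t}(\Omega)$; the dual product is symmetric, and \<open>dual_prod\<close> expects the element
  of the latter space first.\<close>

definition form_E_tilde :: "(real^'n) set \<Rightarrow> real \<Rightarrow>
    ('n \<Rightarrow> 'n \<Rightarrow> ('n::finite, 'm::finite) mfun) \<Rightarrow> ('n \<Rightarrow> ('n, 'm) mfun) \<Rightarrow> ('n, 'm) mfun \<Rightarrow>
    ('n, 'm) vdist \<Rightarrow> ('n, 'm) vdist \<Rightarrow> complex" where
  "form_E_tilde \<Omega> s a b c u v =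
     (\<Sum>i\<in>UNIV. \<Sum>j\<in>UNIV.
        dual_prod \<Omega> (1 - s) (partial_on \<Omega> i v) (mult_tilde \<Omega> (s - 1) (a i j) (partial_Rn j u))) +
     (\<Sum>j\<in>UNIV. dual_prod \<Omega> (2 - s) v (mult_tilde \<Omega> (s - 1) (b j) (partial_Rn j u))) +
     dual_prod \<Omega> (2 - s) v (mult_tilde \<Omega> s c u)"

definition form_E_tilde_defined :: "(real^'n) set \<Rightarrow> real \<Rightarrow>
    ('n \<Rightarrow> 'n \<Rightarrow> ('n::finite, 'm::finite) mfun) \<Rightarrow> ('n \<Rightarrow> ('n, 'm) mfun) \<Rightarrow> ('n, 'm) mfun \<Rightarrow>
    ('n, 'm) vdist \<Rightarrow> ('n, 'm) vdist \<Rightarrow> bool" where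
  "form_E_tilde_defined \<Omega> s a b c u v \<longleftrightarrow>
     (\<forall>i. partial_on \<Omega> i v \<in> Hs_on \<Omega> (1 - s)) \<and>
     (\<forall>i j. mult_tilde \<Omega> (s - 1) (a i j) (partial_Rn j u) \<in> Hs_tilde \<Omega> (s - 1)) \<and>
     (\<forall>j. mult_tilde \<Omega> (s - 1) (b j) (partial_Rn j u) \<in> Hs_tilde \<Omega> (s - 2)) \<and>
     mult_tilde \<Omega> s c u \<in> Hs_tilde \<Omega> (s - 2)"

definition form_E_adj :: "(real^'n) set \<Rightarrow> real \<Rightarrow>
    ('n \<Rightarrow> 'n \<Rightarrow> ('n::finite, 'm::finite) mfun) \<Rightarrow> ('n \<Rightarrow> ('n, 'm) mfun) \<Rightarrow> ('n, 'm) mfun \<Rightarrow>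
    ('n, 'm) vdist \<Rightarrow> ('n, 'm) vdist \<Rightarrow> complex" where
  "form_E_adj \<Omega> s a b c v u = cnj (form_E_tilde \<Omega> s a b c (conj_dist u) (conj_dist v))"

text \<open>The operator from \<open>V\<close> to $H^t(\Omega)$ that a form on $V \times \tilde H^{-t}(\Omega)$ defines.\<close>

definition form_represents :: "(real^'n) set \<Rightarrow> real \<Rightarrow>
    (('n::finite, 'm::finite) vdist \<Rightarrow> ('n, 'm) vdist \<Rightarrow> complex) \<Rightarrow> ('n, 'm) vdist \<Rightarrow> ('n, 'm) vdist \<Rightarrow> bool" where
  "form_represents \<Omega> t B u w \<longleftrightarrow>
     w \<in> Hs_on \<Omega> t \<and> (\<forall>v\<in>Hs_tilde \<Omega> (- t). dual_prod \<Omega> t w v = B u v)"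

definition form_operator :: "(real^'n) set \<Rightarrow> real \<Rightarrow>
    (('n::finite, 'm::finite) vdist \<Rightarrow> ('n, 'm) vdist \<Rightarrow> complex) \<Rightarrow> ('n, 'm) vdist \<Rightarrow> ('n, 'm) vdist" where
  "form_operator \<Omega> t B u = (THE w. form_represents \<Omega> t B u w)"


section \<open>Boundedness\<close>

definition bounded_operator ::
    "('n::finite, 'm::finite) vdist set \<Rightarrow> (('n, 'm) vdist \<Rightarrow> real) \<Rightarrow>
     ('n, 'm) vdist set \<Rightarrow> (('n, 'm) vdist \<Rightarrow> real) \<Rightarrow>
     (('n, 'm) vdist \<Rightarrow> ('n, 'm) vdist) \<Rightarrow> bool" where
  "bounded_operator V nV W nW A \<longleftrightarrow>
     (\<forall>u\<in>V. A u \<in> W) \<and>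
     (\<forall>u\<in>V. \<forall>u'\<in>V. A (add_dist u u') = add_dist (A u) (A u')) \<and>
     (\<forall>z. \<forall>u\<in>V. A (scale_dist z u) = scale_dist z (A u)) \<and>
     (\<exists>C. \<forall>u\<in>V. nW (A u) \<le> C * nV u)"

definition bounded_bilinear_form ::
    "('n::finite, 'm::finite) vdist set \<Rightarrow> (('n, 'm) vdist \<Rightarrow> real) \<Rightarrow>
     ('n, 'm) vdist set \<Rightarrow> (('n, 'm) vdist \<Rightarrow> real) \<Rightarrow>
     (('n, 'm) vdist \<Rightarrow> ('n, 'm) vdist \<Rightarrow> complex) \<Rightarrow> bool" where
  "bounded_bilinear_form V nV W nW B \<longleftrightarrow>
     (\<forall>u\<in>V. \<forall>u'\<in>V. \<forall>v\<in>W. B (add_dist u u') v = B u v + B u' v) \<and>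
     (\<forall>u\<in>V. \<forall>v\<in>W. \<forall>v'\<in>W. B u (add_dist v v') = B u v + B u v') \<and>
     (\<forall>z. \<forall>u\<in>V. \<forall>v\<in>W. B (scale_dist z u) v = z * B u v \<and> B u (scale_dist z v) = z * B u v) \<and>
     (\<exists>C. \<forall>u\<in>V. \<forall>v\<in>W. cmod (B u v) \<le> C * nV u * nW v)"

end

theory Submission
  imports Defs "HOL-Probability.Distributions" "HOL-Probability.Sinc_Integral"
begin

text \<open>The proof transports everything to $R^n$ and to the Fourier side. An element of $H^s(R^n)$ is the
  same as a function in a weighted $L_2$ space, and the integral of the product of two such functions
  (one of them reflected) is a bilinear pairing of $H^\tau(R^n)$ with $H^{-\tau}(R^n)$ which satisfies the
  Cauchy-Schwarz inequality and extends the action of distributions on test functions. By density of the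
  test functions, the dual product on an open set is this pairing, applied to any extension of the first
  factor (lemma \<open>dual_prod_pair\<close>). Derivatives have order one on this scale, so everything depends on
  multiplication by the coefficients.

  Multiplication by \<open>G\<close> is bounded in $H^t$, $t \ge 0$, if \<open>G\<close> is in $W^\nu_\infty$ with $\nu > t$ or with
  $\nu = t$ an integer (lemma \<open>Winfty_multiplier\<close>). The order is reduced by the product rule until it is
  less than 1. Between 0 and 1, the $H^t$ norm is equivalent to a weighted sum of squared $L_2$ norms of
  differences with dyadic steps, as one reads off the Fourier transform. If $\nu < 1$, the differences of
  \<open>G\<close> are bounded by a higher power of the step and are summable; if $\nu \ge 1$, the bounds of orders 0
  and 1 are interpolated by splitting the other factor, for each step, into its low and high
  frequencies. For negative orders multiplication is the transpose of multiplication by the transposed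
  matrix, and the symmetry of the pairing makes the definitions for all orders compatible. Products with
  test functions on the open set stay in $\tilde H^t$, since they can be mollified inside the set.

  The first order coefficients need to act at an order $\beta$ between $s - 2$ and $s - 1$, the zero order
  coefficient at an order $\gamma$ between $s - 2$ and $s$. The orders of least absolute value with this
  property are exactly those of the coefficient classes. The form is then the pairing with a bounded
  operator from $H^s(R^n)$ to $H^{s-2}(R^n)$, the adjoint form the pairing with its transpose, conjugated,
  and the bounds pass to the quotient norms.\<close>

section \<open>Notation\<close>

text \<open>Integrals are over Lebesgue measure. The exponential kernel and the symbol of a derivative are those
 of the Fourier transform; \<open>jb x\<close> is the square of the Japanese bracket.\<close>

abbreviation lmeas :: "('a::euclidean_space => 'b::topological_space) set" where "lmeas \<equiv> borel_measurable lebesgue"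
abbreviation lebint :: "('a::euclidean_space => 'b::{banach, second_countable_topology}) => 'b" (binder "INTG " 10)
 where "lebint f \<equiv> integral\<^sup>L lebesgue f"
abbreviation lebnint :: "('a::euclidean_space => ennreal) => ennreal" (binder "NINT " 10)
 where "lebnint f \<equiv> integral\<^sup>N lebesgue f"
abbreviation seq_tendsto :: "(nat => 'a::topological_space) => 'a => bool" (infixr "--->" 60)
 where "X ---> L \<equiv> X \<longlonglongrightarrow> L"
notation scaleR (infixr "*R" 75)
abbreviation "reg \<equiv> regular_dist schwartz"
abbreviation "restr Om \<equiv> on_tests (test_functions Om)"
abbreviation "jb x \<equiv> 1 + (norm x)^2"
abbreviation "esq v \<equiv> ennreal ((norm v)^2)"
abbreviation "ek x y \<equiv> cis (- (x \<bullet> y))"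
abbreviation "dsym j x \<equiv> \<i> * complex_of_real (x $ j)"
abbreviation trp :: "('n::finite, 'm::finite) mfun => ('n, 'm) mfun" where "trp G \<equiv> %x. transpose (G x)"

section \<open>Square-integrable functions\<close>

definition L2 :: "'a measure => ('a => 'b::euclidean_space) set" where
"L2 M = {f : borel_measurable M. integrable M (%x. (norm (f x))^2)}"

definition L2norm :: "'a measure => ('a => 'b::euclidean_space) => real" where
"L2norm M f = sqrt (\<integral>x. (norm (f x))^2 \<partial>M)"

lemma L2_measurable: "f : L2 M ==> f : borel_measurable M"
by (simp add: L2_def)

lemma L2norm_nonneg [simp]: "0 <= L2norm M f"
by (simp add: L2norm_def)

lemma L2norm_square: "(L2norm M f)^2 = (\<integral>x. (norm (f x))^2 \<partial>M)"
by (simp add: L2norm_def)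

lemma L2_bound:
assumes "f : L2 M" "g : borel_measurable M" "AE x in M. norm (g x) <= C * norm (f x)" "0 <= C"
shows "g : L2 M" "L2norm M g <= C * L2norm M f"
proof -
have i: "integrable M (%x. C^2 * (norm (f x))^2)"
 using assms(1) by (simp add: L2_def)
have ae: "AE x in M. (norm (g x))^2 <= C^2 * (norm (f x))^2"
 using assms(3) by eventually_elim (metis norm_ge_zero power_mono power_mult_distrib)
show g: "g : L2 M"
 unfolding L2_def using assms(2) ae
 by (auto intro!: Bochner_Integration.integrable_bound[OF i])
have "(\<integral>x. (norm (g x))^2 \<partial>M) <= (\<integral>x. C^2 * (norm (f x))^2 \<partial>M)"
 using g i ae by (intro integral_mono_AE) (auto simp: L2_def)
then have "L2norm M g <= sqrt (C^2 * (\<integral>x. (norm (f x))^2 \<partial>M))"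
 unfolding L2norm_def by simp
then show "L2norm M g <= C * L2norm M f"
 using assms(4) by (simp add: L2norm_def real_sqrt_mult)
qed

lemma L2norm_cong_AE:
assumes "f : borel_measurable M" "g : borel_measurable M" "AE x in M. norm (f x) = norm (g x)"
shows "L2norm M f = L2norm M g"
unfolding L2norm_def using assms by (auto intro!: arg_cong[where f=sqrt] integral_cong_AE)

lemma L2_mult_integrable:
assumes "f : L2 M" "g : L2 M"
shows "integrable M (%x. norm (f x) * norm (g x))"
proof (rule Bochner_Integration.integrable_bound[of M "%x. (norm (f x))^2 + (norm (g x))^2"])
show "AE x in M. norm (norm (f x) * norm (g x)) <= norm ((norm (f x))^2 + (norm (g x))^2)"
proof (intro AE_I2)
 fix x
 show "norm (norm (f x) * norm (g x)) <= norm ((norm (f x))^2 + (norm (g x))^2)"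
  using sum_squares_bound[of "norm (f x)" "norm (g x)"]
  by (auto simp: abs_mult intro: order_trans[rotated])
qed
qed (use assms in \<open>auto simp: L2_def\<close>)

lemma L2_Cauchy_Schwarz:
assumes f: "f : L2 M" and g: "g : L2 M"
shows "(\<integral>x. norm (f x) * norm (g x) \<partial>M) <= L2norm M f * L2norm M g"
proof -
define A where "A = (\<integral>x. (norm (f x))^2 \<partial>M)"
define B where "B = (\<integral>x. (norm (g x))^2 \<partial>M)"
define C where "C = (\<integral>x. norm (f x) * norm (g x) \<partial>M)"
have int: "integrable M (%x. (norm (f x))^2)" "integrable M (%x. (norm (g x))^2)"
 "integrable M (%x. norm (f x) * norm (g x))"
 using f g L2_mult_integrable by (auto simp: L2_def)
have B0: "B \<ge> 0" "A \<ge> 0" by (simp_all add: A_def B_def)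
have "C^2 <= A * B"
proof (cases "B = 0")
 case True
 then have "AE x in M. (norm (g x))^2 = 0"
  using integral_nonneg_eq_0_iff_AE[OF int(2)] by (simp add: B_def)
 then have "AE x in M. norm (f x) * norm (g x) = 0"
  by eventually_elim simp
 then have "C = 0" unfolding C_def by (rule integral_eq_zero_AE)
 then show ?thesis using True by simp
next
 case False
 have "0 <= (\<integral>x. (B * norm (f x) - C * norm (g x))^2 \<partial>M)" by simp
 also have "... = (\<integral>x. B^2 * (norm (f x))^2 - 2 * B * C * (norm (f x) * norm (g x)) + C^2 * (norm (g x))^2 \<partial>M)"
  by (simp add: power2_diff power_mult_distrib algebra_simps)
 also have "... = B^2 * A - 2 * B * C * C + C^2 * B"
  using int by (simp add: A_def B_def C_def)
 also have "... = B * (A * B - C^2)" by (simp add: algebra_simps power2_eq_square)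
 finally show ?thesis using False B0 by (simp add: zero_le_mult_iff)
qed
then have "C <= sqrt (A * B)" by (rule real_le_rsqrt)
then have "C <= sqrt A * sqrt B" by (simp add: real_sqrt_mult)
then show ?thesis by (simp add: A_def B_def C_def L2norm_def)
qed

lemma L2_inner_integrable:
assumes "f : L2 M" "g : L2 M"
shows "integrable M (%x. inner (f x) (g x))"
by (rule Bochner_Integration.integrable_bound[OF L2_mult_integrable[OF assms]])
 (use assms in \<open>auto simp: L2_def Cauchy_Schwarz_ineq2\<close>)

lemma L2_inner_bound:
assumes "f : L2 M" "g : L2 M"
shows "\<bar>\<integral>x. inner (f x) (g x) \<partial>M\<bar> <= L2norm M f * L2norm M g"
proof -
have "\<bar>\<integral>x. inner (f x) (g x) \<partial>M\<bar> <= (\<integral>x. norm (f x) * norm (g x) \<partial>M)"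
 by (rule integral_abs_bound[THEN order_trans])
  (intro integral_mono L2_mult_integrable assms integrable_abs L2_inner_integrable Cauchy_Schwarz_ineq2)
then show ?thesis using L2_Cauchy_Schwarz[OF assms] by simp
qed

lemma L2_add:
assumes "f : L2 M" "g : L2 M"
shows "(%x. f x + g x) : L2 M"
proof -
have "integrable M (%x. (norm (f x))^2 + 2 * inner (f x) (g x) + (norm (g x))^2)"
 using assms L2_inner_integrable[OF assms] by (auto simp: L2_def)
moreover have "(norm (f x + g x))^2 = (norm (f x))^2 + 2 * inner (f x) (g x) + (norm (g x))^2" for x
 by (simp add: power2_norm_eq_inner inner_add inner_commute)
ultimately show ?thesis using assms borel_measurable_add by (auto simp: L2_def)
qed

lemma L2norm_triangle:
assumes "f : L2 M" "g : L2 M"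
shows "L2norm M (%x. f x + g x) <= L2norm M f + L2norm M g"
proof (rule power2_le_imp_le)
have "(L2norm M (%x. f x + g x))^2
  = (\<integral>x. (norm (f x))^2 + 2 * inner (f x) (g x) + (norm (g x))^2 \<partial>M)"
 unfolding L2norm_square
 by (intro Bochner_Integration.integral_cong refl)
  (simp add: power2_norm_eq_inner inner_add inner_commute)
also have "... = (L2norm M f)^2 + 2 * (\<integral>x. inner (f x) (g x) \<partial>M) + (L2norm M g)^2"
 using assms L2_inner_integrable[OF assms] by (simp add: L2norm_square L2_def)
also have "... <= (L2norm M f + L2norm M g)^2"
 using L2_inner_bound[OF assms] by (simp add: power2_sum)
finally show "(L2norm M (%x. f x + g x))^2 <= (L2norm M f + L2norm M g)^2" .
qed simp

lemma L2_scaleR: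
assumes "f : L2 M" shows "(%x. r *R f x) : L2 M"
using assms by (auto simp: L2_def power_mult_distrib)

lemma L2_diff:
assumes "f : L2 M" "g : L2 M"
shows "(%x. f x - g x) : L2 M"
using L2_add[OF assms(1) L2_scaleR[OF assms(2), of "-1"]] by simp

lemma L2norm_minus_commute: "L2norm M (%x. f x - g x) = L2norm M (%x. g x - f x)"
by (simp add: L2norm_def norm_minus_commute)

lemma L2norm_diff_ge:
assumes "f : L2 M" "g : L2 M"
shows "\<bar>L2norm M f - L2norm M g\<bar> <= L2norm M (%x. f x - g x)"
using L2norm_triangle[OF L2_diff[OF assms] assms(2)] L2norm_triangle[OF L2_diff[OF assms(2,1)] assms(1)]
by (simp add: L2norm_minus_commute[of M f g])

lemma L2_nn_integral:
assumes "f : L2 M"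
shows "(\<integral>\<^sup>+x. esq (f x) \<partial>M) = ennreal ((L2norm M f)^2)"
using assms by (simp add: L2norm_square L2_def nn_integral_eq_integral)

lemma L2I_nn_integral:
assumes "f : borel_measurable M" "(\<integral>\<^sup>+x. esq (f x) \<partial>M) <= ennreal (C^2)" "0 <= C"
shows "f : L2 M" "L2norm M f <= C"
proof -
have "(\<integral>\<^sup>+x. esq (f x) \<partial>M) < \<infinity>"
 using assms(2) by (simp add: le_less_trans)
then show f: "f : L2 M"
 using assms(1) by (auto simp: L2_def integrable_iff_bounded)
have "(L2norm M f)^2 <= C^2"
 using assms(2) L2_nn_integral[OF f] by simp
then show "L2norm M f <= C" using assms(3) by (rule power2_le_imp_le)
qed

text \<open>A fast Cauchy subsequence converges almost everywhere since the weighted sum of the squares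
of its increments has a finite integral; Fatou's lemma then gives convergence in norm.\<close>

lemma L2_complete:
fixes F :: "nat => 'a => 'b::euclidean_space"
assumes F: "!!k. F k : L2 M"
 and C: "!!e. e > 0 ==> \<exists>N. \<forall>m\<ge>N. \<forall>n\<ge>N. L2norm M (%x. F m x - F n x) < e"
shows "\<exists>g\<in>L2 M. (%k. L2norm M (%x. F k x - g x)) ---> 0"
proof -
note [measurable] = L2_measurable[OF F]
have "\<forall>k. \<exists>N. \<forall>m\<ge>N. \<forall>n\<ge>N. L2norm M (%x. F m x - F n x) < (1/2)^k"
 using C by simp
then obtain N where N: "!!k m n. m \<ge> N k ==> n \<ge> N k ==> L2norm M (%x. F m x - F n x) < (1/2)^k"
 by metis
define r where "r k = (\<Sum>i\<le>k. N i) + k" for k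
have r_ge: "r k \<ge> N k" "r k \<ge> k" for k
 using member_le_sum[of k "{..k}" N] by (auto simp: r_def)
have r_mono: "r k <= r (Suc k)" for k by (simp add: r_def)
have r_N: "L2norm M (%x. F (r (Suc k)) x - F (r k) x) < (1/2)^k" for k
 using r_ge(1)[of k] r_mono[of k] by (intro N) auto
define d where "d k = (%x. (norm (F (r (Suc k)) x - F (r k) x))^2)" for k
have [measurable]: "d k : borel_measurable M" for k by (simp add: d_def)
have "(\<integral>\<^sup>+x. ennreal (2^k * d k x) \<partial>M) <= ennreal ((1/2)^k)" for k
proof -
 have "(\<integral>\<^sup>+x. ennreal (2^k * d k x) \<partial>M) = ennreal (2^k) * (\<integral>\<^sup>+x. ennreal (d k x) \<partial>M)"
  by (simp add: ennreal_mult' nn_integral_cmult)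
 also have "... = ennreal (2^k) * ennreal ((L2norm M (%x. F (r (Suc k)) x - F (r k) x))^2)"
  by (simp add: d_def L2_nn_integral[OF L2_diff[OF F F]])
 also have "... <= ennreal (2^k) * ennreal (((1/2)^k)^2)"
  by (intro mult_left_mono ennreal_leI power_mono less_imp_le[OF r_N]) simp_all
 also have "... = ennreal ((1/2)^k)"
  by (simp add: ennreal_mult'[symmetric] power2_eq_square power_mult_distrib[symmetric] flip: power_add)
 finally show ?thesis .
qed
then have "(\<Sum>k. \<integral>\<^sup>+x. ennreal (2^k * d k x) \<partial>M) <= (\<Sum>k. ennreal ((1/2)^k))"
 by (intro suminf_le) auto
also have "... < \<infinity>"
 by (subst suminf_ennreal2) auto
finally have "(\<integral>\<^sup>+x. (\<Sum>k. ennreal (2^k * d k x)) \<partial>M) < \<infinity>"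
 by (subst nn_integral_suminf) auto
then have "AE x in M. (\<Sum>k. ennreal (2^k * d k x)) ~= \<infinity>"
 by (intro nn_integral_PInf_AE) auto
then have conv: "AE x in M. convergent (%k. F (r k) x)"
proof eventually_elim
 case (elim x)
 define S where "S = enn2real (\<Sum>k. ennreal (2^k * d k x))"
 have S: "ennreal S = (\<Sum>k. ennreal (2^k * d k x))"
  using elim by (simp add: S_def less_top)
 have "S \<ge> 0" by (simp add: S_def)
 have bd: "2^k * d k x <= S" for k
 proof -
  have "ennreal (2^k * d k x) <= (\<Sum>k. ennreal (2^k * d k x))"
   using sum_le_suminf[of "%k. ennreal (2^k * d k x)" "{k}"] by simp
  then show ?thesis unfolding S[symmetric] using \<open>S \<ge> 0\<close> by simp
 qed
 have nb: "norm (F (r (Suc k)) x - F (r k) x) <= sqrt S * (sqrt (1/2))^k" for k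
 proof -
  have "d k x <= S * (1/2)^k" using bd[of k] by (simp add: field_simps)
  then have "sqrt (d k x) <= sqrt (S * (1/2)^k)" by simp
  then show ?thesis by (simp add: d_def real_sqrt_mult real_sqrt_power real_sqrt_divide power_divide)
 qed
 have "summable (%k. sqrt S * (sqrt (1/2))^k)"
  by (intro summable_mult summable_geometric) simp
 then have "summable (%k. F (r (Suc k)) x - F (r k) x)"
  by (rule summable_comparison_test'[where N=0]) (use nb in simp)
 then have "convergent (%n. \<Sum>k<n. F (r (Suc k)) x - F (r k) x)"
  by (simp add: summable_iff_convergent)
 then have "convergent (%n. F (r n) x - F (r 0) x)"
  by (simp only: sum_lessThan_telescope[where f="%k. F (r k) x"])
 then have "convergent (%n. (F (r n) x - F (r 0) x) + F (r 0) x)"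
  by (intro convergent_add convergent_const)
 then show ?case by simp
qed
define g where "g x = lim (%k. F (r k) x)" for x
have g_meas [measurable]: "g : borel_measurable M"
 unfolding g_def by (intro borel_measurable_lim_metric) simp
have lim: "AE x in M. (%k. F (r k) x) ---> g x"
 using conv by eventually_elim (simp add: g_def convergent_LIMSEQ_iff)
have key: "(%x. F m x - g x) : L2 M & L2norm M (%x. F m x - g x) <= (1/2)^k" if "m \<ge> N k" for m k
proof -
 have "(\<integral>\<^sup>+x. esq (F m x - g x) \<partial>M)
   = (\<integral>\<^sup>+x. liminf (%l. esq (F m x - F (r l) x)) \<partial>M)"
 proof (rule nn_integral_cong_AE, use lim in eventually_elim)
  case (elim x)
  have "(%l. esq (F m x - F (r l) x)) ---> esq (F m x - g x)"
   by (intro tendsto_ennrealI tendsto_intros elim)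
  then show ?case by (rule lim_imp_Liminf[OF trivial_limit_sequentially, symmetric])
 qed
 also have "... <= liminf (%l. \<integral>\<^sup>+x. esq (F m x - F (r l) x) \<partial>M)"
  by (rule nn_integral_liminf) simp
 also have "... <= ennreal (((1/2)^k)^2)"
 proof (rule Liminf_le)
  show "\<forall>\<^sub>F l in sequentially. (\<integral>\<^sup>+x. esq (F m x - F (r l) x) \<partial>M) <= ennreal (((1/2)^k)^2)"
   unfolding eventually_sequentially
  proof (intro exI[of _ "N k"] allI impI)
   fix l assume "N k <= l"
   then have "N k <= r l" using r_ge(2)[of l] by simp
   then show "(\<integral>\<^sup>+x. esq (F m x - F (r l) x) \<partial>M) <= ennreal (((1/2)^k)^2)"
    unfolding L2_nn_integral[OF L2_diff[OF F F]]
    using N[OF that, of "r l"] by (intro ennreal_leI power_mono) auto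
  qed
 qed simp
 finally show ?thesis
  using L2I_nn_integral[of "%x. F m x - g x" M "(1/2)^k"] by simp
qed
have "g : L2 M"
 using L2_diff[OF F conjunct1[OF key[of 0 "N 0"]], of "N 0"] by simp
moreover have "(%k. L2norm M (%x. F k x - g x)) ---> 0"
proof (rule LIMSEQ_I)
 fix e :: real assume "e > 0"
 then obtain k where k: "(1/2)^k < e" using real_arch_pow_inv[of e "1/2"] by auto
 show "\<exists>no. \<forall>n\<ge>no. norm (L2norm M (%x. F n x - g x) - 0) < e"
 proof (intro exI[of _ "N k"] allI impI)
  fix n assume "n \<ge> N k"
  then show "norm (L2norm M (%x. F n x - g x) - 0) < e"
   using key[of k n] k by simp
 qed
qed
ultimately show ?thesis by blast
qed

lemma L2norm_tendsto:
assumes "!!k. F k : L2 M" "g : L2 M" "(%k. L2norm M (%x. F k x - g x)) ---> 0"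
shows "(%k. L2norm M (F k)) ---> L2norm M g"
proof (rule Lim_null[THEN iffD2], rule Lim_null_comparison[OF _ assms(3)])
show "\<forall>\<^sub>F k in sequentially. norm (L2norm M (F k) - L2norm M g) <= L2norm M (%x. F k x - g x)"
 using L2norm_diff_ge[OF assms(1,2)] by (simp add: eventually_sequentially)
qed

lemma L2_inner_tendsto:
assumes "!!k. F k : L2 M" "g : L2 M" "h : L2 M" "(%k. L2norm M (%x. F k x - g x)) ---> 0"
shows "(%k. \<integral>x. inner (F k x) (h x) \<partial>M) ---> (\<integral>x. inner (g x) (h x) \<partial>M)"
proof (rule Lim_null[THEN iffD2], rule Lim_null_comparison)
show "(%k. L2norm M (%x. F k x - g x) * L2norm M h) ---> 0"
 using tendsto_mult_right[OF assms(4), of "L2norm M h"] by simp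
have "(\<integral>x. inner (F k x) (h x) \<partial>M) - (\<integral>x. inner (g x) (h x) \<partial>M) = (\<integral>x. inner (F k x - g x) (h x) \<partial>M)" for k
 using assms by (simp add: inner_diff_left L2_inner_integrable)
then show "\<forall>\<^sub>F k in sequentially. norm ((\<integral>x. inner (F k x) (h x) \<partial>M) - (\<integral>x. inner (g x) (h x) \<partial>M))
  <= L2norm M (%x. F k x - g x) * L2norm M h"
 using L2_inner_bound[OF L2_diff[OF assms(1,2)] assms(3)] by simp
qed

lemma parallelogram_law:
fixes a b :: "'a::real_inner"
shows "(norm (a + b))^2 + (norm (a - b))^2 = 2 * (norm a)^2 + 2 * (norm b)^2"
unfolding power2_norm_eq_inner by (simp add: inner_add inner_diff inner_commute)

text \<open>The Riesz representation theorem for a functional that is defined on a linear subspace only.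
A minimising sequence of $\|f\|^2 - 2\ell(f)$ is a Cauchy sequence by the parallelogram law, and
its limit represents $\ell$. That the limit is approximated from within the subspace
is what density statements are drawn from.\<close>

lemma L2_Riesz:
fixes X :: "('a => 'b::euclidean_space) set" and l :: "('a => 'b) => real"
assumes X: "X \<subseteq> L2 M" "X ~= {}"
 and X_add: "!!f g. f : X ==> g : X ==> (%x. f x + g x) : X"
 and X_scale: "!!f r. f : X ==> (%x. r *R f x) : X"
 and l_add: "!!f g. f : X ==> g : X ==> l (%x. f x + g x) = l f + l g"
 and l_scale: "!!f r. f : X ==> l (%x. r *R f x) = r * l f"
 and l_bound: "!!f. f : X ==> \<bar>l f\<bar> <= K * L2norm M f"
obtains g F where "g : L2 M" "!!k::nat. F k : X" "(%k. L2norm M (%x. F k x - g x)) ---> 0"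
 "!!f. f : X ==> l f = (\<integral>x. inner (g x) (f x) \<partial>M)" "L2norm M g <= \<bar>K\<bar>"
proof -
define J where "J f = (L2norm M f)^2 - 2 * l f" for f
have J_lower: "- K\<^sup>2 <= J f" if "f : X" for f
proof -
 have "l f <= K * L2norm M f" using l_bound[OF that] by simp
 moreover have "0 <= (L2norm M f - K)^2" by simp
 ultimately show ?thesis by (simp add: J_def power2_diff algebra_simps)
qed
define I where "I = Inf (J ` X)"
have bdd: "bdd_below (J ` X)" using J_lower by (intro bdd_belowI2[of _ "- K\<^sup>2"])
have I_le: "I <= J f" if "f : X" for f
 unfolding I_def using bdd that by (auto intro: cInf_lower)
have "\<exists>f\<in>X. J f < I + 1 / real (Suc k)" for k
 using cInf_lessD[of "J ` X" "I + 1 / real (Suc k)"] X(2) by (auto simp: I_def)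
then obtain F where F: "!!k. F k : X" "!!k. J (F k) < I + 1 / real (Suc k)" by metis
have FL: "F k : L2 M" for k using F X by blast
\<comment> \<open>By the parallelogram law, since the midpoint is in \<open>X\<close> as well.\<close>
have sq: "(L2norm M (%x. F m x - F n x))^2 <= 2 / real (Suc m) + 2 / real (Suc n)" for m n
proof -
 define h where "h = (%x. (1/2) *R (F m x + F n x))"
 have h: "h : X" unfolding h_def using X_scale[OF X_add[OF F(1) F(1)]] .
 have lh: "l h = (l (F m) + l (F n)) / 2"
  unfolding h_def using l_scale[OF X_add[OF F(1) F(1)], of "1/2" m n] l_add[OF F(1) F(1)] by simp
 have "(L2norm M (%x. F m x - F n x))^2 + 4 * (L2norm M h)^2
   = (\<integral>x. (norm (F m x - F n x))^2 + 4 * (norm (h x))^2 \<partial>M)"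
  using L2_diff[OF FL FL] h X(1) by (subst Bochner_Integration.integral_add) (auto simp: L2norm_square L2_def)
 also have "... = (\<integral>x. 2 * (norm (F m x))^2 + 2 * (norm (F n x))^2 \<partial>M)"
 proof (intro Bochner_Integration.integral_cong refl)
  fix x
  have "norm (h x) = norm (F m x + F n x) / 2" by (simp add: h_def del: scaleR_add_right)
  then show "(norm (F m x - F n x))^2 + 4 * (norm (h x))^2 = 2 * (norm (F m x))^2 + 2 * (norm (F n x))^2"
   using parallelogram_law[of "F m x" "F n x"] by (simp only: power_divide) simp
 qed
 also have "... = 2 * (L2norm M (F m))^2 + 2 * (L2norm M (F n))^2"
  using FL by (simp add: L2norm_square L2_def)
 finally have "(L2norm M (%x. F m x - F n x))^2 = 2 * J (F m) + 2 * J (F n) - 4 * J h"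
  by (simp add: J_def lh field_simps)
 also have "... <= 2 / real (Suc m) + 2 / real (Suc n)"
  using F(2)[of m] F(2)[of n] I_le[OF h] by simp
 finally show ?thesis .
qed
have "\<exists>N. \<forall>m\<ge>N. \<forall>n\<ge>N. L2norm M (%x. F m x - F n x) < e" if "e > 0" for e
proof -
 have "0 < e^2 / 4" using that by simp
 then obtain N where N: "inverse (real (Suc N)) < e^2 / 4"
  using reals_Archimedean by blast
 show ?thesis
 proof (intro exI[of _ N] allI impI)
  fix m n assume "N <= m" "N <= n"
  then have "2 / real (Suc m) <= 2 / real (Suc N)" "2 / real (Suc n) <= 2 / real (Suc N)"
   by (intro divide_left_mono; simp)+
  then have "(L2norm M (%x. F m x - F n x))^2 < e^2"
   using sq[of m n] N by (simp add: inverse_eq_divide)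
  then show "L2norm M (%x. F m x - F n x) < e"
   using that by (simp add: power2_less_imp_less)
 qed
qed
then obtain g where g: "g : L2 M" "(%k. L2norm M (%x. F k x - g x)) ---> 0"
 using L2_complete[of F M] FL by blast
have repr: "l f = (\<integral>x. inner (g x) (f x) \<partial>M)" if f: "f : X" for f
proof -
 have fL: "f : L2 M" using f X by blast
 define b where "b k = (\<integral>x. inner (F k x) (f x) \<partial>M) - l f" for k
 define c where "c = (\<integral>x. inner (g x) (f x) \<partial>M) - l f"
 have bc: "b ---> c"
  unfolding b_def c_def by (intro tendsto_intros L2_inner_tendsto FL g fL)
 have ineq: "- (1 / real (Suc k)) <= 2 * t * b k + t^2 * (L2norm M f)^2" for k t
 proof -
  have m: "(%x. F k x + t *R f x) : X" using X_add[OF F(1) X_scale[OF f]] .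
  have "(L2norm M (%x. F k x + t *R f x))^2
   = (\<integral>x. (norm (F k x))^2 + 2 * t * inner (F k x) (f x) + t^2 * (norm (f x))^2 \<partial>M)"
   unfolding L2norm_square power2_norm_eq_inner
   by (intro Bochner_Integration.integral_cong refl)
    (simp add: inner_add inner_commute algebra_simps power2_eq_square)
  also have "... = (L2norm M (F k))^2 + 2 * t * (\<integral>x. inner (F k x) (f x) \<partial>M) + t^2 * (L2norm M f)^2"
   using FL[of k] fL L2_inner_integrable[OF FL fL, of k] by (simp add: L2norm_square L2_def)
  finally have "J (%x. F k x + t *R f x) = J (F k) + 2 * t * b k + t^2 * (L2norm M f)^2"
   using l_add[OF F(1) X_scale[OF f]] l_scale[OF f] by (simp add: J_def b_def algebra_simps)
  then show ?thesis using I_le[OF m] F(2)[of k] by simp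
 qed
 have quad: "0 <= 2 * t * c + t^2 * (L2norm M f)^2" for t
 proof (rule LIMSEQ_le)
  show "(%k. - (1 / real (Suc k))) ---> 0"
   using tendsto_minus[OF LIMSEQ_inverse_real_of_nat] by (simp add: inverse_eq_divide)
  show "(%k. 2 * t * b k + t^2 * (L2norm M f)^2) ---> 2 * t * c + t^2 * (L2norm M f)^2"
   by (intro tendsto_intros bc)
 qed (use ineq in blast)
 have "c = 0"
 proof (rule ccontr)
  assume c: "c ~= 0"
  define D where "D = (L2norm M f)^2 + 1"
  have D: "D \<ge> 1" by (simp add: D_def)
  have "0 <= 2 * (- c / D) * c + (- c / D)^2 * (L2norm M f)^2" by (rule quad)
  also have "... <= 2 * (- c / D) * c + (- c / D)^2 * D"
   by (intro add_left_mono mult_left_mono) (auto simp: D_def)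
  also have "... = - c\<^sup>2 / D" using D by (simp add: field_simps power2_eq_square)
  finally show False using c D by (simp add: field_simps)
 qed
 then show ?thesis by (simp add: c_def)
qed
have "L2norm M g <= \<bar>K\<bar>"
proof -
 have "(%k. l (F k)) ---> (L2norm M g)^2"
  using L2_inner_tendsto[OF FL g(1) g(1) g(2)]
  by (simp add: repr[OF F(1)] inner_commute L2norm_square power2_norm_eq_inner)
 moreover have "(%k. \<bar>K\<bar> * L2norm M (F k)) ---> \<bar>K\<bar> * L2norm M g"
  by (intro tendsto_intros L2norm_tendsto FL g)
 moreover have "l (F k) <= \<bar>K\<bar> * L2norm M (F k)" for k
 proof -
  have "K * L2norm M (F k) <= \<bar>K\<bar> * L2norm M (F k)" by (intro mult_right_mono) auto
  then show ?thesis using l_bound[OF F(1), of k] by simp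
 qed
 ultimately have "(L2norm M g)^2 <= \<bar>K\<bar> * L2norm M g" by (intro LIMSEQ_le) auto
 then show ?thesis
  using mult_le_cancel_right[of "L2norm M g" "L2norm M g" "\<bar>K\<bar>"]
  by (cases "L2norm M g = 0") (auto simp: power2_eq_square)
qed
then show ?thesis using that[of g F] g F(1) repr by blast
qed

abbreviation "LL \<equiv> L2  lebesgue"
abbreviation "L2n \<equiv> L2norm  lebesgue"

section \<open>Calculus of smooth functions\<close>

lemma norm_vector_smult: "norm (z *s v) = cmod z * norm v" for v :: "complex^'m"
by (simp add: norm_vec_def vector_scalar_mult_def norm_mult L2_set_right_distrib)

lemma bilinear_smult: "bounded_bilinear (%(z::complex) (v::complex^'m). z *s v)"
proof
show "\<exists>K. \<forall>a b. norm ((a::complex) *s (b::complex^'m)) <= norm a * norm b * K"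
 by (rule exI[of _ 1]) (simp add: norm_vector_smult)
qed (auto simp: vec_eq_iff algebra_simps)

lemma norm_cdot_le: "cmod (cdot z w) <= norm z * norm w"
proof -
have "cmod (cdot z w) <= (\<Sum>k\<in>UNIV. \<bar>cmod (z $ k)\<bar> * \<bar>cmod (w $ k)\<bar>)"
 unfolding cdot_def by (rule order_trans[OF norm_sum]) (simp add: norm_mult)
also have "... <= norm z * norm w"
 unfolding norm_vec_def by (rule L2_set_mult_ineq)
finally show ?thesis .
qed

lemma bilinear_cdot: "bounded_bilinear cdot"
proof
show "\<exists>K. \<forall>a b. norm (cdot a b) <= norm a * norm b * K"
 by (rule exI[of _ 1]) (simp add: norm_cdot_le)
qed (auto simp: cdot_def sum.distrib algebra_simps scaleR_sum_right)

lemma cdot_commute: "cdot z w = cdot w z"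
by (simp add: cdot_def mult.commute)

lemma cdot_smult: "cdot (c *s z) w = c * cdot z w" "cdot z (c *s w) = c * cdot z w"
by (simp_all add: cdot_def sum_distrib_left mult_ac)

lemma partials_simps [simp]:
"partials [] f = f" "partials (j # js) f = partial j (partials js f)"
by (simp_all add: partials_def)

lemma partials_append: "partials (js @ ks) f = partials js (partials ks f)"
by (simp add: partials_def)

lemma smooth_differentiable: "smooth f ==> f differentiable (at x)"
unfolding smooth_def by (metis partials_simps(1))

lemma smooth_partials: "smooth f ==> smooth (partials js f)"
unfolding smooth_def by (simp flip: partials_append)

lemma smooth_partial: "smooth f ==> smooth (partial j f)"
using smooth_partials[of f "[j]"] by simp

lemma partials_closed:
assumes "!!g j. g : F ==> partial j g : F" "f : F"
shows "partials js f : F"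
using assms by (induction js) auto

lemma smooth_coinduct:
assumes "f : F" "!!g x. g : F ==> g differentiable (at x)" "!!g j. g : F ==> partial j g : F"
shows "smooth f"
unfolding smooth_def using partials_closed[OF assms(3,1)] assms(2) by blast

lemma smooth_continuous_on: "smooth f ==> continuous_on A f"
using smooth_differentiable
by (metis continuous_on_eq_continuous_within continuous_at_imp_continuous_at_within
  differentiable_imp_continuous_within)

lemma partial_eq: "(f has_derivative f') (at x) ==> partial j f x = f' (axis j 1)"
unfolding partial_def using frechet_derivative_at[of f f' x] by simp

lemma differentiable_has_derivative:
"f differentiable (at x) ==> (f has_derivative frechet_derivative f (at x)) (at x)"
by (simp add: frechet_derivative_works)

lemma frechet_derivative_partials:
fixes f :: "real^'n => 'a::real_normed_vector"
assumes "f differentiable (at x)"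
shows "frechet_derivative f (at x) h = (\<Sum>j\<in>UNIV. h $ j *R partial j f x)"
proof -
have l: "linear (frechet_derivative f (at x))"
 using assms by (rule linear_frechet_derivative)
have "h = (\<Sum>j\<in>UNIV. h $ j *R axis j 1)"
 using basis_expansion[of h] by (simp add: scalar_mult_eq_scaleR)
then have "frechet_derivative f (at x) h = frechet_derivative f (at x) (\<Sum>j\<in>UNIV. h $ j *R axis j 1)"
 by simp
also have "... = (\<Sum>j\<in>UNIV. h $ j *R frechet_derivative f (at x) (axis j 1))"
 by (simp add: linear_sum[OF l] linear_cmul[OF l])
finally show ?thesis by (simp add: partial_def)
qed

lemma has_derivative_partials:
fixes f :: "real^'n => 'a::real_normed_vector"
assumes "f differentiable (at x)"
shows "(f has_derivative (%h. \<Sum>j\<in>UNIV. h $ j *R partial j f x)) (at x)"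
using differentiable_has_derivative[OF assms]
by (rule has_derivative_eq_rhs) (rule ext, rule frechet_derivative_partials[OF assms])

lemma partial_const: "partial j (%x. c) = (%x. 0)"
by (rule ext) (rule partial_eq[OF has_derivative_const])

lemma partial_add:
assumes "!!x. f differentiable (at x)" "!!x. g differentiable (at x)"
shows "partial j (%x. f x + g x) = (%x. partial j f x + partial j g x)"
by (rule ext, subst partial_eq[OF has_derivative_add[OF differentiable_has_derivative[OF assms(1)] differentiable_has_derivative[OF assms(2)]]])
 (simp add: partial_def)

lemma partial_linear_image:
assumes "bounded_linear L" "!!x. f differentiable (at x)"
shows "partial j (%x. L (f x)) = (%x. L (partial j f x))"
by (rule ext, subst partial_eq[OF bounded_linear.has_derivative[OF assms(1) differentiable_has_derivative[OF assms(2)]]])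
 (simp add: partial_def)

lemma partial_bilinear:
assumes "bounded_bilinear B" "!!x. f differentiable (at x)" "!!x. g differentiable (at x)"
shows "partial j (%x. B (f x) (g x)) = (%x. B (f x) (partial j g x) + B (partial j f x) (g x))"
by (rule ext, subst partial_eq[OF bounded_bilinear.FDERIV[OF assms(1) differentiable_has_derivative[OF assms(2)] differentiable_has_derivative[OF assms(3)]]])
 (simp add: partial_def)

lemma affine_has_derivative:
fixes f :: "real^'n => 'a::real_normed_vector"
assumes "f differentiable (at (r *R x + a))"
shows "((%x. f (r *R x + a)) has_derivative (%h. r *R frechet_derivative f (at (r *R x + a)) h)) (at x)"
proof -
have "((%x. r *R x + a) has_derivative (%h. r *R h)) (at x)"
 by (auto intro!: derivative_eq_intros)
from has_derivative_compose[OF this differentiable_has_derivative[OF assms]]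
show ?thesis
 using linear_cmul[OF linear_frechet_derivative[OF assms]] by simp
qed

lemma partial_affine:
assumes "!!x. f differentiable (at x)"
shows "partial j (%x. f (r *R x + a)) = (%x. r *R partial j f (r *R x + a))"
by (rule ext, subst partial_eq[OF affine_has_derivative[OF assms]]) (simp add: partial_def)

lemma smooth_add:
assumes "smooth f" "smooth g"
shows "smooth (%x. f x + g x)"
proof (rule smooth_coinduct)
let ?F = "{%x. f x + g x | f g. smooth f & smooth g}"
show "(%x. f x + g x) : ?F" using assms by blast
show "h differentiable (at x)" if "h : ?F" for h x
 using that by (auto intro: smooth_differentiable differentiable_add)
show "partial j h : ?F" if hF: "h : ?F" for h j
proof -
 obtain f g where h: "h = (%x. f x + g x)" "smooth f" "smooth g" using hF by blast
 have "partial j h = (%x. partial j f x + partial j g x)"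
  unfolding h(1) by (intro partial_add smooth_differentiable h)
 then show ?thesis using smooth_partial h by blast
qed
qed

lemma smooth_linear_image:
assumes "bounded_linear L" "smooth f"
shows "smooth (%x. L (f x))"
proof (rule smooth_coinduct)
show "(%x. L (f x)) : {%x. L (f x) | f. smooth f}" using assms by blast
show "g differentiable (at x)" if "g : {%x. L (f x) | f. smooth f}" for g x
 using that bounded_linear.has_derivative[OF assms(1) differentiable_has_derivative[OF smooth_differentiable]]
 by (auto simp: differentiable_def)
show "partial j h : {%x. L (f x) | f. smooth f}" if hF: "h : {%x. L (f x) | f. smooth f}" for h j
proof -
 obtain f where h: "h = (%x. L (f x))" "smooth f" using hF by blast
 have "partial j h = (%x. L (partial j f x))"
  unfolding h(1) by (intro partial_linear_image assms smooth_differentiable h)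
 then show ?thesis using smooth_partial h by blast
qed
qed

lemma smooth_affine:
fixes f :: "real^'n => 'a::real_normed_vector"
assumes "smooth f"
shows "smooth (%x. f (r *R x + a))"
proof (rule smooth_coinduct)
let ?F = "{%x. c *R f (r *R x + a) | (f :: real^'n => 'a) c. smooth f}"
show "(%x. f (r *R x + a)) : ?F" using assms by (force intro: exI[of _ f] exI[of _ 1])
have d: "(%x. f (r *R x + a)) differentiable (at x)" if "smooth f" for f :: "real^'n => 'a" and x
 using affine_has_derivative[OF smooth_differentiable[OF that]] unfolding differentiable_def by blast
show "g differentiable (at x)" if gF: "g : ?F" for g x
proof -
 obtain f c where g: "g = (%x. c *R f (r *R x + a))" "smooth f" using gF by blast
 show ?thesis
  unfolding g(1) differentiable_def
  using bounded_linear.has_derivative[OF bounded_linear_scaleR_right differentiable_has_derivative[OF d[OF g(2)]]]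
  by blast
qed
show "partial j g : ?F" if gF: "g : ?F" for g j
proof -
 obtain f c where g: "g = (%x. c *R f (r *R x + a))" "smooth f" using gF by blast
 have "partial j g = (%x. (c * r) *R partial j f (r *R x + a))"
  unfolding g(1) partial_linear_image[OF bounded_linear_scaleR_right d[OF g(2)]]
   partial_affine[OF smooth_differentiable[OF g(2)]] by simp
 then show ?thesis using smooth_partial[OF g(2)] by blast
qed
qed

text \<open>The iterated derivatives of a product are sums of products of derivatives of the factors.
All that is ever used of the Leibniz formula is that they stay in the span of such products.\<close>

inductive_set product_span ::
 "('a => 'b => 'c) => (real^'n => 'a) set => (real^'n => 'b) set => (real^'n => 'c::real_normed_vector) set"
for B U V where
prod: "u : U ==> v : V ==> (%x. B (u x) (v x)) : product_span B U V"
| add: "f : product_span B U V ==> g : product_span B U V ==> (%x. f x + g x) : product_span B U V"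

lemma product_span_partial:
assumes B: "bounded_bilinear B"
 and U: "!!u x. u : U ==> u differentiable (at x)" "!!u j. u : U ==> partial j u : U"
 and V: "!!v x. v : V ==> v differentiable (at x)" "!!v j. v : V ==> partial j v : V"
 and f: "f : product_span B U V"
shows "(\<forall>x. f differentiable (at x)) & (\<forall>j. partial j f : product_span B U V)"
using f
proof induction
case (prod u v)
have "(%x. B (u x) (v x)) differentiable (at x)" for x
 using bounded_bilinear.FDERIV[OF B differentiable_has_derivative[OF U(1)[OF prod(1)]] differentiable_has_derivative[OF V(1)[OF prod(2)]]]
 unfolding differentiable_def by blast
moreover have "partial j (%x. B (u x) (v x)) : product_span B U V" for j
 unfolding partial_bilinear[OF B U(1)[OF prod(1)] V(1)[OF prod(2)]]
 using prod U V by (intro product_span.intros) auto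
ultimately show ?case by blast
next
case (add f g)
then show ?case by (auto simp: partial_add intro: product_span.add)
qed

lemma smooth_bilinear:
assumes "bounded_bilinear B" "smooth u" "smooth v"
shows "smooth (%x. B (u x) (v x))"
proof (rule smooth_coinduct[of _ "product_span B {u. smooth u} {v. smooth v}"])
have *: "(\<forall>x. g differentiable (at x)) & (\<forall>j. partial j g : product_span B {u. smooth u} {v. smooth v})"
 if "g : product_span B {u. smooth u} {v. smooth v}" for g
 using that by (intro product_span_partial[OF assms(1)]) (simp_all add: smooth_differentiable smooth_partial)
show "g differentiable (at x)" "partial j g : product_span B {u. smooth u} {v. smooth v}"
 if "g : product_span B {u. smooth u} {v. smooth v}" for g x j
 using *[OF that] by simp_all
show "(%x. B (u x) (v x)) : product_span B {u. smooth u} {v. smooth v}"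
 using assms by (intro product_span.prod) simp_all
qed

lemma smooth_const: "smooth (%x. c)"
proof (rule smooth_coinduct)
show "(%x. c) : {%x. c | c. True}" by blast
show "partial j g : {%x. c | c. True}" if "g : {%x. c | c. True}" for g :: "real^'a => 'b" and j
 using that by (auto simp: partial_const)
qed auto

lemma smooth_prod:
assumes "finite A" "!!i. i : A ==> smooth (f i)"
shows "smooth (%x. \<Prod>i\<in>A. f i x :: real)"
using assms by (induction A) (auto intro: smooth_const smooth_bilinear[OF bounded_bilinear_mult])

lemma partials_add:
assumes "smooth f" "smooth g"
shows "partials js (%x. f x + g x) = (%x. partials js f x + partials js g x)"
by (induction js) (simp_all add: partial_add smooth_differentiable[OF smooth_partials] assms)

lemma partials_linear_image:
assumes "bounded_linear L" "smooth f"
shows "partials js (%x. L (f x)) = (%x. L (partials js f x))"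
by (induction js) (simp_all add: partial_linear_image[OF assms(1)] smooth_differentiable[OF smooth_partials] assms)

lemma partials_affine:
assumes "smooth f"
shows "partials js (%x. f (r *R x + a)) = (%x. r ^ length js *R partials js f (r *R x + a))"
proof (induction js)
case (Cons j js)
have s: "smooth (partials js f)" by (rule smooth_partials[OF assms])
have "partial j (%x. r ^ length js *R partials js f (r *R x + a))
  = (%x. r ^ length js *R partial j (%x. partials js f (r *R x + a)) x)"
 by (rule partial_linear_image[OF bounded_linear_scaleR_right]) (rule smooth_differentiable[OF smooth_affine[OF s]])
then show ?case
 by (simp add: Cons partial_affine[OF smooth_differentiable[OF s]] mult.commute)
qed simp

section \<open>Schwartz functions\<close>

definition rapid :: "('a::real_normed_vector => 'b::real_normed_vector) => bool" where
"rapid f \<longleftrightarrow> (\<forall>k. \<exists>C. \<forall>x. (1 + norm x)^k * norm (f x) <= C)"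

definition slow :: "('a::real_normed_vector => 'b::real_normed_vector) => bool" where
"slow f \<longleftrightarrow> (\<exists>k C. \<forall>x. norm (f x) <= C * (1 + norm x)^k)"

definition slow_smooth :: "(real^'n => 'a::real_normed_vector) set" where
"slow_smooth = {u. smooth u & (\<forall>js. slow (partials js u))}"

lemma schwartz_iff: "phi : schwartz \<longleftrightarrow> smooth phi & (\<forall>js. rapid (partials js phi))"
by (simp add: schwartz_def rapid_def bounded_iff)

lemma schwartz_smooth: "phi : schwartz ==> smooth phi"
by (simp add: schwartz_iff)

lemma schwartz_rapid: "phi : schwartz ==> rapid phi"
unfolding schwartz_iff by (metis partials_simps(1))

lemma schwartz_partials: "phi : schwartz ==> partials js phi : schwartz"
unfolding schwartz_iff by (auto simp: smooth_partials simp flip: partials_append)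

lemma schwartz_partial: "phi : schwartz ==> partial j phi : schwartz"
using schwartz_partials[of phi "[j]"] by simp

lemma schwartz_coinduct:
assumes "f : F" "!!g x. g : F ==> g differentiable (at x)" "!!g j. g : F ==> partial j g : F"
 "!!g. g : F ==> rapid g"
shows "f : schwartz"
unfolding schwartz_iff using smooth_coinduct[OF assms(1-3)] partials_closed[OF assms(3,1)] assms(4) by blast

lemma slow_smooth_coinduct:
assumes "f : F" "!!g x. g : F ==> g differentiable (at x)" "!!g j. g : F ==> partial j g : F"
 "!!g. g : F ==> slow g"
shows "f : slow_smooth"
unfolding slow_smooth_def using smooth_coinduct[OF assms(1-3)] partials_closed[OF assms(3,1)] assms(4) by blast

lemma slow_smooth_partial: "u : slow_smooth ==> partial j u : slow_smooth"
unfolding slow_smooth_def using partials_append[of _ "[j]" u]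
by (simp add: smooth_partial) (metis partials_append partials_simps)

lemma slow_smooth_smooth: "u : slow_smooth ==> smooth u"
by (simp add: slow_smooth_def)

lemma slow_smooth_slow: "u : slow_smooth ==> slow u"
unfolding slow_smooth_def by (metis (no_types, lifting) mem_Collect_eq partials_simps(1))

lemma rapid_add:
assumes "rapid f" "rapid g" shows "rapid (%x. f x + g x)"
unfolding rapid_def
proof
fix k
obtain C D where C: "!!x. (1 + norm x)^k * norm (f x) <= C" and D: "!!x. (1 + norm x)^k * norm (g x) <= D"
 using assms unfolding rapid_def by metis
have "(1 + norm x)^k * norm (f x + g x) <= C + D" for x
proof -
 have "(1 + norm x)^k * norm (f x + g x) <= (1 + norm x)^k * (norm (f x) + norm (g x))"
  by (intro mult_left_mono norm_triangle_ineq) simp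
 then show ?thesis using C[of x] D[of x] by (simp add: distrib_left)
qed
then show "\<exists>C. \<forall>x. (1 + norm x)^k * norm (f x + g x) <= C" by blast
qed

lemma rapid_bilinear:
assumes B: "bounded_bilinear B" and f: "slow f" and g: "rapid g"
shows "rapid (%x. B (f x) (g x))"
unfolding rapid_def
proof
fix k
obtain K where K: "K \<ge> 0" "!!a b. norm (B a b) <= norm a * norm b * K"
 using bounded_bilinear.nonneg_bounded[OF B] by blast
obtain l C where C: "!!x. norm (f x) <= C * (1 + norm x)^l" using f unfolding slow_def by blast
obtain D where D: "!!x. (1 + norm x)^(k + l) * norm (g x) <= D" using g unfolding rapid_def by blast
have C0: "0 <= C" using C[of 0] norm_ge_zero[of "f 0"] by (simp del: norm_ge_zero)
have "(1 + norm x)^k * norm (B (f x) (g x)) <= C * D * K" for x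
proof -
 have "(1 + norm x)^k * norm (B (f x) (g x)) <= (1 + norm x)^k * ((C * (1 + norm x)^l) * norm (g x) * K)"
  using K C[of x] by (intro mult_left_mono order_trans[OF K(2)] mult_right_mono) auto
 also have "... = C * ((1 + norm x)^(k + l) * norm (g x)) * K" by (simp add: power_add)
 also have "... <= C * D * K" using D[of x] C0 K by (intro mult_right_mono mult_left_mono) auto
 finally show ?thesis .
qed
then show "\<exists>C. \<forall>x. (1 + norm x)^k * norm (B (f x) (g x)) <= C" by blast
qed

lemma slow_const: "slow (%x. c)"
unfolding slow_def by (rule exI[of _ 0], rule exI[of _ "norm c"]) simp

lemma slow_bounded: "(!!x. norm (f x) <= C) ==> slow f"
unfolding slow_def by (rule exI[of _ 0], rule exI[of _ C]) simp

lemma schwartz_bilinear: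
assumes B: "bounded_bilinear B" and "u : slow_smooth" "v : schwartz"
shows "(%x. B (u x) (v x)) : schwartz"
proof (rule schwartz_coinduct[of _ "product_span B slow_smooth schwartz"])
have *: "(\<forall>x. g differentiable (at x)) & (\<forall>j. partial j g : product_span B slow_smooth schwartz)"
 if "g : product_span B slow_smooth schwartz" for g
 using that by (intro product_span_partial[OF B])
  (simp_all add: smooth_differentiable slow_smooth_smooth schwartz_smooth slow_smooth_partial schwartz_partial)
show "g differentiable (at x)" "partial j g : product_span B slow_smooth schwartz"
 if "g : product_span B slow_smooth schwartz" for g x j
 using *[OF that] by simp_all
show "rapid g" if "g : product_span B slow_smooth schwartz" for g
 using that
 by induction (auto intro: rapid_add rapid_bilinear[OF B] slow_smooth_slow schwartz_rapid)
show "(%x. B (u x) (v x)) : product_span B slow_smooth schwartz"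
 using assms by (intro product_span.prod)
qed

lemma schwartz_add: "f : schwartz ==> g : schwartz ==> (%x. f x + g x) : schwartz"
unfolding schwartz_iff by (simp add: smooth_add partials_add rapid_add)

lemma slow_smooth_const: "(%x. c) : slow_smooth"
proof (rule slow_smooth_coinduct)
show "(%x. c) : {%x. c | c. True}" by blast
show "partial j g : {%x. c | c. True}" if "g : {%x. c | c. True}" for g :: "real^'a => 'b" and j
 using that by (auto simp: partial_const)
qed (auto intro: slow_const)

lemma schwartz_linear_image:
assumes "bounded_linear L" "f : schwartz"
shows "(%x. L (f x)) : schwartz"
proof -
have "bounded_bilinear (%(r::real) y. r *R L y)"
 using bounded_bilinear.comp[OF bounded_bilinear_scaleR bounded_linear_ident assms(1)] by simp
from schwartz_bilinear[OF this slow_smooth_const assms(2), of 1] show ?thesis by simp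
qed

lemma schwartz_diff: "f : schwartz ==> g : schwartz ==> (%x. f x - g x) : schwartz"
using schwartz_add[OF _ schwartz_linear_image[OF bounded_linear_minus[OF bounded_linear_ident]], of f g] by simp

lemma schwartz_zero: "(%x. 0) : schwartz"
proof (rule schwartz_coinduct)
show "(%x. 0) : {%x. 0}" by blast
show "partial j g : {%x. 0}" if "g : {%x. 0}" for g :: "real^'a => 'b" and j
 using that by (auto simp: partial_const)
qed (auto simp: rapid_def)

lemma schwartz_sum:
"(!!i. i : A ==> f i : schwartz) ==> (%x. \<Sum>i\<in>A. f i x) : schwartz"
by (induction A rule: infinite_finite_induct) (auto intro: schwartz_add schwartz_zero)

lemma schwartz_smult: "f : schwartz ==> (%x. z *s f x) : schwartz" for f :: "('n::finite, 'm::finite) vfun"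
by (rule schwartz_linear_image[OF bounded_bilinear.bounded_linear_right[OF bilinear_smult]])

lemma schwartz_affine:
assumes f: "f : schwartz" and r: "r ~= 0"
shows "(%x. f (r *R x + a)) : schwartz"
proof -
have "rapid (%x. c *R g (r *R x + a))" if g: "rapid g" for g :: "real^'a => 'b" and c
 unfolding rapid_def
proof
 fix k
 obtain C where C: "!!x. (1 + norm x)^k * norm (g x) <= C" using g unfolding rapid_def by blast
 define D where "D = 1 + (1 + norm a) / \<bar>r\<bar>"
 have D0: "0 <= D" by (simp add: D_def)
 have le: "1 + norm x <= D * (1 + norm (r *R x + a))" for x
 proof -
  have "\<bar>r\<bar> * norm x <= norm (r *R x + a) + norm a"
   using norm_triangle_ineq4[of "r *R x + a" a] by simp
  also have "... <= (1 + norm a) * (1 + norm (r *R x + a))"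
   by (simp add: algebra_simps)
  finally have "norm x <= (1 + norm a) / \<bar>r\<bar> * (1 + norm (r *R x + a))"
   using r by (simp add: field_simps)
  moreover have "1 <= 1 + norm (r *R x + a)" by simp
  ultimately show ?thesis unfolding D_def distrib_right by (simp only: mult_1)
 qed
 have "(1 + norm x)^k * norm (c *R g (r *R x + a)) <= D^k * \<bar>c\<bar> * C" for x
 proof -
  have "(1 + norm x)^k * norm (c *R g (r *R x + a)) <= (D * (1 + norm (r *R x + a)))^k * (\<bar>c\<bar> * norm (g (r *R x + a)))"
   using le[of x] D0 by (intro mult_mono power_mono) auto
  also have "... = D^k * \<bar>c\<bar> * ((1 + norm (r *R x + a))^k * norm (g (r *R x + a)))"
   by (simp add: power_mult_distrib)
  also have "... <= D^k * \<bar>c\<bar> * C"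
   using C by (intro mult_left_mono) (auto simp: D_def)
  finally show ?thesis .
 qed
 then show "\<exists>C. \<forall>x. (1 + norm x)^k * norm (c *R g (r *R x + a)) <= C" by blast
qed
then show ?thesis
 using f unfolding schwartz_iff by (simp add: smooth_affine partials_affine)
qed

lemma slow_smooth_cis: "(%x. z * cis (h \<bullet> x)) : slow_smooth"
proof (rule slow_smooth_coinduct)
let ?F = "{%x. z * cis (h \<bullet> x) | z. True}"
show "(%x. z * cis (h \<bullet> x)) : ?F" by blast
have d: "((%x. z * cis (h \<bullet> x)) has_derivative (%v. (z * \<i> * of_real (h \<bullet> v)) * cis (h \<bullet> x))) (at x)" for z x
proof -
 have "((%x. \<i> * of_real (h \<bullet> x)) has_derivative (%v. \<i> * of_real (h \<bullet> v))) (at x)"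
  by (intro has_derivative_mult_right bounded_linear.has_derivative[OF bounded_linear_of_real]
    has_derivative_inner_right has_derivative_ident)
 from has_derivative_mult_right[OF has_derivative_compose[OF this DERIV_exp[unfolded has_field_derivative_def]], of z]
 show ?thesis by (simp add: cis_conv_exp mult_ac)
qed
show "g differentiable (at x)" if "g : ?F" for g x
 using that d unfolding differentiable_def by blast
have p: "partial j (%x. z * cis (h \<bullet> x)) = (%x. (z * \<i> * of_real (h \<bullet> axis j 1)) * cis (h \<bullet> x))" for z j
 by (rule ext) (rule partial_eq[OF d])
show "partial j g : ?F" if "g : ?F" for g j
 using that p by blast
have "slow (%x. z * cis (h \<bullet> x))" for z
 by (rule slow_bounded[of _ "cmod z"]) (simp add: norm_mult)
then show "slow g" if "g : ?F" for g
 using that by blast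
qed

lemma slow_smooth_coord: "(%x. of_real (x $ j) :: complex) : slow_smooth"
proof (rule slow_smooth_coinduct)
let ?F = "{%x. of_real (x $ j) * a + b | a (b::complex). True}"
show "(%x. of_real (x $ j) :: complex) : ?F" by (force intro: exI[of _ 1] exI[of _ 0])
have d: "((%x. of_real (x $ j) * a + b) has_derivative (%v. of_real (v $ j) * a)) (at x)" for a b :: complex and x
 using has_derivative_add[OF has_derivative_mult_left[OF bounded_linear.has_derivative[OF bounded_linear_of_real
   bounded_linear_imp_has_derivative[OF bounded_linear_vec_nth]]] has_derivative_const]
 by simp
show "g differentiable (at x)" if "g : ?F" for g x
 using that d unfolding differentiable_def by blast
show "partial k g : ?F" if "g : ?F" for g k
 using that partial_eq[OF d] by (force intro: exI[of _ 0] exI[of _ 1])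
show "slow g" if gF: "g : ?F" for g
proof -
 obtain a b where g: "g = (%x. of_real (x $ j) * a + b)" using gF by blast
 have "norm (g x) <= (cmod a + cmod b) * (1 + norm x)^1" for x
 proof -
  have "norm (g x) <= \<bar>x $ j\<bar> * cmod a + cmod b"
   unfolding g by (rule order_trans[OF norm_triangle_ineq]) (simp add: norm_mult)
  also have "... <= norm x * cmod a + cmod b"
   using component_le_norm_cart[of x j] by (simp add: mult_right_mono)
  also have "... <= (cmod a + cmod b) * (1 + norm x)^1" by (simp add: algebra_simps)
  finally show ?thesis .
 qed
 then show ?thesis unfolding slow_def by blast
qed
qed

lemma schwartz_cis: "f : schwartz ==> (%x. (z * cis (h \<bullet> x)) *s f x) : schwartz" for f :: "('n::finite, 'm::finite) vfun"
by (rule schwartz_bilinear[OF bilinear_smult slow_smooth_cis])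

lemma schwartz_coord: "f : schwartz ==> (%x. of_real (x $ j) *s f x) : schwartz" for f :: "('n::finite, 'm::finite) vfun"
by (rule schwartz_bilinear[OF bilinear_smult slow_smooth_coord])

section \<open>Test functions\<close>

lemma partial_support: "closure {x. partial j f x ~= 0} \<subseteq> closure {x. f x ~= 0}"
proof (rule closure_minimal)
show "{x. partial j f x ~= 0} \<subseteq> closure {x. f x ~= 0}"
proof (rule subsetI, rule ccontr)
 fix x assume x: "x : {x. partial j f x ~= 0}" "x \<notin> closure {x. f x ~= 0}"
 have o: "open (- closure {x. f x ~= 0})" by (intro open_Compl closed_closure)
 have z: "0 = f y" if "y : - closure {x. f x ~= 0}" for y
  using that closure_subset[of "{x. f x ~= 0}"] by auto
 have xin: "x : - closure {x. f x ~= 0}" using x(2) by simp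
 have "(f has_derivative (%h. 0)) (at x)"
  by (rule has_derivative_transform_within_open[OF has_derivative_const o xin z])
 from partial_eq[OF this] x(1) show False by simp
qed
qed simp

lemma test_functions_partial: "phi : test_functions Om ==> partial j phi : test_functions Om"
proof -
assume phi: "phi : test_functions Om"
have "{x. partial j phi x ~= 0} \<subseteq> closure {x. phi x ~= 0}"
 using partial_support[of j phi] closure_subset[of "{x. partial j phi x ~= 0}"] by (rule order_trans[rotated])
then show "partial j phi : test_functions Om"
 using phi bounded_subset[of "closure {x. phi x ~= 0}" "{x. partial j phi x ~= 0}"]
  order_trans[OF partial_support[of j phi], of Om] smooth_partial[of phi j]
  bounded_closure[of "{x. phi x ~= 0}"]
 unfolding test_functions_def by simp
qed

lemma test_functions_partials: "phi : test_functions Om ==> partials js phi : test_functions Om"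
by (induction js) (auto intro: test_functions_partial)

lemma test_functions_smooth: "phi : test_functions Om ==> smooth phi"
by (simp add: test_functions_def)

lemma test_functions_outside: "phi : test_functions Om ==> x \<notin> Om ==> phi x = 0"
unfolding test_functions_def using closure_subset[of "{x. phi x ~= 0}"] by blast

lemma test_functions_supportI:
assumes "smooth f" "{x. f x ~= 0} \<subseteq> K" "compact K" "K \<subseteq> Om"
shows "f : test_functions Om"
proof -
have "closure {x. f x ~= 0} \<subseteq> K" using assms(2,3) by (intro closure_minimal compact_imp_closed)
then show ?thesis
 using assms bounded_subset[OF compact_imp_bounded[OF assms(3)] assms(2)]
 unfolding test_functions_def by simp
qed

lemma test_functions_support:
assumes "f : test_functions Om"
obtains K where "compact K" "K \<subseteq> Om" "{x. f x ~= 0} \<subseteq> K"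
using assms closure_subset[of "{x. f x ~= 0}"] that[of "closure {x. f x ~= 0}"]
by (simp add: test_functions_def)

lemma test_functions_subset_schwartz: "test_functions Om \<subseteq> schwartz"
proof
fix phi :: "real^'a => 'b" assume phi: "phi : test_functions Om"
show "phi : schwartz"
proof (rule schwartz_coinduct[OF phi])
 show "rapid g" if g: "g : test_functions Om" for g :: "real^'a => 'b"
  unfolding rapid_def
 proof
  fix k
  obtain K where K: "compact K" "{x. g x ~= 0} \<subseteq> K" using test_functions_support[OF g] by metis
  have "bounded ((%x. (1 + norm x)^k * norm (g x)) ` K)"
   by (intro compact_imp_bounded compact_continuous_image continuous_intros K
     smooth_continuous_on[OF test_functions_smooth[OF g]])
  then obtain C where C: "!!x. x : K ==> (1 + norm x)^k * norm (g x) <= C" unfolding bounded_iff by auto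
  have "(1 + norm x)^k * norm (g x) <= \<bar>C\<bar>" for x using C[of x] K(2) by (cases "x : K") force+
  then show "\<exists>C. \<forall>x. (1 + norm x)^k * norm (g x) <= C" by blast
 qed
qed (auto intro: test_functions_partial smooth_differentiable test_functions_smooth)
qed

lemma test_functions_bilinear:
assumes B: "bounded_bilinear B" and "smooth u" "v : test_functions Om"
shows "(%x. B (u x) (v x)) : test_functions Om"
proof -
obtain K where K: "compact K" "K \<subseteq> Om" "{x. v x ~= 0} \<subseteq> K" using test_functions_support[OF assms(3)] .
have "{x. B (u x) (v x) ~= 0} \<subseteq> K" using K(3) bounded_bilinear.zero_right[OF B] by force
then show ?thesis
 using K smooth_bilinear[OF B assms(2) test_functions_smooth[OF assms(3)]] by (intro test_functions_supportI)
qed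

lemma test_functions_linear_image:
assumes "bounded_linear L" "f : test_functions Om"
shows "(%x. L (f x)) : test_functions Om"
proof -
obtain K where K: "compact K" "K \<subseteq> Om" "{x. f x ~= 0} \<subseteq> K" using test_functions_support[OF assms(2)] .
have "{x. L (f x) ~= 0} \<subseteq> K" using K(3) linear_0[OF bounded_linear.linear[OF assms(1)]] by force
then show ?thesis
 using K smooth_linear_image[OF assms(1) test_functions_smooth[OF assms(2)]] by (intro test_functions_supportI)
qed

lemma test_functions_add:
assumes "f : test_functions Om" "g : test_functions Om"
shows "(%x. f x + g x) : test_functions Om"
proof -
obtain K where K: "compact K" "K \<subseteq> Om" "{x. f x ~= 0} \<subseteq> K" using test_functions_support[OF assms(1)] .
obtain L where L: "compact L" "L \<subseteq> Om" "{x. g x ~= 0} \<subseteq> L" using test_functions_support[OF assms(2)] .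
have "{x. f x + g x ~= 0} \<subseteq> K \<union> L" using K L by force
then show ?thesis
 using K L smooth_add[OF test_functions_smooth[OF assms(1)] test_functions_smooth[OF assms(2)]]
 by (intro test_functions_supportI[of _ "K \<union> L"]) auto
qed

text \<open>The function $p(1/t)e^{-1/t}$ for $t > 0$, extended by $0$. These functions are closed under
differentiation, so they are smooth; a product of them over the coordinates is a bump function
for a box.\<close>

definition exp_flat :: "real poly => real => real" where
"exp_flat p t = (if t > 0 then poly p (1 / t) * exp (- 1 / t) else 0)"

lemma poly_exp_tendsto_0: "((%s::real. poly p s * exp (- s)) \<longlongrightarrow> 0) at_top"
proof -
have "((%s::real. \<Sum>i\<le>degree p. coeff p i * (s ^ i / exp s)) \<longlongrightarrow> (\<Sum>i\<le>degree p. coeff p i * 0)) at_top"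
 by (intro tendsto_intros tendsto_power_div_exp_0)
then show ?thesis
 by (simp add: poly_altdef sum_distrib_right exp_minus divide_inverse mult.assoc)
qed

lemma exp_flat_tendsto_0: "(exp_flat p \<longlongrightarrow> 0) (at_right 0)"
proof -
have "((%t. poly p (inverse t) * exp (- inverse t)) \<longlongrightarrow> 0) (at_right 0)"
 using filterlim_compose[OF poly_exp_tendsto_0 filterlim_inverse_at_top_right] by simp
then show ?thesis
 by (rule Lim_transform_eventually)
  (auto simp: exp_flat_def eventually_at_filter inverse_eq_divide)
qed

lemma exp_flat_has_derivative:
"(exp_flat p has_real_derivative exp_flat ([:0, 0, 1:] * (p - pderiv p)) t) (at t)"
proof (cases t "0::real" rule: linorder_cases)
case less
have "((%t. 0) has_real_derivative 0) (at t)" by simp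
then have "(exp_flat p has_real_derivative 0) (at t)"
 by (rule has_field_derivative_transform_within_open[of _ _ _ "{..<0}"]) (use less in \<open>auto simp: exp_flat_def\<close>)
then show ?thesis using less by (simp add: exp_flat_def)
next
case greater
have "((%t. poly p (1 / t) * exp (- 1 / t)) has_real_derivative
  exp_flat ([:0, 0, 1:] * (p - pderiv p)) t) (at t)"
 using greater unfolding exp_flat_def
 by (auto intro!: derivative_eq_intros DERIV_chain2[OF poly_DERIV] simp: field_simps power2_eq_square)
then show ?thesis
 by (rule has_field_derivative_transform_within_open[of _ _ _ "{0<..}"]) (use greater in \<open>auto simp: exp_flat_def\<close>)
next
case equal
have "((%h. (exp_flat p (0 + h) - exp_flat p 0) / h) \<longlongrightarrow> 0) (at 0)"
proof (rule filterlim_split_at)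
 show "((%h. (exp_flat p (0 + h) - exp_flat p 0) / h) \<longlongrightarrow> 0) (at_left 0)"
  by (rule Lim_transform_eventually[OF tendsto_const]) (auto simp: exp_flat_def eventually_at_filter)
 show "((%h. (exp_flat p (0 + h) - exp_flat p 0) / h) \<longlongrightarrow> 0) (at_right 0)"
  by (rule Lim_transform_eventually[OF exp_flat_tendsto_0[of "[:0, 1:] * p"]])
   (auto simp: exp_flat_def eventually_at_filter)
qed
then show ?thesis using equal by (simp add: DERIV_def exp_flat_def)
qed

lemma smooth_exp_flat: "smooth (%x. exp_flat p (r * x $ j + b))"
proof (rule smooth_coinduct)
let ?F = "{%x. c * exp_flat p (r * x $ j + b) | c p. True}"
show "(%x. exp_flat p (r * x $ j + b)) : ?F" by (force intro: exI[of _ 1])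
have d: "((%x. c * exp_flat p (r * x $ j + b)) has_derivative
  (%v. c * (exp_flat ([:0, 0, 1:] * (p - pderiv p)) (r * x $ j + b) * (r * v $ j)))) (at x)" for c p x
 by (intro has_derivative_mult_right has_derivative_compose[OF _ exp_flat_has_derivative[unfolded has_field_derivative_def]])
  (rule derivative_eq_intros bounded_linear_imp_has_derivative[OF bounded_linear_vec_nth] refl | simp)+
show "g differentiable (at x)" if gF: "g : ?F" for g x
proof -
 obtain c p where g: "g = (%x. c * exp_flat p (r * x $ j + b))" using gF by blast
 show ?thesis unfolding g differentiable_def by (rule exI) (rule d)
qed
show "partial k g : ?F" if gF: "g : ?F" for g k
proof -
 obtain c p where g: "g = (%x. c * exp_flat p (r * x $ j + b))" using gF by blast
 have "partial k g = (%x. (c * r * axis k 1 $ j) * exp_flat ([:0, 0, 1:] * (p - pderiv p)) (r * x $ j + b))"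
  unfolding g by (rule ext, subst partial_eq[OF d]) (simp only: mult_ac)
 then show ?thesis by blast
qed
qed

lemma exp_flat_nonzero: "exp_flat p t ~= 0 ==> t > 0"
by (cases "t > 0") (auto simp: exp_flat_def)

lemma exp_flat_one: "0 <= exp_flat 1 t" "exp_flat 1 t <= 1" "exp_flat 1 t > 0 \<longleftrightarrow> t > 0"
by (auto simp: exp_flat_def)

definition box_bump :: "real => real^'n => real^'n => real^'n => real" where
"box_bump r a b x = (\<Prod>j\<in>UNIV. exp_flat 1 (r * (x $ j - a $ j)) * exp_flat 1 (r * (b $ j - x $ j)))"

lemma box_bump_bounds: "0 <= box_bump r a b x" "box_bump r a b x <= 1"
unfolding box_bump_def by (auto intro!: prod_nonneg prod_le_1 mult_le_one simp: exp_flat_one)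

lemma box_bump_pos:
assumes "r > 0" shows "box_bump r a b x > 0 \<longleftrightarrow> x : box a b"
proof
assume "box_bump r a b x > 0"
then have "box_bump r a b x ~= 0" by simp
then have "(\<Prod>j\<in>UNIV. exp_flat 1 (r * (x $ j - a $ j)) * exp_flat 1 (r * (b $ j - x $ j))) ~= 0"
 unfolding box_bump_def .
then have "exp_flat 1 (r * (x $ j - a $ j)) ~= 0 & exp_flat 1 (r * (b $ j - x $ j)) ~= 0" for j
 by simp
then have "r * (x $ j - a $ j) > 0 & r * (b $ j - x $ j) > 0" for j
 using exp_flat_nonzero by blast
then show "x : box a b" using assms by (simp add: mem_box_cart zero_less_mult_iff)
qed (use assms in \<open>auto simp: box_bump_def mem_box_cart exp_flat_one intro!: prod_pos mult_pos_pos\<close>)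

lemma box_bump_smooth: "smooth (box_bump r a b)"
proof -
have "smooth (%x. exp_flat 1 (r * x $ j + (- r * a $ j)) * exp_flat 1 ((- r) * x $ j + r * b $ j))" for j
 by (intro smooth_bilinear[OF bounded_bilinear_mult] smooth_exp_flat)
then have "smooth (%x. \<Prod>j\<in>UNIV. exp_flat 1 (r * x $ j + (- r * a $ j)) * exp_flat 1 ((- r) * x $ j + r * b $ j))"
 by (intro smooth_prod) auto
moreover have "box_bump r a b = (%x. \<Prod>j\<in>UNIV. exp_flat 1 (r * x $ j + (- r * a $ j)) * exp_flat 1 ((- r) * x $ j + r * b $ j))"
 unfolding box_bump_def by (intro ext prod.cong refl) (simp add: algebra_simps)
ultimately show ?thesis by simp
qed

lemma box_bump_test:
assumes "r > 0" shows "box_bump r a b : test_functions UNIV"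
proof (rule test_functions_supportI[OF box_bump_smooth])
show "{x. box_bump r a b x ~= 0} \<subseteq> cbox a b"
proof
 fix x assume "x : {x. box_bump r a b x ~= 0}"
 then have "box_bump r a b x > 0" using box_bump_bounds(1)[of r a b x] by simp
 then show "x : cbox a b" using box_bump_pos[OF assms] box_subset_cbox by blast
qed
qed simp_all

lemma exp_flat_scaled_tendsto: "(%k. exp_flat 1 (real k * t)) ---> (if t > 0 then 1 else 0)"
proof (cases "t > 0")
case True
have "(%k. exp (- (1 / t) * (1 / real k))) ---> exp (- (1 / t) * 0)"
 by (intro tendsto_intros lim_1_over_n)
then have "(%k. exp (- (1 / t) * (1 / real k))) ---> 1" by simp
then show ?thesis
 using True by (simp, elim Lim_transform_eventually)
  (auto simp: exp_flat_def zero_less_mult_iff intro!: eventually_sequentiallyI[of 1])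
next
case False
then have "\<not> 0 < real k * t" for k by (simp add: zero_less_mult_iff)
then show ?thesis using False by (simp add: exp_flat_def)
qed

lemma box_bump_tendsto: "(%k. box_bump (real k) a b x) ---> indicator (box a b) x"
proof -
have "(%k. box_bump (real k) a b x) --->
 (\<Prod>j\<in>UNIV. (if x $ j - a $ j > 0 then 1 else 0) * (if b $ j - x $ j > 0 then 1 else 0))"
 unfolding box_bump_def by (intro tendsto_prod tendsto_mult exp_flat_scaled_tendsto)
also have "(\<Prod>j\<in>UNIV. (if x $ j - a $ j > 0 then 1 else 0) * (if b $ j - x $ j > 0 then 1 else 0)) = (indicator (box a b) x :: real)"
 by (auto simp: indicator_def mem_box_cart intro!: prod.neutral)
finally show ?thesis .
qed

section \<open>Integration over Euclidean space\<close>

lemma bilinear_measurable: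
fixes B :: "'a::euclidean_space => 'b::euclidean_space => 'c::euclidean_space"
assumes "bounded_bilinear B" "f : borel_measurable M" "g : borel_measurable M"
shows "(%x. B (f x) (g x)) : borel_measurable M"
using assms(2,3)
by (rule borel_measurable_continuous_Pair)
 (intro bounded_bilinear.continuous_on[OF assms(1)] continuous_intros)

lemma linear_measurable:
assumes "bounded_linear L" "f : borel_measurable M"
shows "(%x. L (f x)) : borel_measurable M"
using borel_measurable_continuous_on[OF linear_continuous_on[OF assms(1)] assms(2)] .

lemma continuous_measurable_lebesgue:
"continuous_on UNIV f ==> f : lmeas"
by (intro measurable_completion) (simp add: borel_measurable_continuous_onI)

lemma smooth_measurable: "smooth f ==> f : lmeas"
by (intro continuous_measurable_lebesgue smooth_continuous_on)

lemma smooth_borel: "smooth f ==> f : borel_measurable borel"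
by (intro borel_measurable_continuous_onI smooth_continuous_on)

lemma lebesgue_affine:
fixes a :: "'a::euclidean_space" and r :: real
assumes "r ~= 0"
shows "lebesgue = density (distr lebesgue lebesgue (%x. r *R x + a)) (%_. ennreal (\<bar>r\<bar> ^ DIM('a)))"
 and lebesgue_measurable_affine: "(%x. r *R x + a) : lebesgue \<rightarrow>\<^sub>M (lebesgue :: 'a measure)"
proof -
have T: "(%x. a + (\<Sum>j\<in>Basis. (r * (x \<bullet> j)) *R j)) = (%x. r *R x + a)"
proof
 fix x :: 'a
 have "(\<Sum>j\<in>Basis. (r * (x \<bullet> j)) *R j) = r *R (\<Sum>j\<in>Basis. (x \<bullet> j) *R j)"
  by (simp add: scaleR_sum_right)
 then show "a + (\<Sum>j\<in>Basis. (r * (x \<bullet> j)) *R j) = r *R x + a"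
  by (simp add: euclidean_representation add.commute)
qed
show "lebesgue = density (distr lebesgue lebesgue (%x. r *R x + a)) (%_. ennreal (\<bar>r\<bar> ^ DIM('a)))"
 using lebesgue_affine_euclidean[of "%_. r" a] assms unfolding T by simp
show "(%x. r *R x + a) : lebesgue \<rightarrow>\<^sub>M (lebesgue :: 'a measure)"
 using lebesgue_affine_measurable[of "%_. r" a] assms unfolding T by simp
qed

lemma measurable_lebesgue_affine:
fixes f :: "'a::euclidean_space => 'b::euclidean_space"
assumes "f : lmeas" "r ~= 0"
shows "(%x. f (r *R x + a)) : lmeas"
using measurable_compose[OF lebesgue_measurable_affine[OF assms(2)] assms(1)] .

lemma AE_lebesgue_affine:
fixes a :: "'a::euclidean_space"
assumes "AE x in lebesgue. P x" "r ~= 0"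
shows "AE x in lebesgue. P (r *R x + a)"
proof -
have "AE x in density (distr lebesgue lebesgue (%x. r *R x + a)) (%_. ennreal (\<bar>r\<bar> ^ DIM('a))). P x"
 using assms(1) by (subst lebesgue_affine(1)[OF assms(2), of a, symmetric])
then have "AE x in distr lebesgue lebesgue (%x. r *R x + a). P x"
 using assms(2) by (subst (asm) AE_density) auto
then show ?thesis by (rule AE_distrD[OF lebesgue_measurable_affine[OF assms(2)]])
qed

lemma lebesgue_integral_affine:
fixes f :: "'a::euclidean_space => 'b::euclidean_space"
assumes f: "f : lmeas" and r: "r ~= 0"
shows "(INTG x. f x) = \<bar>r\<bar> ^ DIM('a) *R (INTG x. f (r *R x + a))"
proof -
note m = lebesgue_measurable_affine[OF r, of a]
have "(INTG x. f x) = (\<integral>x. f x \<partial>density (distr lebesgue lebesgue (%x. r *R x + a)) (%_. ennreal (\<bar>r\<bar> ^ DIM('a))))"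
 by (rule arg_cong[where f="%M. \<integral>x. f x \<partial>M", OF lebesgue_affine(1)[OF r, of a]])
also have "... = (\<integral>x. \<bar>r\<bar> ^ DIM('a) *R f x \<partial>distr lebesgue lebesgue (%x. r *R x + a))"
 using f by (subst integral_density) (simp_all add: measurable_distr_eq1)
also have "... = (INTG x. \<bar>r\<bar> ^ DIM('a) *R f (r *R x + a))"
 using f by (subst integral_distr[OF m]) simp_all
finally show ?thesis by simp
qed

lemma lebesgue_nn_integral_affine:
fixes f :: "'a::euclidean_space => ennreal"
assumes f: "f : lmeas" and r: "r ~= 0"
shows "(NINT x. f x) = ennreal (\<bar>r\<bar> ^ DIM('a)) * (NINT x. f (r *R x + a))"
proof -
note m = lebesgue_measurable_affine[OF r, of a]
have "(NINT x. f x) = (\<integral>\<^sup>+x. f x \<partial>density (distr lebesgue lebesgue (%x. r *R x + a)) (%_. ennreal (\<bar>r\<bar> ^ DIM('a))))"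
 by (rule arg_cong[where f="%M. \<integral>\<^sup>+x. f x \<partial>M", OF lebesgue_affine(1)[OF r, of a]])
also have "... = (\<integral>\<^sup>+x. ennreal (\<bar>r\<bar> ^ DIM('a)) * f x \<partial>distr lebesgue lebesgue (%x. r *R x + a))"
 using f by (subst nn_integral_density) (simp_all add: measurable_distr_eq1)
also have "... = (NINT x. ennreal (\<bar>r\<bar> ^ DIM('a)) * f (r *R x + a))"
 using f by (subst nn_integral_distr[OF m]) simp_all
also have "... = ennreal (\<bar>r\<bar> ^ DIM('a)) * (NINT x. f (r *R x + a))"
 using measurable_compose[OF m f] by (subst nn_integral_cmult) simp_all
finally show ?thesis .
qed

lemma lebesgue_integrable_affine:
fixes f :: "'a::euclidean_space => 'b::euclidean_space"
assumes f: "integrable lebesgue f" and r: "r ~= 0"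
shows "integrable lebesgue (%x. f (r *R x + a))"
proof (rule integrableI_bounded)
have fm: "f : lmeas" using f by simp
show "(%x. f (r *R x + a)) : lmeas"
 by (rule measurable_lebesgue_affine[OF fm r])
have "ennreal (\<bar>r\<bar> ^ DIM('a)) * (NINT x. ennreal (norm (f (r *R x + a)))) < \<infinity>"
 using f fm by (subst lebesgue_nn_integral_affine[OF _ r, symmetric]) (auto simp: integrable_iff_bounded)
then show "(NINT x. ennreal (norm (f (r *R x + a)))) < \<infinity>"
 using r by (auto simp: ennreal_mult_less_top)
qed

lemma lebesgue_integral_shift:
fixes f :: "'a::euclidean_space => 'b::euclidean_space"
assumes "f : lmeas"
shows "(INTG x. f (x + a)) = (INTG x. f x)"
using lebesgue_integral_affine[OF assms, of 1 a] by simp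

lemma lebesgue_integral_reflect:
fixes f :: "'a::euclidean_space => 'b::euclidean_space"
assumes "f : lmeas"
shows "(INTG x. f (- x)) = (INTG x. f x)"
using lebesgue_integral_affine[OF assms, of "-1" 0] by simp

lemma integrable_inverse_bracket:
"integrable lebesgue (%x::'a::euclidean_space. inverse ((jb x) ^ DIM('a)))"
proof -
have one: "integrable lborel (%t::real. inverse (1 + t^2))"
 using integrable_inverse_1_plus_square by (simp add: set_integrable_def)
have "nn_integral lborel (%x::'a. ennreal (norm (inverse ((jb x) ^ DIM('a)))))
 <= nn_integral lborel (%x::'a. \<Prod>b\<in>Basis. ennreal (inverse (1 + (x \<bullet> b)^2)))"
proof (intro nn_integral_mono)
 fix x :: 'a
 have "(\<Prod>b\<in>(Basis::'a set). 1 + (x \<bullet> b)^2) <= (\<Prod>b\<in>(Basis::'a set). 1 + (norm x)^2)"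
 proof (intro prod_mono conjI)
  fix b :: 'a assume b: "b : Basis"
  have "\<bar>x \<bullet> b\<bar> <= norm x" using Basis_le_norm[OF b] .
  then have "(x \<bullet> b)^2 <= (norm x)^2" using power_mono[OF _ abs_ge_zero, of "x \<bullet> b" "norm x" 2] by simp
  then show "1 + (x \<bullet> b)^2 <= 1 + (norm x)^2" by simp
 qed (simp add: add_nonneg_nonneg)
 moreover have "0 < (\<Prod>b\<in>(Basis::'a set). 1 + (x \<bullet> b)^2)"
  by (intro prod_pos) (simp add: add_pos_nonneg)
 ultimately have "inverse ((jb x) ^ DIM('a)) <= (\<Prod>b\<in>(Basis::'a set). inverse (1 + (x \<bullet> b)^2))"
  by (simp add: prod_inversef[unfolded comp_def])
 moreover have "0 <= inverse ((jb x) ^ DIM('a))" by simp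
 ultimately show "ennreal (norm (inverse ((jb x) ^ DIM('a)))) <= (\<Prod>b\<in>Basis. ennreal (inverse (1 + (x \<bullet> b)^2)))"
  by (subst prod_ennreal) (auto intro!: ennreal_leI simp: add_nonneg_nonneg)
qed
also have "... = (\<Prod>b\<in>(Basis::'a set). \<integral>\<^sup>+t. ennreal (inverse (1 + t^2)) \<partial>lborel)"
 by (rule nn_integral_lborel_prod) auto
also have "... < \<infinity>"
proof -
 have "(\<integral>\<^sup>+t. ennreal (inverse (1 + t^2)) \<partial>lborel) < \<infinity>"
  using one by (simp add: integrable_iff_bounded)
 then show ?thesis by (simp add: power_less_top_ennreal)
qed
finally have "integrable lborel (%x::'a. inverse ((jb x) ^ DIM('a)))"
 by (intro integrableI_bounded) auto
then show ?thesis by (simp add: integrable_completion)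
qed

lemma integrable_inverse_power_norm:
"integrable lebesgue (%x::'a::euclidean_space. inverse ((1 + norm x) ^ (2 * DIM('a))))"
proof (rule Bochner_Integration.integrable_bound[OF integrable_inverse_bracket])
show "(%x::'a. inverse ((1 + norm x) ^ (2 * DIM('a)))) : lmeas"
 by (intro continuous_measurable_lebesgue continuous_intros)
  (metis add.right_neutral add_less_le_mono less_irrefl norm_ge_zero power_eq_0_iff zero_less_one)
show "AE x::'a in lebesgue. norm (inverse ((1 + norm x) ^ (2 * DIM('a)))) <= norm (inverse ((jb x) ^ DIM('a)))"
proof (intro AE_I2)
 fix x :: 'a
 have "(jb x) ^ DIM('a) <= ((1 + norm x)^2) ^ DIM('a)"
  by (intro power_mono) (simp_all add: power2_sum)
 then show "norm (inverse ((1 + norm x) ^ (2 * DIM('a)))) <= norm (inverse ((jb x) ^ DIM('a)))"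
  by (simp add: power_mult le_imp_inverse_le add_pos_nonneg)
qed
qed

lemma rapid_bound:
assumes "rapid f"
obtains C where "0 <= C" "!!x. norm (f x) <= C * inverse ((1 + norm x) ^ k)"
proof -
obtain C where C: "!!x. (1 + norm x)^k * norm (f x) <= C" using assms unfolding rapid_def by blast
have p: "0 < (1 + norm x) ^ k" for x :: 'a by (intro zero_less_power) (simp add: add_pos_nonneg)
have "0 <= C" using C[of 0] by (auto intro: order_trans[rotated])
moreover have "norm (f x) <= C * inverse ((1 + norm x) ^ k)" for x
 using C[of x] p[of x] by (simp add: field_simps)
ultimately show ?thesis using that by blast
qed

lemma rapid_integrable:
fixes f :: "'a::euclidean_space => 'b::euclidean_space"
assumes "rapid f" "f : lmeas"
shows "integrable lebesgue f"
proof -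
obtain C where C: "0 <= C" "!!x. norm (f x) <= C * inverse ((1 + norm x) ^ (2 * DIM('a)))"
 using rapid_bound[OF assms(1), where k="2 * DIM('a)"] by metis
show ?thesis
 by (rule Bochner_Integration.integrable_bound[OF integrable_mult_right[OF integrable_inverse_power_norm, of C]])
  (use assms(2) C in auto)
qed

lemma schwartz_measurable: "f : schwartz ==> f : lmeas"
by (intro smooth_measurable schwartz_smooth)

lemma schwartz_integrable:
fixes f :: "real^'n => 'a::euclidean_space"
shows "f : schwartz ==> integrable lebesgue f"
by (intro rapid_integrable schwartz_rapid schwartz_measurable)

text \<open>Differentiation under the integral sign: the difference quotients are dominated by the mean
value theorem.\<close>

lemma has_derivative_lebesgue_integral:
fixes F :: "'x::euclidean_space => 'a => 'c::euclidean_space"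
assumes r: "r > 0"
 and int: "!!x. x : ball x0 r ==> integrable M (F x)"
 and der: "!!x y. x : ball x0 r ==> ((%x. F x y) has_derivative D x y) (at x)"
 and bd: "!!x y h. x : ball x0 r ==> norm (D x y h) <= g y * norm h"
 and g: "integrable M g"
 and meas: "!!h. (%y. D x0 y h) : borel_measurable M"
shows "((%x. \<integral>y. F x y \<partial>M) has_derivative (%h. \<integral>y. D x0 y h \<partial>M)) (at x0)"
proof -
have x0: "x0 : ball x0 r" using r by simp
have lin: "linear (D x0 y)" for y
 using der[OF x0] has_derivative_linear by blast
have intD: "integrable M (%y. D x0 y h)" for h
 by (rule Bochner_Integration.integrable_bound[OF integrable_mult_left[OF g, of "norm h"]])
  (use meas bd[OF x0] in \<open>auto intro!: AE_I2 order_trans[OF _ abs_ge_self]\<close>)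
have linI: "bounded_linear (%h. \<integral>y. D x0 y h \<partial>M)"
 by (rule linear_conv_bounded_linear[THEN iffD1], rule linearI)
  (simp_all add: linear_add[OF lin] linear_cmul[OF lin] intD)
have g0: "0 <= g y" for y
proof -
 obtain b :: 'x where "b : Basis" using nonempty_Basis by blast
 then have "norm (D x0 y b) <= g y" using bd[OF x0, of y b] by simp
 then show ?thesis using norm_ge_zero order_trans by blast
qed
have lim: "(%h. norm ((\<integral>y. F (x0 + h) y \<partial>M) - (\<integral>y. F x0 y \<partial>M) - (\<integral>y. D x0 y h \<partial>M)) / norm h) \<midarrow>0\<rightarrow> 0"
 unfolding tendsto_at_iff_sequentially comp_def
proof (intro allI impI)
 fix X :: "nat => 'x" assume X: "\<forall>i. X i : UNIV - {0}" and X0: "X ---> 0"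
 have "\<forall>\<^sub>F i in sequentially. norm (X i) < r"
  using tendsto_norm_zero[OF X0] r by (rule order_tendstoD(2))
 then obtain N where N: "!!i. i \<ge> N ==> norm (X i) < r" unfolding eventually_sequentially by blast
 define Q where "Q i y = (F (x0 + X (i + N)) y - F x0 y - D x0 y (X (i + N))) /\<^sub>R norm (X (i + N))" for i y
 have inb: "x0 + X (i + N) : ball x0 r" for i using N[of "i + N"] by (simp add: dist_norm)
 have "(%i. \<integral>y. Q i y \<partial>M) ---> (\<integral>y. 0 \<partial>M)"
 proof (rule integral_dominated_convergence[where w="%y. 2 * g y"])
  show "Q i : borel_measurable M" for i
   unfolding Q_def using int[OF inb] int[OF x0] meas by (intro borel_measurable_scaleR borel_measurable_diff) auto
  show "integrable M (%y. 2 * g y)" using g by simp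
  show "AE y in M. (%i. Q i y) ---> 0"
  proof (intro AE_I2)
   fix y
   have "(%h. norm (F (x0 + h) y - F x0 y - D x0 y h) / norm h) \<midarrow>0\<rightarrow> 0"
    using der[OF x0, of y] unfolding has_derivative_at by blast
   moreover have "filterlim (%i. X (i + N)) (at 0) sequentially"
    using LIMSEQ_ignore_initial_segment[OF X0, of N] X by (auto simp: filterlim_at)
   ultimately have "(%i. norm (F (x0 + X (i + N)) y - F x0 y - D x0 y (X (i + N))) / norm (X (i + N))) ---> 0"
    by (rule filterlim_compose)
   then have "(%i. norm (Q i y)) ---> 0"
    by (simp add: Q_def divide_inverse mult.commute)
   then show "(%i. Q i y) ---> 0" by (rule tendsto_norm_zero_cancel)
  qed
  show "AE y in M. norm (Q i y) <= 2 * g y" for i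
  proof (intro AE_I2)
   fix y
   have "norm (F (x0 + X (i + N)) y - F x0 y) <= g y * norm ((x0 + X (i + N)) - x0)"
   proof (rule differentiable_bound[where S="ball x0 r" and f'="%x. D x y"])
    show "((%x. F x y) has_derivative D x y) (at x within ball x0 r)" if "x : ball x0 r" for x
     using der[OF that] by (rule has_derivative_at_withinI)
    show "onorm (D x y) <= g y" if "x : ball x0 r" for x
     using bd[OF that] by (intro onorm_le) (simp add: mult.commute)
   qed (use inb x0 in auto)
   then have "norm (F (x0 + X (i + N)) y - F x0 y - D x0 y (X (i + N))) <= 2 * g y * norm (X (i + N))"
    using norm_triangle_ineq4[of "F (x0 + X (i + N)) y - F x0 y" "D x0 y (X (i + N))"] bd[OF x0, of y "X (i + N)"]
    by simp
   moreover have "norm (X (i + N)) > 0" using X by simp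
   moreover have "norm (Q i y) = norm (F (x0 + X (i + N)) y - F x0 y - D x0 y (X (i + N))) / norm (X (i + N))"
    unfolding Q_def norm_scaleR by (simp add: divide_inverse mult.commute)
   ultimately show "norm (Q i y) <= 2 * g y"
    by (simp only: pos_divide_le_eq)
  qed
 qed simp
 then have "(%i. norm (\<integral>y. Q i y \<partial>M)) ---> 0"
  by (auto intro: tendsto_norm_zero)
 moreover have "(\<integral>y. Q i y \<partial>M) = ((\<integral>y. F (x0 + X (i + N)) y \<partial>M) - (\<integral>y. F x0 y \<partial>M) - (\<integral>y. D x0 y (X (i + N)) \<partial>M)) /\<^sub>R norm (X (i + N))" for i
  unfolding Q_def using int[OF inb] int[OF x0] intD by simp
 ultimately have "(%i. norm ((\<integral>y. F (x0 + X (i + N)) y \<partial>M) - (\<integral>y. F x0 y \<partial>M) - (\<integral>y. D x0 y (X (i + N)) \<partial>M)) / norm (X (i + N))) ---> 0"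
  by (simp add: divide_inverse mult.commute)
 then show "(%i. norm ((\<integral>y. F (x0 + X i) y \<partial>M) - (\<integral>y. F x0 y \<partial>M) - (\<integral>y. D x0 y (X i) \<partial>M)) / norm (X i)) ---> 0"
  by (rule LIMSEQ_offset[where k=N])
qed
show ?thesis unfolding has_derivative_at using linI lim by blast
qed

text \<open>The integrals of the translates of \<open>f\<close> are all equal; they are differentiated under the integral sign.\<close>

lemma integral_partial_zero:
fixes f :: "real^'n => 'a::euclidean_space"
assumes f: "f : schwartz"
shows "(INTG x. partial j f x) = 0"
proof -
have "\<exists>C. 0 <= C & (\<forall>x. norm (partial k f x) <= C * inverse ((1 + norm x) ^ (2 * DIM(real^'n))))" for k
 using rapid_bound[OF schwartz_rapid[OF schwartz_partial[OF f]]] by metis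
then obtain C where C: "!!k. 0 <= C k"
  "!!k x. norm (partial k f x) <= C k * inverse ((1 + norm x) ^ (2 * DIM(real^'n)))"
 by metis
define D where "D x y h = (\<Sum>k\<in>UNIV. h $ k *R partial k f (x + y))" for x y h :: "real^'n"
define g where "g y = (\<Sum>k\<in>UNIV. C k) * 2 ^ (2 * DIM(real^'n)) * inverse ((1 + norm y) ^ (2 * DIM(real^'n)))" for y :: "real^'n"
have "((%x. INTG y. f (x + y)) has_derivative (%h. INTG y. D 0 y h)) (at 0)"
proof (rule has_derivative_lebesgue_integral[where r=1 and g=g])
 show "integrable lebesgue (%y. f (x + y))" for x
  using lebesgue_integrable_affine[OF schwartz_integrable[OF f], of 1 x] by (simp add: add.commute)
 show "((%x. f (x + y)) has_derivative D x y) (at x)" for x y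
  unfolding D_def
  by (rule has_derivative_compose[OF has_derivative_add_const[OF has_derivative_ident]
     has_derivative_partials[OF smooth_differentiable[OF schwartz_smooth[OF f]]]])
 show "norm (D x y h) <= g y * norm h" if "x : ball 0 1" for x y h
 proof -
  have le: "inverse ((1 + norm (x + y)) ^ (2 * DIM(real^'n))) <= 2 ^ (2 * DIM(real^'n)) * inverse ((1 + norm y) ^ (2 * DIM(real^'n)))"
  proof -
   have "norm y <= norm (x + y) + norm x" using norm_triangle_ineq4[of "x + y" x] by simp
   moreover have "norm x < 1" using that by simp
   ultimately have "1 + norm y <= 2 * (1 + norm (x + y))"
    using norm_ge_zero[of "x + y"] by argo
   then have "(1 + norm y) ^ (2 * DIM(real^'n)) <= (2 * (1 + norm (x + y))) ^ (2 * DIM(real^'n))"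
    by (intro power_mono) auto
   moreover have "0 < (1 + norm y) ^ (2 * DIM(real^'n))" "0 < (1 + norm (x + y)) ^ (2 * DIM(real^'n))"
    by (intro zero_less_power; simp add: add_pos_nonneg)+
   ultimately show ?thesis unfolding power_mult_distrib by (simp add: field_simps)
  qed
  have "norm (D x y h) <= (\<Sum>k\<in>UNIV. norm h * (C k * (2 ^ (2 * DIM(real^'n)) * inverse ((1 + norm y) ^ (2 * DIM(real^'n))))))"
   unfolding D_def
  proof (rule order_trans[OF norm_sum], intro sum_mono)
   fix k
   have "norm (h $ k *R partial k f (x + y)) <= norm h * (C k * inverse ((1 + norm (x + y)) ^ (2 * DIM(real^'n))))"
    unfolding norm_scaleR using component_le_norm_cart[of h k] C by (intro mult_mono) auto
   also have "... <= norm h * (C k * (2 ^ (2 * DIM(real^'n)) * inverse ((1 + norm y) ^ (2 * DIM(real^'n)))))"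
    by (intro mult_left_mono le C(1)) auto
   finally show "norm (h $ k *R partial k f (x + y)) <= norm h * (C k * (2 ^ (2 * DIM(real^'n)) * inverse ((1 + norm y) ^ (2 * DIM(real^'n)))))" .
  qed
  also have "... = g y * norm h" by (simp add: g_def sum_distrib_left sum_distrib_right mult_ac)
  finally show ?thesis .
 qed
 show "integrable lebesgue g" unfolding g_def
  by (intro integrable_mult_right integrable_inverse_power_norm)
 show "(%y. D 0 y h) : lmeas" for h
  unfolding D_def using schwartz_measurable[OF schwartz_partial[OF f]]
  by (auto intro!: borel_measurable_sum borel_measurable_scaleR)
qed simp
moreover have "(%x. INTG y. f (x + y)) = (%x. INTG y. f y)"
 using lebesgue_integral_shift[OF schwartz_measurable[OF f]] by (simp add: add.commute)
ultimately have "((%x. INTG y. f y) has_derivative (%h. INTG y. D 0 y h)) (at 0)" by simp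
then have "(%h. INTG y. D 0 y h) = (%h. 0)"
 using has_derivative_unique[OF _ has_derivative_const] by blast
then have "(INTG y. D 0 y (axis j 1)) = 0" by meson
moreover have "D 0 y (axis j 1) = partial j f y" for y
 unfolding D_def by (subst sum.remove[of _ j]) (auto simp: axis_def intro!: sum.neutral)
ultimately show ?thesis by simp
qed

section \<open>The Fourier transform of Schwartz functions\<close>

abbreviation fourier_const :: "'n itself => real" where
"fourier_const _ \<equiv> (2 * pi) powr (- real CARD('n) / 2)"

lemma continuous_cis_inner: "continuous_on A (%x::'a::euclidean_space. cis (c * (x \<bullet> xi)))"
unfolding cis_conv_exp by (intro continuous_intros)

lemma cis_inner_measurable: "(%x::'a::euclidean_space. ek x xi) : borel_measurable borel"
using continuous_cis_inner[of UNIV "-1" xi] by (intro borel_measurable_continuous_onI) simp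

lemma cis_inner_measurable_lebesgue:
"(%x::'a::euclidean_space. ek x xi) : lmeas"
using cis_inner_measurable by (intro measurable_completion) simp

lemma integrable_cis:
fixes f :: "('n::finite, 'm::finite) vfun"
assumes "integrable lebesgue f"
shows "integrable lebesgue (%x. ek x xi *s f x)"
proof (rule Bochner_Integration.integrable_bound[OF assms])
show "(%x. ek x xi *s f x) : lmeas"
 by (intro bilinear_measurable[OF bilinear_smult] cis_inner_measurable_lebesgue
   borel_measurable_integrable[OF assms])
qed (simp add: norm_vector_smult)

lemma integral_bounded_linear':
assumes "bounded_linear L" "integrable M f"
shows "(\<integral>x. L (f x) \<partial>M) = L (\<integral>x. f x \<partial>M)"
using integral_bounded_linear[OF assms] .

lemma fourier_add:
fixes f g :: "('n::finite, 'm::finite) vfun"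
assumes "integrable lebesgue f" "integrable lebesgue g"
shows "fourier (%x. f x + g x) xi = fourier f xi + fourier g xi"
unfolding fourier_def using integrable_cis[OF assms(1), of xi] integrable_cis[OF assms(2), of xi]
by (simp add: bounded_bilinear.add_right[OF bilinear_smult] scaleR_add_right)

lemma bounded_linear_smult: "bounded_linear (%v :: complex^'m. z *s v)"
by (rule bounded_bilinear.bounded_linear_right[OF bilinear_smult])

lemma smult_scaleR_commute: "z *s (r *R v) = r *R (z *s v)" for v :: "complex^'m"
by (simp add: vec_eq_iff)

lemma scaleR_eq_smult: "r *R v = of_real r *s v" for v :: "complex^'m"
by (simp add: vec_eq_iff complex_eq_iff)

lemma fourier_smult:
fixes f :: "('n::finite, 'm::finite) vfun"
assumes "integrable lebesgue f"
shows "fourier (%x. z *s f x) xi = z *s fourier f xi"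
proof -
have "(INTG x. ek x xi *s (z *s f x)) = (INTG x. z *s (ek x xi *s f x))"
 by (simp add: mult.commute)
also have "... = z *s (INTG x. ek x xi *s f x)"
 by (rule integral_bounded_linear'[OF bounded_linear_smult integrable_cis[OF assms]])
finally show ?thesis unfolding fourier_def by (simp only: smult_scaleR_commute)
qed

lemma fourier_bound:
fixes f :: "('n::finite, 'm::finite) vfun"
shows "norm (fourier f xi) <= fourier_const TYPE('n) * (INTG x. norm (f x))"
proof -
have "norm (INTG x. ek x xi *s f x) <= (INTG x. norm (ek x xi *s f x))"
 by (rule integral_norm_bound)
then show ?thesis unfolding fourier_def by (simp add: norm_vector_smult mult_left_mono)
qed

lemma rapid_norm_times: "rapid f ==> rapid (%x. norm x * norm (f x))"
proof (rule rapid_bilinear[OF bounded_bilinear_mult])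
show "slow (norm :: 'a => real)"
 unfolding slow_def by (rule exI[of _ 1], rule exI[of _ 1]) simp
qed (simp add: rapid_def)

lemma fourier_has_derivative:
fixes f :: "('n::finite, 'm::finite) vfun"
assumes f: "f : schwartz"
shows "(fourier f has_derivative (%h. fourier (%x. (- \<i> * of_real (x \<bullet> h)) *s f x) xi)) (at xi)"
proof -
define D where "D xi x h = (- (\<i> * of_real (x \<bullet> h)) * ek x xi) *s f x" for xi x h :: "real^'n"
have "((%xi. INTG x. ek x xi *s f x) has_derivative (%h. INTG x. D xi x h)) (at xi)"
proof (rule has_derivative_lebesgue_integral[where r=1 and g="%x. norm x * norm (f x)"])
 show "integrable lebesgue (%y. cis (- (y \<bullet> x)) *s f y)" for x
  by (intro integrable_cis schwartz_integrable f)
 show "((%x. cis (- (y \<bullet> x)) *s f y) has_derivative D x y) (at x)" for x y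
 proof -
  have "((%x. - (\<i> * of_real (y \<bullet> x))) has_derivative (%h. - (\<i> * of_real (y \<bullet> h)))) (at x)"
   by (intro has_derivative_minus has_derivative_mult_right bounded_linear.has_derivative[OF bounded_linear_of_real]
    has_derivative_inner_right has_derivative_ident)
  from has_derivative_compose[OF this DERIV_exp[unfolded has_field_derivative_def]]
  have "((%x. cis (- (y \<bullet> x))) has_derivative (%h. - (\<i> * of_real (y \<bullet> h)) * cis (- (y \<bullet> x)))) (at x)"
   by (simp add: cis_conv_exp mult.commute)
  from bounded_linear.has_derivative[OF bounded_bilinear.bounded_linear_left[OF bilinear_smult] this]
  show ?thesis unfolding D_def .
 qed
 show "norm (D x y h) <= norm y * norm (f y) * norm h" for x y h
  using mult_right_mono[OF Cauchy_Schwarz_ineq2[of y h] norm_ge_zero[of "f y"]]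
  by (simp add: D_def norm_vector_smult norm_mult mult_ac)
 show "integrable lebesgue (%x. norm x * norm (f x))"
  by (intro rapid_integrable rapid_norm_times schwartz_rapid f borel_measurable_times
    measurable_compose[OF schwartz_measurable[OF f] borel_measurable_norm])
   (auto intro: measurable_completion)
 show "(%y. D xi y h) : lmeas" for h
  unfolding D_def cis_conv_exp
  by (rule bilinear_measurable[OF bilinear_smult _ schwartz_measurable[OF f]])
   (intro continuous_measurable_lebesgue continuous_intros)
qed simp
from bounded_linear.has_derivative[OF bounded_linear_scaleR_right this, of "fourier_const TYPE('n)"]
show ?thesis unfolding fourier_def[abs_def] D_def by (simp add: mult.commute)
qed

lemma fourier_partial:
fixes f :: "('n::finite, 'm::finite) vfun"
assumes f: "f : schwartz"
shows "partial j (fourier f) = fourier (%x. (- \<i>) *s (of_real (x $ j) *s f x))"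
by (rule ext, subst partial_eq[OF fourier_has_derivative[OF f]]) (simp add: inner_axis)

lemma partial_cis:
fixes xi :: "real^'n"
shows "(%x. ek x xi) differentiable (at x)"
 and "partial j (%x. ek x xi) = (%x. - (dsym j xi) * ek x xi)"
proof -
have d: "((%x. ek x xi) has_derivative (%h. - (\<i> * of_real (h \<bullet> xi)) * ek x xi)) (at x)" for x
proof -
 have "((%x. - (\<i> * of_real (x \<bullet> xi))) has_derivative (%h. - (\<i> * of_real (h \<bullet> xi)))) (at x)"
  by (intro has_derivative_minus has_derivative_mult_right bounded_linear.has_derivative[OF bounded_linear_of_real]
   has_derivative_inner_left has_derivative_ident)
 from has_derivative_compose[OF this DERIV_exp[unfolded has_field_derivative_def]]
 show ?thesis by (simp add: cis_conv_exp mult.commute)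
qed
show "(%x. ek x xi) differentiable (at x)"
 unfolding differentiable_def by (rule exI) (rule d)
show "partial j (%x. ek x xi) = (%x. - (dsym j xi) * ek x xi)"
 by (rule ext, subst partial_eq[OF d]) (simp add: inner_commute inner_axis)
qed

lemma schwartz_cis_mult:
fixes f :: "('n::finite, 'm::finite) vfun"
shows "f : schwartz ==> (%x. ek x xi *s f x) : schwartz"
using schwartz_cis[of f 1 "- xi"] by (simp add: inner_commute)

lemma fourier_of_partial:
fixes f :: "('n::finite, 'm::finite) vfun"
assumes f: "f : schwartz"
shows "fourier (partial j f) xi = (dsym j xi) *s fourier f xi"
proof -
have "partial j (%x. ek x xi *s f x)
  = (%x. ek x xi *s partial j f x + (- (dsym j xi) * ek x xi) *s f x)"
 using partial_bilinear[OF bilinear_smult partial_cis(1) smooth_differentiable[OF schwartz_smooth[OF f]]]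
 unfolding partial_cis(2) .
also have "... = (%x. ek x xi *s partial j f x + (- (dsym j xi)) *s (ek x xi *s f x))"
 by simp
finally have "0 = (INTG x. ek x xi *s partial j f x + (- (dsym j xi)) *s (ek x xi *s f x))"
 using integral_partial_zero[OF schwartz_cis_mult[OF f], of j xi] by simp
also have "... = (INTG x. ek x xi *s partial j f x)
  + (- (dsym j xi)) *s (INTG x. ek x xi *s f x)"
proof -
 note i = integrable_cis[OF schwartz_integrable[OF schwartz_partial[OF f]], of xi j] integrable_cis[OF schwartz_integrable[OF f], of xi]
 show ?thesis
  by (subst Bochner_Integration.integral_add[OF i(1) integrable_bounded_linear[OF bounded_linear_smult i(2)]])
   (simp only: integral_bounded_linear'[OF bounded_linear_smult i(2)])
qed
finally have "(INTG x. ek x xi *s partial j f x) = (dsym j xi) *s (INTG x. ek x xi *s f x)"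
 by (simp add: vec_eq_iff eq_neg_iff_add_eq_0)
then show ?thesis unfolding fourier_def by (simp only: smult_scaleR_commute)
qed

text \<open>The operator $1 - \Delta$, which the Fourier transform turns into multiplication by
$1 + |\xi|^2$.\<close>

definition helmholtz :: "(real^'n => 'a::real_normed_vector) => real^'n => 'a" where
"helmholtz f x = f x - (\<Sum>j\<in>UNIV. partial j (partial j f) x)"

lemma helmholtz_schwartz: "f : schwartz ==> helmholtz f : schwartz"
unfolding helmholtz_def[abs_def] by (intro schwartz_diff schwartz_sum schwartz_partial)

lemma helmholtz_power_schwartz: "f : schwartz ==> (helmholtz ^^ k) f : schwartz"
by (induction k) (auto intro: helmholtz_schwartz)

lemma fourier_diff:
fixes f g :: "('n::finite, 'm::finite) vfun"
assumes "integrable lebesgue f" "integrable lebesgue g"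
shows "fourier (%x. f x - g x) xi = fourier f xi - fourier g xi"
unfolding fourier_def using integrable_cis[OF assms(1), of xi] integrable_cis[OF assms(2), of xi]
by (simp add: bounded_bilinear.diff_right[OF bilinear_smult] scaleR_diff_right)

lemma fourier_zero: "fourier (%x. 0) xi = 0"
by (simp add: fourier_def)

lemma fourier_sum:
fixes f :: "'i => ('n::finite, 'm::finite) vfun"
assumes "!!i. i : A ==> integrable lebesgue (f i)"
shows "fourier (%x. \<Sum>i\<in>A. f i x) xi = (\<Sum>i\<in>A. fourier (f i) xi)"
using assms by (induction A rule: infinite_finite_induct) (simp_all add: fourier_zero fourier_add)

lemma norm_square_sum: "(norm x)^2 = (\<Sum>j\<in>UNIV. (x $ j)^2)" for x :: "real^'n"
unfolding power2_norm_eq_inner inner_vec_def by (simp add: power2_eq_square)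

lemma fourier_helmholtz:
fixes f :: "('n::finite, 'm::finite) vfun"
assumes f: "f : schwartz"
shows "fourier (helmholtz f) xi = (jb xi) *R fourier f xi"
proof -
have "fourier (helmholtz f) xi = fourier f xi - (\<Sum>j\<in>UNIV. fourier (partial j (partial j f)) xi)"
 unfolding helmholtz_def[abs_def]
 by (subst fourier_diff) (auto intro!: schwartz_integrable f schwartz_sum schwartz_partial fourier_sum)
also have "(\<Sum>j\<in>UNIV. fourier (partial j (partial j f)) xi) = (\<Sum>j\<in>UNIV. - (xi $ j)\<^sup>2 *R fourier f xi)"
 by (simp add: fourier_of_partial schwartz_partial f scaleR_eq_smult power2_eq_square)
  (simp add: vec_eq_iff algebra_simps)
also have "... = - (norm xi)\<^sup>2 *R fourier f xi"
 by (simp add: norm_square_sum sum_negf scaleR_sum_left)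
finally show ?thesis by (simp add: scaleR_add_left)
qed

lemma fourier_helmholtz_power:
fixes f :: "('n::finite, 'm::finite) vfun"
assumes f: "f : schwartz"
shows "fourier ((helmholtz ^^ k) f) xi = (jb xi) ^ k *R fourier f xi"
by (induction k) (simp_all add: fourier_helmholtz helmholtz_power_schwartz f)

lemma rapidI_bracket:
assumes "!!k. \<exists>C. \<forall>x. (jb x)^k * norm (f x) <= C"
shows "rapid f"
unfolding rapid_def
proof
fix k
obtain C where C: "!!x. (jb x)^k * norm (f x) <= C" using assms by blast
have "(1 + norm x)^k * norm (f x) <= 2^k * C" for x
proof -
 have "1 + norm x <= 2 * (jb x)"
  using sum_squares_bound[of "norm x" 1] zero_le_power2[of "norm x"]
  unfolding power_one mult_1_right by argo
 then have "(1 + norm x)^k * norm (f x) <= (2 * (jb x))^k * norm (f x)"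
  by (intro mult_right_mono power_mono) auto
 also have "... = 2^k * ((jb x)^k * norm (f x))" by (simp only: power_mult_distrib mult.assoc)
 also have "... <= 2^k * C" using C[of x] by simp
 finally show ?thesis .
qed
then show "\<exists>C. \<forall>x. (1 + norm x)^k * norm (f x) <= C" by blast
qed

lemma rapid_fourier:
fixes f :: "('n::finite, 'm::finite) vfun"
assumes f: "f : schwartz"
shows "rapid (fourier f)"
proof (rule rapidI_bracket)
fix k
have "(jb xi)^k * norm (fourier f xi) <= fourier_const TYPE('n) * (INTG x. norm ((helmholtz ^^ k) f x))" for xi
 using fourier_bound[of "(helmholtz ^^ k) f" xi] by (simp add: fourier_helmholtz_power[OF f])
then show "\<exists>C. \<forall>xi. (jb xi)^k * norm (fourier f xi) <= C" by blast
qed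

lemma fourier_schwartz:
fixes f :: "('n::finite, 'm::finite) vfun"
assumes f: "f : schwartz"
shows "fourier f : schwartz"
proof (rule schwartz_coinduct[of _ "fourier ` schwartz"])
show "g differentiable (at x)" if "g : fourier ` schwartz" for g :: "('n, 'm) vfun" and x
 using that fourier_has_derivative unfolding differentiable_def by blast
show "partial j g : fourier ` schwartz" if gF: "g : fourier ` schwartz" for g :: "('n, 'm) vfun" and j
proof -
 obtain f where f: "f : schwartz" "g = fourier f" using gF by blast
 show ?thesis unfolding f(2) fourier_partial[OF f(1)]
  by (intro imageI schwartz_smult schwartz_coord f(1))
qed
qed (use f rapid_fourier in auto)

lemma lebesgue_borel_representative:
fixes f :: "'a::euclidean_space => 'b::euclidean_space"
assumes "f : lmeas"
obtains f' where "f' : borel_measurable borel" "AE x in lebesgue. f x = f' x"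
proof -
have "\<forall>b. \<exists>g. g : borel_measurable lborel & (AE x in lborel. f x \<bullet> b = g x)"
 using completion_ex_borel_measurable_real[of "%x. f x \<bullet> b" lborel for b] assms by auto
from choice[OF this] obtain g where g: "!!b. g b : borel_measurable borel" "!!b. AE x in lborel. f x \<bullet> b = g b x"
 by auto
have "AE x in lborel. \<forall>b\<in>Basis. f x \<bullet> b = g b x"
 using g(2) by (intro AE_finite_allI) auto
then have "AE x in lborel. f x = (\<Sum>b\<in>Basis. g b x *R b)"
proof eventually_elim
 case (elim x)
 have "(\<Sum>b\<in>Basis. g b x *R b) = (\<Sum>b\<in>Basis. (f x \<bullet> b) *R b)"
  using elim by (intro sum.cong) auto
 then show ?case by (simp add: euclidean_representation)
qed
then have "AE x in lebesgue. f x = (\<Sum>b\<in>Basis. g b x *R b)"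
 by (rule AE_completion)
moreover have "(%x. \<Sum>b\<in>Basis. g b x *R b) : borel_measurable borel"
 using g(1) by (intro borel_measurable_sum borel_measurable_scaleR) auto
ultimately show ?thesis using that by blast
qed

lemma integrable_product:
fixes f g :: "'a::euclidean_space => real"
assumes f: "integrable lborel f" and g: "integrable lborel g"
shows "integrable (lborel \<Otimes>\<^sub>M lborel) (%p. f (fst p) * g (snd p))"
proof (rule lborel_pair.Fubini_integrable)
have "f : borel_measurable borel" "g : borel_measurable borel"
 using assms by (auto dest: borel_measurable_integrable)
then show "(%p. f (fst p) * g (snd p)) : borel_measurable (lborel \<Otimes>\<^sub>M lborel)"
 by measurable
show "integrable lborel (%x. \<integral>y. norm (f (fst (x, y)) * g (snd (x, y))) \<partial>lborel)"
 using f by (simp add: abs_mult)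
show "AE x in lborel. integrable lborel (%y. f (fst (x, y)) * g (snd (x, y)))"
 using g by simp
qed

lemma fourier_cong_AE:
fixes f g :: "('n::finite, 'm::finite) vfun"
assumes "f : lmeas" "g : lmeas" "AE x in lebesgue. f x = g x"
shows "fourier f xi = fourier g xi"
proof -
have c: "(%x. ek x xi) : lmeas"
 using continuous_cis_inner[of UNIV "-1" xi] by (intro continuous_measurable_lebesgue) simp
show ?thesis unfolding fourier_def
 using assms by (intro arg_cong[where f="scaleR _"] integral_cong_AE bilinear_measurable[OF bilinear_smult] c) auto
qed

text \<open>The symmetry of the Fourier transform with respect to the bilinear product, by Fubini's theorem.\<close>

lemma fourier_symmetric:
fixes f g :: "('n::finite, 'm::finite) vfun"
assumes f: "integrable lebesgue f" and g: "integrable lebesgue g"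
shows "(INTG xi. cdot (fourier f xi) (g xi)) = (INTG x. cdot (f x) (fourier g x))"
proof -
obtain f' where f': "f' : borel_measurable borel" "AE x in lebesgue. f x = f' x"
 using lebesgue_borel_representative[OF borel_measurable_integrable[OF f]] .
obtain g' where g': "g' : borel_measurable borel" "AE x in lebesgue. g x = g' x"
 using lebesgue_borel_representative[OF borel_measurable_integrable[OF g]] .
have fm: "f : lmeas" "f' : lmeas"
 and gm: "g : lmeas" "g' : lmeas"
 using f g f'(1) g'(1) by (auto intro: measurable_completion)
have "integrable lebesgue f'" "integrable lebesgue g'"
 using integrable_cong_AE_imp[OF f fm(2)] integrable_cong_AE_imp[OF g gm(2)] f'(2) g'(2)
 by (auto elim: AE_mp)
then have fi: "integrable lborel f'" and gi: "integrable lborel g'"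
 using f'(1) g'(1) by (simp_all add: integrable_completion)
define H where "H x xi = ek x xi * cdot (f' x) (g' xi)" for x xi
have cis_meas: "(%p::(real^'n) \<times> (real^'n). cis (- (fst p \<bullet> snd p))) : borel_measurable (lborel \<Otimes>\<^sub>M lborel)"
proof -
 have "(%p::(real^'n) \<times> (real^'n). cis (- (fst p \<bullet> snd p))) : borel_measurable borel"
  unfolding cis_conv_exp by (intro borel_measurable_continuous_onI continuous_intros)
 then show ?thesis unfolding lborel_prod by simp
qed
have pm: "(%p. f' (fst p)) : borel_measurable (lborel \<Otimes>\<^sub>M lborel)"
 "(%p. f' (snd p)) : borel_measurable (lborel \<Otimes>\<^sub>M lborel)"
 "(%p. g' (snd p)) : borel_measurable (lborel \<Otimes>\<^sub>M lborel)"
 using measurable_compose[OF measurable_fst[of lborel lborel], of f' borel] f'(1)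
  measurable_compose[OF measurable_snd[of lborel lborel], of f' borel]
  measurable_compose[OF measurable_snd[of lborel lborel], of g' borel] g'(1) by simp_all
have H: "integrable (lborel \<Otimes>\<^sub>M lborel) (%(x, xi). H x xi)"
proof (rule Bochner_Integration.integrable_bound)
 show "integrable (lborel \<Otimes>\<^sub>M lborel) (%p. norm (f' (fst p)) * norm (g' (snd p)))"
  using fi gi by (intro integrable_product) auto
 have "(%p. cdot (f' (fst p)) (g' (snd p))) : borel_measurable (lborel \<Otimes>\<^sub>M lborel)"
  by (intro bilinear_measurable[OF bilinear_cdot] pm)
 then show "(%(x, xi). H x xi) : borel_measurable (lborel \<Otimes>\<^sub>M lborel)"
  unfolding H_def split_beta by (rule borel_measurable_times[OF cis_meas])
 show "AE p in lborel \<Otimes>\<^sub>M lborel. norm (case p of (x, xi) => H x xi) <= norm (norm (f' (fst p)) * norm (g' (snd p)))"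
  by (intro AE_I2) (auto simp: H_def norm_mult norm_cdot_le split: prod.split)
qed
have cf: "integrable lborel (%x. ek x xi *s f' x)" for xi
proof (rule Bochner_Integration.integrable_bound[OF fi])
 show "(%x. ek x xi *s f' x) : borel_measurable lborel"
  using f'(1) cis_inner_measurable by (intro bilinear_measurable[OF bilinear_smult]) simp_all
qed (simp add: norm_vector_smult)
have cg: "integrable lborel (%xi. cis (- (xi \<bullet> x)) *s g' xi)" for x
proof (rule Bochner_Integration.integrable_bound[OF gi])
 show "(%xi. cis (- (xi \<bullet> x)) *s g' xi) : borel_measurable lborel"
  using g'(1) cis_inner_measurable by (intro bilinear_measurable[OF bilinear_smult]) simp_all
qed (simp add: norm_vector_smult)
have ff: "fourier f xi = fourier_const TYPE('n) *R (\<integral>x. ek x xi *s f' x \<partial>lborel)" for xi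
proof -
 have "fourier f xi = fourier f' xi" by (rule fourier_cong_AE[OF fm f'(2)])
 then show ?thesis unfolding fourier_def using borel_measurable_integrable[OF cf] by (simp add: integral_completion)
qed
have fg: "fourier g x = fourier_const TYPE('n) *R (\<integral>xi. cis (- (xi \<bullet> x)) *s g' xi \<partial>lborel)" for x
proof -
 have "fourier g x = fourier g' x" by (rule fourier_cong_AE[OF gm g'(2)])
 then show ?thesis unfolding fourier_def using borel_measurable_integrable[OF cg] by (simp add: integral_completion)
qed
have Hl: "(\<integral>x. H x xi \<partial>lborel) = cdot (\<integral>x. ek x xi *s f' x \<partial>lborel) (g' xi)" for xi
 unfolding H_def
 using integral_bounded_linear'[OF bounded_bilinear.bounded_linear_left[OF bilinear_cdot] cf]
 by (simp add: cdot_smult)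
have Hr: "(\<integral>xi. H x xi \<partial>lborel) = cdot (f' x) (\<integral>xi. cis (- (xi \<bullet> x)) *s g' xi \<partial>lborel)" for x
proof -
 have "H x xi = cdot (f' x) (cis (- (xi \<bullet> x)) *s g' xi)" for xi
  by (simp add: H_def cdot_smult inner_commute[of x xi])
 then show ?thesis
  using integral_bounded_linear'[OF bounded_bilinear.bounded_linear_right[OF bilinear_cdot] cg]
  by simp
qed
have Fm: "(%xi. \<integral>x. ek x xi *s f' x \<partial>lborel) : borel_measurable borel"
proof -
 have "(%p. cis (- (fst p \<bullet> snd p)) *s f' (snd p)) : borel_measurable (lborel \<Otimes>\<^sub>M lborel)"
  by (rule bilinear_measurable[OF bilinear_smult cis_meas pm(2)])
 then have "(%(xi, x). cis (- (xi \<bullet> x)) *s f' x) : borel_measurable (lborel \<Otimes>\<^sub>M lborel)"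
  by (simp add: case_prod_beta')
 from lborel.borel_measurable_lebesgue_integral[OF this] show ?thesis by (simp add: inner_commute)
qed
have Gm: "(%xi. \<integral>x. ek x xi *s g' x \<partial>lborel) : borel_measurable borel"
proof -
 have "(%p. cis (- (fst p \<bullet> snd p)) *s g' (snd p)) : borel_measurable (lborel \<Otimes>\<^sub>M lborel)"
  by (rule bilinear_measurable[OF bilinear_smult cis_meas pm(3)])
 then have "(%(xi, x). cis (- (xi \<bullet> x)) *s g' x) : borel_measurable (lborel \<Otimes>\<^sub>M lborel)"
  by (simp add: case_prod_beta')
 from lborel.borel_measurable_lebesgue_integral[OF this] show ?thesis by (simp add: inner_commute)
qed
have "(INTG xi. cdot (fourier f xi) (g xi)) = (INTG xi. cdot (fourier f xi) (g' xi))"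
 unfolding ff using gm g'(2) Fm
 by (intro integral_cong_AE bilinear_measurable[OF bilinear_cdot] borel_measurable_scaleR)
   (auto intro: measurable_completion)
also have "... = (\<integral>xi. cdot (fourier f xi) (g' xi) \<partial>lborel)"
 unfolding ff using g'(1) Fm
 by (intro integral_completion bilinear_measurable[OF bilinear_cdot] borel_measurable_scaleR) auto
also have "... = (\<integral>xi. fourier_const TYPE('n) *R (\<integral>x. H x xi \<partial>lborel) \<partial>lborel)"
 unfolding ff Hl by (simp add: bounded_bilinear.scaleR_left[OF bilinear_cdot])
also have "... = fourier_const TYPE('n) *R (\<integral>xi. (\<integral>x. H x xi \<partial>lborel) \<partial>lborel)" by simp
also have "(\<integral>xi. (\<integral>x. H x xi \<partial>lborel) \<partial>lborel) = (\<integral>x. (\<integral>xi. H x xi \<partial>lborel) \<partial>lborel)"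
 by (rule lborel_pair.Fubini_integral[OF H])
also have "fourier_const TYPE('n) *R ... = (\<integral>x. fourier_const TYPE('n) *R (\<integral>xi. H x xi \<partial>lborel) \<partial>lborel)" by simp
also have "... = (\<integral>x. cdot (f' x) (fourier g x) \<partial>lborel)"
 unfolding fg Hr by (simp add: bounded_bilinear.scaleR_right[OF bilinear_cdot])
also have "... = (INTG x. cdot (f' x) (fourier g x))"
 unfolding fg using f'(1) Gm
 by (intro integral_completion[symmetric] bilinear_measurable[OF bilinear_cdot] borel_measurable_scaleR) auto
also have "... = (INTG x. cdot (f x) (fourier g x))"
 unfolding fg using fm f'(2) Gm
 by (intro integral_cong_AE bilinear_measurable[OF bilinear_cdot] borel_measurable_scaleR)
   (auto intro: measurable_completion)
finally show ?thesis .
qed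

section \<open>Fourier inversion\<close>

definition gauss :: "complex^'m => real^'n => complex^'m" where
"gauss v x = exp (- (x \<bullet> x) / 2) *R v"

text \<open>The span of the functions obtained from a Gaussian by multiplication by coordinates.
It is closed under differentiation.\<close>

inductive_set gauss_span :: "(real^'n => complex^'m) set" where
base: "gauss v : gauss_span"
| coord: "f : gauss_span ==> (%x. of_real (x $ j) *s f x) : gauss_span"
| add: "f : gauss_span ==> g : gauss_span ==> (%x. f x + g x) : gauss_span"
| smult: "f : gauss_span ==> (%x. z *s f x) : gauss_span"

lemma gauss_has_derivative: "(gauss v has_derivative (%h. - (x \<bullet> h) *R gauss v x)) (at x)"
proof -
have "((%x. - (x \<bullet> x) / 2) has_derivative (%h. - (x \<bullet> h))) (at x)"
 by (auto intro!: derivative_eq_intros simp: inner_commute)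
from has_derivative_compose[OF this DERIV_exp[unfolded has_field_derivative_def]]
have "((%x. exp (- (x \<bullet> x) / 2)) has_derivative (%h. exp (- (x \<bullet> x) / 2) * - (x \<bullet> h))) (at x)" .
from bounded_linear.has_derivative[OF bounded_linear_scaleR_left this]
show ?thesis unfolding gauss_def[abs_def] by (simp add: mult.commute)
qed

lemma partial_gauss: "partial j (gauss v) = (%x. (- 1) *s (of_real (x $ j) *s gauss v x))"
by (rule ext, subst partial_eq[OF gauss_has_derivative]) (simp add: inner_axis scaleR_eq_smult)

lemma gauss_span_smooth:
assumes "f : gauss_span"
shows "(\<forall>x. f differentiable (at x)) & (\<forall>j. partial j f : gauss_span)"
using assms
proof induction
case (base v)
have "gauss v differentiable (at x)" for x
 unfolding differentiable_def by (rule exI) (rule gauss_has_derivative)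
then show ?case
 unfolding partial_gauss by (intro conjI allI gauss_span.intros)
next
case (coord f j)
have c: "(%x. of_real (x $ j) :: complex) differentiable (at x)" for x
 by (rule smooth_differentiable[OF slow_smooth_smooth[OF slow_smooth_coord]])
have d: "f differentiable (at x)" for x using coord by blast
have "(%x. of_real (x $ j) *s f x) differentiable (at x)" for x
 using bounded_bilinear.FDERIV[OF bilinear_smult differentiable_has_derivative[OF c] differentiable_has_derivative[OF d]]
 unfolding differentiable_def by blast
moreover have "partial i (%x. of_real (x $ j) *s f x) : gauss_span" for i
proof -
 have "partial i (%x. of_real (x $ j) :: complex) = (%x. of_real (axis i 1 $ j))"
  by (rule ext, rule partial_eq, rule bounded_linear.has_derivative[OF bounded_linear_of_real
    bounded_linear_imp_has_derivative[OF bounded_linear_vec_nth]])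
 then show ?thesis
  unfolding partial_bilinear[OF bilinear_smult c d]
  using coord by (auto intro!: gauss_span.intros)
qed
ultimately show ?case by blast
next
case (add f g)
then show ?case by (auto simp: partial_add intro!: gauss_span.add)
next
case (smult f z)
have d: "f differentiable (at x)" for x using smult by blast
have "(%x. z *s f x) differentiable (at x)" for x
 using bounded_linear.has_derivative[OF bounded_linear_smult differentiable_has_derivative[OF d]]
 unfolding differentiable_def by blast
moreover have "partial j (%x. z *s f x) : gauss_span" for j
 unfolding partial_linear_image[OF bounded_linear_smult d] using smult by (auto intro!: gauss_span.intros)
ultimately show ?case by blast
qed

lemma gauss_rapid: "rapid (gauss v :: real^'n => complex^'m)"
unfolding rapid_def
proof
fix k
have "(1 + norm x)^k * norm (gauss v x) <= real k ^ k * exp (1/2) * norm v" for x :: "real^'n"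
proof -
 have "(1 + norm x)^k <= real k ^ k * exp (norm x)"
 proof (cases "k = 0")
  case False
  have "((1 + norm x) / real k) ^ k <= (1 + norm x / real k) ^ k"
   using False by (intro power_mono) (auto simp: field_simps)
  also have "... <= exp (norm x)"
   using False by (intro exp_ge_one_plus_x_over_n_power_n) (auto intro: order_trans[of _ 0])
  finally show ?thesis using False by (simp add: power_divide field_simps)
 qed simp
 moreover have "exp (- (x \<bullet> x) / 2) <= exp (1/2 - norm x)"
  using sum_squares_bound[of "norm x" 1] by (simp add: power2_norm_eq_inner)
 ultimately have "(1 + norm x)^k * exp (- (x \<bullet> x) / 2) <= (real k ^ k * exp (norm x)) * exp (1/2 - norm x)"
  by (intro mult_mono) auto
 also have "... = real k ^ k * exp (1/2)" by (simp add: exp_diff)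
 finally show ?thesis
  unfolding gauss_def using mult_right_mono[OF _ norm_ge_zero[of v]] by (fastforce simp: mult_ac)
qed
then show "\<exists>C. \<forall>x::real^'n. (1 + norm x)^k * norm (gauss v x) <= C" by blast
qed

lemma gauss_schwartz: "(gauss v :: real^'n => complex^'m) : schwartz"
proof (rule schwartz_coinduct[of _ gauss_span])
have slow: "slow (%x. z)" for z :: complex by (rule slow_const)
show "rapid g" if "g : gauss_span" for g :: "real^'n => complex^'m"
 using that
 by induction (auto intro: gauss_rapid rapid_add rapid_bilinear[OF bilinear_smult]
   slow_smooth_slow[OF slow_smooth_coord] slow)
qed (auto intro: gauss_span.base simp: gauss_span_smooth)

lemma gauss_integral: "(INTG x. gauss v (x :: real^'n)) = (2 * pi) powr (real CARD('n) / 2) *R v"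
for v :: "complex^'m"
proof -
have one: "(\<integral>\<^sup>+t. ennreal (exp (- t\<^sup>2 / 2)) \<partial>lborel) = ennreal (sqrt (2 * pi))"
proof -
 have "has_bochner_integral lborel (%t. std_normal_density t) 1"
  using std_normal_moment_even[of 0] by simp
 then have "has_bochner_integral lborel (%t. sqrt (2 * pi) * std_normal_density t) (sqrt (2 * pi) * 1)"
  by (intro has_bochner_integral_mult_right)
 then have "has_bochner_integral lborel (%t. exp (- t\<^sup>2 / 2)) (sqrt (2 * pi))"
  by (simp add: std_normal_density_def)
 then show ?thesis
  by (intro nn_integral_eq_integral[THEN trans]) (auto simp: has_bochner_integral_iff)
qed
have "nn_integral lborel (%x::real^'n. ennreal (exp (- (x \<bullet> x) / 2)))
  = nn_integral lborel (%x::real^'n. \<Prod>b\<in>Basis. ennreal (exp (- (x \<bullet> b)\<^sup>2 / 2)))"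
proof (rule nn_integral_cong)
 fix x :: "real^'n"
 have "exp (- (x \<bullet> x) / 2) = (\<Prod>b\<in>Basis. exp (- (x \<bullet> b)\<^sup>2 / 2))"
  by (simp add: exp_sum[symmetric] euclidean_inner[of x x] sum_divide_distrib sum_negf power2_eq_square)
 then show "ennreal (exp (- (x \<bullet> x) / 2)) = (\<Prod>b\<in>Basis. ennreal (exp (- (x \<bullet> b)\<^sup>2 / 2)))"
  by (simp add: prod_ennreal)
qed
also have "... = (\<Prod>b\<in>(Basis::(real^'n) set). \<integral>\<^sup>+t. ennreal (exp (- t\<^sup>2 / 2)) \<partial>lborel)"
 by (rule nn_integral_lborel_prod) auto
also have "... = ennreal (sqrt (2 * pi) ^ CARD('n))"
 unfolding one by (simp add: ennreal_power)
also have "sqrt (2 * pi) ^ CARD('n) = (2 * pi) powr (real CARD('n) / 2)"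
 by (simp add: powr_half_sqrt[symmetric] powr_powr powr_realpow[symmetric])
finally have nn: "nn_integral lborel (%x::real^'n. ennreal (exp (- (x \<bullet> x) / 2))) = ennreal ((2 * pi) powr (real CARD('n) / 2))" .
have "has_bochner_integral lborel (%x::real^'n. exp (- (x \<bullet> x) / 2)) ((2 * pi) powr (real CARD('n) / 2))"
 using nn by (intro has_bochner_integral_nn_integral) auto
then have "has_bochner_integral lebesgue (%x::real^'n. exp (- (x \<bullet> x) / 2)) ((2 * pi) powr (real CARD('n) / 2))"
 by (simp add: has_bochner_integral_iff integrable_completion integral_completion)
then show ?thesis unfolding gauss_def by (simp add: has_bochner_integral_iff)
qed

text \<open>The Gaussian is a fixed point of the Fourier transform since both solve
$\nabla g = - \xi g$.\<close>

lemma fourier_gauss: "fourier (gauss v) = gauss v" for v :: "complex^'m"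
proof
fix xi :: "real^'n::finite"
let ?G = "fourier (gauss v) :: real^'n => complex^'m"
have p: "partial j ?G xi = - (xi $ j) *R ?G xi" for j xi
proof -
 have "partial j ?G = fourier (%x. \<i> *s partial j (gauss v) x)"
  unfolding fourier_partial[OF gauss_schwartz] partial_gauss by simp
 also have "... = (%xi. \<i> *s fourier (partial j (gauss v)) xi)"
  by (rule ext) (rule fourier_smult[OF schwartz_integrable[OF schwartz_partial[OF gauss_schwartz]]])
 finally show ?thesis
  by (simp add: fourier_of_partial[OF gauss_schwartz] scaleR_eq_smult)
qed
have d: "(?G has_derivative (%h. - (xi \<bullet> h) *R ?G xi)) (at xi)" for xi
proof -
 have "?G differentiable (at xi)" by (rule smooth_differentiable[OF schwartz_smooth[OF fourier_schwartz[OF gauss_schwartz]]])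
 from has_derivative_partials[OF this] show ?thesis
  unfolding p by (rule has_derivative_eq_rhs) (simp add: inner_vec_def scaleR_sum_left sum_negf mult.commute)
qed
have e: "((%xi::real^'n. exp ((xi \<bullet> xi) / 2)) has_derivative (%h. exp ((xi \<bullet> xi) / 2) * (xi \<bullet> h))) (at xi)" for xi
proof -
 have "((%x. (x \<bullet> x) / 2) has_derivative (%h. xi \<bullet> h)) (at xi)"
  by (auto intro!: derivative_eq_intros simp: inner_commute)
 from has_derivative_compose[OF this DERIV_exp[unfolded has_field_derivative_def]] show ?thesis .
qed
have "((%xi. exp ((xi \<bullet> xi) / 2) *R ?G xi) has_derivative (%h. 0)) (at xi within UNIV)" for xi
 by (rule has_derivative_eq_rhs[OF has_derivative_scaleR[OF e d]]) (simp add: mult.commute)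
then obtain c where c: "!!xi. exp ((xi \<bullet> xi) / 2) *R ?G xi = c"
 using has_derivative_zero_constant[of UNIV "%xi. exp ((xi \<bullet> xi) / 2) *R ?G xi"] by auto
have "?G 0 = (2 * pi) powr (- real CARD('n) / 2) *R ((2 * pi) powr (real CARD('n) / 2) *R v)"
 unfolding fourier_def by (simp add: gauss_integral)
also have "... = v" by (simp add: powr_add[symmetric])
finally have "c = v" using c[of 0] by simp
then have "exp (- (xi \<bullet> xi) / 2) *R (exp ((xi \<bullet> xi) / 2) *R ?G xi) = exp (- (xi \<bullet> xi) / 2) *R v"
 using c by simp
then show "?G xi = gauss v xi" by (simp add: gauss_def exp_add[symmetric])
qed

lemma cdot_eqI: "(!!v. cdot z v = cdot w v) ==> z = w"
proof -
assume *: "!!v. cdot z v = cdot w v"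
have "cdot z (axis k 1) = z $ k" for z :: "complex^'m" and k
 unfolding cdot_def by (subst sum.remove[of _ k]) (auto simp: axis_def intro!: sum.neutral)
then show "z = w" using * by (metis vec_eq_iff)
qed

text \<open>The inversion formula at the origin: the symmetry of the Fourier transform is applied to $f$ and
a Gaussian of width tending to infinity.\<close>

lemma fourier_inversion_0:
fixes f :: "('n::finite, 'm::finite) vfun"
assumes f: "f : schwartz"
shows "fourier (fourier f) 0 = f 0"
proof (rule cdot_eqI)
fix v :: "complex^'m"
define r where "r k = inverse (real (Suc k))" for k
have r: "r k > 0" "r ---> 0" for k
 unfolding r_def by (simp, rule LIMSEQ_inverse_real_of_nat)
have gs: "(%x. gauss v (r k *R x + 0)) : schwartz" for k
 using r(1)[of k] by (intro schwartz_affine gauss_schwartz) simp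
have F: "fourier (%x. gauss v (r k *R x)) (r k *R y) = inverse (r k ^ CARD('n)) *R gauss v y" for k and y :: "real^'n"
proof -
 have "(%x. cis (- (x \<bullet> y)) *s gauss v x) : lmeas"
  by (intro schwartz_measurable schwartz_cis_mult gauss_schwartz)
 from lebesgue_integral_affine[OF this, of "r k" 0] r(1)[of k]
 have "(INTG x. cis (- (x \<bullet> y)) *s gauss v x)
   = r k ^ CARD('n) *R (INTG x. cis (- (x \<bullet> (r k *R y))) *s gauss v (r k *R x))"
  by simp
 then have "fourier (gauss v) y = r k ^ CARD('n) *R fourier (%x. gauss v (r k *R x)) (r k *R y)"
  unfolding fourier_def by simp
 then show ?thesis using r(1)[of k] by (simp add: fourier_gauss)
qed
have eq: "(INTG xi. cdot (fourier f xi) (gauss v (r k *R xi))) = (INTG y. cdot (f (r k *R y)) (gauss v y))" for k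
proof -
 have gs': "(%x. gauss v (r k *R x)) : schwartz" using gs[of k] by simp
 have "(INTG xi. cdot (fourier f xi) (gauss v (r k *R xi)))
   = (INTG x. cdot (f x) (fourier (%x. gauss v (r k *R x)) x))"
  by (rule fourier_symmetric[OF schwartz_integrable[OF f] schwartz_integrable[OF gs']])
 also have "... = \<bar>r k\<bar> ^ DIM(real^'n) *R (INTG y. cdot (f (r k *R y + 0)) (fourier (%x. gauss v (r k *R x)) (r k *R y + 0)))"
  using r(1)[of k]
  by (intro lebesgue_integral_affine bilinear_measurable[OF bilinear_cdot] schwartz_measurable fourier_schwartz f gs') auto
 also have "... = (INTG y. cdot (f (r k *R y)) (gauss v y))"
  using r(1)[of k] by (simp add: F bounded_bilinear.scaleR_right[OF bilinear_cdot])
 finally show ?thesis .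
qed
have g0: "(%k. gauss v (r k *R xi)) ---> v" for xi :: "real^'n"
proof -
 have "isCont (gauss v :: real^'n => _) 0"
  using smooth_continuous_on[OF schwartz_smooth[OF gauss_schwartz], of UNIV] continuous_on_eq_continuous_at[OF open_UNIV] by blast
 moreover have "(%k. r k *R xi) ---> 0"
  using tendsto_scaleR[OF r(2) tendsto_const, of xi] by simp
 ultimately have "(%k. gauss v (r k *R xi)) ---> gauss v (0::real^'n)" by (rule isCont_tendsto_compose)
 then show ?thesis by (simp add: gauss_def)
qed
have f0: "(%k. f (r k *R y)) ---> f 0" for y :: "real^'n"
proof -
 have "isCont f 0"
  using smooth_continuous_on[OF schwartz_smooth[OF f], of UNIV] continuous_on_eq_continuous_at[OF open_UNIV] by blast
 moreover have "(%k. r k *R y) ---> 0"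
  using tendsto_scaleR[OF r(2) tendsto_const, of y] by simp
 ultimately show ?thesis by (rule isCont_tendsto_compose)
qed
have gb: "norm (gauss v x) <= norm v" for x :: "real^'n"
 unfolding gauss_def norm_scaleR by (intro mult_left_le_one_le) auto
have l1: "(%k. INTG xi. cdot (fourier f xi) (gauss v (r k *R xi))) ---> (INTG xi. cdot (fourier f xi) v)"
proof (rule integral_dominated_convergence[where w="%xi. norm (fourier f xi) * norm v"])
 show "integrable lebesgue (%xi. norm (fourier f xi) * norm v)"
  using schwartz_integrable[OF fourier_schwartz[OF f]] by simp
 show "AE xi in lebesgue. (%k. cdot (fourier f xi) (gauss v (r k *R xi))) ---> cdot (fourier f xi) v"
  by (intro AE_I2 bounded_bilinear.tendsto[OF bilinear_cdot] tendsto_const g0)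
 show "AE xi in lebesgue. norm (cdot (fourier f xi) (gauss v (r k *R xi))) <= norm (fourier f xi) * norm v" for k
  by (intro AE_I2 order_trans[OF norm_cdot_le] mult_left_mono gb) auto
 show "(%xi. cdot (fourier f xi) (gauss v (r k *R xi))) : lmeas" for k
  using schwartz_measurable[OF gs[of k]] schwartz_measurable[OF fourier_schwartz[OF f]]
  by (intro bilinear_measurable[OF bilinear_cdot]) simp_all
 show "(%xi. cdot (fourier f xi) v) : lmeas"
  using schwartz_measurable[OF fourier_schwartz[OF f]] by (intro bilinear_measurable[OF bilinear_cdot]) simp_all
qed
obtain K where K: "!!x. norm (f x) <= K"
 using rapid_bound[OF schwartz_rapid[OF f], of 0] by auto
have l2: "(%k. INTG y. cdot (f (r k *R y)) (gauss v y)) ---> (INTG y. cdot (f 0) (gauss v (y::real^'n)))"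
proof (rule integral_dominated_convergence[where w="%y::real^'n. K * norm (gauss v y)"])
 show "integrable lebesgue (%y::real^'n. K * norm (gauss v y))"
  by (intro integrable_mult_right integrable_norm schwartz_integrable gauss_schwartz)
 show "AE y in lebesgue. (%k. cdot (f (r k *R y)) (gauss v y)) ---> cdot (f 0) (gauss v y)"
  by (intro AE_I2 bounded_bilinear.tendsto[OF bilinear_cdot] tendsto_const f0)
 show "AE y in lebesgue. norm (cdot (f (r k *R y)) (gauss v y)) <= K * norm (gauss v y)" for k
  by (intro AE_I2 order_trans[OF norm_cdot_le] mult_right_mono K) auto
 show "(%y. cdot (f (r k *R y)) (gauss v y)) : lmeas" for k
  using schwartz_measurable[OF schwartz_affine[OF f, of "r k" 0]] r(1)[of k] schwartz_measurable[OF gauss_schwartz]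
  by (intro bilinear_measurable[OF bilinear_cdot]) simp_all
 show "(%y::real^'n. cdot (f 0) (gauss v y)) : lmeas"
  using schwartz_measurable[OF gauss_schwartz] by (intro bilinear_measurable[OF bilinear_cdot]) simp_all
qed
have "(INTG xi. cdot (fourier f xi) v) = (INTG y. cdot (f 0) (gauss v (y::real^'n)))"
 using LIMSEQ_unique[OF l1 l2[folded eq]] .
also have "... = cdot (f 0) (INTG y. gauss v (y::real^'n))"
 by (rule integral_bounded_linear'[OF bounded_bilinear.bounded_linear_right[OF bilinear_cdot]
    schwartz_integrable[OF gauss_schwartz]])
also have "... = (2 * pi) powr (real CARD('n) / 2) *R cdot (f 0) v"
 by (simp add: gauss_integral bounded_bilinear.scaleR_right[OF bilinear_cdot])
finally have "(INTG xi. cdot (fourier f xi) v) = (2 * pi) powr (real CARD('n) / 2) *R cdot (f 0) v" .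
moreover have "(INTG xi. cdot (fourier f xi) v) = cdot (INTG xi. fourier f xi) v"
 by (rule integral_bounded_linear'[OF bounded_bilinear.bounded_linear_left[OF bilinear_cdot]
    schwartz_integrable[OF fourier_schwartz[OF f]]])
ultimately have "cdot (INTG xi. fourier f xi) v = (2 * pi) powr (real CARD('n) / 2) *R cdot (f 0) v" by simp
then have "cdot (fourier (fourier f) 0) v = ((2 * pi) powr (- real CARD('n) / 2) * (2 * pi) powr (real CARD('n) / 2)) *R cdot (f 0) v"
 unfolding fourier_def[of "fourier f"] by (simp add: bounded_bilinear.scaleR_left[OF bilinear_cdot])
also have "... = cdot (f 0) v" by (simp add: powr_add[symmetric])
finally show "cdot (fourier (fourier f) 0) v = cdot (f 0) v" .
qed

lemma fourier_shift:
fixes f :: "('n::finite, 'm::finite) vfun"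
assumes "f : lmeas"
shows "fourier (%x. f (x + a)) xi = cis (a \<bullet> xi) *s fourier f xi"
proof -
have m: "(%x. cis (- ((x - a) \<bullet> xi)) *s f x) : lmeas"
proof -
 have "(%x. ek x xi *s f x) : lmeas"
  using assms by (intro bilinear_measurable[OF bilinear_smult] cis_inner_measurable_lebesgue)
 then have "(%x. cis (a \<bullet> xi) *s (ek x xi *s f x)) : lmeas"
  by (rule linear_measurable[OF bounded_linear_smult])
 then show ?thesis by (simp add: cis_mult inner_diff_left)
qed
have "(INTG x. ek x xi *s f (x + a)) = (INTG x. cis (- ((x - a) \<bullet> xi)) *s f x)"
 using lebesgue_integral_shift[OF m, of a] by simp
also have "... = (INTG x. cis (a \<bullet> xi) *s (ek x xi *s f x))"
 by (simp add: cis_mult inner_diff_left)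
also have "... = cis (a \<bullet> xi) *s (INTG x. ek x xi *s f x)"
proof (cases "integrable lebesgue (%x. ek x xi *s f x)")
 case True
 then show ?thesis by (rule integral_bounded_linear'[OF bounded_linear_smult])
next
 case False
 have "\<not> integrable lebesgue (%x. cis (a \<bullet> xi) *s (ek x xi *s f x))"
 proof
  assume "integrable lebesgue (%x. cis (a \<bullet> xi) *s (ek x xi *s f x))"
  from integrable_bounded_linear[OF bounded_linear_smult[of "ek a xi"] this]
  show False using False by (simp add: cis_mult flip: mult.assoc)
 qed
 then show ?thesis using False by (simp add: not_integrable_integral_eq)
qed
finally show ?thesis unfolding fourier_def by (simp only: smult_scaleR_commute)
qed

lemma fourier_modulate:
"fourier (%x. cis (a \<bullet> x) *s f x) xi = fourier f (xi - a)"
unfolding fourier_def by (simp add: cis_mult inner_diff_right inner_commute)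

lemma fourier_reflect:
fixes f :: "('n::finite, 'm::finite) vfun"
assumes "f : lmeas"
shows "fourier (%x. f (- x)) xi = fourier f (- xi)"
proof -
have "(%x. cis (- (x \<bullet> (- xi))) *s f x) : lmeas"
 using assms by (intro bilinear_measurable[OF bilinear_smult] cis_inner_measurable_lebesgue)
from lebesgue_integral_reflect[OF this] show ?thesis unfolding fourier_def by simp
qed

lemma fourier_fourier:
fixes f :: "('n::finite, 'm::finite) vfun"
assumes f: "f : schwartz"
shows "fourier (fourier f) x = f (- x)"
proof -
have s: "(%y. f (1 *R y + (- x))) : schwartz" by (intro schwartz_affine f) simp
have "f (- x) = fourier (fourier (%y. f (y + (- x)))) 0"
 using fourier_inversion_0[OF s] by simp
also have "fourier (%y. f (y + (- x))) = (%xi. cis ((- x) \<bullet> xi) *s fourier f xi)"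
 by (rule ext) (rule fourier_shift[OF schwartz_measurable[OF f]])
also have "fourier ... 0 = fourier (fourier f) (0 - (- x))" by (rule fourier_modulate)
finally show ?thesis by simp
qed

lemma schwartz_reflect: "f : schwartz ==> (%x. f (- x)) : schwartz"
using schwartz_affine[of f "-1" 0] by simp

lemma fourier_surj:
fixes f :: "('n::finite, 'm::finite) vfun"
assumes f: "f : schwartz"
shows "fourier (%x. fourier f (- x)) = f" "(%x. fourier f (- x)) : schwartz"
using fourier_reflect[OF schwartz_measurable[OF fourier_schwartz[OF f]]] fourier_fourier[OF f]
by (auto intro: schwartz_reflect fourier_schwartz f)

lemma conj_vec_simps [simp]: "conj_vec (conj_vec z) = z" "conj_vec z $ k = cnj (z $ k)" "norm (conj_vec z) = norm z"
by (simp_all add: conj_vec_def vec_eq_iff norm_vec_def)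

lemma bounded_linear_conj_vec: "bounded_linear conj_vec"
by (rule bounded_linear_intro[where K=1]) (simp_all add: vec_eq_iff complex_eq_iff)

lemma conj_vec_smult: "conj_vec (z *s v) = cnj z *s conj_vec v"
by (simp add: vec_eq_iff)

lemma cdot_conj_vec: "cdot (conj_vec z) (conj_vec w) = cnj (cdot z w)"
by (simp add: cdot_def)

lemma cdot_conj_self: "cdot z (conj_vec z) = of_real ((norm z)^2)"
by (simp add: cdot_def norm_vec_def L2_set_def sum_nonneg complex_norm_square[symmetric])

lemma Re_cdot_conj: "Re (cdot (conj_vec z) w) = inner z w"
by (simp add: cdot_def inner_vec_def inner_complex_def Re_sum)

lemma fourier_conj: "conj_vec (fourier f xi) = fourier (%x. conj_vec (f x)) (- xi)"
proof -
have "conj_vec (INTG x. ek x xi *s f x) = (INTG x. conj_vec (ek x xi *s f x))"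
proof (cases "integrable lebesgue (%x. ek x xi *s f x)")
 case True
 then show ?thesis by (rule integral_bounded_linear'[OF bounded_linear_conj_vec, symmetric])
next
 case False
 have "\<not> integrable lebesgue (%x. conj_vec (ek x xi *s f x))"
  using False integrable_bounded_linear[OF bounded_linear_conj_vec, of lebesgue "%x. conj_vec (ek x xi *s f x)"] by auto
 then show ?thesis using False linear_0[OF bounded_linear.linear[OF bounded_linear_conj_vec]]
  by (simp add: not_integrable_integral_eq)
qed
then show ?thesis
 unfolding fourier_def
 by (simp add: linear_cmul[OF bounded_linear.linear[OF bounded_linear_conj_vec]] conj_vec_smult cis_cnj)
qed

lemma fourier_Plancherel:
fixes f :: "('n::finite, 'm::finite) vfun"
assumes f: "f : schwartz"
shows "L2n (fourier f) = L2n f"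
proof -
define g where "g x = conj_vec (f (- x))" for x
have g: "g : schwartz"
 unfolding g_def by (intro schwartz_linear_image[OF bounded_linear_conj_vec] schwartz_reflect f)
have Fg: "fourier g xi = conj_vec (fourier f xi)" for xi
 using fourier_reflect[OF schwartz_measurable[OF schwartz_linear_image[OF bounded_linear_conj_vec f]]]
 unfolding g_def fourier_conj by simp
have "(INTG xi. cdot (fourier f xi) (fourier g xi)) = (INTG x. cdot (f x) (fourier (fourier g) x))"
 by (rule fourier_symmetric[OF schwartz_integrable[OF f] schwartz_integrable[OF fourier_schwartz[OF g]]])
then have "(INTG xi. complex_of_real ((norm (fourier f xi))^2)) = (INTG x. complex_of_real ((norm (f x))^2))"
 by (simp add: fourier_fourier[OF g] Fg cdot_conj_self del: of_real_power) (simp add: g_def cdot_conj_self del: of_real_power)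
then show ?thesis unfolding L2norm_def integral_complex_of_real of_real_eq_iff by simp
qed

section \<open>The fundamental lemma of the calculus of variations\<close>

lemma box_bump_dominates:
fixes a b :: "real^'n"
obtains m where "m > 0" "!!x. x : box a b ==> m <= box_bump 1 (a - 1) (b + 1) x"
 "box_bump 1 (a - 1) (b + 1) : test_functions UNIV"
proof (cases "cbox a b = {}")
case True
then have "box a b = {}" using box_subset_cbox by blast
then show ?thesis using that[of 1] box_bump_test[of 1] by auto
next
case False
let ?\<chi> = "box_bump 1 (a - 1) (b + 1)"
have "continuous_on (cbox a b) ?\<chi>" by (rule smooth_continuous_on[OF box_bump_smooth])
then obtain x where x: "x : cbox a b" "!!y. y : cbox a b ==> ?\<chi> x <= ?\<chi> y"
 using continuous_attains_inf[OF compact_cbox False] by blast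
have "x : box (a - 1) (b + 1)" using x(1) by (simp add: mem_box_cart) (smt (verit))
then have "?\<chi> x > 0" by (simp add: box_bump_pos)
then show ?thesis using x(2) box_subset_cbox[of a b] that[of "?\<chi> x"] box_bump_test[of 1] by auto
qed

lemma box_Int_box_cart: "box a b \<inter> box c d = box (\<chi> i. max (a $ i) (c $ i)) (\<chi> i. min (b $ i) (d $ i))"
for a b c d :: "real^'n"
by (auto simp: mem_box_cart set_eq_iff)

lemma sets_lborel_boxes: "sets (lborel :: (real^'n) measure) = sigma_sets UNIV (range (%(a, b). box a b))"
unfolding sets_lborel borel_eq_box by (rule sets_measure_of) simp

text \<open>Boxes form an intersection-stable generator of the Borel sets.\<close>

lemma integral_boxes_zero_imp_AE_zero:
fixes g :: "real^'n => 'b::euclidean_space"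
assumes g: "integrable lborel g"
 and box: "!!a b. (\<integral>x. indicator (box a b) x *R g x \<partial>lborel) = 0"
 and all: "(\<integral>x. g x \<partial>lborel) = 0"
shows "AE x in lborel. g x = 0"
proof (rule sigma_finite_measure.density_zero[OF sigma_finite_lborel g])
fix A :: "(real^'n) set" assume "A : sets lborel"
then have A: "A : sigma_sets UNIV (range (%(a, b). box a b))"
 by (simp only: sets_lborel_boxes)
have I: "Int_stable (range (%(a, b). box a b :: (real^'n) set))"
proof (rule Int_stableI)
 fix B C assume "B : range (%(a, b). box a b :: (real^'n) set)" "C : range (%(a, b). box a b :: (real^'n) set)"
 then show "B \<inter> C : range (%(a, b). box a b)" by (force simp: box_Int_box_cart)
qed
have m: "B : sets lborel" if "B : sigma_sets UNIV (range (%(a, b). box a b))" for B :: "(real^'n) set"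
 using that by (simp only: sets_lborel_boxes)
have int: "integrable lborel (%x. indicator B x *R g x)" if "B : sigma_sets UNIV (range (%(a, b). box a b))" for B :: "(real^'n) set"
 using g m[OF that] by (intro integrable_mult_indicator)
have "(\<integral>x. indicator A x *R g x \<partial>lborel) = 0"
proof (rule sigma_sets_induct_disjoint[OF I _ A])
 show "(\<integral>x. indicator B x *R g x \<partial>lborel) = 0" if "B : range (%(a, b). box a b)" for B
  using that box by auto
 show "(\<integral>x. indicator (UNIV - B) x *R g x \<partial>lborel) = 0"
  if B: "B : sigma_sets UNIV (range (%(a, b). box a b))" and z: "(\<integral>x. indicator B x *R g x \<partial>lborel) = 0" for B
 proof -
  have "(\<integral>x. indicator (UNIV - B) x *R g x \<partial>lborel) = (\<integral>x. g x - indicator B x *R g x \<partial>lborel)"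
   by (intro Bochner_Integration.integral_cong) (auto simp: indicator_def)
  also have "... = 0" using g int[OF B] z all by simp
  finally show ?thesis .
 qed
 show "(\<integral>x. indicator (\<Union>i. B i) x *R g x \<partial>lborel) = 0"
  if d: "disjoint_family B" and B: "range B \<subseteq> sigma_sets UNIV (range (%(a, b). box a b))"
   and z: "!!i. (\<integral>x. indicator (B i) x *R g x \<partial>lborel) = 0" for B :: "nat => (real^'n) set"
 proof -
  have "!!i. B i : sets lborel" using B m by blast
  moreover from this have "set_integrable lborel (\<Union>i. B i) g"
   unfolding set_integrable_def using g by (intro integrable_mult_indicator) auto
  ultimately have "(LINT x:(\<Union>i. B i)|lborel. g x) = (\<Sum>i. (LINT x:(B i)|lborel. g x))"
   using d by (intro lebesgue_integral_countable_add) (auto simp: disjoint_family_on_def)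
  then show ?thesis using z by (simp add: set_lebesgue_integral_def)
 qed
qed (auto simp: indicator_def)
then show "(LINT x:A|lborel. g x) = 0" by (simp add: set_lebesgue_integral_def)
qed

text \<open>The indicator of a box is a dominated limit of test functions, so that the integrals over boxes vanish.\<close>

lemma AE_zero_if_test_integrals_zero:
fixes g :: "real^'n => 'b::euclidean_space"
assumes g: "g : lmeas"
 and int: "!!phi :: real^'n => real. phi : test_functions UNIV ==> integrable lebesgue (%x. phi x *R g x)"
 and zero: "!!phi :: real^'n => real. phi : test_functions UNIV ==> (INTG x. phi x *R g x) = 0"
shows "AE x in lebesgue. g x = 0"
proof -
obtain g' where g': "g' : borel_measurable borel" "AE x in lebesgue. g x = g' x"
 using lebesgue_borel_representative[OF g] .
have gm': "g' : lmeas" using g'(1) by (auto intro: measurable_completion)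
have int': "integrable lborel (%x. phi x *R g' x)" and zero': "(\<integral>x. phi x *R g' x \<partial>lborel) = 0"
 if phi: "phi : test_functions UNIV" for phi :: "real^'n => real"
proof -
 have pb: "phi : borel_measurable borel" by (rule smooth_borel[OF test_functions_smooth[OF phi]])
 have pl: "phi : lmeas" by (rule smooth_measurable[OF test_functions_smooth[OF phi]])
 have ae: "AE x in lebesgue. phi x *R g x = phi x *R g' x" using g'(2) by eventually_elim simp
 have m: "(%x. phi x *R g' x) : borel_measurable lborel" using pb g'(1) by simp
 have ml: "(%x. phi x *R g' x) : lmeas" using pl gm' by simp
 have "integrable lebesgue (%x. phi x *R g' x)"
  using integrable_cong_AE_imp[OF int[OF phi] ml] ae by (auto elim: AE_mp)
 then show "integrable lborel (%x. phi x *R g' x)" using m by (simp add: integrable_completion)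
 have "(INTG x. phi x *R g' x) = (INTG x. phi x *R g x)"
  using ml pl g ae by (intro integral_cong_AE) (auto elim: AE_mp)
 then show "(\<integral>x. phi x *R g' x \<partial>lborel) = 0" using zero[OF phi] m by (simp add: integral_completion)
qed
have boxint: "integrable lborel (%x. indicator (box a b) x *R g' x)" for a b
proof -
 obtain m where m: "m > 0" "!!x. x : box a b ==> m <= box_bump 1 (a - 1) (b + 1) x"
  "box_bump 1 (a - 1) (b + 1) : test_functions UNIV" using box_bump_dominates[of a b] by blast
 have i: "integrable lborel (%x. (1 / m) *R (box_bump 1 (a - 1) (b + 1) x *R g' x))"
  using int'[OF m(3)] by (intro integrable_scaleR_right)
 show ?thesis
 proof (rule Bochner_Integration.integrable_bound[OF i])
  show "AE x in lborel. norm (indicator (box a b) x *R g' x) <= norm ((1 / m) *R (box_bump 1 (a - 1) (b + 1) x *R g' x))"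
  proof (intro AE_I2)
   fix x
   show "norm (indicator (box a b) x *R g' x) <= norm ((1 / m) *R (box_bump 1 (a - 1) (b + 1) x *R g' x))"
   proof (cases "x : box a b")
    case True
    have "1 * norm (g' x) <= (box_bump 1 (a - 1) (b + 1) x / m) * norm (g' x)"
     using m(1) m(2)[OF True] by (intro mult_right_mono) auto
    then show ?thesis using True m(1) box_bump_bounds(1)[of 1 "a - 1" "b + 1" x] by simp
   qed simp
  qed
 qed (use g'(1) in simp)
qed
have box: "(\<integral>x. indicator (box a b) x *R g' x \<partial>lborel) = 0" for a b
proof -
 have "(%k. \<integral>x. box_bump (real (Suc k)) a b x *R g' x \<partial>lborel) ---> (\<integral>x. indicator (box a b) x *R g' x \<partial>lborel)"
 proof (rule integral_dominated_convergence[where w="%x. norm (indicator (box a b) x *R g' x)"])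
  show "integrable lborel (%x. norm (indicator (box a b) x *R g' x))"
   using boxint by (intro integrable_norm)
  show "AE x in lborel. (%k. box_bump (real (Suc k)) a b x *R g' x) ---> indicator (box a b) x *R g' x"
   by (intro AE_I2 tendsto_scaleR tendsto_const LIMSEQ_Suc[OF box_bump_tendsto])
  show "AE x in lborel. norm (box_bump (real (Suc k)) a b x *R g' x) <= norm (indicator (box a b) x *R g' x)" for k
  proof (intro AE_I2)
   fix x
   have "box_bump (real (Suc k)) a b x <= indicator (box a b) x"
   proof (cases "x : box a b")
    case False
    then have "\<not> box_bump (real (Suc k)) a b x > 0" by (simp add: box_bump_pos)
    then show ?thesis using False by simp
   qed (simp add: box_bump_bounds)
   then show "norm (box_bump (real (Suc k)) a b x *R g' x) <= norm (indicator (box a b) x *R g' x)"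
    unfolding norm_scaleR using box_bump_bounds(1)[of "real (Suc k)" a b x] by (intro mult_right_mono) auto
  qed
  show "(%x. box_bump (real (Suc k)) a b x *R g' x) : borel_measurable lborel" for k
   using borel_measurable_scaleR[OF smooth_borel[OF box_bump_smooth] g'(1)] by simp
 qed (use g'(1) in simp)
 moreover have "(\<integral>x. box_bump (real (Suc k)) a b x *R g' x \<partial>lborel) = 0" for k
  by (intro zero' box_bump_test) simp
 ultimately show ?thesis by (simp only: LIMSEQ_const_iff)
qed
define Q :: "nat => (real^'n) set" where "Q k = box (\<chi> i. - real k) (\<chi> i. real k)" for k
have "AE x in lborel. indicator (Q k :: (real^'n) set) x *R g' x = 0" for k
proof (rule integral_boxes_zero_imp_AE_zero)
 show "(\<integral>x. indicator (box a b) x *R (indicator (Q k) x *R g' x) \<partial>lborel) = 0" for a b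
 proof -
  have "(\<integral>x. indicator (box a b) x *R (indicator (Q k) x *R g' x) \<partial>lborel) = (\<integral>x. indicator (box a b \<inter> Q k) x *R g' x \<partial>lborel)"
   by (intro Bochner_Integration.integral_cong) (auto simp: indicator_def)
  then show ?thesis unfolding Q_def box_Int_box_cart by (simp add: box)
 qed
qed (simp_all add: Q_def box boxint)
then have "AE x in lborel. \<forall>k. indicator (Q k) x *R g' x = 0" by (subst AE_all_countable) blast
then have "AE x in lborel. g' x = 0"
proof eventually_elim
 case (elim x)
 obtain k where k: "norm x < real k" using reals_Archimedean2 by blast
 have "x : Q k"
  unfolding Q_def mem_box_cart
 proof
  fix i
  show "(\<chi> i. - real k) $ i < x $ i & x $ i < (\<chi> i. real k) $ i"
   using component_le_norm_cart[of x i] k by (simp add: abs_le_iff)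
 qed
 then show ?case using elim[rule_format, of k] by simp
qed
then have "AE x in lebesgue. g' x = 0" by (rule AE_completion)
with g'(2) show ?thesis by eventually_elim simp
qed

lemma cdot_axis: "cdot z (axis k 1) = z $ k"
unfolding cdot_def by (subst sum.remove[of _ k]) (auto simp: axis_def intro!: sum.neutral)

lemma AE_zero_if_schwartz_integrals_zero:
fixes g :: "('n::finite, 'm::finite) vfun"
assumes g: "g : lmeas"
 and int: "!!phi. phi : schwartz ==> integrable lebesgue (%x. cdot (g x) (phi x))"
 and zero: "!!phi. phi : schwartz ==> (INTG x. cdot (g x) (phi x)) = 0"
shows "AE x in lebesgue. g x = 0"
proof -
have "AE x in lebesgue. g x $ k = 0" for k
proof (rule AE_zero_if_test_integrals_zero)
 show "(%x. g x $ k) : lmeas"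
  by (rule linear_measurable[OF bounded_linear_vec_nth g])
 fix phi :: "real^'n => real" assume phi: "phi : test_functions UNIV"
 have s: "(%x. phi x *R (axis k 1 :: complex^'m)) : schwartz"
  by (rule subsetD[OF test_functions_subset_schwartz test_functions_linear_image[OF bounded_linear_scaleR_left phi]])
 have "cdot z (r *R axis k 1) = r *R (z $ k)" for z :: "complex^'m" and r :: real
  by (simp add: bounded_bilinear.scaleR_right[OF bilinear_cdot] cdot_axis)
 then show "integrable lebesgue (%x. phi x *R (g x $ k))" "(INTG x. phi x *R (g x $ k)) = 0"
  using int[OF s] zero[OF s] by simp_all
qed
then have "AE x in lebesgue. \<forall>k. g x $ k = 0" by (subst AE_all_countable) blast
then show ?thesis by eventually_elim (simp add: vec_eq_iff)
qed

section \<open>Weighted square-integrable functions\<close>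

definition wt :: "real => (real^'n => 'a::euclidean_space) => real^'n => 'a" where
"wt s g xi = (jb xi) powr (s / 2) *R g xi"

definition Lw :: "real => (real^'n => 'a::euclidean_space) set" where
"Lw s = {g. wt s g : LL}"

definition wnorm :: "real => (real^'n => 'a::euclidean_space) => real" where
"wnorm s g = L2n (wt s g)"

lemma bracket_ge_1: "1 <= 1 + (norm xi)^2" by simp

lemma bracket_pos: "0 < 1 + (norm xi)^2" by (simp add: add_pos_nonneg)

lemma bracket_nonzero: "1 + (norm xi)^2 ~= 0" using bracket_pos[of xi] by linarith

lemma wt_wt [simp]: "wt s (wt t g) = wt (s + t) g"
unfolding wt_def by (simp add: powr_add add_divide_distrib)

lemma wt_0 [simp]: "wt 0 g = g"
unfolding wt_def by (rule ext) (simp add: bracket_nonzero)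

lemma norm_wt_square: "(norm (wt s g xi))^2 = (jb xi) powr s * (norm (g xi))^2"
proof -
have "((jb xi) powr (s / 2))^2 = (jb xi) powr s"
 unfolding power2_eq_square by (subst powr_add[symmetric]) simp
then show ?thesis by (simp add: wt_def power_mult_distrib)
qed

lemma wt_measurable:
fixes g :: "real^'n => 'a::euclidean_space"
assumes "g : lmeas"
shows "wt s g : lmeas"
proof -
have "(%xi::real^'n. (jb xi) powr (s / 2)) : lmeas"
 by (intro continuous_measurable_lebesgue continuous_intros) (simp add: bracket_nonzero)
then show ?thesis unfolding wt_def[abs_def] using assms by (rule borel_measurable_scaleR)
qed

lemma wt_measurable_iff: "wt s g : lmeas \<longleftrightarrow> g : lmeas"
proof
assume "wt s g : lmeas"
from wt_measurable[OF this, of "- s"] show "g : lmeas" by simp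
qed (rule wt_measurable)

lemma Lw_measurable: "g : Lw s ==> g : lmeas"
unfolding Lw_def using L2_measurable wt_measurable_iff by blast

lemma Lw_iff: "g : Lw s \<longleftrightarrow> g : lmeas &
 integrable lebesgue (%xi. (jb xi) powr s * (norm (g xi))^2)"
by (simp add: Lw_def L2_def wt_measurable_iff norm_wt_square)

lemma wnorm_eq: "wnorm s g = sqrt (INTG xi. (jb xi) powr s * (norm (g xi))^2)"
by (simp add: wnorm_def L2norm_def norm_wt_square)

lemma wnorm_nonneg [simp]: "0 <= wnorm s g" by (simp add: wnorm_def)

lemma wt_add: "wt s (%x. f x + g x) = (%x. wt s f x + wt s g x)"
by (simp add: wt_def[abs_def] scaleR_add_right)

lemma wt_diff: "wt s (%x. f x - g x) = (%x. wt s f x - wt s g x)"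
by (simp add: wt_def[abs_def] scaleR_diff_right)

lemma wt_scaleR: "wt s (%x. r *R g x) = (%x. r *R wt s g x)"
by (simp add: wt_def[abs_def] mult.commute)

lemma Lw_add: "f : Lw s ==> g : Lw s ==> (%x. f x + g x) : Lw s"
by (simp add: Lw_def wt_add L2_add)

lemma Lw_diff: "f : Lw s ==> g : Lw s ==> (%x. f x - g x) : Lw s"
by (simp add: Lw_def wt_diff L2_diff)

lemma wnorm_triangle: "f : Lw s ==> g : Lw s ==> wnorm s (%x. f x + g x) <= wnorm s f + wnorm s g"
by (simp add: Lw_def wnorm_def wt_add L2norm_triangle)

lemma Lw_bound:
assumes "f : Lw s" "g : lmeas"
 "AE xi in lebesgue. (jb xi) powr (t / 2) * norm (g xi) <= C * ((jb xi) powr (s / 2) * norm (f xi))" "0 <= C"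
shows "g : Lw t" "wnorm t g <= C * wnorm s f"
using L2_bound[of "wt s f" lebesgue "wt t g" C] assms
by (simp_all add: Lw_def wnorm_def wt_measurable) (simp_all add: wt_def)

lemma Lw_smult:
fixes g :: "('n::finite, 'm::finite) vfun"
assumes "g : Lw s"
shows "(%x. z *s g x) : Lw s" "wnorm s (%x. z *s g x) <= cmod z * wnorm s g"
proof -
have ae: "AE xi in lebesgue. (jb xi) powr (s / 2) * norm (z *s g xi) <= cmod z * ((jb xi) powr (s / 2) * norm (g xi))"
 by (simp add: norm_vector_smult)
from Lw_bound[OF assms linear_measurable[OF bounded_linear_smult Lw_measurable[OF assms]] this norm_ge_zero]
show "(%x. z *s g x) : Lw s" "wnorm s (%x. z *s g x) <= cmod z * wnorm s g" .
qed

lemma Lw_mono: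
assumes "g : Lw s" "t <= s"
shows "g : Lw t" "wnorm t g <= wnorm s g"
proof -
have "AE xi in lebesgue. (jb xi) powr (t / 2) * norm (g xi) <= 1 * ((jb xi) powr (s / 2) * norm (g xi))"
 unfolding mult_1 using assms(2) by (intro AE_I2 mult_right_mono powr_mono) simp_all
from Lw_bound[OF assms(1) Lw_measurable[OF assms(1)] this]
show "g : Lw t" "wnorm t g <= wnorm s g" by simp_all
qed

lemma wnorm_cong_AE:
assumes "f : lmeas" "g : lmeas" "AE x in lebesgue. f x = g x"
shows "wnorm s f = wnorm s g"
unfolding wnorm_def using assms(3)
by (intro L2norm_cong_AE wt_measurable assms(1,2)) (auto simp: wt_def)

lemma Lw_cong_AE:
assumes "f : Lw s" "g : lmeas" "AE x in lebesgue. f x = g x"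
shows "g : Lw s"
using assms(3) by (intro Lw_bound(1)[OF assms(1,2), where C=1]) auto

lemma Lw_reflect:
assumes "g : Lw s"
shows "(%xi. g (- xi)) : Lw s" "wnorm s (%xi. g (- xi)) = wnorm s g"
proof -
have i: "integrable lebesgue (%xi. (jb xi) powr s * (norm (g xi))^2)" and gm: "g : lmeas"
 using assms by (simp_all add: Lw_iff)
show "(%xi. g (- xi)) : Lw s"
 using lebesgue_integrable_affine[OF i, of "-1" 0] measurable_lebesgue_affine[OF gm, of "-1" 0] by (simp add: Lw_iff)
show "wnorm s (%xi. g (- xi)) = wnorm s g"
 using lebesgue_integral_reflect[OF borel_measurable_integrable[OF i]] by (simp add: wnorm_eq)
qed

lemma L2_cdot:
assumes "f : L2 M" "g : L2 M"
shows "integrable M (%x. cdot (f x) (g x))" "cmod (\<integral>x. cdot (f x) (g x) \<partial>M) <= L2norm M f * L2norm M g"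
proof -
have m: "(%x. cdot (f x) (g x)) : borel_measurable M"
 using assms by (intro bilinear_measurable[OF bilinear_cdot] L2_measurable)
show i: "integrable M (%x. cdot (f x) (g x))"
 by (rule Bochner_Integration.integrable_bound[OF L2_mult_integrable[OF assms] m]) (simp add: norm_cdot_le)
have "cmod (\<integral>x. cdot (f x) (g x) \<partial>M) <= (\<integral>x. norm (f x) * norm (g x) \<partial>M)"
 by (rule integral_norm_bound[THEN order_trans])
  (intro integral_mono integrable_norm i L2_mult_integrable assms norm_cdot_le)
then show "cmod (\<integral>x. cdot (f x) (g x) \<partial>M) <= L2norm M f * L2norm M g"
 using L2_Cauchy_Schwarz[OF assms] by simp
qed

lemma Lw_cdot:
assumes "f : Lw s" "g : Lw (- s)"
shows "integrable lebesgue (%x. cdot (f x) (g x))" "cmod (INTG x. cdot (f x) (g x)) <= wnorm s f * wnorm (- s) g"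
proof -
have "cdot (wt s f x) (wt (- s) g x) = cdot (f x) (g x)" for x
 unfolding wt_def bounded_bilinear.scaleR_left[OF bilinear_cdot] bounded_bilinear.scaleR_right[OF bilinear_cdot]
 using bracket_pos[of x] by (simp flip: powr_add)
then show "integrable lebesgue (%x. cdot (f x) (g x))" "cmod (INTG x. cdot (f x) (g x)) <= wnorm s f * wnorm (- s) g"
 using L2_cdot[of "wt s f" lebesgue "wt (- s) g"] assms by (simp_all add: Lw_def wnorm_def)
qed

lemma rapid_L2:
fixes f :: "'a::euclidean_space => 'b::euclidean_space"
assumes "rapid f" "f : lmeas"
shows "f : LL"
proof -
obtain K where K: "0 <= K" "!!x. norm (f x) <= K" using rapid_bound[OF assms(1), of 0] by auto
have "integrable lebesgue (%x. K * norm (f x))"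
 using rapid_integrable[OF assms] by simp
then have "integrable lebesgue (%x. (norm (f x))^2)"
 by (rule Bochner_Integration.integrable_bound)
  (use assms(2) K in \<open>auto simp: power2_eq_square abs_mult intro!: mult_right_mono\<close>)
then show ?thesis using assms(2) by (simp add: L2_def)
qed

lemma slow_bracket: "slow (%xi. (jb xi) powr s)"
proof -
define k where "k = nat \<lceil>s\<rceil>"
have "norm ((jb xi) powr s) <= 1 * (1 + norm xi) ^ (2 * k)" for xi :: 'a
proof -
 have "(jb xi) powr s <= (jb xi) powr real k"
  by (intro powr_mono) (simp_all add: k_def real_nat_ceiling_ge)
 also have "... = (jb xi) ^ k" using bracket_pos[of xi] by (simp add: powr_realpow)
 also have "... <= ((1 + norm xi)^2) ^ k" by (intro power_mono) (simp_all add: power2_sum)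
 finally show ?thesis by (simp add: power_mult)
qed
then show ?thesis unfolding slow_def by blast
qed

lemma schwartz_Lw:
fixes f :: "real^'n => 'a::euclidean_space"
assumes "f : schwartz"
shows "f : Lw s"
proof -
have "rapid (wt s f)"
 unfolding wt_def[abs_def] by (intro rapid_bilinear[OF bounded_bilinear_scaleR] slow_bracket schwartz_rapid assms)
then show ?thesis unfolding Lw_def using rapid_L2[OF _ wt_measurable[OF schwartz_measurable[OF assms]]] by blast
qed

text \<open>The Riesz theorem for functionals on Schwartz functions that are bounded in a weighted norm.
The real inner product of the conjugate of $g$ with $f$ is the real part of the bilinear product.\<close>

lemma Lw_Riesz:
fixes l :: "('n::finite, 'm::finite) vfun => complex"
assumes add: "!!f g. f : schwartz ==> g : schwartz ==> l (%x. f x + g x) = l f + l g"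
 and smult: "!!f z. f : schwartz ==> l (%x. z *s f x) = z * l f"
 and bound: "!!f. f : schwartz ==> cmod (l f) <= K * wnorm s f"
shows "\<exists>g phi. g : Lw (- s) & wnorm (- s) g <= \<bar>K\<bar> & (\<forall>f\<in>schwartz. l f = (INTG x. cdot (g x) (f x))) &
 (\<forall>k::nat. phi k : schwartz) & (%k. wnorm s (%x. phi k x - wt (- 2 * s) (%x. conj_vec (g x)) x)) ---> 0"
proof -
define X where "X = wt s ` (schwartz :: ('n, 'm) vfun set)"
define l' where "l' F = Re (l (wt (- s) F))" for F
have inv: "wt (- s) (wt s f) = f" for f :: "('n, 'm) vfun" by simp
have XL: "X \<subseteq> LL" unfolding X_def using schwartz_Lw by (auto simp: Lw_def)
have Xne: "X ~= {}" unfolding X_def using schwartz_zero by blast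
have X_add: "(%x. F x + G x) : X" if "F : X" "G : X" for F G
 using that unfolding X_def by (auto simp flip: wt_add intro: schwartz_add)
have X_scale: "(%x. r *R F x) : X" if "F : X" for F r
 using that unfolding X_def by (auto simp flip: wt_scaleR intro: schwartz_linear_image[OF bounded_linear_scaleR_right])
have l_add: "l' (%x. F x + G x) = l' F + l' G" if "F : X" "G : X" for F G
 using that unfolding X_def l'_def by (auto simp: wt_add add)
have l_scale: "l' (%x. r *R F x) = r * l' F" if "F : X" for F r
proof -
 obtain f where f: "f : schwartz" "F = wt s f" using \<open>F : X\<close> X_def by blast
 show ?thesis unfolding l'_def f(2) wt_scaleR inv using smult[OF f(1), of "of_real r"] by (simp add: scaleR_eq_smult)
qed
have l_bound: "\<bar>l' F\<bar> <= K * L2n F" if "F : X" for F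
proof -
 obtain f where f: "f : schwartz" "F = wt s f" using \<open>F : X\<close> X_def by blast
 show ?thesis unfolding l'_def f(2) inv using bound[OF f(1)] abs_Re_le_cmod[of "l f"] by (simp add: wnorm_def)
qed
have "\<exists>g0 F. g0 : LL & (\<forall>k::nat. F k : X) & (%k. L2n (%x. F k x - g0 x)) ---> 0 &
  (\<forall>f\<in>X. l' f = (INTG x. inner (g0 x) (f x))) & L2n g0 <= \<bar>K\<bar>"
proof (rule L2_Riesz[where X=X and l=l' and K=K, OF XL Xne])
 fix g0 F
 assume "g0 : LL" "!!k::nat. F k : X" "(%k. L2n (%x. F k x - g0 x)) ---> 0"
  "!!f. f : X ==> l' f = (INTG x. inner (g0 x) (f x))" "L2n g0 <= \<bar>K\<bar>"
 then show ?thesis by (intro exI[of _ g0] exI[of _ F]) simp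
qed (rule X_add X_scale l_add l_scale l_bound; assumption)+
then obtain g0 F where g0: "g0 : LL" "!!k::nat. F k : X" "(%k. L2n (%x. F k x - g0 x)) ---> 0"
  "!!f. f : X ==> l' f = (INTG x. inner (g0 x) (f x))" "L2n g0 <= \<bar>K\<bar>"
 by blast
define g where "g = wt s (%x. conj_vec (g0 x))"
have cg0: "(%x. conj_vec (g0 x)) : LL"
 using g0(1) linear_measurable[OF bounded_linear_conj_vec L2_measurable[OF g0(1)]] by (simp add: L2_def)
have g: "g : Lw (- s)" unfolding g_def Lw_def using cg0 by simp
have gn: "wnorm (- s) g = L2n g0" unfolding g_def wnorm_def by (simp add: L2norm_def)
have Re: "Re (l f) = Re (INTG x. cdot (g x) (f x))" if f: "f : schwartz" for f
proof -
 have "Re (l f) = (INTG x. inner (g0 x) (wt s f x))"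
  using g0(4)[of "wt s f"] f by (simp add: l'_def X_def)
 also have "... = (INTG x. Re (cdot (g x) (f x)))"
  unfolding g_def wt_def Re_cdot_conj[symmetric]
  by (simp add: bounded_bilinear.scaleR_left[OF bilinear_cdot] bounded_bilinear.scaleR_right[OF bilinear_cdot])
 also have "... = Re (INTG x. cdot (g x) (f x))"
  by (rule integral_Re[OF Lw_cdot(1)[OF g]]) (simp add: schwartz_Lw[OF f])
 finally show ?thesis .
qed
have rep: "l f = (INTG x. cdot (g x) (f x))" if f: "f : schwartz" for f
proof (rule complex_eqI)
 show "Re (l f) = Re (INTG x. cdot (g x) (f x))" by (rule Re[OF f])
 have "Re (\<i> * l f) = Re (INTG x. \<i> * cdot (g x) (f x))"
  using Re[OF schwartz_smult[OF f, of \<i>]] smult[OF f, of \<i>] by (simp add: cdot_smult)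
 then show "Im (l f) = Im (INTG x. cdot (g x) (f x))" by simp
qed
define phi where "phi k = wt (- s) (F k)" for k
have phi: "phi k : schwartz" "F k = wt s (phi k)" for k
 using g0(2)[of k] unfolding X_def phi_def by auto
have "wt (- 2 * s) (%x. conj_vec (g x)) = wt (- s) g0"
 unfolding g_def wt_def
 by (rule ext) (simp add: linear_cmul[OF bounded_linear.linear[OF bounded_linear_conj_vec]] flip: powr_add)
then have "wnorm s (%x. phi k x - wt (- 2 * s) (%x. conj_vec (g x)) x) = L2n (%x. F k x - g0 x)" for k
 by (simp add: wnorm_def wt_diff phi(2)[symmetric])
then show ?thesis using g gn g0(3,5) rep phi(1) by (intro exI[of _ g] exI[of _ phi]) simp
qed

text \<open>In the Riesz theorem the representing function is a limit of Schwartz functions. It is applied to the functional that the conjugate of \<open>g\<close>, suitably weighted, represents: by uniqueness \<open>g\<close> is this limit.\<close>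

lemma schwartz_dense_Lw:
fixes g :: "('n::finite, 'm::finite) vfun"
assumes g: "g : Lw s"
obtains phi where "!!k::nat. phi k : schwartz" "(%k. wnorm s (%x. g x - phi k x)) ---> 0"
proof -
define G where "G = wt (2 * s) (%x. conj_vec (g x))"
have cg: "(%x. conj_vec (g x)) : Lw s"
 using g linear_measurable[OF bounded_linear_conj_vec Lw_measurable[OF g]] by (simp add: Lw_iff)
have G: "G : Lw (- s)" unfolding G_def Lw_def using cg by (simp add: Lw_def)
define l where "l f = (INTG x. cdot (G x) (f x))" for f
have fL: "f : schwartz ==> f : Lw (- (- s))" for f :: "('n, 'm) vfun" by (rule schwartz_Lw)
have l3: "cmod (l f) <= wnorm (- s) G * wnorm s f" if "f : schwartz" for f
 unfolding l_def using Lw_cdot(2)[OF G fL[OF that]] by simp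
have l1: "l (%x. f x + h x) = l f + l h" if "f : schwartz" "h : schwartz" for f h
 unfolding l_def using Lw_cdot(1)[OF G fL[OF that(1)]] Lw_cdot(1)[OF G fL[OF that(2)]]
 by (simp add: bounded_bilinear.add_right[OF bilinear_cdot])
have l2: "l (%x. z *s f x) = z * l f" if "f : schwartz" for f z
 unfolding l_def by (simp add: cdot_smult)
have "\<exists>h phi. h : Lw (- s) & wnorm (- s) h <= \<bar>wnorm (- s) G\<bar> & (\<forall>f\<in>schwartz. l f = (INTG x. cdot (h x) (f x))) &
 (\<forall>k::nat. phi k : schwartz) & (%k. wnorm s (%x. phi k x - wt (- 2 * s) (%x. conj_vec (h x)) x)) ---> 0"
 by (rule Lw_Riesz) (rule l1 l2 l3; assumption)+
then obtain h phi where h: "h : Lw (- s)" "!!f. f : schwartz ==> l f = (INTG x. cdot (h x) (f x))"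
 "!!k::nat. phi k : schwartz" "(%k. wnorm s (%x. phi k x - wt (- 2 * s) (%x. conj_vec (h x)) x)) ---> 0"
 by blast
have "AE x in lebesgue. G x - h x = 0"
proof (rule AE_zero_if_schwartz_integrals_zero)
 show "(%x. G x - h x) : lmeas"
  using Lw_measurable[OF G] Lw_measurable[OF h(1)] by simp
 fix f :: "('n, 'm) vfun" assume f: "f : schwartz"
 note i = Lw_cdot(1)[OF G fL[OF f]] Lw_cdot(1)[OF h(1) fL[OF f]]
 show "integrable lebesgue (%x. cdot (G x - h x) (f x))" "(INTG x. cdot (G x - h x) (f x)) = 0"
  using i h(2)[OF f] by (simp_all add: bounded_bilinear.diff_left[OF bilinear_cdot] l_def)
qed
then have ae: "AE x in lebesgue. wt (- 2 * s) (%x. conj_vec (h x)) x = g x"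
proof eventually_elim
 case (elim x)
 then have "wt (- 2 * s) (%x. conj_vec (h x)) x = wt (- 2 * s) (%x. conj_vec (G x)) x" by (simp add: wt_def)
 also have "wt (- 2 * s) (%x. conj_vec (G x)) = wt (- 2 * s) (wt (2 * s) g)"
  unfolding G_def wt_def by (simp add: linear_cmul[OF bounded_linear.linear[OF bounded_linear_conj_vec]])
 finally show ?case by simp
qed
have "wnorm s (%x. phi k x - wt (- 2 * s) (%x. conj_vec (h x)) x) = wnorm s (%x. g x - phi k x)" for k
proof -
 have "wnorm s (%x. phi k x - wt (- 2 * s) (%x. conj_vec (h x)) x) = wnorm s (%x. phi k x - g x)"
  using ae linear_measurable[OF bounded_linear_conj_vec Lw_measurable[OF h(1)]]
   schwartz_measurable[OF h(3)[of k]] Lw_measurable[OF g]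
  by (intro wnorm_cong_AE borel_measurable_diff wt_measurable) auto
 also have "... = wnorm s (%x. g x - phi k x)"
  by (simp add: wnorm_eq norm_minus_commute)
 finally show ?thesis .
qed
then show ?thesis using that[of phi] h(3,4) by simp
qed

section \<open>Bessel potential spaces and their Fourier representatives\<close>

definition of_rep :: "('n::finite, 'm::finite) vfun => ('n, 'm) vdist" where
"of_rep g = on_tests schwartz (%psi. INTG xi. cdot (g xi) (fourier psi (- xi)))"

lemma of_rep_schwartz: "psi : schwartz ==> of_rep g psi = (INTG xi. cdot (g xi) (fourier psi (- xi)))"
by (simp add: of_rep_def on_tests_def)

lemma of_rep_fourier: "phi : schwartz ==> of_rep g (fourier phi) = (INTG xi. cdot (g xi) (phi xi))"
by (simp add: of_rep_schwartz fourier_schwartz fourier_fourier)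

lemma fourier_reflect_schwartz: "psi : schwartz ==> (%xi. fourier psi (- xi)) : schwartz"
for psi :: "('n::finite, 'm::finite) vfun"
by (rule fourier_surj(2))

lemma fourier_rep_of_rep:
assumes "g : Lw s"
shows "fourier_rep (of_rep g) g"
unfolding fourier_rep_def
proof (intro conjI ballI)
show "g : lmeas" by (rule Lw_measurable[OF assms])
fix phi :: "('a, 'b) vfun" assume phi: "phi : schwartz"
show "integrable lebesgue (%xi. cdot (g xi) (phi xi))" by (rule Lw_cdot(1)[OF assms schwartz_Lw[OF phi]])
show "of_rep g (fourier phi) = (INTG xi. cdot (g xi) (phi xi))" by (rule of_rep_fourier[OF phi])
qed

text \<open>The fundamental lemma applies, since every Schwartz function is a Fourier transform.\<close>

lemma fourier_rep_unique:
assumes "fourier_rep u g" "fourier_rep u h"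
shows "AE xi in lebesgue. g xi = h xi"
proof -
have "AE xi in lebesgue. g xi - h xi = 0"
 using assms unfolding fourier_rep_def
 by (intro AE_zero_if_schwartz_integrals_zero borel_measurable_diff)
  (simp_all add: bounded_bilinear.diff_left[OF bilinear_cdot])
then show ?thesis by eventually_elim simp
qed

lemma fourier_rep_measurable: "fourier_rep u g ==> g : lmeas"
by (simp add: fourier_rep_def)

lemma Hs_norm_eq:
assumes "fourier_rep u g"
shows "Hs_norm s u = wnorm s g"
proof -
let ?h = "SOME g. fourier_rep u g"
have h: "fourier_rep u ?h" using assms by (rule someI[where P="fourier_rep u"])
have "wnorm s ?h = wnorm s g"
 by (rule wnorm_cong_AE[OF fourier_rep_measurable[OF h] fourier_rep_measurable[OF assms] fourier_rep_unique[OF h assms]])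
then show ?thesis by (simp add: Hs_norm_def wnorm_eq)
qed

lemma Hs_norm_of_rep: "g : Lw s ==> Hs_norm t (of_rep g) = wnorm t g"
by (rule Hs_norm_eq[OF fourier_rep_of_rep])

lemma partials_helmholtz:
fixes f :: "real^'n => 'a::real_normed_vector"
assumes "f : schwartz"
shows "partials js (helmholtz f) x = partials js f x - (\<Sum>j\<in>UNIV. partials (js @ [j, j]) f x)"
proof -
have s: "smooth (%x. \<Sum>j\<in>A. partial j (partial j f) x)" if "finite A" for A
 using that assms by (intro schwartz_smooth schwartz_sum schwartz_partial)
have sm: "smooth (partial j (partial j f))" for j by (intro smooth_partial schwartz_smooth assms)
have "partials js (%x. \<Sum>j\<in>A. partial j (partial j f) x) x = (\<Sum>j\<in>A. partials js (partial j (partial j f)) x)" if "finite A" for A x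
 using that
proof induction
 case empty
 have "partials js (%x::real^'n. 0 :: 'a) = (%x. 0)" by (induction js) (simp_all add: partial_const)
 then show ?case by simp
qed (simp add: partials_add[OF sm s])
then have *: "partials js (%x. \<Sum>j\<in>UNIV. partial j (partial j f) x) x = (\<Sum>j\<in>UNIV. partials js (partial j (partial j f)) x)" for x
 by simp
have "partials js (%x. f x + (- (\<Sum>j\<in>UNIV. partial j (partial j f) x)))
  = (%x. partials js f x + partials js (%x. - (\<Sum>j\<in>UNIV. partial j (partial j f) x)) x)"
 by (intro partials_add schwartz_smooth[OF assms] smooth_linear_image[OF bounded_linear_minus[OF bounded_linear_ident]] s finite)
also have "partials js (%x. - (\<Sum>j\<in>UNIV. partial j (partial j f) x)) = (%x. - partials js (%x. \<Sum>j\<in>UNIV. partial j (partial j f) x) x)"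
 by (intro partials_linear_image bounded_linear_minus bounded_linear_ident s finite)
finally show ?thesis
 unfolding helmholtz_def[abs_def] using *[of x] by (simp add: partials_append)
qed

lemma helmholtz_power_bound:
fixes f :: "real^'n => 'a::real_normed_vector"
assumes f: "f : schwartz"
 and M: "!!js x. length js <= N + 2 * k ==> (1 + norm x) ^ L * norm (partials js f x) <= M"
 and js: "length js <= N"
shows "(1 + norm x) ^ L * norm (partials js ((helmholtz ^^ k) f) x) <= (1 + real CARD('n)) ^ k * M"
using M js
proof (induction k arbitrary: N js)
case 0
then show ?case by simp
next
case (Suc k)
let ?g = "(helmholtz ^^ k) f"
have g: "?g : schwartz" by (rule helmholtz_power_schwartz[OF f])
have IH: "(1 + norm x) ^ L * norm (partials ks ?g x) <= (1 + real CARD('n)) ^ k * M" if "length ks <= N + 2" for ks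
 using that Suc.prems(1) by (intro Suc.IH[of "N + 2"]) auto
have "(1 + norm x) ^ L * norm (partials js (helmholtz ?g) x)
  <= (1 + norm x) ^ L * (norm (partials js ?g x) + (\<Sum>j\<in>UNIV. norm (partials (js @ [j, j]) ?g x)))"
 unfolding partials_helmholtz[OF g]
 by (intro mult_left_mono order_trans[OF norm_triangle_ineq4] add_left_mono norm_sum) auto
also have "... = (1 + norm x) ^ L * norm (partials js ?g x) + (\<Sum>j\<in>UNIV. (1 + norm x) ^ L * norm (partials (js @ [j, j]) ?g x))"
 by (simp add: distrib_left sum_distrib_left)
also have "... <= (1 + real CARD('n)) ^ k * M + (\<Sum>j\<in>(UNIV::'n set). (1 + real CARD('n)) ^ k * M)"
 using Suc.prems(2) by (intro add_mono sum_mono IH) auto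
also have "... = (1 + real CARD('n)) ^ Suc k * M" by (simp add: algebra_simps)
finally show ?case by simp
qed

lemma Lw_inverse_bracket:
"(%xi::real^'n. inverse ((jb xi) ^ CARD('n)) *R (axis undefined 1 :: complex^'m)) : LL"
proof -
have i: "integrable lebesgue (%xi::real^'n. inverse ((jb xi) ^ CARD('n)))"
 using integrable_inverse_bracket[where 'a="real^'n"] by simp
have m: "(%xi::real^'n. inverse ((jb xi) ^ CARD('n))) : lmeas"
 using i by (rule borel_measurable_integrable)
have "integrable lebesgue (%xi::real^'n. (inverse ((jb xi) ^ CARD('n)))^2)"
proof (rule Bochner_Integration.integrable_bound[OF i])
 show "AE xi::real^'n in lebesgue. norm ((inverse ((jb xi) ^ CARD('n)))^2) <= norm (inverse ((jb xi) ^ CARD('n)))"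
 proof (intro AE_I2)
  fix xi :: "real^'n"
  have "norm (c^2) <= norm c" if "0 <= c" "c <= 1" for c :: real
   using that mult_left_mono[OF that(2,1)] by (simp add: power2_eq_square)
  moreover have "0 <= inverse ((jb xi) ^ CARD('n))" "inverse ((jb xi) ^ CARD('n)) <= 1"
   using bracket_ge_1[of xi] by (simp_all add: inverse_le_1_iff one_le_power)
  ultimately show "norm ((inverse ((jb xi) ^ CARD('n)))^2) <= norm (inverse ((jb xi) ^ CARD('n)))"
   by blast
 qed
qed (use m in simp)
then show ?thesis using m by (simp add: L2_def power_mult_distrib)
qed

lemma wnorm_fourier_bound:
obtains C k where "0 <= C" "!!psi :: ('n::finite, 'm::finite) vfun. psi : schwartz ==>
 wnorm s (fourier psi) <= C * (INTG x. norm ((helmholtz ^^ k) psi x))"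
proof -
define l where "l = nat \<lceil>s\<rceil>"
define k where "k = l + CARD('n)"
let ?G = "%xi::real^'n. inverse ((jb xi) ^ CARD('n)) *R (axis undefined 1 :: complex^'m)"
let ?C = "fourier_const TYPE('n) * L2n ?G"
have "wnorm s (fourier psi) <= ?C * (INTG x. norm ((helmholtz ^^ k) psi x))" if psi: "psi : schwartz" for psi :: "('n, 'm) vfun"
proof -
 define K where "K = fourier_const TYPE('n) * (INTG x. norm ((helmholtz ^^ k) psi x))"
 have K: "0 <= K" by (simp add: K_def)
 have "L2n (wt s (fourier psi)) <= K * L2n ?G"
 proof (rule L2_bound(2)[OF Lw_inverse_bracket])
  show "wt s (fourier psi) : lmeas"
   by (intro wt_measurable schwartz_measurable fourier_schwartz psi)
  show "AE xi in lebesgue. norm (wt s (fourier psi) xi) <= K * norm (?G xi)"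
  proof (intro AE_I2)
   fix xi :: "real^'n"
   let ?b = "1 + (norm xi)^2"
   have b: "0 < ?b ^ CARD('n)" using bracket_pos[of xi] by (rule zero_less_power)
   have "?b powr (s / 2) <= ?b powr real l"
    unfolding l_def by (intro powr_mono) (auto intro: order_trans[OF _ real_nat_ceiling_ge], linarith)
   also have "... = ?b ^ l" using bracket_pos[of xi] by (simp add: powr_realpow)
   finally have "norm (wt s (fourier psi) xi) <= ?b ^ l * norm (fourier psi xi)"
    unfolding wt_def norm_scaleR by (intro mult_right_mono) auto
   also have "... = inverse (?b ^ CARD('n)) * (?b ^ k * norm (fourier psi xi))"
   proof -
    have "c ^ l * X = inverse (c ^ n) * (c ^ (l + n) * X)" if "c > 0" for c X :: real and n
     using that by (simp add: power_add field_simps)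
    from this[OF bracket_pos] show ?thesis unfolding k_def .
   qed
   also have "?b ^ k * norm (fourier psi xi) <= K"
    using fourier_bound[of "(helmholtz ^^ k) psi" xi] by (simp add: fourier_helmholtz_power[OF psi] K_def)
   finally show "norm (wt s (fourier psi) xi) <= K * norm (?G xi)"
    using b by (simp add: mult_left_mono mult.commute)
  qed
 qed (rule K)
 then show ?thesis by (simp add: wnorm_def K_def mult_ac)
qed
then show ?thesis using that[of ?C k] by simp
qed

text \<open>Powers of $1 - \Delta$ that are moved to the test function provide the decay of its Fourier transform
that the growth of the weight requires.\<close>

lemma of_rep_tempered:
fixes g :: "('n::finite, 'm::finite) vfun"
assumes g: "g : Lw s"
shows "of_rep g : tempered"
proof -
have i: "integrable lebesgue (%xi. cdot (g xi) (fourier psi (- xi)))" if "psi : schwartz" for psi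
 by (rule Lw_cdot(1)[OF g schwartz_Lw[OF fourier_reflect_schwartz[OF that]]])
obtain C k where C: "0 <= C" "!!psi :: ('n, 'm) vfun. psi : schwartz ==>
 wnorm (- s) (fourier psi) <= C * (INTG x. norm ((helmholtz ^^ k) psi x))" using wnorm_fourier_bound by blast
define I where "I = (INTG x. inverse ((1 + norm (x :: real^'n)) ^ (2 * CARD('n))))"
have ii: "integrable lebesgue (%x::real^'n. inverse ((1 + norm x) ^ (2 * CARD('n))))"
 using integrable_inverse_power_norm[where 'a="real^'n"] by simp
have I0: "0 <= I" unfolding I_def by (intro integral_nonneg_AE AE_I2) simp
define N where "N = 2 * k + 2 * CARD('n)"
have bound: "cmod (of_rep g psi) <= (wnorm s g * C * (1 + real CARD('n)) ^ k * I) * M"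
 if psi: "psi : schwartz" and M: "!!js x. length js <= N ==> (1 + norm x) ^ N * norm (partials js psi x) <= M" for psi M
proof -
 have M': "(1 + norm x) ^ (2 * CARD('n)) * norm (partials js psi x) <= M" if "length js <= 0 + 2 * k" for js x
 proof -
  have "(1 + norm x) ^ (2 * CARD('n)) * norm (partials js psi x) <= (1 + norm x) ^ N * norm (partials js psi x)"
   by (intro mult_right_mono power_increasing) (auto simp: N_def)
  also have "... <= M" using that by (intro M) (simp add: N_def)
  finally show ?thesis .
 qed
 let ?h = "(helmholtz ^^ k) psi"
 have pw: "norm (?h x) <= ((1 + real CARD('n)) ^ k * M) * inverse ((1 + norm x) ^ (2 * CARD('n)))" for x
 proof -
  have "(1 + norm x) ^ (2 * CARD('n)) * norm (?h x) <= (1 + real CARD('n)) ^ k * M"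
   using helmholtz_power_bound[OF psi, where N=0 and k=k and L="2 * CARD('n)" and M=M and js="[]" and x=x] M' by simp
  moreover have "0 < (1 + norm x) ^ (2 * CARD('n))" by (intro zero_less_power) (simp add: add_pos_nonneg)
  ultimately show ?thesis by (simp add: field_simps)
 qed
 have "(INTG x. norm (?h x)) <= (INTG x. ((1 + real CARD('n)) ^ k * M) * inverse ((1 + norm (x :: real^'n)) ^ (2 * CARD('n))))"
  by (rule integral_mono[OF integrable_norm[OF schwartz_integrable[OF helmholtz_power_schwartz[OF psi]]]
     integrable_mult_right[OF ii] pw])
 also have "... = ((1 + real CARD('n)) ^ k * M) * I" by (simp add: I_def)
 finally have hI: "(INTG x. norm (?h x)) <= ((1 + real CARD('n)) ^ k * M) * I" .
 have "cmod (of_rep g psi) <= wnorm s g * wnorm (- s) (%xi. fourier psi (- xi))"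
  unfolding of_rep_schwartz[OF psi]
  by (rule Lw_cdot(2)[OF g schwartz_Lw[OF fourier_reflect_schwartz[OF psi]]])
 also have "wnorm (- s) (%xi. fourier psi (- xi)) = wnorm (- s) (fourier psi)"
  by (rule Lw_reflect(2)[OF schwartz_Lw[OF fourier_schwartz[OF psi]]])
 also have "wnorm s g * ... <= wnorm s g * (C * (((1 + real CARD('n)) ^ k * M) * I))"
  by (intro mult_left_mono order_trans[OF C(2)[OF psi]] hI C(1)) auto
 finally show ?thesis by (simp only: mult_ac)
qed
show ?thesis
 unfolding tempered_def
proof (intro CollectI conjI ballI allI exI impI)
 show "of_rep g = on_tests schwartz (of_rep g)" by (auto simp: of_rep_def on_tests_def)
 show "of_rep g (%x. phi x + psi x) = of_rep g phi + of_rep g psi" if "phi : schwartz" "psi : schwartz" for phi psi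
  using that i[OF that(1)] i[OF that(2)]
  by (simp add: of_rep_schwartz schwartz_add fourier_add schwartz_integrable bounded_bilinear.add_right[OF bilinear_cdot])
 show "of_rep g (%x. z *s phi x) = z * of_rep g phi" if "phi : schwartz" for z phi
  using that by (simp add: of_rep_schwartz schwartz_smult fourier_smult schwartz_integrable cdot_smult)
 show "cmod (of_rep g psi) <= (wnorm s g * C * (1 + real CARD('n)) ^ k * I) * M"
  if "psi : schwartz" "\<forall>js x. length js <= N --> (1 + norm x) ^ N * norm (partials js psi x) <= M" for psi M
  using that by (intro bound) auto
qed
qed

lemma of_rep_Hs: "g : Lw s ==> of_rep g : Hs s"
using of_rep_tempered[of g s] fourier_rep_of_rep[of g s] unfolding Hs_def Lw_iff by blast

lemma eq_of_rep:
assumes "u : tempered" "fourier_rep u g"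
shows "u = of_rep g"
proof
fix psi
show "u psi = of_rep g psi"
proof (cases "psi : schwartz")
 case True
 have "u (fourier (%x. fourier psi (- x))) = (INTG xi. cdot (g xi) (fourier psi (- xi)))"
  using assms(2) fourier_surj(2)[OF True] unfolding fourier_rep_def by blast
 then show ?thesis by (simp add: fourier_surj(1)[OF True] of_rep_schwartz[OF True])
next
 case False
 have "u = on_tests schwartz u" using assms(1) by (simp add: tempered_def)
 then have "u psi = 0" using False by (metis on_tests_def)
 then show ?thesis using False by (simp add: of_rep_def on_tests_def)
qed
qed

lemma HsE:
assumes "u : Hs s"
obtains g where "g : Lw s" "u = of_rep g" "!!t. Hs_norm t u = wnorm t g"
proof -
obtain g where g: "fourier_rep u g" "g : Lw s"
 using assms unfolding Hs_def by (auto simp: Lw_iff fourier_rep_def)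
have "u = of_rep g" using assms g(1) by (intro eq_of_rep) (auto simp: Hs_def)
then show ?thesis using that g(2) Hs_norm_eq[OF g(1)] by blast
qed

lemma of_rep_eq_iff:
assumes "g : Lw s" "h : Lw t"
shows "of_rep g = of_rep h \<longleftrightarrow> (AE xi in lebesgue. g xi = h xi)"
proof
assume "of_rep g = of_rep h"
then show "AE xi in lebesgue. g xi = h xi"
 using fourier_rep_unique fourier_rep_of_rep[OF assms(1)] fourier_rep_of_rep[OF assms(2)] by metis
next
assume ae: "AE xi in lebesgue. g xi = h xi"
have "(INTG xi. cdot (g xi) (fourier psi (- xi))) = (INTG xi. cdot (h xi) (fourier psi (- xi)))" if "psi : schwartz" for psi
 using ae Lw_measurable[OF assms(1)] Lw_measurable[OF assms(2)] schwartz_measurable[OF fourier_reflect_schwartz[OF that]]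
 by (intro integral_cong_AE bilinear_measurable[OF bilinear_cdot]) auto
then show "of_rep g = of_rep h" by (auto simp: of_rep_def on_tests_def)
qed

lemma of_rep_add:
assumes "g : Lw s" "h : Lw s"
shows "add_dist (of_rep g) (of_rep h) = of_rep (%xi. g xi + h xi)"
proof
fix psi :: "('a, 'b) vfun"
show "add_dist (of_rep g) (of_rep h) psi = of_rep (%xi. g xi + h xi) psi"
proof (cases "psi : schwartz")
 case True
 note i = schwartz_Lw[OF fourier_reflect_schwartz[OF True]]
 show ?thesis using Lw_cdot(1)[OF assms(1) i] Lw_cdot(1)[OF assms(2) i]
  by (simp add: add_dist_def of_rep_schwartz[OF True] bounded_bilinear.add_left[OF bilinear_cdot])
qed (simp add: add_dist_def of_rep_def on_tests_def)
qed

lemma of_rep_diff: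
assumes "g : Lw s" "h : Lw s"
shows "diff_dist (of_rep g) (of_rep h) = of_rep (%xi. g xi - h xi)"
proof
fix psi :: "('a, 'b) vfun"
show "diff_dist (of_rep g) (of_rep h) psi = of_rep (%xi. g xi - h xi) psi"
proof (cases "psi : schwartz")
 case True
 note i = schwartz_Lw[OF fourier_reflect_schwartz[OF True]]
 show ?thesis using Lw_cdot(1)[OF assms(1) i] Lw_cdot(1)[OF assms(2) i]
  by (simp add: diff_dist_def of_rep_schwartz[OF True] bounded_bilinear.diff_left[OF bilinear_cdot])
qed (simp add: diff_dist_def of_rep_def on_tests_def)
qed

lemma of_rep_scale: "scale_dist z (of_rep g) = of_rep (%xi. z *s g xi)"
by (auto simp: fun_eq_iff scale_dist_def of_rep_def on_tests_def cdot_smult)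

lemma of_rep_partial: "partial_dist schwartz j (of_rep g) = of_rep (%xi. (dsym j xi) *s g xi)"
by (auto simp: fun_eq_iff partial_dist_def of_rep_def on_tests_def schwartz_partial fourier_of_partial cdot_smult
  bounded_bilinear.minus_right[OF bilinear_cdot])

lemma schwartz_conj: "psi : schwartz ==> (%x. conj_vec (psi x)) : schwartz"
by (rule schwartz_linear_image[OF bounded_linear_conj_vec])

lemma schwartz_conj_iff: "(%x. conj_vec (psi x)) : schwartz \<longleftrightarrow> psi : schwartz"
using schwartz_conj[of psi] schwartz_conj[of "%x. conj_vec (psi x)"] by auto

lemma of_rep_conj:
assumes "g : lmeas"
shows "conj_dist (of_rep g) = of_rep (%xi. conj_vec (g (- xi)))"
proof
fix psi :: "('a, 'b) vfun"
show "conj_dist (of_rep g) psi = of_rep (%xi. conj_vec (g (- xi))) psi"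
proof (cases "psi : schwartz")
 case True
 have m: "(%xi. cdot (conj_vec (g (- xi))) (fourier psi (- xi))) : lmeas"
  using linear_measurable[OF bounded_linear_conj_vec measurable_lebesgue_affine[OF assms, of "-1" 0]]
   schwartz_measurable[OF fourier_reflect_schwartz[OF True]]
  by (intro bilinear_measurable[OF bilinear_cdot]) auto
 have "conj_dist (of_rep g) psi = cnj (INTG xi. cdot (g xi) (fourier (%x. conj_vec (psi x)) (- xi)))"
  using True by (simp add: conj_dist_def of_rep_schwartz schwartz_conj)
 also have "... = (INTG xi. cnj (cdot (g xi) (conj_vec (fourier psi xi))))"
  by (simp add: fourier_conj)
 also have "... = (INTG xi. cdot (conj_vec (g xi)) (fourier psi xi))"
  by (simp flip: cdot_conj_vec)
 also have "... = (INTG xi. cdot (conj_vec (g (- xi))) (fourier psi (- xi)))"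
  using lebesgue_integral_reflect[OF m] by simp
 finally show ?thesis by (simp add: of_rep_schwartz[OF True])
qed (simp add: conj_dist_def of_rep_def on_tests_def schwartz_conj_iff)
qed

lemma regular_dist_integrable:
fixes f :: "('n::finite, 'm::finite) vfun"
assumes "integrable lebesgue f"
shows "reg f = of_rep (fourier f)"
proof
fix psi :: "('n, 'm) vfun"
show "reg f psi = of_rep (fourier f) psi"
proof (cases "psi : schwartz")
 case True
 have "(INTG xi. cdot (fourier f xi) (fourier psi (- xi))) = (INTG x. cdot (f x) (fourier (%xi. fourier psi (- xi)) x))"
  by (rule fourier_symmetric[OF assms schwartz_integrable[OF fourier_reflect_schwartz[OF True]]])
 then show ?thesis by (simp add: regular_dist_def on_tests_def True of_rep_schwartz fourier_surj(1)[OF True])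
qed (simp add: regular_dist_def of_rep_def on_tests_def)
qed

lemma regular_dist_Schwartz: "f : schwartz ==> reg f = of_rep (fourier f)"
by (rule regular_dist_integrable[OF schwartz_integrable])

lemma Hs_0_L2: "Lw 0 = LL" "wnorm 0 = L2n"
by (auto simp: Lw_def wnorm_def fun_eq_iff)

text \<open>The Fourier transform on $L_2$, by duality from Plancherel's theorem for Schwartz functions.\<close>

lemma L2_fourier_exists:
fixes f :: "('n::finite, 'm::finite) vfun"
assumes f: "f : LL"
obtains g where "g : LL" "reg f = of_rep g" "L2n g <= L2n f"
proof -
have L: "f : Lw 0" "!!phi :: ('n, 'm) vfun. phi : schwartz ==> fourier phi : Lw (- 0)"
 using f by (simp only: Hs_0_L2) (rule schwartz_Lw[OF fourier_schwartz])
define l where "l phi = (INTG x. cdot (f x) (fourier phi x))" for phi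
have l1: "l (%x. phi x + psi x) = l phi + l psi" if "phi : schwartz" "psi : schwartz" for phi psi
 using Lw_cdot(1)[OF L(1) L(2)[OF that(1)]] Lw_cdot(1)[OF L(1) L(2)[OF that(2)]] that
 by (simp add: l_def fourier_add schwartz_integrable bounded_bilinear.add_right[OF bilinear_cdot])
have l2: "l (%x. z *s phi x) = z * l phi" if "phi : schwartz" for z phi
 using that by (simp add: l_def fourier_smult schwartz_integrable cdot_smult)
have l3: "cmod (l phi) <= L2n f * wnorm 0 phi" if "phi : schwartz" for phi
 using Lw_cdot(2)[OF L(1) L(2)[OF that]] fourier_Plancherel[OF that] by (simp add: l_def Hs_0_L2)
have "\<exists>g phi. g : Lw (- 0) & wnorm (- 0) g <= \<bar>L2n f\<bar> & (\<forall>psi\<in>schwartz. l psi = (INTG x. cdot (g x) (psi x))) &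
 (\<forall>k::nat. phi k : schwartz) & (%k. wnorm 0 (%x. phi k x - wt (- 2 * 0) (%x. conj_vec (g x)) x)) ---> 0"
 by (rule Lw_Riesz) (rule l1 l2 l3; assumption)+
then obtain g where g: "g : Lw (- 0)" "wnorm (- 0) g <= \<bar>L2n f\<bar>"
  "!!phi. phi : schwartz ==> l phi = (INTG x. cdot (g x) (phi x))"
 by blast
have "reg f = of_rep g"
proof
 fix psi :: "('n, 'm) vfun"
 show "reg f psi = of_rep g psi"
 proof (cases "psi : schwartz")
  case True
  then show ?thesis
   using g(3)[OF fourier_surj(2)[OF True]]
   by (simp add: l_def fourier_surj(1)[OF True] regular_dist_def on_tests_def of_rep_schwartz)
 qed (simp add: regular_dist_def of_rep_def on_tests_def)
qed
then show ?thesis using that[of g] g by (simp add: Hs_0_L2)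
qed

lemma L2_inverse_fourier_exists:
fixes g :: "('n::finite, 'm::finite) vfun"
assumes g: "g : LL"
obtains f where "f : LL" "reg f = of_rep g" "L2n f <= L2n g"
proof -
have L: "g : Lw 0" "!!phi :: ('n, 'm) vfun. phi : schwartz ==> (%xi. fourier phi (- xi)) : Lw (- 0)"
 using g by (simp only: Hs_0_L2) (rule schwartz_Lw[OF fourier_reflect_schwartz])
define l where "l phi = (INTG x. cdot (g x) (fourier phi (- x)))" for phi
have l1: "l (%x. phi x + psi x) = l phi + l psi" if "phi : schwartz" "psi : schwartz" for phi psi
 using Lw_cdot(1)[OF L(1) L(2)[OF that(1)]] Lw_cdot(1)[OF L(1) L(2)[OF that(2)]] that
 by (simp add: l_def fourier_add schwartz_integrable bounded_bilinear.add_right[OF bilinear_cdot])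
have l2: "l (%x. z *s phi x) = z * l phi" if "phi : schwartz" for z phi
 using that by (simp add: l_def fourier_smult schwartz_integrable cdot_smult)
have l3: "cmod (l phi) <= L2n g * wnorm 0 phi" if "phi : schwartz" for phi
 using Lw_cdot(2)[OF L(1) L(2)[OF that]] fourier_Plancherel[OF that] Lw_reflect(2)[OF schwartz_Lw[OF fourier_schwartz[OF that]], of 0]
 by (simp add: l_def Hs_0_L2)
have "\<exists>f phi. f : Lw (- 0) & wnorm (- 0) f <= \<bar>L2n g\<bar> & (\<forall>psi\<in>schwartz. l psi = (INTG x. cdot (f x) (psi x))) &
 (\<forall>k::nat. phi k : schwartz) & (%k. wnorm 0 (%x. phi k x - wt (- 2 * 0) (%x. conj_vec (f x)) x)) ---> 0"
 by (rule Lw_Riesz) (rule l1 l2 l3; assumption)+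
then obtain f where f: "f : Lw (- 0)" "wnorm (- 0) f <= \<bar>L2n g\<bar>"
  "!!phi. phi : schwartz ==> l phi = (INTG x. cdot (f x) (phi x))"
 by blast
have "reg f = of_rep g"
proof
 fix psi :: "('n, 'm) vfun"
 show "reg f psi = of_rep g psi"
  using f(3)[of psi] by (cases "psi : schwartz") (simp_all add: l_def regular_dist_def on_tests_def of_rep_def)
qed
then show ?thesis using that[of f] f by (simp add: Hs_0_L2)
qed

lemma regular_dist_inj:
assumes "f : LL" "g : LL" "reg f = reg g"
shows "AE x in lebesgue. f x = g x"
proof -
have "AE x in lebesgue. f x - g x = 0"
proof (rule AE_zero_if_schwartz_integrals_zero)
 show "(%x. f x - g x) : lmeas" using assms L2_measurable by (intro borel_measurable_diff) auto
 fix phi :: "('a, 'b) vfun" assume phi: "phi : schwartz"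
 have p: "phi : LL" using schwartz_Lw[OF phi, of 0] by (simp add: Hs_0_L2)
 have "(INTG x. cdot (f x) (phi x)) = (INTG x. cdot (g x) (phi x))"
  using fun_cong[OF assms(3), of phi] phi by (simp add: regular_dist_def on_tests_def)
 then show "integrable lebesgue (%x. cdot (f x - g x) (phi x))" "(INTG x. cdot (f x - g x) (phi x)) = 0"
  using L2_cdot(1)[OF assms(1) p] L2_cdot(1)[OF assms(2) p]
  by (simp_all add: bounded_bilinear.diff_left[OF bilinear_cdot])
qed
then show ?thesis by eventually_elim simp
qed

lemma L2_Plancherel:
assumes f: "f : LL" and g: "g : Lw s" and eq: "reg f = of_rep g"
shows "g : LL" "L2n g = L2n f"
proof -
obtain h where h: "h : LL" "reg f = of_rep h" "L2n h <= L2n f"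
 using L2_fourier_exists[OF f] .
have hg: "AE x in lebesgue. h x = g x"
 using of_rep_eq_iff[of h 0 g s] h(1,2) g eq by (simp add: Hs_0_L2)
show gL: "g : LL"
 using Lw_cong_AE[of h 0 g] h(1) Lw_measurable[OF g] hg by (simp add: Hs_0_L2)
have hgn: "L2n h = L2n g"
 using hg L2_measurable[OF h(1)] Lw_measurable[OF g] by (intro L2norm_cong_AE) auto
obtain f' where f': "f' : LL" "reg f' = of_rep g" "L2n f' <= L2n g"
 using L2_inverse_fourier_exists[OF gL] .
have ff: "AE x in lebesgue. f x = f' x" using regular_dist_inj[OF f f'(1)] eq f'(2) by simp
have "L2n f = L2n f'"
 using ff L2_measurable[OF f] L2_measurable[OF f'(1)] by (intro L2norm_cong_AE) auto
then show "L2n g = L2n f" using h(3) f'(3) hgn by simp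
qed

section \<open>The Fourier transform of square-integrable functions\<close>

definition ft :: "('n::finite, 'm::finite) vfun => ('n, 'm) vfun" where
"ft f = (SOME g. g : LL & reg f = of_rep g)"

lemma ft:
assumes "f : LL"
shows "ft f : LL" "reg f = of_rep (ft f)"
proof -
have "\<exists>g. g : LL & reg f = of_rep g"
 using L2_fourier_exists[OF assms] by metis
from someI_ex[OF this] show "ft f : LL" "reg f = of_rep (ft f)"
 unfolding ft_def by blast+
qed

lemma ft_unique:
assumes "f : LL" "g : Lw s" "reg f = of_rep g"
shows "AE xi in lebesgue. ft f xi = g xi"
proof -
have f0: "ft f : Lw 0" using ft(1)[OF assms(1)] by (simp add: Hs_0_L2)
have "of_rep (ft f) = of_rep g" using ft(2)[OF assms(1)] assms(3) by simp
then show ?thesis by (simp only: of_rep_eq_iff[OF f0 assms(2)])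
qed

lemma L2norm_ft: "f : LL ==> L2n (ft f) = L2n f"
using L2_Plancherel(2)[of f "ft f" 0] ft[of f] by (simp add: Hs_0_L2)

lemma L2_ex_ft:
fixes g :: "('n::finite, 'm::finite) vfun"
assumes "g : LL"
obtains f where "f : LL" "reg f = of_rep g" "AE xi in lebesgue. ft f xi = g xi"
proof -
obtain f where f: "f : LL" "reg f = of_rep g"
 using L2_inverse_fourier_exists[OF assms] by metis
have g0: "g : Lw 0" using assms by (simp add: Hs_0_L2)
show ?thesis by (rule that[OF f ft_unique[OF f(1) g0 f(2)]])
qed

lemma regular_dist_Hs_iff:
assumes "f : LL"
shows "reg f : Hs t \<longleftrightarrow> ft f : Lw t"
 and "Hs_norm t (reg f) = wnorm t (ft f)"
proof -
have f0: "ft f : Lw 0" using ft(1)[OF assms(1)] by (simp add: Hs_0_L2)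
show "Hs_norm t (reg f) = wnorm t (ft f)"
 unfolding ft(2)[OF assms] by (rule Hs_norm_of_rep[OF f0])
show "reg f : Hs t \<longleftrightarrow> ft f : Lw t"
proof
 assume "reg f : Hs t"
 then obtain g where g: "g : Lw t" "reg f = of_rep g" by (rule HsE) blast
 have ae: "AE xi in lebesgue. ft f xi = g xi" by (rule ft_unique[OF assms g])
 show "ft f : Lw t"
  using ae by (intro Lw_cong_AE[OF g(1) L2_measurable[OF ft(1)[OF assms]]]) (auto elim: AE_mp)
next
 assume "ft f : Lw t"
 then show "reg f : Hs t" unfolding ft(2)[OF assms] by (rule of_rep_Hs)
qed
qed

lemma schwartz_L2: "f : schwartz ==> f : LL" for f :: "real^'n => 'a::euclidean_space"
using schwartz_Lw[of f 0] by (simp add: Hs_0_L2)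

lemma regular_dist_add:
assumes "f : LL" "g : LL"
shows "add_dist (reg f) (reg g) = reg (%x. f x + g x)"
using L2_cdot(1)[OF assms(1) schwartz_L2] L2_cdot(1)[OF assms(2) schwartz_L2]
by (auto simp: fun_eq_iff add_dist_def regular_dist_def on_tests_def bounded_bilinear.add_left[OF bilinear_cdot])

lemma regular_dist_diff:
assumes "f : LL" "g : LL"
shows "diff_dist (reg f) (reg g) = reg (%x. f x - g x)"
using L2_cdot(1)[OF assms(1) schwartz_L2] L2_cdot(1)[OF assms(2) schwartz_L2]
by (auto simp: fun_eq_iff diff_dist_def regular_dist_def on_tests_def bounded_bilinear.diff_left[OF bilinear_cdot])

lemma ft_add:
assumes "f : LL" "g : LL"
shows "AE xi in lebesgue. ft (%x. f x + g x) xi = ft f xi + ft g xi"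
proof (rule ft_unique[OF L2_add[OF assms]])
have *: "ft f : Lw 0" "ft g : Lw 0" using ft(1)[OF assms(1)] ft(1)[OF assms(2)] by (simp_all add: Hs_0_L2)
then show "(%xi. ft f xi + ft g xi) : Lw 0" by (rule Lw_add)
show "reg (%x. f x + g x) = of_rep (%xi. ft f xi + ft g xi)"
 unfolding regular_dist_add[OF assms, symmetric] ft(2)[OF assms(1)] ft(2)[OF assms(2)] by (rule of_rep_add[OF *])
qed

lemma ft_diff:
assumes "f : LL" "g : LL"
shows "AE xi in lebesgue. ft (%x. f x - g x) xi = ft f xi - ft g xi"
proof (rule ft_unique[OF L2_diff[OF assms]])
have *: "ft f : Lw 0" "ft g : Lw 0" using ft(1)[OF assms(1)] ft(1)[OF assms(2)] by (simp_all add: Hs_0_L2)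
then show "(%xi. ft f xi - ft g xi) : Lw 0" by (rule Lw_diff)
show "reg (%x. f x - g x) = of_rep (%xi. ft f xi - ft g xi)"
 unfolding regular_dist_diff[OF assms, symmetric] ft(2)[OF assms(1)] ft(2)[OF assms(2)] by (rule of_rep_diff[OF *])
qed

lemma regular_dist_cong_AE:
assumes "f : lmeas" "g : lmeas" "AE x in lebesgue. f x = g x"
shows "reg f = reg g"
proof -
have "(INTG x. cdot (f x) (psi x)) = (INTG x. cdot (g x) (psi x))" if "psi : schwartz" for psi
 using assms schwartz_measurable[OF that] by (intro integral_cong_AE bilinear_measurable[OF bilinear_cdot]) auto
then show ?thesis by (auto simp: fun_eq_iff regular_dist_def on_tests_def)
qed

lemma L2_shift:
fixes f :: "'a::euclidean_space => 'b::euclidean_space"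
assumes "f : LL"
shows "(%x. f (x + h)) : LL" "L2n (%x. f (x + h)) = L2n f"
proof -
have f: "f : lmeas" "integrable lebesgue (%x. (norm (f x))^2)" using assms by (simp_all add: L2_def)
show "(%x. f (x + h)) : LL"
 using measurable_lebesgue_affine[OF f(1), of 1 h] lebesgue_integrable_affine[OF f(2), of 1 h] by (simp add: L2_def)
show "L2n (%x. f (x + h)) = L2n f"
 using lebesgue_integral_shift[OF borel_measurable_integrable[OF f(2)], of h] by (simp add: L2norm_def)
qed

lemma ft_shift:
fixes f :: "('n::finite, 'm::finite) vfun"
assumes f: "f : LL"
shows "AE xi in lebesgue. ft (%x. f (x + h)) xi = cis (h \<bullet> xi) *s ft f xi"
proof (rule ft_unique[OF L2_shift(1)[OF f]])
have m: "(%xi. cis (h \<bullet> xi) *s ft f xi) : lmeas"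
 using cis_inner_measurable_lebesgue[of "- h"] L2_measurable[OF ft(1)[OF f]]
 by (intro bilinear_measurable[OF bilinear_smult]) (simp_all add: inner_commute)
have f0: "ft f : Lw 0" using ft(1)[OF f] by (simp add: Hs_0_L2)
show "(%xi. cis (h \<bullet> xi) *s ft f xi) : Lw 0"
 by (rule Lw_bound(1)[OF f0 m, where C=1]) (simp_all add: norm_vector_smult)
show "reg (%x. f (x + h)) = of_rep (%xi. cis (h \<bullet> xi) *s ft f xi)"
proof
 fix psi :: "('n, 'm) vfun"
 show "reg (%x. f (x + h)) psi = of_rep (%xi. cis (h \<bullet> xi) *s ft f xi) psi"
 proof (cases "psi : schwartz")
  case True
  have s: "(%x. psi (x + (- h))) : schwartz" using schwartz_affine[OF True, of 1 "- h"] by simp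
  have m: "(%x. cdot (f x) (psi (x - h))) : lmeas"
   using L2_measurable[OF f] schwartz_measurable[OF s] by (intro bilinear_measurable[OF bilinear_cdot]) simp_all
  have "reg (%x. f (x + h)) psi = (INTG x. cdot (f x) (psi (x - h)))"
   using lebesgue_integral_shift[OF m, of h] True by (simp add: regular_dist_def on_tests_def)
  also have "... = of_rep (ft f) (%x. psi (x + (- h)))"
   using fun_cong[OF ft(2)[OF f], of "%x. psi (x + (- h))"] s by (simp add: regular_dist_def on_tests_def)
  also have "... = of_rep (%xi. cis (h \<bullet> xi) *s ft f xi) psi"
   using s True by (simp add: of_rep_schwartz fourier_shift[OF schwartz_measurable[OF True], of "- h", simplified] cdot_smult)
  finally show ?thesis .
 qed (simp add: regular_dist_def of_rep_def on_tests_def)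
qed
qed

lemma ft_difference:
fixes f :: "('n::finite, 'm::finite) vfun"
assumes f: "f : LL"
shows "(NINT x. esq (f (x + h) - f x))
 = (NINT xi. ennreal ((cmod (cis (h \<bullet> xi) - 1))^2 * (norm (ft f xi))^2))"
proof -
have d: "(%x. f (x + h) - f x) : LL" by (intro L2_diff L2_shift f)
have "(NINT x. esq (f (x + h) - f x)) = (NINT xi. esq (ft (%x. f (x + h) - f x) xi))"
 unfolding L2_nn_integral[OF d] L2_nn_integral[OF ft(1)[OF d]] L2norm_ft[OF d] ..
also have "... = (NINT xi. ennreal ((cmod (cis (h \<bullet> xi) - 1))^2 * (norm (ft f xi))^2))"
proof (rule nn_integral_cong_AE, use ft_diff[OF L2_shift(1)[OF f, of h] f] ft_shift[OF f, of h] in eventually_elim)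
 case (elim xi)
 have "cis (h \<bullet> xi) *s ft f xi - ft f xi = (cis (h \<bullet> xi) - 1) *s ft f xi"
  by (simp add: vec_eq_iff algebra_simps)
 then have "norm (cis (h \<bullet> xi) *s ft f xi - ft f xi) = cmod (cis (h \<bullet> xi) - 1) * norm (ft f xi)"
  by (simp only: norm_vector_smult)
 then show ?case using elim by (simp only: power_mult_distrib)
qed
finally show ?thesis .
qed

section \<open>Dyadic differences and fractional smoothness\<close>

lemma cmod_cis_diff_le: "(cmod (cis y - 1))^2 <= 4 * min 1 (y^2)"
proof -
have e: "(cmod (cis y - 1))^2 = 2 - 2 * cos y"
 by (simp add: cmod_power2 power2_diff sin_squared_eq)
have "2 - 2 * cos y <= 4" using cos_ge_minus_one[of y] by linarith
moreover have "2 - 2 * cos y <= 4 * y^2"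
proof -
 have "2 - 2 * cos y = 4 * (sin (y / 2))^2" using cos_double_sin[of "y / 2"] by simp
 also have "(sin (y / 2))^2 <= (y / 2)^2" using power_mono[OF abs_sin_x_le_abs_x[of "y / 2"] abs_ge_zero, of 2] by (simp only: power2_abs)
 finally show ?thesis by (simp add: power_divide) (use zero_le_power2[of y] in linarith)
qed
ultimately show ?thesis unfolding e by (simp add: min_def)
qed

lemma cmod_cis_diff_ge:
assumes "1 <= \<bar>y\<bar>" "\<bar>y\<bar> <= 2"
shows "2 - 2 * cos 1 <= (cmod (cis y - 1))^2"
proof -
have e: "(cmod (cis y - 1))^2 = 2 - 2 * cos y"
 by (simp add: cmod_power2 power2_diff sin_squared_eq)
have "cos \<bar>y\<bar> <= cos 1" using assms pi_ge_two by (intro cos_monotone_0_pi_le) auto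
then show ?thesis unfolding e by simp
qed

lemma cos_1_less_1: "cos 1 < (1::real)"
using cos_monotone_0_pi[of 0 1] pi_ge_two by simp

text \<open>The geometric sums up to and from the index at which $4^k$ passes $Y$ are both comparable to
their last and first term, since $0 < t < 1$.\<close>

lemma dyadic_sum_le:
fixes t :: real
assumes t: "0 < t" "t < 1"
obtains C where "0 <= C" "!!Y. 1 <= Y ==> (\<Sum>k. ennreal (4 powr (real k * t) * min 1 (Y / 4 ^ k))) <= ennreal (C * Y powr t)"
proof -
define p where "p = 4 powr t"
define q where "q = 4 powr (t - 1)"
have p: "p > 1" using t by (simp add: p_def)
have q: "0 < q" "q < 1" using t by (simp_all add: q_def powr_less_one)
have pq: "p = 4 * q" by (simp add: p_def q_def powr_diff)
define C where "C = p / (p - 1) + 1 / (1 - q)"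
have C: "0 <= C" using p q by (simp add: C_def)
have "(\<Sum>k. ennreal (4 powr (real k * t) * min 1 (Y / 4 ^ k))) <= ennreal (C * Y powr t)" if Y: "1 <= Y" for Y
proof -
 define a where "a k = 4 powr (real k * t) * min 1 (Y / 4 ^ k)" for k
 have pk: "4 powr (real k * t) = p ^ k" for k by (simp add: p_def powr_powr[symmetric] mult.commute flip: powr_realpow)
 have a0: "0 <= a k" for k using Y by (simp add: a_def)
 obtain K where K: "4 ^ K <= Y" "Y < 4 ^ Suc K"
 proof -
  obtain n where n: "Y < 4 ^ n" using real_arch_pow[of 4 Y] by auto
  define N where "N = (LEAST n. Y < 4 ^ n)"
  have N: "Y < 4 ^ N" unfolding N_def using n by (rule LeastI)
  have "N ~= 0" using N Y by (metis less_le_not_le power_0)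
  then obtain K where NK: "N = Suc K" by (cases N) auto
  have "\<not> Y < 4 ^ K" using not_less_Least[of K "%n. Y < 4 ^ n"] NK unfolding N_def by simp
  then show ?thesis using that[of K] N NK by simp
 qed
 have le1: "a k <= p ^ k" for k
  unfolding a_def pk using p by (intro mult_left_le) auto
 have le2: "a k <= Y * q ^ k" for k
 proof -
  have "a k <= p ^ k * (Y / 4 ^ k)" unfolding a_def pk using p by (intro mult_left_mono) auto
  also have "... = Y * q ^ k" by (simp add: pq power_mult_distrib)
  finally show ?thesis .
 qed
 have s2: "(%k. Y * q ^ (k + Suc K)) sums (Y * q ^ Suc K / (1 - q))"
 proof -
  have "(%k. (Y * q ^ Suc K) * q ^ k) sums ((Y * q ^ Suc K) * (1 / (1 - q)))"
   using q by (intro sums_mult geometric_sums) simp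
  then show ?thesis by (simp add: power_add mult_ac)
 qed
 have sa: "summable (%k. a (k + Suc K))"
 proof (rule summable_comparison_test'[OF sums_summable[OF s2], of 0])
  show "norm (a (k + Suc K)) <= Y * q ^ (k + Suc K)" for k
   using a0 le2[of "k + Suc K"] by (simp only: real_norm_def abs_of_nonneg)
 qed
 have tail: "(\<Sum>k. a (k + Suc K)) <= Y * q ^ Suc K / (1 - q)"
  using suminf_le[OF le2 sa sums_summable[OF s2]] sums_unique[OF s2] by simp
 have head: "(\<Sum>k<Suc K. a k) <= p ^ Suc K / (p - 1)"
 proof -
  have "(\<Sum>k<Suc K. a k) <= (\<Sum>k<Suc K. p ^ k)" by (intro sum_mono le1)
  also have "... = (p ^ Suc K - 1) / (p - 1)" using p by (subst geometric_sum) auto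
  also have "... <= p ^ Suc K / (p - 1)" using p by (intro divide_right_mono) auto
  finally show ?thesis .
 qed
 have "p ^ K = (4 ^ K) powr t" unfolding p_def by (simp add: powr_powr powr_realpow[symmetric] mult.commute)
 also have "... <= Y powr t" using K t by (intro powr_mono2) auto
 finally have pK: "p ^ K <= Y powr t" .
 have "q ^ Suc K = (4 ^ Suc K) powr (t - 1)" unfolding q_def by (simp add: powr_powr powr_realpow[symmetric] mult.commute del: power_Suc)
 also have "... <= Y powr (t - 1)" using K(2) t Y by (intro powr_mono2') auto
 finally have "Y * q ^ Suc K <= Y * Y powr (t - 1)" using Y by (intro mult_left_mono) auto
 also have "... = Y powr t" using Y by (simp add: powr_diff)
 finally have qK: "Y * q ^ Suc K <= Y powr t" .
 have sa': "summable a" using sa summable_iff_shift[of a "Suc K"] by simp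
 have "suminf a = (\<Sum>k. a (k + Suc K)) + (\<Sum>k<Suc K. a k)" by (rule suminf_split_initial_segment[OF sa'])
 also have "... <= Y powr t / (1 - q) + p * Y powr t / (p - 1)"
 proof (intro add_mono)
  show "(\<Sum>k. a (k + Suc K)) <= Y powr t / (1 - q)"
   using tail divide_right_mono[OF qK, of "1 - q"] q by simp
  have "p ^ Suc K / (p - 1) <= p * Y powr t / (p - 1)" using pK p by (intro divide_right_mono) auto
  then show "(\<Sum>k<Suc K. a k) <= p * Y powr t / (p - 1)" using head by linarith
 qed
 also have "... = C * Y powr t" by (simp add: C_def algebra_simps add_divide_distrib)
 finally have "suminf a <= C * Y powr t" .
 then have "(\<Sum>k. ennreal (a k)) <= ennreal (C * Y powr t)"
  by (subst suminf_ennreal2[OF a0 sa']) (rule ennreal_leI)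
 then show ?thesis by (simp add: a_def)
qed
then show ?thesis using that C by blast
qed

text \<open>The sum of squared dyadic differences of order \<open>t\<close>, on the side of the function and of its
Fourier transform.\<close>

definition dyadic_energy :: "real => ('n::finite, 'm::finite) vfun => ennreal" where
"dyadic_energy t f = (\<Sum>j\<in>UNIV. \<Sum>k. ennreal (4 powr (real k * t)) *
  (NINT x. esq (f (x + (1/2)^k *R axis j 1) - f x)))"

lemma dyadic_energy_ft:
fixes f :: "('n::finite, 'm::finite) vfun"
assumes f: "f : LL"
shows "dyadic_energy t f = (NINT xi. (\<Sum>j\<in>UNIV. \<Sum>k. ennreal (4 powr (real k * t) * (cmod (cis ((1/2)^k * xi $ j) - 1))^2)) *
  esq (ft f xi))"
proof -
have m: "(%xi. norm (ft f xi)) : lmeas" using L2_measurable[OF ft(1)[OF f]] by simp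
have c: "(%xi::real^'n. cmod (cis ((1/2)^k * xi $ j) - 1)) : lmeas" for j :: 'n and k
 unfolding cis_conv_exp by (intro continuous_measurable_lebesgue continuous_intros)
have "(NINT xi. (\<Sum>j\<in>UNIV. \<Sum>k. ennreal (4 powr (real k * t) * (cmod (cis ((1/2)^k * xi $ j) - 1))^2)) * esq (ft f xi))
 = (NINT xi. (\<Sum>j\<in>UNIV. \<Sum>k. ennreal (4 powr (real k * t)) * ennreal ((cmod (cis ((1/2)^k * xi $ j) - 1))^2 * (norm (ft f xi))^2)))"
 by (simp add: sum_distrib_right ennreal_suminf_multc[symmetric] ennreal_mult mult.assoc)
also have "... = (\<Sum>j\<in>UNIV. \<Sum>k. ennreal (4 powr (real k * t)) * (NINT xi. ennreal ((cmod (cis ((1/2)^k * xi $ j) - 1))^2 * (norm (ft f xi))^2)))"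
 using m c by (subst nn_integral_sum) (auto simp: nn_integral_suminf nn_integral_cmult)
also have "... = dyadic_energy t f"
 unfolding dyadic_energy_def ft_difference[OF f] by (simp add: inner_commute inner_axis)
finally show ?thesis by (rule sym)
qed

lemma nn_integral_wt:
"(NINT xi. esq (wt t g xi)) = (NINT xi. ennreal ((jb xi) powr t) * esq (g xi))"
by (simp add: norm_wt_square ennreal_mult)

lemma Lw_nn_integral: "g : Lw t ==> (NINT xi. esq (wt t g xi)) = ennreal ((wnorm t g)^2)"
using L2_nn_integral[of "wt t g" lebesgue] by (simp add: Lw_def wnorm_def)

lemma component_sq_le: "(x $ j)^2 <= (norm x)^2" for x :: "real^'n"
using component_le_norm_cart[of x j] power_mono[of "\<bar>x $ j\<bar>" "norm x" 2] by simp

lemma ennreal_term_le_suminf: "f k <= (\<Sum>k. f k)" for f :: "nat => ennreal"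
using sum_le_suminf[OF summableI, of "{k}" f] by simp

text \<open>For each large $|\xi_j|$ there is a dyadic step whose product with $|\xi_j|$ is in $[1, 2]$. The
difference symbol is bounded below there, and the weight of this step is comparable to
$|\xi_j|^{2t}$.\<close>

lemma Lw_if_dyadic_energy_finite:
assumes t: "0 < t" "t < 1"
obtains C where "0 <= C" "!!(f :: ('n::finite, 'm::finite) vfun) E. f : LL ==> 0 <= E ==> dyadic_energy t f <= ennreal E ==>
 ft f : Lw t & (wnorm t (ft f))^2 <= C * ((L2n f)^2 + E)"
proof -
define n where "n = real CARD('n)"
\<comment> \<open>Lower bound of $|e^{iy} - 1|^2$ for $1 \<le> |y| \<le> 2$.\<close>
define c where "c = 2 - 2 * cos (1::real)"
have c: "c > 0" using cos_1_less_1 by (simp add: c_def)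
define C where "C = (1 + n) * (1 + 4 / c)"
have n: "n \<ge> 1" by (simp add: n_def Suc_le_eq)
have C: "0 <= C" using n c by (simp add: C_def)
have le_add: "1 <= 1 + X" "X <= 1 + X" for X :: ennreal
 using add_increasing2[of X 1 1] add_increasing[of 1 X X] by simp_all
have pt: "ennreal ((jb xi) powr t) <= ennreal C * (1 + (\<Sum>j\<in>UNIV. \<Sum>k. ennreal (4 powr (real k * t) * (cmod (cis ((1/2)^k * xi $ j) - 1))^2)))"
 for xi :: "real^'n"
proof -
 obtain j where j: "!!i. \<bar>xi $ i\<bar> <= \<bar>xi $ j\<bar>"
 proof -
  have "finite (range (%i. \<bar>xi $ i\<bar>))" by simp
  then have "Max (range (%i. \<bar>xi $ i\<bar>)) : range (%i. \<bar>xi $ i\<bar>)" by (intro Max_in) auto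
  then obtain j where "Max (range (%i. \<bar>xi $ i\<bar>)) = \<bar>xi $ j\<bar>" by blast
  then have "\<bar>xi $ i\<bar> <= \<bar>xi $ j\<bar>" for i using Max_ge[of "range (%i. \<bar>xi $ i\<bar>)" "\<bar>xi $ i\<bar>"] by simp
  then show ?thesis using that by blast
 qed
 have nrm: "(norm xi)^2 <= n * (xi $ j)^2"
 proof -
  have "(norm xi)^2 <= (\<Sum>i\<in>(UNIV::'n set). (xi $ j)^2)"
   unfolding norm_square_sum using j by (intro sum_mono) (simp add: abs_le_square_iff[symmetric])
  then show ?thesis by (simp add: n_def)
 qed
 let ?S = "\<Sum>j\<in>UNIV. \<Sum>k. ennreal (4 powr (real k * t) * (cmod (cis ((1/2)^k * xi $ j) - 1))^2)"
 show ?thesis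
 proof (cases "\<bar>xi $ j\<bar> <= 1")
  case True
  then have "(xi $ j)^2 <= 1" by (simp add: abs_square_le_1)
  then have "(norm xi)^2 <= n" using order_trans[OF nrm mult_left_mono[of "(xi $ j)^2" 1 n]] n by simp
  then have "(jb xi) powr t <= (1 + n) powr t" using t by (intro powr_mono2) auto
  also have "... <= (1 + n) powr 1" using t n by (intro powr_mono) auto
  also have "... <= C" using n c by (simp add: C_def mult_left_mono[of 1 "1 + 4 / c" "1 + n", simplified])
  finally have "ennreal ((jb xi) powr t) <= ennreal C" by (rule ennreal_leI)
  also have "... = ennreal C * 1" by simp
  also have "... <= ennreal C * (1 + ?S)" by (rule mult_left_mono[OF le_add(1)]) simp
  finally show ?thesis .
 next
  case False
  define y where "y = \<bar>xi $ j\<bar>"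
  have y: "y > 1" using False by (simp add: y_def)
  obtain k where k: "2 ^ k <= y" "y < 2 ^ Suc k"
  proof -
   obtain m where m: "y < 2 ^ m" using real_arch_pow[of 2 y] by auto
   define N where "N = (LEAST n. y < 2 ^ n)"
   have N: "y < 2 ^ N" unfolding N_def using m by (rule LeastI)
   have "N ~= 0" using N y by (metis less_asym power_0)
   then obtain K where NK: "N = Suc K" by (cases N) auto
   have "\<not> y < 2 ^ K" using not_less_Least[of K "%n. y < 2 ^ n"] NK unfolding N_def by simp
   then show ?thesis using that[of K] N NK by simp
  qed
  have "c <= (cmod (cis ((1/2)^k * xi $ j) - 1))^2"
   unfolding c_def
  proof (rule cmod_cis_diff_ge)
   show "1 <= \<bar>(1/2)^k * xi $ j\<bar>" using k(1) by (simp add: abs_mult y_def power_divide field_simps)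
   show "\<bar>(1/2)^k * xi $ j\<bar> <= 2" using k(2) by (simp add: abs_mult y_def power_divide field_simps)
  qed
  moreover have "y\<^sup>2 powr t / 4 <= 4 powr (real k * t)"
  proof -
   have "y^2 <= (2 ^ Suc k)^2" using k(2) y by (intro power_mono) auto
   also have "... = 4 * 4 ^ k" by (simp add: power_mult_distrib power2_eq_square flip: power_mult_distrib)
   finally have "y\<^sup>2 powr t <= (4 * 4 ^ k) powr t" using t by (intro powr_mono2) auto
   also have "... = 4 powr t * 4 powr (real k * t)" by (simp add: powr_mult powr_powr flip: powr_realpow)
   also have "... <= 4 powr 1 * 4 powr (real k * t)" using t by (intro mult_right_mono powr_mono) auto
   finally show ?thesis by simp
  qed
  ultimately have term_ge: "y\<^sup>2 powr t / 4 * c <= 4 powr (real k * t) * (cmod (cis ((1/2)^k * xi $ j) - 1))^2"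
   using c by (intro mult_mono) auto
  have "ennreal (4 powr (real k * t) * (cmod (cis ((1/2)^k * xi $ j) - 1))^2)
    <= (\<Sum>k. ennreal (4 powr (real k * t) * (cmod (cis ((1/2)^k * xi $ j) - 1))^2))"
   by (rule ennreal_term_le_suminf)
  also have "... <= ?S"
   by (rule member_le_sum[of j UNIV "%j. \<Sum>k. ennreal (4 powr (real k * t) * (cmod (cis ((1/2)^k * xi $ j) - 1))^2)"]) simp_all
  finally have S: "ennreal (y\<^sup>2 powr t / 4 * c) <= ?S" using ennreal_leI[OF term_ge] by (rule order_trans[rotated])
  have "1 + (norm xi)^2 <= (1 + n) * y^2"
  proof -
   have "1 <= y^2" using y by (simp add: one_le_power)
   then show ?thesis using nrm by (simp add: y_def algebra_simps)
  qed
  then have "(jb xi) powr t <= ((1 + n) * y^2) powr t" using t by (intro powr_mono2) auto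
  also have "... = (1 + n) powr t * y\<^sup>2 powr t" using n by (simp add: powr_mult)
  also have "... <= (1 + n) powr 1 * y\<^sup>2 powr t" using n t by (intro mult_right_mono powr_mono) auto
  also have "... = (1 + n) * (4 / c) * (y\<^sup>2 powr t / 4 * c)" using c n by simp
  also have "... <= C * (y\<^sup>2 powr t / 4 * c)" unfolding C_def using n c by (intro mult_right_mono mult_left_mono) auto
  finally have "ennreal ((jb xi) powr t) <= ennreal C * ennreal (y\<^sup>2 powr t / 4 * c)"
   using C c by (subst ennreal_mult[symmetric]) (auto intro: ennreal_leI)
  also have "... <= ennreal C * (1 + ?S)" by (rule mult_left_mono[OF order_trans[OF S le_add(2)]]) simp
  finally show ?thesis .
 qed
qed
have "ft f : Lw t & (wnorm t (ft f))^2 <= C * ((L2n f)^2 + E)"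
 if f: "f : LL" and E: "0 <= E" "dyadic_energy t f <= ennreal E" for f :: "('n, 'm) vfun" and E
proof -
 have m: "(%xi. norm (ft f xi)) : lmeas" using L2_measurable[OF ft(1)[OF f]] by simp
 have c: "(%xi::real^'n. cmod (cis ((1/2)^k * xi $ j) - 1)) : lmeas" for j :: 'n and k
  unfolding cis_conv_exp by (intro continuous_measurable_lebesgue continuous_intros)
 let ?S = "%xi :: real^'n. \<Sum>j\<in>UNIV. \<Sum>k. ennreal (4 powr (real k * t) * (cmod (cis ((1/2)^k * xi $ j) - 1))^2)"
 have c1: "(%xi::real^'n. ennreal (4 powr (real k * t) * (cmod (cis ((1/2)^k * xi $ j) - 1))^2)) : lmeas" for j :: 'n and k
  by (rule measurable_compose[OF borel_measurable_times[OF borel_measurable_const borel_measurable_power[OF c]] measurable_ennreal])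
 have Sm: "?S : lmeas"
  by (rule borel_measurable_sum, rule borel_measurable_suminf_order, rule c1)
 have "(NINT xi. esq (wt t (ft f) xi))
  <= (NINT xi. ennreal C * (esq (ft f xi) + ?S xi * esq (ft f xi)))"
  unfolding nn_integral_wt
 proof (intro nn_integral_mono)
  fix xi :: "real^'n"
  have "ennreal ((jb xi) powr t) * esq (ft f xi) <= (ennreal C * (1 + ?S xi)) * esq (ft f xi)"
   by (intro mult_right_mono pt) auto
  then show "ennreal ((jb xi) powr t) * esq (ft f xi)
   <= ennreal C * (esq (ft f xi) + ?S xi * esq (ft f xi))"
   by (simp only: mult.assoc distrib_right mult_1)
 qed
 also have "... = ennreal C * ((NINT xi. esq (ft f xi)) + dyadic_energy t f)"
 proof -
  have Am: "(%xi. esq (ft f xi)) : lmeas" using m by simp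
  have SA: "(%xi. ?S xi * esq (ft f xi)) : lmeas"
   by (rule borel_measurable_times_ennreal[OF Sm Am])
  show ?thesis
   unfolding dyadic_energy_ft[OF f] nn_integral_add[OF Am SA, symmetric]
   by (rule nn_integral_cmult[OF borel_measurable_add[OF Am SA]])
 qed
 also have "(NINT xi. esq (ft f xi)) = ennreal ((L2n f)^2)"
  using L2_nn_integral[OF ft(1)[OF f]] by (simp add: L2norm_ft[OF f])
 also have "ennreal C * (ennreal ((L2n f)^2) + dyadic_energy t f) <= ennreal C * (ennreal ((L2n f)^2) + ennreal E)"
  using E by (intro mult_left_mono add_left_mono) auto
 also have "... = ennreal (C * ((L2n f)^2 + E))"
  using C E by (simp add: ennreal_mult)
 also have "... = ennreal ((sqrt (C * ((L2n f)^2 + E)))^2)" using C E by simp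
 finally have le: "(NINT xi. esq (wt t (ft f) xi)) <= ennreal ((sqrt (C * ((L2n f)^2 + E)))^2)" .
 have s0: "0 <= sqrt (C * ((L2n f)^2 + E))" using C E by simp
 note r = L2I_nn_integral[OF wt_measurable[OF L2_measurable[OF ft(1)[OF f]]] le s0]
 have "(wnorm t (ft f))^2 <= (sqrt (C * ((L2n f)^2 + E)))^2"
  unfolding wnorm_def by (intro power_mono r(2)) simp
 then show ?thesis using r(1) C E by (simp add: Lw_def)
qed
then show ?thesis using that C by blast
qed

section \<open>Multiplication by bounded matrix functions\<close>

lemma bilinear_matvec: "bounded_bilinear (%(A :: complex^'m^'m) x. A *v x)"
unfolding bilinear_conv_bounded_bilinear[symmetric] bilinear_def
proof (intro conjI allI linearI)
show "(A *v (r *R x)) = r *R (A *v x)" for A :: "complex^'m^'m" and x r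
 by (simp add: vec_eq_iff matrix_vector_mult_def scaleR_sum_right)
show "((r *R A) *v x) = r *R (A *v x)" for A :: "complex^'m^'m" and x r
 by (simp add: vec_eq_iff matrix_vector_mult_def scaleR_sum_right)
qed (simp_all add: matrix_vector_right_distrib matrix_vector_mult_add_rdistrib)

lemma Linfty_bound:
assumes "G : Linfty"
obtains C where "0 <= C" "AE x in lebesgue. norm (G x) <= C"
proof -
obtain C where C: "AE x in lebesgue. norm (G x) <= C" using assms by (auto simp: Linfty_def)
then have "AE x in lebesgue. norm (G x) <= \<bar>C\<bar>" by eventually_elim simp
then show ?thesis using that[of "\<bar>C\<bar>"] by simp
qed

lemma Linfty_measurable: "G : Linfty ==> G : lmeas"
by (simp add: Linfty_def)

lemma mult_measurable:
fixes f :: "('n::finite, 'm::finite) vfun" and G :: "('n, 'm) mfun"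
assumes "G : lmeas" "f : lmeas"
shows "(%x. G x *v f x) : lmeas"
by (rule bilinear_measurable[OF bilinear_matvec assms])

lemma mult_L2_bound:
fixes G :: "('n::finite, 'm::finite) mfun"
assumes G: "G : Linfty"
obtains C where "0 <= C" "!!f :: ('n, 'm) vfun. f : LL ==> (%x. G x *v f x) : LL"
 "!!f :: ('n, 'm) vfun. f : LL ==> L2n (%x. G x *v f x) <= C * L2n f"
proof -
obtain K where K: "K \<ge> 0" "!!(A :: complex^'m^'m) x. norm (A *v x) <= norm A * norm x * K"
 using bounded_bilinear.nonneg_bounded[OF bilinear_matvec] by blast
obtain B where B: "0 <= B" "AE x in lebesgue. norm (G x) <= B" using Linfty_bound[OF G] .
have ae: "AE x in lebesgue. norm (G x *v f x) <= (B * K) * norm (f x)" for f :: "('n, 'm) vfun"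
 using B(2)
proof eventually_elim
 case (elim x)
 have "norm (G x *v f x) <= norm (G x) * norm (f x) * K" by (rule K(2))
 also have "... <= B * norm (f x) * K" using elim K(1) by (intro mult_right_mono) auto
 finally show ?case by (simp add: mult_ac)
qed
have BK: "0 <= B * K" using B(1) K(1) by simp
show ?thesis
proof (rule that[OF BK])
 fix f :: "('n, 'm) vfun" assume f: "f : LL"
 note * = L2_bound[OF f mult_measurable[OF Linfty_measurable[OF G] L2_measurable[OF f]] ae BK]
 show "(%x. G x *v f x) : LL" by (rule *)
 show "L2n (%x. G x *v f x) <= B * K * L2n f" by (rule *)
qed
qed

lemma mult_L2:
fixes f :: "('n::finite, 'm::finite) vfun" and G :: "('n, 'm) mfun"
assumes "G : Linfty" "f : LL"
shows "(%x. G x *v f x) : LL"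
using mult_L2_bound[OF assms(1)] assms(2) by metis

definition multiplier :: "real => ('n::finite, 'm::finite) mfun => bool" where
"multiplier t G \<longleftrightarrow> G : Linfty & (\<exists>C\<ge>0. \<forall>f\<in>LL. ft f : Lw t -->
  ft (%x. G x *v f x) : Lw t & wnorm t (ft (%x. G x *v f x)) <= C * wnorm t (ft f))"

lemma multiplier_Linfty: "multiplier t G ==> G : Linfty"
by (simp add: multiplier_def)

lemma multiplierE:
assumes "multiplier t (G :: ('n::finite, 'm::finite) mfun)"
obtains C where "0 <= C" "!!f. f : LL ==> ft f : Lw t ==> ft (%x. G x *v f x) : Lw t"
 "!!f. f : LL ==> ft f : Lw t ==> wnorm t (ft (%x. G x *v f x)) <= C * wnorm t (ft f)"
using assms unfolding multiplier_def by blast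

lemma multiplier_0:
fixes G :: "('n::finite, 'm::finite) mfun"
assumes G: "G : Linfty"
shows "multiplier 0 G"
proof -
obtain C where C: "0 <= C" "!!f :: ('n, 'm) vfun. f : LL ==> (%x. G x *v f x) : LL"
 "!!f :: ('n, 'm) vfun. f : LL ==> L2n (%x. G x *v f x) <= C * L2n f"
 using mult_L2_bound[OF G] by blast
show ?thesis unfolding multiplier_def Hs_0_L2
proof (intro conjI exI[of _ C] ballI impI G C(1))
 fix f :: "('n, 'm) vfun" assume f: "f : LL"
 show "ft (%x. G x *v f x) : LL" by (intro ft(1) C(2) f)
 show "L2n (ft (%x. G x *v f x)) <= C * L2n (ft f)"
  using C(3)[OF f] by (simp add: L2norm_ft C(2) f)
qed
qed

lemma power2_sum_le: "(a + b)^2 <= 2 * a^2 + 2 * b^2" for a b :: real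
using sum_squares_bound[of a b] by (simp add: power2_sum)

lemma geometric_ennreal:
assumes "0 <= r" "r < 1" "0 <= c"
shows "(\<Sum>k. ennreal (c * r ^ k)) = ennreal (c / (1 - r :: real))"
proof -
have "(%k. c * r ^ k) sums (c * (1 / (1 - r)))" using assms by (intro sums_mult geometric_sums) simp
then show ?thesis using assms by (subst suminf_ennreal2) (auto simp: sums_iff)
qed

lemma cis_step_bound:
fixes xi :: "real^'n"
shows "(cmod (cis (((1/2)^k *R axis j 1) \<bullet> xi) - 1))^2 <= 4 * min 1 ((jb xi) / 4 ^ k)"
proof -
have "(((1/2)^k *R axis j 1) \<bullet> xi)^2 = (xi $ j)^2 / 4 ^ k"
 by (simp add: inner_commute[of _ xi] inner_axis power_mult_distrib power_divide power2_eq_square flip: power_mult_distrib)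
also have "... <= (jb xi) / 4 ^ k" using component_sq_le[of xi j] by (intro divide_right_mono) auto
finally have "min 1 ((((1/2)^k *R axis j 1) \<bullet> xi)^2) <= min 1 ((jb xi) / 4 ^ k)" by (intro min.mono) auto
then show ?thesis using cmod_cis_diff_le[of "((1/2)^k *R axis j 1) \<bullet> xi"] by linarith
qed

lemma min_bracket_measurable: "(%xi::real^'n. ennreal (min 1 ((jb xi) / 4 ^ k))) : lmeas"
proof -
have "(%xi::real^'n. min 1 ((jb xi) / 4 ^ k)) : lmeas"
 by (intro continuous_measurable_lebesgue continuous_intros) simp
then show ?thesis by simp
qed

abbreviation "low_energy k g \<equiv> \<integral>\<^sup>+y. ennreal (min 1 ((jb y) / 4 ^ k)) * esq (g y) \<partial>lebesgue"

text \<open>Membership of a product in a space of fractional order is derived from bounds of its dyadic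
differences. A bound at the scale of the step by the low frequencies of \<open>f\<close> is as good as the
difference of \<open>f\<close> itself, and a remainder of higher order in the step is summable.\<close>

lemma Lw_if_difference_bounds:
assumes t: "0 < t" "t < 1" and th: "t < th"
obtains D where "0 <= D" "!!(f :: ('n::finite, 'm::finite) vfun) (u :: ('n, 'm) vfun) M Q. ft f : Lw t ==> u : LL ==> 0 <= M ==> 0 <= Q ==>
 (!!j k. (NINT x. esq (u (x + (1/2)^k *R axis j 1) - u x))
  <= ennreal M * low_energy k (ft f) + ennreal (Q * ((1/4)^k) powr th)) ==>
 ft u : Lw t & (wnorm t (ft u))^2 <= D * ((L2n u)^2 + M * (wnorm t (ft f))^2 + Q)"
proof -
obtain C2 where C2: "0 <= C2" "!!(f :: ('n, 'm) vfun) E. f : LL ==> 0 <= E ==> dyadic_energy t f <= ennreal E ==>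
 ft f : Lw t & (wnorm t (ft f))^2 <= C2 * ((L2n f)^2 + E)" using Lw_if_dyadic_energy_finite[OF t] by blast
obtain C where C: "0 <= C" "!!Y. 1 <= Y ==> (\<Sum>k. ennreal (4 powr (real k * t) * min 1 (Y / 4 ^ k))) <= ennreal (C * Y powr t)"
 using dyadic_sum_le[OF t] by blast
define rho where "rho = 4 powr (t - th)"
have rho: "0 <= rho" "rho < 1" using th by (simp_all add: rho_def powr_less_one)
define n where "n = real CARD('n)"
define N where "N = 1 + n * C + n / (1 - rho)"
have N: "0 <= n" "0 <= N" "1 <= N" "n * C <= N" "n / (1 - rho) <= N" using C(1) rho by (simp_all add: N_def n_def)
show ?thesis
proof (rule that[of "C2 * N"])
 show "0 <= C2 * N" using C2(1) N by simp
 fix f u :: "('n, 'm) vfun" and M Q :: real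
 assume f: "ft f : Lw t" and u: "u : LL" and MQ: "0 <= M" "0 <= Q"
 let ?I = "%k. NINT xi. ennreal (min 1 ((jb xi) / 4 ^ k)) * esq (ft f xi)"
 assume step: "!!j k. (NINT x. esq (u (x + (1/2)^k *R axis j 1) - u x)) <= ennreal M * ?I k + ennreal (Q * ((1/4)^k) powr th)"
 have ffm: "ft f : lmeas" by (rule Lw_measurable[OF f])
 note Ym = min_bracket_measurable
 have fm2: "(%xi. esq (ft f xi)) : lmeas" using ffm by simp
 have geo: "(\<Sum>k. ennreal (4 powr (real k * t)) * ennreal (Q * ((1/4)^k) powr th))
   = ennreal (Q / (1 - rho))"
 proof -
  have "4 powr (real k * t) * (Q * ((1/4)^k) powr th) = Q * rho ^ k" for k
  proof -
   have "((1/4)^k) powr th = (4::real) powr (- (real k * th))"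
    by (simp add: powr_minus powr_realpow[symmetric] powr_powr power_one_over inverse_eq_divide powr_divide)
   moreover have "rho ^ k = 4 powr (real k * t) * 4 powr (- (real k * th))"
    by (simp add: rho_def powr_realpow[symmetric] powr_powr powr_add[symmetric] algebra_simps)
   ultimately show ?thesis by simp
  qed
  note q = this
  have "ennreal (4 powr (real k * t)) * ennreal (Q * ((1/4)^k) powr th) = ennreal (Q * rho ^ k)" for k
  proof -
   have "0 <= Q * ((1/4)^k) powr th" using MQ by simp
   then show ?thesis unfolding q[of k, symmetric] by (intro ennreal_mult[symmetric]) simp
  qed
  then show ?thesis by (simp add: geometric_ennreal[OF rho MQ(2)])
 qed
 have ssum: "(\<Sum>k. ennreal (4 powr (real k * t)) * (ennreal M * low_energy k (ft f)))
  <= ennreal (M * C * (wnorm t (ft f))^2)"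
 proof -
  have mm: "(%xi::real^'n. ennreal (min 1 ((jb xi) / 4 ^ k)) * esq (ft f xi)) : lmeas" for k
   by (rule borel_measurable_times_ennreal[OF Ym fm2])
  have "(\<Sum>k. ennreal (4 powr (real k * t)) * (ennreal M * low_energy k (ft f)))
   = ennreal M * (\<Sum>k. ennreal (4 powr (real k * t)) * low_energy k (ft f))"
   unfolding mult.left_commute[of _ "ennreal M"] by (rule ennreal_suminf_cmult)
  also have "(\<Sum>k. ennreal (4 powr (real k * t)) * low_energy k (ft f))
   = (\<Sum>k. NINT xi. ennreal (4 powr (real k * t)) * (ennreal (min 1 ((jb xi) / 4 ^ k)) * esq (ft f xi)))"
   by (rule suminf_cong) (rule nn_integral_cmult[OF mm, symmetric])
  also have "... = (NINT xi. (\<Sum>k. ennreal (4 powr (real k * t)) * (ennreal (min 1 ((jb xi) / 4 ^ k)) * esq (ft f xi))))"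
   by (rule nn_integral_suminf[symmetric]) (rule borel_measurable_times_ennreal[OF borel_measurable_const mm])
  also have "... <= (NINT xi. ennreal C * esq (wt t (ft f) xi))"
  proof (rule nn_integral_mono)
   fix xi :: "real^'n"
   have "(\<Sum>k. ennreal (4 powr (real k * t)) * (ennreal (min 1 ((jb xi) / 4 ^ k)) * esq (ft f xi)))
    = (\<Sum>k. ennreal (4 powr (real k * t) * min 1 ((jb xi) / 4 ^ k)) * esq (ft f xi))"
    by (simp add: ennreal_mult mult.assoc)
   also have "... = (\<Sum>k. ennreal (4 powr (real k * t) * min 1 ((jb xi) / 4 ^ k))) * esq (ft f xi)"
    by (rule ennreal_suminf_multc)
   also have "... <= ennreal (C * (jb xi) powr t) * esq (ft f xi)"
    by (rule mult_right_mono[OF C(2)[OF bracket_ge_1]]) simp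
   also have "... = ennreal C * esq (wt t (ft f) xi)"
    using C(1) by (simp add: norm_wt_square ennreal_mult mult.assoc)
   finally show "(\<Sum>k. ennreal (4 powr (real k * t)) * (ennreal (min 1 ((jb xi) / 4 ^ k)) * esq (ft f xi)))
    <= ennreal C * esq (wt t (ft f) xi)" .
  qed
  also have "... = ennreal C * ennreal ((wnorm t (ft f))^2)"
   using wt_measurable[OF ffm, of t] by (simp add: nn_integral_cmult Lw_nn_integral[OF f])
  finally show ?thesis using MQ C(1) by (simp add: ennreal_mult mult.assoc mult_left_mono)
 qed
 let ?w = "(wnorm t (ft f))^2"
 have nn: "0 <= M * C * ?w" "0 <= Q / (1 - rho)" using MQ C(1) rho by simp_all
 have "dyadic_energy t u <= (\<Sum>j\<in>(UNIV::'n set). \<Sum>k. ennreal (4 powr (real k * t)) * (ennreal M * ?I k + ennreal (Q * ((1/4)^k) powr th)))"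
  unfolding dyadic_energy_def by (intro sum_mono suminf_le summableI mult_left_mono step) auto
 also have "... = (\<Sum>j\<in>(UNIV::'n set). (\<Sum>k. ennreal (4 powr (real k * t)) * (ennreal M * ?I k)) + (\<Sum>k. ennreal (4 powr (real k * t)) * ennreal (Q * ((1/4)^k) powr th)))"
  by (intro sum.cong refl, subst suminf_add[OF summableI summableI]) (simp only: distrib_left)
 also have "... <= (\<Sum>j\<in>(UNIV::'n set). ennreal (M * C * ?w) + ennreal (Q / (1 - rho)))"
  unfolding geo by (intro sum_mono add_mono ssum order_refl)
 also have "... = ennreal (n * (M * C * ?w + Q / (1 - rho)))"
  unfolding sum_constant ennreal_of_nat_eq_real_of_nat ennreal_plus[OF nn, symmetric] n_def
  by (rule ennreal_mult[symmetric]) (use nn in simp_all)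
 finally have E: "dyadic_energy t u <= ennreal (n * (M * C * ?w + Q / (1 - rho)))" .
 have E0: "0 <= n * (M * C * ?w + Q / (1 - rho))" using MQ C(1) rho N(1) by (intro mult_nonneg_nonneg add_nonneg_nonneg) auto
 note R = C2(2)[OF u E0 E]
 have "(L2n u)^2 + n * (M * C * ?w + Q / (1 - rho)) = 1 * (L2n u)^2 + (n * C) * (M * ?w) + (n / (1 - rho)) * Q"
  by (simp add: algebra_simps)
 also have "... <= N * (L2n u)^2 + N * (M * ?w) + N * Q"
  using MQ by (intro add_mono mult_right_mono N) auto
 finally have "C2 * ((L2n u)^2 + n * (M * C * ?w + Q / (1 - rho))) <= C2 * (N * ((L2n u)^2 + M * ?w + Q))"
  using C2(1) by (intro mult_left_mono) (simp_all add: distrib_left)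
 then show "ft u : Lw t & (wnorm t (ft u))^2 <= C2 * N * ((L2n u)^2 + M * ?w + Q)"
  using R unfolding mult.assoc by (blast intro: order_trans)
qed
qed

text \<open>A coefficient is a multiplier if the products satisfy difference bounds with constants of the
order of the norm of \<open>f\<close>.\<close>

lemma multiplier_if_difference_bounds:
fixes G :: "('n::finite, 'm::finite) mfun"
assumes t: "0 < t" "t < 1" "t < th" and G: "G : Linfty" and MQ: "0 <= M" "0 <= Q"
 and step: "!!(f :: ('n, 'm) vfun) j k. f : LL ==> ft f : Lw t ==>
  (NINT x. esq (G (x + (1/2)^k *R axis j 1) *v f (x + (1/2)^k *R axis j 1) - G x *v f x))
  <= ennreal M * low_energy k (ft f)
   + ennreal (Q * (L2n f)^2 * ((1/4)^k) powr th)"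
shows "multiplier t G"
proof -
obtain D where D: "0 <= D" "!!(f :: ('n, 'm) vfun) (u :: ('n, 'm) vfun) M Q. ft f : Lw t ==> u : LL ==> 0 <= M ==> 0 <= Q ==>
 (!!j k. (NINT x. esq (u (x + (1/2)^k *R axis j 1) - u x))
  <= ennreal M * low_energy k (ft f) + ennreal (Q * ((1/4)^k) powr th)) ==>
 ft u : Lw t & (wnorm t (ft u))^2 <= D * ((L2n u)^2 + M * (wnorm t (ft f))^2 + Q)"
 using Lw_if_difference_bounds[OF t] by blast
obtain C where C: "0 <= C" "!!f :: ('n, 'm) vfun. f : LL ==> (%x. G x *v f x) : LL"
 "!!f :: ('n, 'm) vfun. f : LL ==> L2n (%x. G x *v f x) <= C * L2n f"
 using mult_L2_bound[OF G] by blast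
let ?K = "D * (C^2 + M + Q)"
have K: "0 <= ?K" using D(1) MQ by simp
have "ft (%x. G x *v f x) : Lw t & wnorm t (ft (%x. G x *v f x)) <= sqrt ?K * wnorm t (ft f)"
 if f: "f : LL" "ft f : Lw t" for f :: "('n, 'm) vfun"
proof -
 let ?w = "(wnorm t (ft f))^2"
 have L: "(L2n f)^2 <= ?w"
 proof (rule power_mono)
  have "L2n f = wnorm 0 (ft f)" using L2norm_ft[OF f(1)] by (simp add: Hs_0_L2)
  also have "... <= wnorm t (ft f)" using Lw_mono(2)[OF f(2), of 0] t by simp
  finally show "L2n f <= wnorm t (ft f)" .
 qed simp
 have R: "ft (%x. G x *v f x) : Lw t & (wnorm t (ft (%x. G x *v f x)))^2
   <= D * ((L2n (%x. G x *v f x))^2 + M * ?w + Q * (L2n f)^2)"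
  using MQ by (intro D(2) f C(2) step) auto
 have "(L2n (%x. G x *v f x))^2 <= (C * L2n f)^2" by (intro power_mono C(3) f) simp
 also have "... <= C^2 * ?w" unfolding power_mult_distrib by (intro mult_left_mono L) simp
 finally have "D * ((L2n (%x. G x *v f x))^2 + M * ?w + Q * (L2n f)^2) <= D * (C^2 * ?w + M * ?w + Q * ?w)"
  using MQ D(1) by (intro mult_left_mono add_mono L order_refl) auto
 also have "... = (sqrt ?K * wnorm t (ft f))^2"
  unfolding power_mult_distrib real_sqrt_pow2[OF K] by (simp add: algebra_simps)
 finally have "(wnorm t (ft (%x. G x *v f x)))^2 <= (sqrt ?K * wnorm t (ft f))^2" using R by linarith
 then have "wnorm t (ft (%x. G x *v f x)) <= sqrt ?K * wnorm t (ft f)" by (rule power2_le_imp_le) (simp add: K)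
 then show ?thesis using R by blast
qed
then show ?thesis unfolding multiplier_def using G K by (intro conjI exI[of _ "sqrt ?K"]) auto
qed

text \<open>The difference of a product is split in the usual way. The part in which
the coefficient is differenced is summable over the dyadic scales since its Hoelder exponent
exceeds the order.\<close>

lemma multiplier_Hoelder:
fixes G :: "('n::finite, 'm::finite) mfun"
assumes t: "0 < t" "t < 1" and th: "t < th" and G: "G : Linfty" and H: "0 <= H"
 and hoelder: "!!j k. AE x in lebesgue. norm (G (x + (1/2)^k *R axis j 1) - G x) <= H * ((1/2)^k) powr th"
shows "multiplier t G"
proof -
obtain K where K: "K \<ge> 0" "!!(A :: complex^'m^'m) x. norm (A *v x) <= norm A * norm x * K"
 using bounded_bilinear.nonneg_bounded[OF bilinear_matvec] by blast
obtain B where B: "0 <= B" "AE x in lebesgue. norm (G x) <= B" using Linfty_bound[OF G] .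
define P where "P = 2 * (B * K)^2"
define Q where "Q = 2 * (H * K)^2"
have PQ: "0 <= P" "0 <= Q" by (simp_all add: P_def Q_def)
show ?thesis
proof (rule multiplier_if_difference_bounds[OF t th G, of "P * 4" Q])
 fix f :: "('n, 'm) vfun" and j k assume f: "f : LL" "ft f : Lw t"
 define h :: "real^'n" where h: "h = (1/2)^k *R axis j 1"
 have fm: "f : lmeas" by (rule L2_measurable[OF f(1)])
 have ffm: "(%xi. esq (ft f xi)) : lmeas" using Lw_measurable[OF f(2)] by simp
 have sm: "(%x. f (x + h)) : lmeas" by (rule L2_measurable[OF L2_shift(1)[OF f(1)]])
 have Gh: "AE x in lebesgue. norm (G (x + h)) <= B" using AE_lebesgue_affine[OF B(2), of 1 h] by simp
 have pw: "(((1/2)^k) powr th)^2 = ((1/4)^k) powr th"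
  by (simp add: power2_eq_square powr_mult[symmetric] power_mult_distrib[symmetric])
 have "(NINT x. esq (G (x + h) *v f (x + h) - G x *v f x))
  <= (NINT x. ennreal P * esq (f (x + h) - f x) + ennreal (Q * ((1/4)^k) powr th) * esq (f x))"
 proof (rule nn_integral_mono_AE, use Gh hoelder[of k j] in eventually_elim)
  case (elim x)
  have "G (x + h) *v f (x + h) - G x *v f x = G (x + h) *v (f (x + h) - f x) + (G (x + h) - G x) *v f x"
   by (simp add: bounded_bilinear.diff_right[OF bilinear_matvec] bounded_bilinear.diff_left[OF bilinear_matvec])
  then have "norm (G (x + h) *v f (x + h) - G x *v f x) <= norm (G (x + h) *v (f (x + h) - f x)) + norm ((G (x + h) - G x) *v f x)"
   using norm_triangle_ineq by metis
  also have "... <= B * K * norm (f (x + h) - f x) + H * K * ((1/2)^k) powr th * norm (f x)"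
  proof (intro add_mono)
   have "norm (G (x + h) *v (f (x + h) - f x)) <= norm (G (x + h)) * norm (f (x + h) - f x) * K" by (rule K(2))
   also have "... <= B * norm (f (x + h) - f x) * K" using elim(1) K(1) by (intro mult_right_mono) auto
   finally show "norm (G (x + h) *v (f (x + h) - f x)) <= B * K * norm (f (x + h) - f x)" by (simp only: mult_ac)
   have "norm ((G (x + h) - G x) *v f x) <= norm (G (x + h) - G x) * norm (f x) * K" by (rule K(2))
   also have "... <= (H * ((1/2)^k) powr th) * norm (f x) * K" using elim(2) K(1) unfolding h by (intro mult_right_mono) auto
   finally show "norm ((G (x + h) - G x) *v f x) <= H * K * ((1/2)^k) powr th * norm (f x)" by (simp only: mult_ac)
  qed
  finally have "(norm (G (x + h) *v f (x + h) - G x *v f x))^2 <= (B * K * norm (f (x + h) - f x) + H * K * ((1/2)^k) powr th * norm (f x))^2"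
   by (intro power_mono) auto
  also have "... <= 2 * (B * K * norm (f (x + h) - f x))^2 + 2 * (H * K * ((1/2)^k) powr th * norm (f x))^2" by (rule power2_sum_le)
  also have "... = P * (norm (f (x + h) - f x))^2 + (Q * ((1/4)^k) powr th) * (norm (f x))^2"
   unfolding P_def Q_def pw[symmetric] by (simp only: power_mult_distrib mult_ac)
  finally have "esq (G (x + h) *v f (x + h) - G x *v f x)
    <= ennreal (P * (norm (f (x + h) - f x))^2 + (Q * ((1/4)^k) powr th) * (norm (f x))^2)" by (rule ennreal_leI)
  then show ?case using PQ by (simp add: ennreal_mult ennreal_plus)
 qed
 also have "... = ennreal P * (NINT x. esq (f (x + h) - f x)) + ennreal (Q * ((1/4)^k) powr th) * (NINT x. esq (f x))"
  using fm sm by (simp add: nn_integral_add nn_integral_cmult)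
 also have "(NINT x. esq (f (x + h) - f x))
   = (NINT xi. ennreal ((cmod (cis (h \<bullet> xi) - 1))^2 * (norm (ft f xi))^2))" by (rule ft_difference[OF f(1)])
 also have "ennreal P * ... <= ennreal P * (NINT xi. ennreal 4 * (ennreal (min 1 ((jb xi) / 4 ^ k)) * esq (ft f xi)))"
 proof (intro mult_left_mono nn_integral_mono)
  fix xi :: "real^'n"
  have "(cmod (cis (h \<bullet> xi) - 1))^2 * (norm (ft f xi))^2 <= 4 * min 1 ((jb xi) / 4 ^ k) * (norm (ft f xi))^2"
   unfolding h by (intro mult_right_mono cis_step_bound) simp
  then have "ennreal ((cmod (cis (h \<bullet> xi) - 1))^2 * (norm (ft f xi))^2) <= ennreal (4 * (min 1 ((jb xi) / 4 ^ k) * (norm (ft f xi))^2))"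
   unfolding mult.assoc by (rule ennreal_leI)
  also have "... = ennreal 4 * (ennreal (min 1 ((jb xi) / 4 ^ k)) * esq (ft f xi))"
   by (subst ennreal_mult, simp, simp, subst ennreal_mult) simp_all
  finally show "ennreal ((cmod (cis (h \<bullet> xi) - 1))^2 * (norm (ft f xi))^2) <= ennreal 4 * (ennreal (min 1 ((jb xi) / 4 ^ k)) * esq (ft f xi))" .
 qed simp
 also have "... = ennreal (P * 4) * low_energy k (ft f)"
  unfolding nn_integral_cmult[OF borel_measurable_times_ennreal[OF min_bracket_measurable ffm]] ennreal_mult[OF PQ(1) zero_le_numeral] by (simp only: mult.assoc)
 also have "ennreal (Q * ((1/4)^k) powr th) * (NINT x. esq (f x)) = ennreal (Q * (L2n f)^2 * ((1/4)^k) powr th)"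
  unfolding L2_nn_integral[OF f(1)] using PQ by (simp add: ennreal_mult[symmetric] mult_ac)
 finally show "(NINT x. esq (G (x + (1/2)^k *R axis j 1) *v f (x + (1/2)^k *R axis j 1) - G x *v f x))
  <= ennreal (P * 4) * low_energy k (ft f)
   + ennreal (Q * (L2n f)^2 * ((1/4)^k) powr th)" unfolding h by (simp add: add_right_mono)
qed (use PQ in simp_all)
qed

section \<open>Interpolation of multipliers\<close>

text \<open>At the step $2^{-k}$ the factor \<open>f\<close> is split at the frequency $2^k$. The bound of order 0 is used for
the high frequencies. The bound of order 1 is used for the low ones; there the difference gains a
factor $2^{-k}$.\<close>

lemma multiplier_interpolate:
fixes G :: "('n::finite, 'm::finite) mfun"
assumes t: "0 < t" "t < 1" and m0: "multiplier 0 G" and m1: "multiplier 1 G"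
shows "multiplier t G"
proof -
have G: "G : Linfty" by (rule multiplier_Linfty[OF m0])
obtain C0 where C0: "0 <= C0" "!!f :: ('n, 'm) vfun. f : LL ==> ft f : Lw 0 ==> ft (%x. G x *v f x) : Lw 0"
 "!!f :: ('n, 'm) vfun. f : LL ==> ft f : Lw 0 ==> wnorm 0 (ft (%x. G x *v f x)) <= C0 * wnorm 0 (ft f)"
 using multiplierE[OF m0] by blast
obtain C1 where C1: "0 <= C1" "!!f :: ('n, 'm) vfun. f : LL ==> ft f : Lw 1 ==> ft (%x. G x *v f x) : Lw 1"
 "!!f :: ('n, 'm) vfun. f : LL ==> ft f : Lw 1 ==> wnorm 1 (ft (%x. G x *v f x)) <= C1 * wnorm 1 (ft f)"
 using multiplierE[OF m1] by blast
\<comment> \<open>The factor 8 is 2 from the square of a sum of two terms, times 4 from the symbol of the difference.\<close>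
define M where "M = 8 * C0^2 + 8 * C1^2"
have M: "0 <= M" by (simp add: M_def)
show ?thesis
proof (rule multiplier_if_difference_bounds[OF t(1,2) less_add_one G M order_refl])
 fix f :: "('n, 'm) vfun" and j k assume f: "f : LL" "ft f : Lw t"
 define h :: "real^'n" where h: "h = (1/2)^k *R axis j 1"
 have ffm: "ft f : lmeas" by (rule Lw_measurable[OF f(2)])
 have ff0: "ft f : Lw 0" using ft(1)[OF f(1)] by (simp add: Hs_0_L2)
 have Gf: "(%x. G x *v f x) : LL" by (rule mult_L2[OF G f(1)])
 note Ym = min_bracket_measurable
 have fm2: "(%xi. esq (ft f xi)) : lmeas" using ffm by simp
 have key: "(NINT x. esq (G (x + h) *v f (x + h) - G x *v f x))
   <= ennreal M * low_energy k (ft f)"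
 proof -
  have c8: "0 <= (8::real)" "0 <= 8 / (4::real) ^ k" by simp_all
  have ec: "ennreal (a * x + b * y) = ennreal a * ennreal x + ennreal b * ennreal y" if "0 <= a" "0 <= b" "0 <= x" "0 <= y" for a b x y :: real
   using that by (simp add: ennreal_mult)
  have em: "ennreal a * ennreal (x * y) = ennreal (a * x) * ennreal y" if "0 <= a" "0 <= x" "0 <= y" for a x y :: real
   using that by (simp add: ennreal_mult mult.assoc)
  \<comment> \<open>The low frequencies: $(1 + |\xi|^2)^{1/2} \<le> 2^k$.\<close>
  define A where "A = {xi :: real^'n. 1 + (norm xi)^2 <= 4 ^ k}"
  have Am: "A : sets lebesgue"
  proof -
   have "closed A" unfolding A_def by (intro closed_Collect_le continuous_intros)
   then show ?thesis by (intro sets_completionI_sets) auto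
  qed
  have im: "(%xi. indicat_real A xi *R ft f xi) : lmeas"
   using Am ffm by (intro borel_measurable_scaleR borel_measurable_indicator)
  have lo1: "(%xi. indicat_real A xi *R ft f xi) : Lw 1"
  proof (rule Lw_bound(1)[OF ff0 im, where C="2 ^ k"], rule AE_I2)
   fix xi :: "real^'n"
   show "(jb xi) powr (1/2) * norm (indicat_real A xi *R ft f xi) <= 2 ^ k * ((jb xi) powr (0/2) * norm (ft f xi))"
   proof (cases "xi : A")
    case True
    have "(jb xi) powr (1/2) = sqrt (jb xi)"
     using bracket_pos[of xi] by (simp add: powr_half_sqrt)
    also have "... <= sqrt (4 ^ k)" using True unfolding A_def by simp
    also have "... = 2 ^ k" by (simp add: real_sqrt_power)
    finally have "(jb xi) powr (1/2) * norm (ft f xi) <= 2 ^ k * norm (ft f xi)" by (intro mult_right_mono) auto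
    then show ?thesis using True bracket_nonzero[of xi] by simp
   qed simp
  qed simp
  have lo0: "(%xi. indicat_real A xi *R ft f xi) : LL" using Lw_mono(1)[OF lo1, of 0] by (simp add: Hs_0_L2)
  have "\<exists>lo. lo : LL & (AE xi in lebesgue. ft lo xi = indicat_real A xi *R ft f xi)"
   by (rule L2_ex_ft[OF lo0]) (intro exI conjI)
  then obtain lo where lo: "lo : LL" "AE xi in lebesgue. ft lo xi = indicat_real A xi *R ft f xi"
   by blast
  have lom: "ft lo : lmeas" by (rule L2_measurable[OF ft(1)[OF lo(1)]])
  have flo1: "ft lo : Lw 1" using lo(2) by (intro Lw_cong_AE[OF lo1 lom]) (auto elim: AE_mp)
  define hi where "hi = (%x. f x - lo x)"
  have hi: "hi : LL" unfolding hi_def by (intro L2_diff f lo)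
  have him: "ft hi : lmeas" by (rule L2_measurable[OF ft(1)[OF hi]])
  have fhi0: "ft hi : Lw 0" using ft(1)[OF hi] by (simp add: Hs_0_L2)
  have hi2: "AE xi in lebesgue. ft hi xi = ft f xi - ft lo xi" unfolding hi_def by (rule ft_diff[OF f(1) lo(1)])
  have Glo: "(%x. G x *v lo x) : LL" "(%x. G x *v hi x) : LL" by (intro mult_L2 G lo hi)+
  have sum: "(%x. G x *v hi x + G x *v lo x) = (%x. G x *v f x)"
   by (simp add: hi_def bounded_bilinear.diff_right[OF bilinear_matvec])
  have fsum: "AE xi in lebesgue. ft (%x. G x *v f x) xi = ft (%x. G x *v hi x) xi + ft (%x. G x *v lo x) xi"
   using ft_add[OF Glo(2,1)] unfolding sum .
  have hm: "(%xi. esq (ft (%x. G x *v hi x) xi)) : lmeas"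
   using L2_measurable[OF ft(1)[OF Glo(2)]] by simp
  have lm: "(%xi. esq (wt 1 (ft (%x. G x *v lo x)) xi)) : lmeas"
   using wt_measurable[OF L2_measurable[OF ft(1)[OF Glo(1)]], of 1] by simp
  have "(NINT x. esq (G (x + h) *v f (x + h) - G x *v f x))
   = (NINT xi. ennreal ((cmod (cis (h \<bullet> xi) - 1))^2 * (norm (ft (%x. G x *v f x) xi))^2))"
   by (rule ft_difference[OF Gf])
  also have "... <= (NINT xi. ennreal 8 * esq (ft (%x. G x *v hi x) xi)
    + ennreal (8 / 4 ^ k) * esq (wt 1 (ft (%x. G x *v lo x)) xi))"
  proof (rule nn_integral_mono_AE, use fsum in eventually_elim)
   case (elim xi)
   let ?a = "norm (ft (%x. G x *v hi x) xi)" and ?b = "norm (ft (%x. G x *v lo x) xi)"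
   have c1: "(cmod (cis (h \<bullet> xi) - 1))^2 <= 4" and c2: "(cmod (cis (h \<bullet> xi) - 1))^2 <= 4 * ((jb xi) / 4 ^ k)"
    using cis_step_bound[of k j xi, folded h] min.cobounded1[of 1 "(jb xi) / 4 ^ k"]
     min.cobounded2[of 1 "(jb xi) / 4 ^ k"] by linarith+
   have "(norm (ft (%x. G x *v f x) xi))^2 <= (?a + ?b)^2"
    unfolding elim by (intro power_mono norm_triangle_ineq) simp
   also have "... <= 2 * ?a^2 + 2 * ?b^2" by (rule power2_sum_le)
   finally have "(cmod (cis (h \<bullet> xi) - 1))^2 * (norm (ft (%x. G x *v f x) xi))^2
    <= (cmod (cis (h \<bullet> xi) - 1))^2 * (2 * ?a^2 + 2 * ?b^2)" by (intro mult_left_mono) auto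
   also have "... = (cmod (cis (h \<bullet> xi) - 1))^2 * (2 * ?a^2) + (cmod (cis (h \<bullet> xi) - 1))^2 * (2 * ?b^2)" by (rule distrib_left)
   also have "... <= 4 * (2 * ?a^2) + (4 * ((jb xi) / 4 ^ k)) * (2 * ?b^2)"
    by (intro add_mono mult_right_mono c1 c2) auto
   also have "... = 8 * ?a^2 + (8 / 4 ^ k) * (norm (wt 1 (ft (%x. G x *v lo x)) xi))^2"
    using bracket_pos[of xi] by (simp add: norm_wt_square)
   finally have "ennreal ((cmod (cis (h \<bullet> xi) - 1))^2 * (norm (ft (%x. G x *v f x) xi))^2)
    <= ennreal (8 * ?a^2 + (8 / 4 ^ k) * (norm (wt 1 (ft (%x. G x *v lo x)) xi))^2)" by (rule ennreal_leI)
   then show ?case unfolding ec[OF c8 zero_le_power2 zero_le_power2] .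
  qed
  also have "... = ennreal 8 * (NINT xi. esq (ft (%x. G x *v hi x) xi))
    + ennreal (8 / 4 ^ k) * (NINT xi. esq (wt 1 (ft (%x. G x *v lo x)) xi))"
   using hm lm by (simp add: nn_integral_add nn_integral_cmult)
  also have "... = ennreal 8 * ennreal ((wnorm 0 (ft (%x. G x *v hi x)))^2) + ennreal (8 / 4 ^ k) * ennreal ((wnorm 1 (ft (%x. G x *v lo x)))^2)"
   unfolding Lw_nn_integral[OF C1(2)[OF lo(1) flo1]] L2_nn_integral[OF ft(1)[OF Glo(2)]] by (simp add: Hs_0_L2)
  also have "... <= ennreal 8 * ennreal ((C0 * wnorm 0 (ft hi))^2) + ennreal (8 / 4 ^ k) * ennreal ((C1 * wnorm 1 (ft lo))^2)"
   by (intro add_mono mult_left_mono ennreal_leI power_mono C0(3)[OF hi fhi0] C1(3)[OF lo(1) flo1]) auto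
  also have "... = ennreal (8 * C0^2) * ennreal ((wnorm 0 (ft hi))^2) + ennreal (8 * C1^2 / 4 ^ k) * ennreal ((wnorm 1 (ft lo))^2)"
   unfolding power_mult_distrib em[OF c8(1) zero_le_power2 zero_le_power2] em[OF c8(2) zero_le_power2 zero_le_power2] by (simp only: times_divide_eq_left)
  also have "... = ennreal (8 * C0^2) * (NINT xi. esq (ft hi xi)) + ennreal (8 * C1^2 / 4 ^ k) * (NINT xi. esq (wt 1 (ft lo) xi))"
   unfolding Lw_nn_integral[OF flo1] L2_nn_integral[OF ft(1)[OF hi]] by (simp add: Hs_0_L2)
  also have "... = (NINT xi. ennreal (8 * C0^2) * esq (ft hi xi) + ennreal (8 * C1^2 / 4 ^ k) * esq (wt 1 (ft lo) xi))"
   using him wt_measurable[OF lom, of 1] by (simp add: nn_integral_add nn_integral_cmult)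
  also have "... <= (NINT xi. ennreal M * (ennreal (min 1 ((jb xi) / 4 ^ k)) * esq (ft f xi)))"
  proof (rule nn_integral_mono_AE, use lo(2) hi2 in eventually_elim)
   case (elim xi)
   have "8 * C0^2 * (norm (ft hi xi))^2 + 8 * C1^2 / 4 ^ k * (norm (wt 1 (ft lo) xi))^2
    <= M * (min 1 ((jb xi) / 4 ^ k) * (norm (ft f xi))^2)"
   proof (cases "xi : A")
    case True
    have e: "ft lo xi = ft f xi" "ft hi xi = 0" using elim True by simp_all
    have m: "min 1 ((jb xi) / 4 ^ k) = (jb xi) / 4 ^ k" using True by (simp add: A_def min_def field_simps)
    have "8 * C1^2 * ((jb xi) / 4 ^ k * (norm (ft f xi))^2) <= M * ((jb xi) / 4 ^ k * (norm (ft f xi))^2)"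
     by (intro mult_right_mono) (auto simp: M_def)
    then show ?thesis using bracket_pos[of xi] by (simp add: norm_wt_square e m)
   next
    case False
    have e: "ft lo xi = 0" "ft hi xi = ft f xi" using elim False by simp_all
    have m: "min 1 ((jb xi) / 4 ^ k) = 1" using False by (simp add: A_def min_def field_simps)
    have "8 * C0^2 * (norm (ft f xi))^2 <= M * (norm (ft f xi))^2"
     by (intro mult_right_mono) (auto simp: M_def)
    then show ?thesis by (simp add: norm_wt_square e m)
   qed
   then have "ennreal (8 * C0^2 * (norm (ft hi xi))^2 + 8 * C1^2 / 4 ^ k * (norm (wt 1 (ft lo) xi))^2)
    <= ennreal (M * (min 1 ((jb xi) / 4 ^ k) * (norm (ft f xi))^2))" by (rule ennreal_leI)
   moreover have "0 <= min 1 ((jb xi) / 4 ^ k)" by simp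
   ultimately show ?case using M
    by (subst (asm) ennreal_plus, simp, simp) (simp only: ennreal_mult mult_nonneg_nonneg zero_le_power2 zero_le_divide_iff zero_le_numeral zero_le_power simp_thms)
  qed
  also have "... = ennreal M * low_energy k (ft f)"
   by (rule nn_integral_cmult[OF borel_measurable_times_ennreal[OF Ym fm2]])
  finally show ?thesis .
 qed
 from key show "(NINT x. esq (G (x + (1/2)^k *R axis j 1) *v f (x + (1/2)^k *R axis j 1) - G x *v f x))
  <= ennreal M * low_energy k (ft f)
   + ennreal (0 * (L2n f)^2 * ((1/4)^k) powr (t + 1))" unfolding h by simp
qed
qed

section \<open>Weak derivatives and the product rule\<close>

lemma schwartz_slow_smooth: "phi : schwartz ==> phi : slow_smooth"
proof (rule slow_smooth_coinduct[of phi schwartz])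
show "slow g" if g: "g : schwartz" for g :: "real^'a => 'b"
proof -
 obtain C where C: "!!x. norm (g x) <= C * inverse ((1 + norm x) ^ 0)" using rapid_bound[OF schwartz_rapid[OF g]] by metis
 then show ?thesis by (intro slow_bounded[of _ C]) simp
qed
qed (simp_all add: smooth_differentiable schwartz_smooth schwartz_partial)

lemma schwartz_bounded:
assumes "phi : schwartz" obtains C where "0 <= C" "!!x. norm (phi x) <= C"
proof -
obtain C where C: "0 <= C" "!!x. norm (phi x) <= C * inverse ((1 + norm x) ^ 0)" using rapid_bound[OF schwartz_rapid[OF assms]] by metis
then show ?thesis using that[of C] by simp
qed

lemma schwartz_Linfty_integrable:
fixes phi :: "real^'n => real" and G :: "real^'n => 'a::euclidean_space"
assumes phi: "phi : schwartz" and G: "G : Linfty"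
shows "integrable lebesgue (%x. phi x *R G x)"
proof -
obtain B where B: "0 <= B" "AE x in lebesgue. norm (G x) <= B" using Linfty_bound[OF G] .
show ?thesis
proof (rule Bochner_Integration.integrable_bound)
 show "integrable lebesgue (%x. B *R phi x)" by (intro integrable_scaleR_right schwartz_integrable phi)
 show "(%x. phi x *R G x) : lmeas"
  by (intro borel_measurable_scaleR schwartz_measurable phi Linfty_measurable G)
 show "AE x in lebesgue. norm (phi x *R G x) <= norm (B *R phi x)"
  using B(2)
 proof eventually_elim
  case (elim x)
  then show ?case using B(1) mult_right_mono[OF elim abs_ge_zero[of "phi x"]] by (simp add: abs_mult mult.commute)
 qed
qed
qed

text \<open>By dilated cut-off functions, a weak derivative may be tested against Schwartz functions.\<close>

lemma weak_partial_schwartz: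
fixes th :: "real^'n => real" and G h :: "real^'n => 'a::euclidean_space"
assumes G: "G : Linfty" and h: "h : Linfty" and w: "weak_partials [j] G h" and th: "th : schwartz"
shows "(INTG x. partial j th x *R G x) = - (INTG x. th x *R h x)"
proof -
define om :: "real^'n => real" where "om = box_bump 1 (- 1) 1"
have om: "om : test_functions UNIV" unfolding om_def by (rule box_bump_test) simp
have omS: "om : schwartz" using om test_functions_subset_schwartz by blast
have om1: "0 <= om x" "om x <= 1" for x unfolding om_def by (rule box_bump_bounds)+
have om0: "om 0 > 0" unfolding om_def by (subst box_bump_pos) (auto simp: mem_box_cart)
obtain D where D: "0 <= D" "!!x. norm (partial j om x) <= D" using schwartz_bounded[OF schwartz_partial[OF omS]] by metis
define r where "r k = inverse (real (Suc k))" for k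
have r: "r k > 0" "r k <= 1" for k by (simp_all add: r_def field_simps)
have r0: "r ---> 0" unfolding r_def by (rule LIMSEQ_inverse_real_of_nat)
define q where "q k x = om (r k *R x) * th x" for k x
have omr: "(%x. om (r k *R x)) : test_functions UNIV" for k
proof -
 obtain K where K: "compact K" "{x. om x ~= 0} \<subseteq> K" using test_functions_support[OF om] by metis
 show ?thesis
 proof (rule test_functions_supportI)
  show "smooth (%x. om (r k *R x))" using smooth_affine[OF test_functions_smooth[OF om], of "r k" 0] by simp
  show "compact ((%x. inverse (r k) *R x) ` K)" using K(1) by (rule compact_scaling)
  show "{x. om (r k *R x) ~= 0} \<subseteq> (%x. inverse (r k) *R x) ` K"
  proof
   fix x assume "x : {x. om (r k *R x) ~= 0}"
   then have "r k *R x : K" using K(2) by auto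
   then have "inverse (r k) *R (r k *R x) : (%x. inverse (r k) *R x) ` K" by (rule imageI)
   then show "x : (%x. inverse (r k) *R x) ` K" using r(1)[of k] by simp
  qed
 qed simp
qed
have q: "q k : test_functions UNIV" for k
proof -
 have "(%x. th x * om (r k *R x)) : test_functions UNIV"
  by (rule test_functions_bilinear[OF bounded_bilinear_mult schwartz_smooth[OF th] omr])
 then show ?thesis unfolding q_def by (simp add: mult.commute)
qed
have pq: "partial j (q k) x = om (r k *R x) * partial j th x + r k * partial j om (r k *R x) * th x" for k x
proof -
 have "partial j (q k) = (%x. om (r k *R x) * partial j th x + partial j (%x. om (r k *R x)) x * th x)"
  unfolding q_def by (rule partial_bilinear[OF bounded_bilinear_mult])
   (intro smooth_differentiable test_functions_smooth[OF omr] schwartz_smooth th)+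
 moreover have "partial j (%x. om (r k *R x)) = (%x. r k *R partial j om (r k *R x))"
  using partial_affine[of om j "r k" 0] smooth_differentiable[OF test_functions_smooth[OF om]] by simp
 ultimately show ?thesis by simp
qed
have omlim: "(%k. om (r k *R x)) ---> om 0" for x
proof -
 have "isCont om 0" using smooth_continuous_on[OF test_functions_smooth[OF om], of UNIV] by (simp add: continuous_on_eq_continuous_at)
 moreover have "(%k. r k *R x) ---> 0" using tendsto_scaleR[OF r0 tendsto_const[of x]] by simp
 ultimately show ?thesis by (rule isCont_tendsto_compose)
qed
obtain B where B: "0 <= B" "AE x in lebesgue. norm (G x) <= B" using Linfty_bound[OF G] .
obtain B' where B': "0 <= B'" "AE x in lebesgue. norm (h x) <= B'" using Linfty_bound[OF h] .
have L: "(%k. INTG x. partial j (q k) x *R G x) ---> (INTG x. (om 0 * partial j th x) *R G x)"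
proof (rule integral_dominated_convergence)
 show "(%x. (om 0 * partial j th x) *R G x) : lmeas"
  by (intro borel_measurable_scaleR borel_measurable_times borel_measurable_const schwartz_measurable schwartz_partial th Linfty_measurable G)
 show "(%x. partial j (q k) x *R G x) : lmeas" for k
  by (intro borel_measurable_scaleR smooth_measurable smooth_partial test_functions_smooth[OF q] Linfty_measurable G)
 show "integrable lebesgue (%x. B * (norm (partial j th x) + D * norm (th x)))"
  by (intro integrable_mult_right Bochner_Integration.integrable_add integrable_norm schwartz_integrable schwartz_partial th)
 show "AE x in lebesgue. (%k. partial j (q k) x *R G x) ---> (om 0 * partial j th x) *R G x"
 proof (rule AE_I2)
  fix x
  have l: "(%k. r k * D) ---> 0" using tendsto_mult[OF r0 tendsto_const[of D]] by simp
  have b: "norm (r k * partial j om (r k *R x)) <= r k * D" for k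
   unfolding norm_mult using D(2)[of "r k *R x"] r(1)[of k] by (intro mult_mono) auto
  have "(%k. r k * partial j om (r k *R x)) ---> 0" by (rule Lim_null_comparison[OF always_eventually[OF allI[OF b]] l])
  then have "(%k. om (r k *R x) * partial j th x + r k * partial j om (r k *R x) * th x) ---> om 0 * partial j th x + 0 * th x"
   by (intro tendsto_intros omlim)
  then have "(%k. partial j (q k) x) ---> om 0 * partial j th x" unfolding pq by simp
  then show "(%k. partial j (q k) x *R G x) ---> (om 0 * partial j th x) *R G x" by (intro tendsto_intros)
 qed
 show "AE x in lebesgue. norm (partial j (q k) x *R G x) <= B * (norm (partial j th x) + D * norm (th x))" for k
  using B(2)
 proof eventually_elim
  case (elim x)
  have "norm (partial j (q k) x) <= norm (om (r k *R x) * partial j th x) + norm (r k * partial j om (r k *R x) * th x)"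
   unfolding pq by (rule norm_triangle_ineq)
  also have "... <= 1 * norm (partial j th x) + 1 * D * norm (th x)"
   unfolding norm_mult using om1[of "r k *R x"] r[of k] D
   by (intro add_mono mult_mono mult_nonneg_nonneg) auto
  finally have "norm (partial j (q k) x) <= norm (partial j th x) + D * norm (th x)" by simp
  then have "norm (partial j (q k) x) * norm (G x) <= (norm (partial j th x) + D * norm (th x)) * B"
   using elim D(1) by (intro mult_mono) auto
  then show ?case by (simp add: mult.commute)
 qed
qed
have R: "(%k. INTG x. q k x *R h x) ---> (INTG x. (om 0 * th x) *R h x)"
proof (rule integral_dominated_convergence)
 show "(%x. (om 0 * th x) *R h x) : lmeas"
  by (intro borel_measurable_scaleR borel_measurable_times borel_measurable_const schwartz_measurable th Linfty_measurable h)
 show "(%x. q k x *R h x) : lmeas" for k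
  by (intro borel_measurable_scaleR smooth_measurable test_functions_smooth[OF q] Linfty_measurable h)
 show "integrable lebesgue (%x. B' * norm (th x))"
  by (intro integrable_mult_right integrable_norm schwartz_integrable th)
 show "AE x in lebesgue. (%k. q k x *R h x) ---> (om 0 * th x) *R h x"
  unfolding q_def by (intro AE_I2 tendsto_intros omlim)
 show "AE x in lebesgue. norm (q k x *R h x) <= B' * norm (th x)" for k
  using B'(2)
 proof eventually_elim
  case (elim x)
  have "norm (q k x) <= 1 * norm (th x)" unfolding q_def norm_mult using om1[of "r k *R x"] by (intro mult_right_mono) auto
  then have "norm (q k x) * norm (h x) <= norm (th x) * B'" using elim by (intro mult_mono) auto
  then show ?case by (simp add: mult.commute)
 qed
qed
have "(INTG x. partial j (q k) x *R G x) = - (INTG x. q k x *R h x)" for k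
 using w q[of k] unfolding weak_partials_def by simp
then have "(INTG x. (om 0 * partial j th x) *R G x) = - (INTG x. (om 0 * th x) *R h x)"
 using LIMSEQ_unique[OF L] tendsto_minus[OF R] by simp
then have "om 0 *R (INTG x. partial j th x *R G x) = om 0 *R (- (INTG x. th x *R h x))"
 by (simp only: scaleR_scaleR[symmetric] integral_scaleR_right scaleR_minus_right)
then show ?thesis by (rule scaleR_left_imp_eq[rotated]) (use om0 in simp)
qed

lemma bounded_linear_matrix_form: "bounded_linear (%A :: complex^'m^'m. cdot (A *v u) w)"
using bounded_linear_compose[OF bounded_bilinear.bounded_linear_left[OF bilinear_cdot]
 bounded_bilinear.bounded_linear_left[OF bilinear_matvec]] .

text \<open>Reduces an identity for products with matrices to the real test functions by which weak derivatives
are defined.\<close>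

lemma matrix_form_expansion:
fixes A :: "complex^'m^'m"
shows "cdot (A *v u) w = (\<Sum>b\<in>Basis. \<Sum>c\<in>Basis. ((u \<bullet> b) * (w \<bullet> c)) *R cdot (A *v b) c)"
proof -
have 1: "cdot (A *v u) w = (\<Sum>b\<in>Basis. (u \<bullet> b) *R cdot (A *v b) w)" for w
proof -
 have l: "linear (%u. cdot (A *v u) w)"
  by (intro bounded_linear.linear bounded_linear_compose[OF bounded_bilinear.bounded_linear_left[OF bilinear_cdot]]
   bounded_bilinear.bounded_linear_right[OF bilinear_matvec])
 have "cdot (A *v u) w = cdot (A *v (\<Sum>b\<in>Basis. (u \<bullet> b) *R b)) w" by (simp only: euclidean_representation)
 also have "... = (\<Sum>b\<in>Basis. (u \<bullet> b) *R cdot (A *v b) w)" by (simp only: linear_sum[OF l] linear_scale[OF l])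
 finally show ?thesis .
qed
have 2: "cdot z w = (\<Sum>c\<in>Basis. (w \<bullet> c) *R cdot z c)" for z :: "complex^'m"
proof -
 have l: "linear (cdot z)" by (intro bounded_linear.linear bounded_bilinear.bounded_linear_right[OF bilinear_cdot])
 have "cdot z w = cdot z (\<Sum>c\<in>Basis. (w \<bullet> c) *R c)" by (simp only: euclidean_representation)
 also have "... = (\<Sum>c\<in>Basis. (w \<bullet> c) *R cdot z c)" by (simp only: linear_sum[OF l] linear_scale[OF l])
 finally show ?thesis .
qed
show ?thesis by (subst 1) (simp only: 2 scaleR_sum_right scaleR_scaleR)
qed

text \<open>In coordinates the two factors multiply to one scalar Schwartz function, which is a test function for the weak derivative of \<open>G\<close>.\<close>

lemma product_rule_schwartz:
fixes phi psi :: "('n::finite, 'm::finite) vfun" and G h :: "('n, 'm) mfun"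
assumes G: "G : Linfty" and h: "h : Linfty" and w: "weak_partials [j] G h" and phi: "phi : schwartz" and psi: "psi : schwartz"
shows "(INTG x. cdot (G x *v phi x) (partial j psi x))
 = - (INTG x. cdot (h x *v phi x + G x *v partial j phi x) (psi x))"
proof -
define th where "th b c x = (phi x \<bullet> b) * (psi x \<bullet> c)" for b c x
have co: "(%x. f x \<bullet> b) : schwartz" if "f : schwartz" for f :: "('n, 'm) vfun" and b
 by (rule schwartz_linear_image[OF bounded_linear_inner_left that])
have pc: "partial j (%x. f x \<bullet> b) = (%x. partial j f x \<bullet> b)" if "f : schwartz" for f :: "('n, 'm) vfun" and b
 by (intro partial_linear_image[OF bounded_linear_inner_left] smooth_differentiable schwartz_smooth that)
have th: "th b c : schwartz" for b c
 unfolding th_def by (intro schwartz_bilinear[OF bounded_bilinear_mult] schwartz_slow_smooth co phi psi)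
have pth: "partial j (th b c) x = (phi x \<bullet> b) * (partial j psi x \<bullet> c) + (partial j phi x \<bullet> b) * (psi x \<bullet> c)" for b c x
proof -
 have "partial j (th b c) = (%x. (phi x \<bullet> b) * partial j (%x. psi x \<bullet> c) x + partial j (%x. phi x \<bullet> b) x * (psi x \<bullet> c))"
  unfolding th_def by (rule partial_bilinear[OF bounded_bilinear_mult]) (intro smooth_differentiable schwartz_smooth co phi psi)+
 then show ?thesis by (simp add: pc phi psi)
qed
have int: "integrable lebesgue (%x. t x *R cdot (H x *v b) c)"
  "(INTG x. t x *R cdot (H x *v b) c) = cdot ((INTG x. t x *R H x) *v b) c"
 if "t : schwartz" "H : Linfty" for t :: "real^'n => real" and H :: "('n, 'm) mfun" and b c
proof -
 note i = schwartz_Linfty_integrable[OF that]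
 have e: "t x *R cdot (H x *v b) c = cdot ((t x *R H x) *v b) c" for x
  using linear_scale[OF bounded_linear.linear[OF bounded_linear_matrix_form[of b c]]] by metis
 show "integrable lebesgue (%x. t x *R cdot (H x *v b) c)"
  unfolding e by (rule integrable_bounded_linear[OF bounded_linear_matrix_form i])
 show "(INTG x. t x *R cdot (H x *v b) c) = cdot ((INTG x. t x *R H x) *v b) c"
  unfolding e by (rule integral_bounded_linear'[OF bounded_linear_matrix_form i])
qed
have L2i: "integrable lebesgue (%x. cdot (H x *v f x) (g x))" if "H : Linfty" "f : schwartz" "g : schwartz" for H :: "('n, 'm) mfun" and f g
 by (intro L2_cdot(1) mult_L2 schwartz_L2 that)
note i1 = L2i[OF G phi schwartz_partial[OF psi, of j]] and i2 = L2i[OF G schwartz_partial[OF phi, of j] psi] and i3 = L2i[OF h phi psi]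
have "(INTG x. cdot (G x *v phi x) (partial j psi x)) + (INTG x. cdot (G x *v partial j phi x) (psi x))
 = (INTG x. cdot (G x *v phi x) (partial j psi x) + cdot (G x *v partial j phi x) (psi x))"
 by (rule Bochner_Integration.integral_add[OF i1 i2, symmetric])
also have "... = (INTG x. (\<Sum>b\<in>Basis. \<Sum>c\<in>Basis. partial j (th b c) x *R cdot (G x *v b) c))"
 unfolding matrix_form_expansion[of "G _" "phi _"] matrix_form_expansion[of "G _" "partial j phi _"] pth
 by (simp only: sum.distrib[symmetric] scaleR_add_left)
also have "... = (\<Sum>b\<in>Basis. \<Sum>c\<in>Basis. cdot ((INTG x. partial j (th b c) x *R G x) *v b) c)"
 by (simp add: Bochner_Integration.integral_sum Bochner_Integration.integrable_sum int[OF schwartz_partial[OF th] G])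
also have "... = - (\<Sum>b\<in>Basis. \<Sum>c\<in>Basis. cdot ((INTG x. th b c x *R h x) *v b) c)"
 unfolding weak_partial_schwartz[OF G h w th] sum_negf[symmetric]
 using linear_neg[OF bounded_linear.linear[OF bounded_linear_matrix_form]] by (intro sum.cong refl) blast
also have "(\<Sum>b\<in>Basis. \<Sum>c\<in>Basis. cdot ((INTG x. th b c x *R h x) *v b) c)
  = (INTG x. (\<Sum>b\<in>Basis. \<Sum>c\<in>Basis. th b c x *R cdot (h x *v b) c))"
 by (simp add: Bochner_Integration.integral_sum Bochner_Integration.integrable_sum int[OF th h])
also have "... = (INTG x. cdot (h x *v phi x) (psi x))"
 unfolding matrix_form_expansion[of "h _" "phi _"] th_def ..
finally have e: "(INTG x. cdot (G x *v phi x) (partial j psi x)) + (INTG x. cdot (G x *v partial j phi x) (psi x))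
 = - (INTG x. cdot (h x *v phi x) (psi x))" .
have s: "(INTG x. cdot (h x *v phi x + G x *v partial j phi x) (psi x))
  = (INTG x. cdot (h x *v phi x) (psi x)) + (INTG x. cdot (G x *v partial j phi x) (psi x))"
 unfolding bounded_bilinear.add_left[OF bilinear_cdot] by (rule Bochner_Integration.integral_add[OF i3 i2])
show ?thesis unfolding s minus_add_distrib diff_conv_add_uminus[symmetric] eq_diff_eq by (rule e)
qed

lemma ft_schwartz: "phi : schwartz ==> AE xi in lebesgue. ft phi xi = fourier phi xi" for phi :: "('n::finite, 'm::finite) vfun"
by (rule ft_unique[OF schwartz_L2 schwartz_Lw[OF fourier_schwartz] regular_dist_Schwartz])

lemma coord_smult_bound: "norm ((dsym j xi) *s v) <= (jb xi) powr (1/2) * norm v" for v :: "complex^'m" and xi :: "real^'n"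
proof -
have "\<bar>xi $ j\<bar> = sqrt ((xi $ j)^2)" by simp
also have "... <= sqrt (jb xi)" using component_sq_le[of xi j] by (intro real_sqrt_le_mono) simp
also have "... = (jb xi) powr (1/2)" using bracket_pos[of xi] by (simp add: powr_half_sqrt)
finally show ?thesis by (simp add: norm_vector_smult norm_mult mult_right_mono)
qed

lemma coord_smult_measurable:
fixes g :: "('n::finite, 'm::finite) vfun"
assumes "g : lmeas"
shows "(%xi. (dsym j xi) *s g xi) : lmeas"
by (intro bilinear_measurable[OF bilinear_smult] assms continuous_measurable_lebesgue continuous_intros)

lemma Lw_coord:
fixes g :: "('n::finite, 'm::finite) vfun"
assumes g: "g : Lw t"
shows "(%xi. (dsym j xi) *s g xi) : Lw (t - 1)" "wnorm (t - 1) (%xi. (dsym j xi) *s g xi) <= wnorm t g"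
proof -
have "(jb xi) powr ((t - 1) / 2) * norm ((dsym j xi) *s g xi)
  <= 1 * ((jb xi) powr (t / 2) * norm (g xi))" for xi
proof -
 have "(jb xi) powr ((t - 1) / 2) * norm ((dsym j xi) *s g xi)
  <= (jb xi) powr ((t - 1) / 2) * ((jb xi) powr (1/2) * norm (g xi))"
  by (intro mult_left_mono coord_smult_bound) simp
 also have "... = (jb xi) powr ((t - 1) / 2 + 1/2) * norm (g xi)" by (simp only: powr_add mult.assoc)
 also have "(t - 1) / 2 + 1/2 = t / 2" by (simp add: field_simps)
 finally show ?thesis by simp
qed
from Lw_bound[OF g coord_smult_measurable[OF Lw_measurable[OF g]] AE_I2[OF this] zero_le_one]
show "(%xi. (dsym j xi) *s g xi) : Lw (t - 1)" "wnorm (t - 1) (%xi. (dsym j xi) *s g xi) <= wnorm t g"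
 by simp_all
qed

text \<open>The weight of order $t$ is the weight of order $t - 1$ times $1 + \sum_j \xi_j^2$.\<close>

lemma Lw_step:
fixes g :: "('n::finite, 'm::finite) vfun"
assumes g: "g : Lw (t - 1)" and gj: "!!j. (%xi. (dsym j xi) *s g xi) : Lw (t - 1)"
shows "g : Lw t" "wnorm t g <= wnorm (t - 1) g + (\<Sum>j\<in>UNIV. wnorm (t - 1) (%xi. (dsym j xi) *s g xi))"
proof -
have e: "(norm (wt t g xi))^2 = (norm (wt (t - 1) g xi))^2 + (\<Sum>j\<in>UNIV. (norm (wt (t - 1) (%xi. (dsym j xi) *s g xi) xi))^2)" for xi
proof -
 have "(jb xi) powr t = (jb xi) powr (t - 1) * (jb xi)"
  using bracket_pos[of xi] powr_add[of "1 + (norm xi)^2" "t - 1" 1] by simp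
 then show ?thesis
  by (simp add: norm_wt_square norm_vector_smult norm_mult power_mult_distrib norm_square_sum[of xi] sum_distrib_left sum_distrib_right algebra_simps)
qed
have i: "integrable lebesgue (%xi. (norm (wt (t - 1) g xi))^2)"
  "integrable lebesgue (%xi. (norm (wt (t - 1) (%xi. (dsym j xi) *s g xi) xi))^2)" for j
 using g gj[of j] by (simp_all add: Lw_def L2_def)
have "integrable lebesgue (%xi. (norm (wt t g xi))^2)" unfolding e by (intro Bochner_Integration.integrable_add Bochner_Integration.integrable_sum i)
then show "g : Lw t" using Lw_measurable[OF g] by (simp add: Lw_def L2_def wt_measurable)
have "(wnorm t g)^2 = (wnorm (t - 1) g)^2 + (\<Sum>j\<in>UNIV. (wnorm (t - 1) (%xi. (dsym j xi) *s g xi))^2)"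
 unfolding wnorm_def L2norm_square e by (simp add: Bochner_Integration.integral_add Bochner_Integration.integral_sum Bochner_Integration.integrable_sum i)
then have "wnorm t g = sqrt ((wnorm (t - 1) g)^2 + (\<Sum>j\<in>UNIV. (wnorm (t - 1) (%xi. (dsym j xi) *s g xi))^2))"
 by (metis abs_of_nonneg real_sqrt_abs wnorm_nonneg)
also have "... <= sqrt ((wnorm (t - 1) g)^2) + sqrt (\<Sum>j\<in>UNIV. (wnorm (t - 1) (%xi. (dsym j xi) *s g xi))^2)"
 by (intro sqrt_add_le_add_sqrt sum_nonneg) auto
also have "... <= wnorm (t - 1) g + (\<Sum>j\<in>UNIV. wnorm (t - 1) (%xi. (dsym j xi) *s g xi))"
 using L2_set_le_sum[of UNIV "%j. wnorm (t - 1) (%xi. (dsym j xi) *s g xi)"] by (simp add: L2_set_def)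
finally show "wnorm t g <= wnorm (t - 1) g + (\<Sum>j\<in>UNIV. wnorm (t - 1) (%xi. (dsym j xi) *s g xi))" .
qed

lemma L2_cdot_tendsto:
assumes "!!k. F k : L2 M" "f : L2 M" "g : L2 M" "(%k. L2norm M (%x. f x - F k x)) ---> 0"
shows "(%k. \<integral>x. cdot (F k x) (g x) \<partial>M) ---> (\<integral>x. cdot (f x) (g x) \<partial>M)"
proof -
have l: "(%k. L2norm M (%x. f x - F k x) * L2norm M g) ---> 0"
 using tendsto_mult[OF assms(4) tendsto_const, of "L2norm M g"] by simp
have b: "norm ((\<integral>x. cdot (F k x) (g x) \<partial>M) - (\<integral>x. cdot (f x) (g x) \<partial>M)) <= L2norm M (%x. f x - F k x) * L2norm M g" for k
proof -
 have d: "(\<integral>x. cdot (f x) (g x) \<partial>M) - (\<integral>x. cdot (F k x) (g x) \<partial>M) = (\<integral>x. cdot (f x - F k x) (g x) \<partial>M)"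
  unfolding bounded_bilinear.diff_left[OF bilinear_cdot]
  by (rule Bochner_Integration.integral_diff[symmetric]) (intro L2_cdot assms)+
 show ?thesis unfolding norm_minus_commute[of "\<integral>x. cdot (F k x) (g x) \<partial>M"] d by (rule L2_cdot(2)[OF L2_diff[OF assms(2) assms(1)[of k]] assms(3)])
qed
have "(%k. (\<integral>x. cdot (F k x) (g x) \<partial>M) - (\<integral>x. cdot (f x) (g x) \<partial>M)) ---> 0"
 by (rule Lim_null_comparison[OF always_eventually[OF allI[OF b]] l])
then show ?thesis by (simp add: LIM_zero_iff)
qed

lemma H1_approximation:
fixes f f' :: "('n::finite, 'm::finite) vfun"
assumes f: "f : LL" "ft f : Lw 1" and f': "f' : LL" "AE xi in lebesgue. ft f' xi = (dsym j xi) *s ft f xi"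
obtains phi where "!!k::nat. phi k : schwartz" "(%k. L2n (%x. f x - phi k x)) ---> 0"
 "(%k. L2n (%x. f' x - partial j (phi k) x)) ---> 0"
proof -
obtain om where om: "!!k::nat. om k : schwartz" "(%k. wnorm 1 (%xi. ft f xi - om k xi)) ---> 0" using schwartz_dense_Lw[OF f(2)] by metis
define phi where "phi k x = fourier (om k) (- x)" for k x
have phi: "phi k : schwartz" "fourier (phi k) = om k" for k unfolding phi_def using fourier_surj[OF om(1)[of k]] by simp_all
have d: "(%xi. ft f xi - om k xi) : Lw 1" for k by (intro Lw_diff f schwartz_Lw om)
have 1: "L2n (%x. f x - phi k x) <= wnorm 1 (%xi. ft f xi - om k xi)" for k
proof -
 have L: "(%x. f x - phi k x) : LL" by (intro L2_diff f schwartz_L2 phi)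
 have "L2n (%x. f x - phi k x) = L2n (ft (%x. f x - phi k x))" by (rule L2norm_ft[OF L, symmetric])
 also have "... = L2n (%xi. ft f xi - om k xi)"
 proof (rule L2norm_cong_AE[OF L2_measurable[OF ft(1)[OF L]] Lw_measurable[OF d]])
  show "AE xi in lebesgue. norm (ft (%x. f x - phi k x) xi) = norm (ft f xi - om k xi)"
   using ft_diff[OF f(1) schwartz_L2[OF phi(1)[of k]]] ft_schwartz[OF phi(1)[of k]] by eventually_elim (simp add: phi(2))
 qed
 also have "... <= wnorm 1 (%xi. ft f xi - om k xi)" using Lw_mono(2)[OF d, of 0] by (simp add: Hs_0_L2)
 finally show ?thesis .
qed
have 2: "L2n (%x. f' x - partial j (phi k) x) <= wnorm 1 (%xi. ft f xi - om k xi)" for k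
proof -
 have L: "(%x. f' x - partial j (phi k) x) : LL" by (intro L2_diff f' schwartz_L2 schwartz_partial phi)
 have "L2n (%x. f' x - partial j (phi k) x) = L2n (ft (%x. f' x - partial j (phi k) x))" by (rule L2norm_ft[OF L, symmetric])
 also have "... = L2n (%xi. (dsym j xi) *s (ft f xi - om k xi))"
 proof (rule L2norm_cong_AE[OF L2_measurable[OF ft(1)[OF L]] coord_smult_measurable[OF Lw_measurable[OF d]]])
  show "AE xi in lebesgue. norm (ft (%x. f' x - partial j (phi k) x) xi) = norm ((dsym j xi) *s (ft f xi - om k xi))"
   using ft_diff[OF f'(1) schwartz_L2[OF schwartz_partial[OF phi(1)[of k]]], of j] ft_schwartz[OF schwartz_partial[OF phi(1)[of k]], of j] f'(2)
   by eventually_elim (simp add: fourier_of_partial phi vector_ssub_ldistrib)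
 qed
 also have "... <= wnorm 1 (%xi. ft f xi - om k xi)" using Lw_coord(2)[OF d] by (simp add: Hs_0_L2)
 finally show ?thesis .
qed
show ?thesis
proof (rule that[OF phi(1)])
 show "(%k. L2n (%x. f x - phi k x)) ---> 0" by (rule tendsto_sandwich[OF _ _ tendsto_const om(2)]) (simp_all add: 1)
 show "(%k. L2n (%x. f' x - partial j (phi k) x)) ---> 0" by (rule tendsto_sandwich[OF _ _ tendsto_const om(2)]) (simp_all add: 2)
qed
qed

text \<open>Both sides are continuous in the norm of $H^1$, and the Schwartz functions are dense.\<close>

lemma product_rule:
fixes f f' :: "('n::finite, 'm::finite) vfun" and G h :: "('n, 'm) mfun"
assumes G: "G : Linfty" and h: "h : Linfty" and w: "weak_partials [j] G h"
 and f: "f : LL" "ft f : Lw 1" and f': "f' : LL" "AE xi in lebesgue. ft f' xi = (dsym j xi) *s ft f xi"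
shows "AE xi in lebesgue. ft (%x. h x *v f x + G x *v f' x) xi = (dsym j xi) *s ft (%x. G x *v f x) xi"
proof -
obtain phi where phi: "!!k::nat. phi k : schwartz" "(%k. L2n (%x. f x - phi k x)) ---> 0"
 "(%k. L2n (%x. f' x - partial j (phi k) x)) ---> 0" using H1_approximation[OF f f'] by blast
have Gf: "(%x. G x *v f x) : LL" "(%x. G x *v f' x) : LL" "(%x. h x *v f x) : LL"
 by (intro mult_L2 G h f f')+
have lim: "(%k. INTG x. cdot (H x *v F k x) (psi x)) ---> (INTG x. cdot (H x *v u x) (psi x))"
 if H: "H : Linfty" and F: "!!k. F k : schwartz" and u: "u : LL" and c: "(%k. L2n (%x. u x - F k x)) ---> 0" and psi: "psi : schwartz"
 for H :: "('n, 'm) mfun" and F and u psi :: "('n, 'm) vfun"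
proof (rule L2_cdot_tendsto)
 obtain C where C: "0 <= C" "!!f :: ('n, 'm) vfun. f : LL ==> (%x. H x *v f x) : LL"
  "!!f :: ('n, 'm) vfun. f : LL ==> L2n (%x. H x *v f x) <= C * L2n f"
  using mult_L2_bound[OF H] by blast
 have b: "L2n (%x. H x *v u x - H x *v F k x) <= C * L2n (%x. u x - F k x)" for k
  using C(3)[OF L2_diff[OF u schwartz_L2[OF F]]] by (simp add: bounded_bilinear.diff_right[OF bilinear_matvec])
 have l: "(%k. C * L2n (%x. u x - F k x)) ---> 0" using tendsto_mult[OF tendsto_const c, of C] by simp
 show "(%k. L2n (%x. H x *v u x - H x *v F k x)) ---> 0"
  by (rule tendsto_sandwich[OF always_eventually[OF allI[OF L2norm_nonneg]] always_eventually[OF allI[OF b]] tendsto_const l])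
qed (intro mult_L2 schwartz_L2 H F u psi)+
have key: "(INTG x. cdot (G x *v f x) (partial j psi x)) = - (INTG x. cdot (h x *v f x + G x *v f' x) (psi x))"
 if psi: "psi : schwartz" for psi :: "('n, 'm) vfun"
proof -
 have split: "(INTG x. cdot (h x *v u x + G x *v v x) (psi x)) = (INTG x. cdot (h x *v u x) (psi x)) + (INTG x. cdot (G x *v v x) (psi x))"
  if "u : LL" "v : LL" for u v :: "('n, 'm) vfun"
  unfolding bounded_bilinear.add_left[OF bilinear_cdot]
  by (rule Bochner_Integration.integral_add) (intro L2_cdot mult_L2 G h schwartz_L2 psi that)+
 have "(%k. - ((INTG x. cdot (h x *v phi k x) (psi x)) + (INTG x. cdot (G x *v partial j (phi k) x) (psi x))))
  ---> - ((INTG x. cdot (h x *v f x) (psi x)) + (INTG x. cdot (G x *v f' x) (psi x)))"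
  by (intro tendsto_minus tendsto_add lim h G phi f f' schwartz_partial psi)
 then have "(%k. INTG x. cdot (G x *v phi k x) (partial j psi x)) ---> - (INTG x. cdot (h x *v f x + G x *v f' x) (psi x))"
  unfolding product_rule_schwartz[OF G h w phi(1) psi] split[OF f(1) f'(1)] split[OF schwartz_L2[OF phi(1)] schwartz_L2[OF schwartz_partial[OF phi(1)]]] .
 moreover have "(%k. INTG x. cdot (G x *v phi k x) (partial j psi x)) ---> (INTG x. cdot (G x *v f x) (partial j psi x))"
  by (intro lim G phi f schwartz_partial psi)
 ultimately show ?thesis by (rule LIMSEQ_unique[rotated])
qed
have sumL2: "(%x. h x *v f x + G x *v f' x) : LL" by (intro L2_add Gf)
have g0: "ft (%x. G x *v f x) : Lw 0" using ft(1)[OF Gf(1)] by (simp add: Hs_0_L2)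
have "reg (%x. h x *v f x + G x *v f' x) = partial_dist schwartz j (reg (%x. G x *v f x))"
proof
 fix psi :: "('n, 'm) vfun"
 show "reg (%x. h x *v f x + G x *v f' x) psi = partial_dist schwartz j (reg (%x. G x *v f x)) psi"
  by (simp add: regular_dist_def partial_dist_def on_tests_def schwartz_partial key)
qed
also have "... = of_rep (%xi. (dsym j xi) *s ft (%x. G x *v f x) xi)"
 unfolding ft(2)[OF Gf(1)] by (rule of_rep_partial)
finally show ?thesis by (rule ft_unique[OF sumL2 Lw_coord(1)[OF g0]])
qed

text \<open>The Leibniz rule reduces the order by one.\<close>

lemma multiplier_product:
fixes G :: "('n::finite, 'm::finite) mfun"
assumes t: "1 <= t" and w: "!!j. weak_partials [j] G (h j)"
 and mG: "multiplier (t - 1) G" and mh: "!!j. multiplier (t - 1) (h j)"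
shows "multiplier t G"
proof -
have G: "G : Linfty" by (rule multiplier_Linfty[OF mG])
have h: "h j : Linfty" for j by (rule multiplier_Linfty[OF mh])
obtain C where C: "0 <= C" "!!f. f : LL ==> ft f : Lw (t - 1) ==> ft (%x. G x *v f x) : Lw (t - 1)"
 "!!f. f : LL ==> ft f : Lw (t - 1) ==> wnorm (t - 1) (ft (%x. G x *v f x)) <= C * wnorm (t - 1) (ft f)"
 using multiplierE[OF mG] by blast
have "\<exists>D. 0 <= D & (\<forall>f\<in>LL. ft f : Lw (t - 1) -->
  ft (%x. h j x *v f x) : Lw (t - 1) & wnorm (t - 1) (ft (%x. h j x *v f x)) <= D * wnorm (t - 1) (ft f))" for j
 using mh[of j] unfolding multiplier_def by blast
then have ex: "\<forall>j. \<exists>D. 0 <= D & (\<forall>f\<in>LL. ft f : Lw (t - 1) -->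
  ft (%x. h j x *v f x) : Lw (t - 1) & wnorm (t - 1) (ft (%x. h j x *v f x)) <= D * wnorm (t - 1) (ft f))" by (rule allI)
obtain D where D': "\<forall>j. 0 <= D j & (\<forall>f\<in>LL. ft f : Lw (t - 1) -->
  ft (%x. h j x *v f x) : Lw (t - 1) & wnorm (t - 1) (ft (%x. h j x *v f x)) <= D j * wnorm (t - 1) (ft f))"
 using choice[OF ex] by (elim exE) (rule that)
have D: "!!j. 0 <= D j" "!!j f. f : LL ==> ft f : Lw (t - 1) ==> ft (%x. h j x *v f x) : Lw (t - 1)"
 "!!j f. f : LL ==> ft f : Lw (t - 1) ==> wnorm (t - 1) (ft (%x. h j x *v f x)) <= D j * wnorm (t - 1) (ft f)"
 using D' by blast+
define E where "E = C + (\<Sum>j\<in>UNIV. D j + C)"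
have E: "0 <= E" unfolding E_def using C D by (intro add_nonneg_nonneg sum_nonneg) auto
have main: "ft (%x. G x *v f x) : Lw t & wnorm t (ft (%x. G x *v f x)) <= E * wnorm t (ft f)"
 if f: "f : LL" "ft f : Lw t" for f :: "('n, 'm) vfun"
proof -
 have f1: "ft f : Lw 1" "ft f : Lw (t - 1)" "wnorm (t - 1) (ft f) <= wnorm t (ft f)"
  using Lw_mono[OF f(2), of 1] Lw_mono[OF f(2), of "t - 1"] t by simp_all
 let ?Gf = "ft (%x. G x *v f x)"
 have Gf: "(%x. G x *v f x) : LL" by (rule mult_L2[OF G f(1)])
 have Gfm: "?Gf : lmeas" by (rule L2_measurable[OF ft(1)[OF Gf]])
 have j: "(%xi. (dsym j xi) *s ?Gf xi) : Lw (t - 1) &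
   wnorm (t - 1) (%xi. (dsym j xi) *s ?Gf xi) <= (D j + C) * wnorm t (ft f)" for j
 proof -
  note Lj = Lw_coord[OF f(2), of j]
  have "(%xi. (dsym j xi) *s ft f xi) : LL" using Lw_mono(1)[OF Lj(1), of 0] t by (simp add: Hs_0_L2)
  then have "\<exists>f'. f' : LL & (AE xi in lebesgue. ft f' xi = (dsym j xi) *s ft f xi)"
   by (rule L2_ex_ft) (intro exI conjI)
  then obtain f' where f': "f' : LL" "AE xi in lebesgue. ft f' xi = (dsym j xi) *s ft f xi"
   by blast
  have f'm: "ft f' : lmeas" by (rule L2_measurable[OF ft(1)[OF f'(1)]])
  have ae: "AE xi in lebesgue. (dsym j xi) *s ft f xi = ft f' xi" using f'(2) by eventually_elim simp
  have f'L: "ft f' : Lw (t - 1)" by (rule Lw_cong_AE[OF Lj(1) f'm ae])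
  have f'n: "wnorm (t - 1) (ft f') <= wnorm t (ft f)"
   using wnorm_cong_AE[OF Lw_measurable[OF Lj(1)] f'm ae, of "t - 1"] Lj(2) by simp
  have l: "(%x. h j x *v f x) : LL" "(%x. G x *v f' x) : LL" by (intro mult_L2 G h f f')+
  note a1 = D(2)[OF f(1) f1(2), of j] and a2 = C(2)[OF f'(1) f'L]
  have ae2: "AE xi in lebesgue. ft (%x. h j x *v f x) xi + ft (%x. G x *v f' x) xi = (dsym j xi) *s ?Gf xi"
   using ft_add[OF l] product_rule[OF G h w f(1) f1(1) f'] by eventually_elim simp
  have m2: "(%xi. (dsym j xi) *s ?Gf xi) : lmeas" by (rule coord_smult_measurable[OF Gfm])
  note s = Lw_add[OF a1 a2]
  have "wnorm (t - 1) (%xi. (dsym j xi) *s ?Gf xi) = wnorm (t - 1) (%xi. ft (%x. h j x *v f x) xi + ft (%x. G x *v f' x) xi)"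
   by (rule wnorm_cong_AE[OF Lw_measurable[OF s] m2 ae2, symmetric])
  also have "... <= wnorm (t - 1) (ft (%x. h j x *v f x)) + wnorm (t - 1) (ft (%x. G x *v f' x))" by (rule wnorm_triangle[OF a1 a2])
  also have "... <= D j * wnorm (t - 1) (ft f) + C * wnorm (t - 1) (ft f')"
   by (intro add_mono D(3) C(3) f f1 f' f'L)
  also have "... <= D j * wnorm t (ft f) + C * wnorm t (ft f)" using D(1) C(1) f1 f'n by (intro add_mono mult_left_mono) auto
  finally show ?thesis using Lw_cong_AE[OF s m2 ae2] by (simp add: distrib_right)
 qed
 have G1: "?Gf : Lw (t - 1)" by (rule C(2)[OF f(1) f1(2)])
 note step = Lw_step[OF G1 conjunct1[OF j]]
 have "wnorm t ?Gf <= wnorm (t - 1) ?Gf + (\<Sum>j\<in>UNIV. wnorm (t - 1) (%xi. (dsym j xi) *s ?Gf xi))" by (rule step(2))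
 also have "... <= C * wnorm t (ft f) + (\<Sum>j\<in>UNIV. (D j + C) * wnorm t (ft f))"
 proof (intro add_mono sum_mono conjunct2[OF j])
  show "wnorm (t - 1) ?Gf <= C * wnorm t (ft f)"
   using C(3)[OF f(1) f1(2)] mult_left_mono[OF f1(3) C(1)] by linarith
 qed
 also have "... = E * wnorm t (ft f)" by (simp add: E_def distrib_right sum_distrib_right)
 finally show ?thesis using step(1) by blast
qed
show ?thesis unfolding multiplier_def using G E main by (intro conjI exI[of _ E]) auto
qed

section \<open>Smooth coefficients are multipliers\<close>

text \<open>A Hoelder condition for almost all pairs of points holds, up to the factor 2, for every fixed
step \<open>h\<close> and almost all base points: the condition holds for almost all steps, and
\<open>h\<close> is a sum of two such steps which are not longer than \<open>h\<close>.\<close>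

lemma Hoelder_fixed_step:
fixes g :: "real^'n => 'a::euclidean_space" and h :: "real^'n"
assumes C: "AE p in lebesgue. case p of (x, y) => norm (g x - g y) <= C * norm (x - y) powr th" and th: "0 <= th"
shows "AE x in lebesgue. norm (g (x + h) - g x) <= (2 * \<bar>C\<bar>) * norm h powr th"
proof (cases "h = 0")
case False
define P where "P x y \<longleftrightarrow> norm (g x - g y) <= C * norm (x - y) powr th" for x y
define T where "T = (%p :: (real^'n) \<times> (real^'n). (snd p - fst p, fst p))"
have linT: "linear T" unfolding T_def by (rule linearI) (auto simp: algebra_simps)
obtain N where N: "N : null_sets lebesgue" "{p. \<not> P (fst p) (snd p)} \<subseteq> N"
 using C by (auto simp: eventually_ae_filter P_def case_prod_beta)
have "negligible {p. \<not> P (fst p) (snd p)}"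
 by (rule negligible_subset[OF _ N(2)]) (use N(1) in \<open>simp add: negligible_iff_null_sets\<close>)
then have "negligible (T ` {p. \<not> P (fst p) (snd p)})"
 by (rule negligible_differentiable_image_negligible[OF order_refl _ linear_imp_differentiable_on[OF linT]])
moreover have "T ` {p. \<not> P (fst p) (snd p)} = {p. \<not> P (snd p) (snd p + fst p)}"
proof (intro equalityI subsetI)
 fix p assume p: "p : {p. \<not> P (snd p) (snd p + fst p)}"
 have "p = T (snd p, snd p + fst p)" by (simp add: T_def)
 then show "p : T ` {p. \<not> P (fst p) (snd p)}" using p by force
qed (auto simp: T_def)
ultimately have "{p :: (real^'n) \<times> (real^'n). \<not> P (snd p) (snd p + fst p)} : null_sets lebesgue" by (simp add: negligible_iff_null_sets)
then have "AE p in lebesgue. P (snd p) (snd p + fst p)" by (intro AE_I'[of "{p. \<not> P (snd p) (snd p + fst p)}"]) auto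
then have "AE p in lborel. P (snd p) (snd p + fst p)" by (simp add: AE_completion_iff)
then have "AE p in (lborel \<Otimes>\<^sub>M lborel). P (snd p) (snd p + fst p)" unfolding lborel_prod .
from lborel_pair.AE_pair[OF this]
have ae: "AE d in lebesgue. AE x in lebesgue. P x (x + d)" by (simp add: AE_completion_iff)
have ae2: "AE d in lebesgue. AE x in lebesgue. P x (x + (h - d))"
 using AE_lebesgue_affine[OF ae, of "-1" h] by simp
have "\<exists>d\<in>ball ((1/2) *R h) (norm h / 2). (AE x in lebesgue. P x (x + d)) & (AE x in lebesgue. P x (x + (h - d)))"
proof (rule ccontr)
 assume "\<not> ?thesis"
 then have sub: "ball ((1/2) *R h) (norm h / 2) \<subseteq> {d. \<not> ((AE x in lebesgue. P x (x + d)) & (AE x in lebesgue. P x (x + (h - d))))}" by blast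
 have "AE d in lebesgue. (AE x in lebesgue. P x (x + d)) & (AE x in lebesgue. P x (x + (h - d)))" using ae ae2 by eventually_elim simp
 then obtain N where N: "N : null_sets lebesgue" "{d. \<not> ((AE x in lebesgue. P x (x + d)) & (AE x in lebesgue. P x (x + (h - d))))} \<subseteq> N"
  by (auto simp: eventually_ae_filter)
 have "negligible (ball ((1/2) *R h) (norm h / 2))"
  by (rule negligible_subset[of N]) (use N sub in \<open>auto simp: negligible_iff_null_sets\<close>)
 moreover have "ball ((1/2) *R h) (norm h / 2) ~= {}" using False by simp
 ultimately show False using open_not_negligible[OF open_ball] by blast
qed
then obtain d where d: "d : ball ((1/2) *R h) (norm h / 2)" "AE x in lebesgue. P x (x + d)" "AE x in lebesgue. P x (x + (h - d))" by blast
have dist: "norm ((1/2) *R h - d) < norm h / 2" using d(1) by (simp add: dist_norm)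
have n1: "norm d <= norm h"
 using norm_triangle_ineq4[of "(1/2) *R h" "(1/2) *R h - d"] dist by simp
have n2: "norm (h - d) <= norm h"
proof -
 have "h - d = (1/2) *R h + ((1/2) *R h - d)" by (simp add: algebra_simps flip: scaleR_add_left)
 then show ?thesis using norm_triangle_ineq[of "(1/2) *R h" "(1/2) *R h - d"] dist by simp
qed
have d3: "AE x in lebesgue. P (x + d) ((x + d) + (h - d))" using AE_lebesgue_affine[OF d(3), of 1 d] by simp
have mono: "C * norm k powr th <= \<bar>C\<bar> * norm h powr th" if "norm k <= norm h" for k :: "real^'n"
 using that th by (intro mult_mono powr_mono2) auto
show ?thesis using d(2) d3
proof eventually_elim
 case (elim x)
 have "norm (g (x + h) - g x) <= norm (g (x + d) - g (x + h)) + norm (g x - g (x + d))"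
  using norm_triangle_ineq[of "g (x + h) - g (x + d)" "g (x + d) - g x"] by (simp add: norm_minus_commute)
 also have "norm (g (x + d) - g (x + h)) <= \<bar>C\<bar> * norm h powr th"
  using elim(2) mono[of "h - d"] n2 by (simp add: P_def norm_minus_commute)
 also have "norm (g x - g (x + d)) <= \<bar>C\<bar> * norm h powr th"
  using elim(1) mono[of d] n1 by (simp add: P_def)
 finally show ?case by simp
qed
qed (simp add: zero_le_mult_iff)

lemma WinftyE:
assumes "G : Winfty nu" "int (length js) <= \<lfloor>nu\<rfloor>"
obtains h where "h : Linfty" "weak_partials js G h" "nu \<notin> \<int> ==> int (length js) = \<lfloor>nu\<rfloor> ==>
 \<exists>C. AE p in lebesgue. case p of (x, y) => norm (h x - h y) <= C * norm (x - y) powr (nu - \<lfloor>nu\<rfloor>)"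
using assms unfolding Winfty_def by blast

lemma Winfty_derivative:
assumes G: "G : Winfty nu" and h: "h : Linfty" "weak_partials [j] G h"
shows "h : Winfty (nu - 1)"
unfolding Winfty_def
proof (intro CollectI conjI h(1) allI impI)
fix js :: "'a list" assume js: "int (length js) <= \<lfloor>nu - 1\<rfloor>"
have "int (length (j # js)) <= \<lfloor>nu\<rfloor>" using js by simp
then obtain H where H: "H : Linfty" "weak_partials (j # js) G H" "nu \<notin> \<int> ==> int (length (j # js)) = \<lfloor>nu\<rfloor> ==>
 \<exists>C. AE p in lebesgue. case p of (x, y) => norm (H x - H y) <= C * norm (x - y) powr (nu - \<lfloor>nu\<rfloor>)"
 using WinftyE[OF G] by blast
have "weak_partials js h H"
 unfolding weak_partials_def
proof (intro allI impI)
 fix phi :: "real^'a => real" assume phi: "phi : test_functions UNIV"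
 have "(INTG x. partial j (partials js phi) x *R G x) = - (INTG x. partials js phi x *R h x)"
  using h(2) test_functions_partials[OF phi, of js] unfolding weak_partials_def by simp
 moreover have "(INTG x. partial j (partials js phi) x *R G x) = (-1) ^ Suc (length js) *R (INTG x. phi x *R H x)"
  using H(2) phi unfolding weak_partials_def by simp
 ultimately show "(INTG x. partials js phi x *R h x) = (-1) ^ length js *R (INTG x. phi x *R H x)" by simp
qed
moreover have "\<exists>C. AE p in lebesgue. case p of (x, y) => norm (H x - H y) <= C * norm (x - y) powr (nu - 1 - \<lfloor>nu - 1\<rfloor>)"
 if "nu - 1 \<notin> \<int>" "int (length js) = \<lfloor>nu - 1\<rfloor>"
proof -
 have "nu \<notin> \<int>" using that(1) by (metis Ints_1 Ints_diff)
 moreover have "int (length (j # js)) = \<lfloor>nu\<rfloor>" using that(2) by simp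
 moreover have "nu - 1 - real_of_int \<lfloor>nu - 1\<rfloor> = nu - real_of_int \<lfloor>nu\<rfloor>" by simp
 ultimately show ?thesis using H(3) by metis
qed
ultimately show "\<exists>H\<in>Linfty. weak_partials js h H & (nu - 1 \<notin> \<int> & int (length js) = \<lfloor>nu - 1\<rfloor> -->
  (\<exists>C. AE p in lebesgue. case p of (x, y) => norm (H x - H y) <= C * norm (x - y) powr (nu - 1 - \<lfloor>nu - 1\<rfloor>)))"
 using H(1) by blast
qed

lemma Winfty_floor: "G : Winfty nu ==> G : Winfty (real_of_int \<lfloor>nu\<rfloor>)"
unfolding Winfty_def by fastforce

lemma weak_partials_Nil:
fixes G h :: "real^'n => 'a::euclidean_space"
assumes G: "G : Linfty" and h: "h : Linfty" and w: "weak_partials [] G h"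
shows "AE x in lebesgue. G x = h x"
proof -
have "AE x in lebesgue. G x - h x = 0"
proof (rule AE_zero_if_test_integrals_zero)
 show "(%x. G x - h x) : lmeas" by (intro borel_measurable_diff Linfty_measurable G h)
 fix phi :: "real^'n => real" assume phi: "phi : test_functions UNIV"
 then have S: "phi : schwartz" using test_functions_subset_schwartz by blast
 note i = schwartz_Linfty_integrable[OF S G] schwartz_Linfty_integrable[OF S h]
 show "integrable lebesgue (%x. phi x *R (G x - h x))" unfolding scaleR_diff_right by (rule Bochner_Integration.integrable_diff[OF i])
 have "(INTG x. phi x *R G x) = (INTG x. phi x *R h x)" using w phi unfolding weak_partials_def by simp
 then show "(INTG x. phi x *R (G x - h x)) = 0" unfolding scaleR_diff_right by (simp add: Bochner_Integration.integral_diff[OF i])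
qed
then show ?thesis by eventually_elim simp
qed

text \<open>Induction on the integer part of the order. The derivatives of the coefficient lose one order of
smoothness, as does the order to which the product rule reduces the claim.\<close>

lemma Winfty_multiplier:
fixes G :: "('n::finite, 'm::finite) mfun"
assumes "G : Winfty nu" "0 <= t" "t < nu \<or> (t = nu & nu : \<int>)"
shows "multiplier t G"
proof -
have *: "\<forall>nu t (G :: ('n, 'm) mfun). G : Winfty nu --> 0 <= t --> nat \<lfloor>t\<rfloor> = k --> t < nu \<or> (t = nu & nu : \<int>) --> multiplier t G" for k
proof (induction k)
 case 0
 show ?case
 proof (intro allI impI)
  fix nu t :: real and G :: "('n, 'm) mfun"
  assume W: "G : Winfty nu" and t: "0 <= t" "nat \<lfloor>t\<rfloor> = 0" and nu: "t < nu \<or> (t = nu & nu : \<int>)"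
  have t1: "t < 1" using t by linarith
  have G: "G : Linfty" using W by (simp add: Winfty_def)
  show "multiplier t G"
  proof (cases "t = 0")
   case True
   then show ?thesis using multiplier_0[OF G] by simp
  next
   case False
   then have t0: "0 < t" using t by simp
   have "t \<notin> \<int>" using t0 t1 by (metis Ints_cases of_int_0_less_iff of_int_less_1_iff zless_imp_add1_zle add_0 not_less)
   then have nut: "t < nu" using nu by blast
   show ?thesis
   proof (cases "1 <= nu")
    case True
    have "\<exists>h. h : Linfty & weak_partials [j] G h" for j
     using WinftyE[OF W, of "[j]"] True by (metis le_floor_iff length_Cons list.size(3) of_int_1 One_nat_def of_nat_1)
    then obtain h where h: "!!j. h j : Linfty" "!!j. weak_partials [j] G (h j)" by metis
    have "multiplier 1 G" by (rule multiplier_product[OF _ h(2)]) (simp_all add: multiplier_0 G h)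
    then show ?thesis by (rule multiplier_interpolate[OF t0 t1 multiplier_0[OF G]])
   next
    case False
    have fl: "\<lfloor>nu\<rfloor> = 0" using False nut t0 by (simp add: floor_eq_iff)
    have nI: "nu \<notin> \<int>" using False nut t0 fl by (metis Ints_cases floor_of_int less_trans of_int_0 less_irrefl)
    have l0: "int (length ([] :: 'n list)) <= \<lfloor>nu\<rfloor>" by (simp add: fl)
    obtain h where h: "h : Linfty" "weak_partials [] G h" "nu \<notin> \<int> ==> int (length ([] :: 'n list)) = \<lfloor>nu\<rfloor> ==>
     \<exists>C. AE p in lebesgue. case p of (x, y) => norm (h x - h y) <= C * norm (x - y) powr (nu - \<lfloor>nu\<rfloor>)"
     using WinftyE[OF W l0] by blast
    obtain C where C: "AE p in lebesgue. case p of (x, y) => norm (h x - h y) <= C * norm (x - y) powr nu"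
     using h(3)[OF nI] fl by auto
    have ae: "AE x in lebesgue. G x = h x" by (rule weak_partials_Nil[OF G h(1,2)])
    show ?thesis
    proof (rule multiplier_Hoelder[OF t0 t1 nut G])
     show "0 <= 2 * \<bar>C\<bar>" by simp
     fix j and k :: nat
     let ?d = "(1/2)^k *R axis j 1 :: real^'n"
     have n: "norm ?d = (1/2)^k" by simp
     have "AE x in lebesgue. norm (h (x + ?d) - h x) <= (2 * \<bar>C\<bar>) * norm ?d powr nu"
      by (rule Hoelder_fixed_step[OF C]) (use nut t0 in simp)
     moreover have "AE x in lebesgue. G (x + ?d) = h (x + ?d)" using AE_lebesgue_affine[OF ae, of 1 ?d] by simp
     ultimately show "AE x in lebesgue. norm (G (x + ?d) - G x) <= 2 * \<bar>C\<bar> * ((1/2)^k) powr nu"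
      using ae unfolding n by eventually_elim simp
    qed
   qed
  qed
 qed
next
 case (Suc k)
 show ?case
 proof (intro allI impI)
  fix nu t :: real and G :: "('n, 'm) mfun"
  assume W: "G : Winfty nu" and t: "0 <= t" "nat \<lfloor>t\<rfloor> = Suc k" and nu: "t < nu \<or> (t = nu & nu : \<int>)"
  have t1: "1 <= t" "nat \<lfloor>t - 1\<rfloor> = k" using t by linarith+
  have nu1: "t <= nu" using nu by auto
  have "\<exists>h. h : Linfty & weak_partials [j] G h" for j
  proof -
   have "int (length [j]) <= \<lfloor>nu\<rfloor>" using t1 nu1 by simp
   then show ?thesis using WinftyE[OF W] by metis
  qed
  then obtain h where h: "!!j. h j : Linfty" "!!j. weak_partials [j] G (h j)" by metis
  show "multiplier t G"
  proof (rule multiplier_product[OF t1(1) h(2)])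
   have "t - 1 < real_of_int \<lfloor>nu\<rfloor>" using nu1 by linarith
   then show "multiplier (t - 1) G" using Suc.IH Winfty_floor[OF W] t1 by (metis diff_ge_0_iff_ge)
   have "t - 1 < nu - 1 \<or> (t - 1 = nu - 1 & nu - 1 : \<int>)" using nu by (auto intro: Ints_diff)
   then show "multiplier (t - 1) (h j)" for j
    using Suc.IH Winfty_derivative[OF W h(1)[of j] h(2)[of j]] t1 by (metis diff_ge_0_iff_ge)
  qed
 qed
qed
show ?thesis using *[of "nat \<lfloor>t\<rfloor>"] assms by blast
qed

lemma Winfty_linear_image:
fixes L :: "'a::euclidean_space => 'b::euclidean_space" and G :: "real^'n => 'a"
assumes L: "bounded_linear L" and G: "G : Winfty nu"
shows "(%x. L (G x)) : Winfty nu"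
proof -
obtain K where K: "0 <= K" "!!x. norm (L x) <= norm x * K" using bounded_linear.nonneg_bounded[OF L] by blast
have inf: "(%x. L (H x)) : Linfty" if H: "H : Linfty" for H :: "real^'n => 'a"
proof -
 obtain B where B: "0 <= B" "AE x in lebesgue. norm (H x) <= B" using Linfty_bound[OF H] .
 have "AE x in lebesgue. norm (L (H x)) <= B * K"
  using B(2) by eventually_elim (rule order_trans[OF K(2)], rule mult_right_mono, simp_all add: K)
 then show ?thesis using linear_measurable[OF L Linfty_measurable[OF H]] by (auto simp: Linfty_def)
qed
have GL: "G : Linfty" using G by (simp add: Winfty_def)
have weak: "weak_partials js (%x. L (G x)) (%x. L (h x))" if w: "weak_partials js G h" and h: "h : Linfty" for js h
 unfolding weak_partials_def
proof (intro allI impI)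
 fix phi :: "real^'n => real" assume phi: "phi : test_functions UNIV"
 then have S: "phi : schwartz" using test_functions_subset_schwartz by blast
 have e: "r *R L v = L (r *R v)" for r v using linear_scale[OF bounded_linear.linear[OF L]] by metis
 have "(INTG x. partials js phi x *R G x) = (-1) ^ length js *R (INTG x. phi x *R h x)"
  using w phi unfolding weak_partials_def by blast
 then show "(INTG x. partials js phi x *R L (G x)) = (-1) ^ length js *R (INTG x. phi x *R L (h x))"
  unfolding e integral_bounded_linear'[OF L schwartz_Linfty_integrable[OF S h]]
   integral_bounded_linear'[OF L schwartz_Linfty_integrable[OF schwartz_partials[OF S] GL]] by simp
qed
show ?thesis unfolding Winfty_def
proof (intro CollectI conjI inf GL allI impI)
 fix js :: "'n list" assume js: "int (length js) <= \<lfloor>nu\<rfloor>"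
 obtain h where h: "h : Linfty" "weak_partials js G h" "nu \<notin> \<int> ==> int (length js) = \<lfloor>nu\<rfloor> ==>
  \<exists>C. AE p in lebesgue. case p of (x, y) => norm (h x - h y) <= C * norm (x - y) powr (nu - \<lfloor>nu\<rfloor>)"
  using WinftyE[OF G js] by blast
 have "\<exists>C. AE p in lebesgue. case p of (x, y) => norm (L (h x) - L (h y)) <= C * norm (x - y) powr (nu - \<lfloor>nu\<rfloor>)"
  if nI: "nu \<notin> \<int>" and lj: "int (length js) = \<lfloor>nu\<rfloor>"
 proof -
  obtain C where C: "AE p in lebesgue. case p of (x, y) => norm (h x - h y) <= C * norm (x - y) powr (nu - \<lfloor>nu\<rfloor>)"
   using h(3)[OF nI lj] by blast
  have "AE p in lebesgue. case p of (x, y) => norm (L (h x) - L (h y)) <= (K * C) * norm (x - y) powr (nu - \<lfloor>nu\<rfloor>)"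
   using C
  proof eventually_elim
   case (elim p)
   obtain x y where p: "p = (x, y)" by (cases p)
   have "norm (L (h x) - L (h y)) = norm (L (h x - h y))" by (simp add: linear_diff[OF bounded_linear.linear[OF L]])
   also have "... <= norm (h x - h y) * K" by (rule K)
   also have "... <= (C * norm (x - y) powr (nu - \<lfloor>nu\<rfloor>)) * K" using elim K(1) by (intro mult_right_mono) (auto simp: p)
   finally show ?case by (simp add: p mult_ac)
  qed
  then show ?thesis by blast
 qed
 then show "\<exists>h\<in>Linfty. weak_partials js (%x. L (G x)) h & (nu \<notin> \<int> & int (length js) = \<lfloor>nu\<rfloor> -->
  (\<exists>C. AE p in lebesgue. case p of (x, y) => norm (h x - h y) <= C * norm (x - y) powr (nu - \<lfloor>nu\<rfloor>)))"
  using inf[OF h(1)] weak[OF h(2,1)] by (intro bexI[of _ "%x. L (h x)"]) auto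
qed
qed

lemma bounded_linear_transpose: "bounded_linear (transpose :: complex^'m^'m => complex^'m^'m)"
unfolding linear_conv_bounded_linear[symmetric] by (rule linearI) (simp_all add: transpose_def vec_eq_iff)

section \<open>Mollification\<close>

definition convolution :: "(real^'n => real) => ('n::finite, 'm::finite) vfun => ('n, 'm) vfun" where
"convolution eta f x = (INTG y. eta (x - y) *R f y)"

lemma convolution_integrable:
fixes f :: "('n::finite, 'm::finite) vfun"
assumes f: "integrable lebesgue f" and eta: "eta : schwartz"
shows "integrable lebesgue (%y. eta (x - y) *R f y)"
proof -
obtain C where C: "0 <= C" "!!x. norm (eta x) <= C" using schwartz_bounded[OF eta] by blast
have m: "(%y. eta (x - y)) : lmeas"
 using measurable_lebesgue_affine[OF schwartz_measurable[OF eta], of "-1" x] by simp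
show ?thesis
proof (rule Bochner_Integration.integrable_bound)
 show "integrable lebesgue (%y. C *R f y)" using f by (rule integrable_scaleR_right)
 show "(%y. eta (x - y) *R f y) : lmeas" by (rule borel_measurable_scaleR[OF m borel_measurable_integrable[OF f]])
 show "AE y in lebesgue. norm (eta (x - y) *R f y) <= norm (C *R f y)"
  using C by (intro AE_I2) (simp add: mult_right_mono)
qed
qed

lemma convolution_has_derivative:
fixes f :: "('n::finite, 'm::finite) vfun"
assumes f: "integrable lebesgue f" and eta: "eta : schwartz"
shows "(convolution eta f has_derivative (%h. INTG y. (\<Sum>j\<in>UNIV. h $ j *R partial j eta (x - y)) *R f y)) (at x)"
proof -
have "\<exists>C. 0 <= C & (\<forall>x. norm (partial j eta x) <= C)" for j using schwartz_bounded[OF schwartz_partial[OF eta]] by metis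
then obtain C where C: "!!j. 0 <= C j" "!!j x. norm (partial j eta x) <= C j" by metis
have "((%x. INTG y. eta (x - y) *R f y) has_derivative (%h. INTG y. (\<Sum>j\<in>UNIV. h $ j *R partial j eta (x - y)) *R f y)) (at x)"
proof (rule has_derivative_lebesgue_integral[where r=1 and g="%y. (\<Sum>j\<in>UNIV. C j) * norm (f y)"])
 show "integrable lebesgue (%y. eta (x - y) *R f y)" for x by (rule convolution_integrable[OF f eta])
 show "((%x. eta (x - y) *R f y) has_derivative (%h. (\<Sum>j\<in>UNIV. h $ j *R partial j eta (x - y)) *R f y)) (at x)" for x y
 proof -
  have "(eta has_derivative (%h. \<Sum>j\<in>UNIV. h $ j *R partial j eta (x - y))) (at (x - y))"
   by (rule has_derivative_partials[OF smooth_differentiable[OF schwartz_smooth[OF eta]]])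
  then have "((%x. eta (x - y)) has_derivative (%h. \<Sum>j\<in>UNIV. h $ j *R partial j eta (x - y))) (at x)"
   by (rule has_derivative_compose[rotated]) (auto intro!: derivative_eq_intros)
  then show ?thesis by (rule has_derivative_scaleR_left)
 qed
 show "norm ((\<Sum>j\<in>UNIV. h $ j *R partial j eta (x - y)) *R f y) <= (\<Sum>j\<in>UNIV. C j) * norm (f y) * norm h" for x y h
 proof -
  have "norm (\<Sum>j\<in>UNIV. h $ j *R partial j eta (x - y)) <= norm h * (\<Sum>j\<in>UNIV. C j)"
   unfolding sum_distrib_left
  proof (rule sum_norm_le)
   show "norm (h $ j *R partial j eta (x - y)) <= norm h * C j" for j
    unfolding norm_scaleR using C component_le_norm_cart[of h j] by (intro mult_mono) auto
  qed
  then have "norm (\<Sum>j\<in>UNIV. h $ j *R partial j eta (x - y)) * norm (f y) <= norm h * (\<Sum>j\<in>UNIV. C j) * norm (f y)"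
   by (rule mult_right_mono) simp
  then show ?thesis unfolding norm_scaleR real_norm_def by (simp only: mult_ac)
 qed
 show "integrable lebesgue (%y. (\<Sum>j\<in>UNIV. C j) * norm (f y))" using f by simp
 show "(%y. (\<Sum>j\<in>UNIV. h $ j *R partial j eta (x - y)) *R f y) : lmeas" for h
 proof -
  have "(%y. partial j eta (x - y)) : lmeas" for j
   using measurable_lebesgue_affine[OF schwartz_measurable[OF schwartz_partial[OF eta, of j]], of "-1" x] by simp
  then show ?thesis
   by (intro borel_measurable_scaleR borel_measurable_sum borel_measurable_const borel_measurable_integrable[OF f])
 qed
qed simp
then show ?thesis unfolding convolution_def[abs_def] .
qed

lemma convolution_smooth:
fixes f :: "('n::finite, 'm::finite) vfun"
assumes f: "integrable lebesgue f" and eta: "eta : schwartz"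
shows "smooth (convolution eta f)"
proof (rule smooth_coinduct[of _ "(%th. convolution th f) ` schwartz"])
show "convolution eta f : (%th. convolution th f) ` schwartz" using eta by blast
show "g differentiable (at x)" if "g : (%th. convolution th f) ` schwartz" for g x
 using that convolution_has_derivative[OF f] unfolding differentiable_def by blast
show "partial j g : (%th. convolution th f) ` schwartz" if "g : (%th. convolution th f) ` schwartz" for g j
proof -
 obtain th where th: "th : schwartz" "g = convolution th f" using \<open>g : _\<close> by blast
 have s: "(\<Sum>i\<in>UNIV. axis j 1 $ i *R partial i th z) = partial j th z" for z
  by (simp add: axis_def if_distrib[of "%r. r * _"] sum.delta cong: if_cong)
 have "partial j g x = convolution (partial j th) f x" for x
  unfolding th(2) partial_eq[OF convolution_has_derivative[OF f th(1)]] convolution_def s ..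
 then show ?thesis using schwartz_partial[OF th(1)] by (metis (no_types) image_eqI ext)
qed
qed

lemma integrable_product_Lw:
fixes g :: "('n::finite, 'm::finite) vfun" and s :: "real^'n => complex"
assumes g: "g : Lw rho" and s: "s : schwartz"
shows "integrable lebesgue (%xi. s xi *s g xi)"
proof (rule Bochner_Integration.integrable_bound)
have "wt rho g : LL" "wt (- rho) s : LL" using g schwartz_Lw[OF s, of "- rho"] by (simp_all add: Lw_def)
then show "integrable lebesgue (%xi. norm (wt rho g xi) * norm (wt (- rho) s xi))" by (rule L2_mult_integrable)
show "(%xi. s xi *s g xi) : lmeas"
 by (rule bilinear_measurable[OF bilinear_smult schwartz_measurable[OF s] Lw_measurable[OF g]])
have "norm (s xi *s g xi) = norm (wt rho g xi) * norm (wt (- rho) s xi)" for xi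
proof -
 have "(jb xi) powr (rho / 2) * (jb xi) powr (- rho / 2) = 1"
  using bracket_pos[of xi] by (simp add: powr_add[symmetric])
 then have "((jb xi) powr (rho / 2) * (jb xi) powr (- rho / 2)) * (norm (s xi) * norm (g xi)) = norm (s xi) * norm (g xi)" by simp
 then show ?thesis by (simp add: wt_def norm_vector_smult mult_ac)
qed
then show "AE xi in lebesgue. norm (s xi *s g xi) <= norm (norm (wt rho g xi) * norm (wt (- rho) s xi))" by simp
qed

definition scalar_fourier :: "(real^'n => real) => real^'n => complex" where
"scalar_fourier eta xi = (INTG z. ek z xi * of_real (eta z))"

lemma cis_scalar_integrable:
fixes eta :: "real^'n => real"
assumes eta: "eta : schwartz"
shows "integrable lebesgue (%z. ek z xi * of_real (eta z))"
proof (rule Bochner_Integration.integrable_bound)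
show "integrable lebesgue eta" by (rule schwartz_integrable[OF eta])
show "(%z. ek z xi * of_real (eta z)) : lmeas"
 by (intro borel_measurable_times cis_inner_measurable_lebesgue linear_measurable[OF bounded_linear_of_real] schwartz_measurable eta)
qed (simp add: norm_mult)

lemma fourier_scalar:
fixes eta :: "real^'n => real" and v :: "complex^'m"
assumes eta: "eta : schwartz"
shows "fourier (%z. eta z *R v) xi = ((2 * pi) powr (- real CARD('n) / 2)) *R (scalar_fourier eta xi *s v)"
proof -
have e: "ek z xi *s (eta z *R v) = (ek z xi * of_real (eta z)) *s v" for z
 by (simp add: scaleR_eq_smult)
show ?thesis unfolding fourier_def e scalar_fourier_def
 by (subst integral_bounded_linear'[OF bounded_bilinear.bounded_linear_left[OF bilinear_smult] cis_scalar_integrable[OF eta]]) simp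
qed

lemma scalar_schwartz: "eta : schwartz ==> (%z. eta z *R v) : schwartz"
by (rule schwartz_linear_image[OF bounded_linear_scaleR_left])

lemma scalar_fourier_schwartz:
fixes eta :: "real^'n => real"
assumes eta: "eta : schwartz"
shows "scalar_fourier eta : schwartz"
proof -
define c where "c = (2 * pi) powr (- real CARD('n) / 2)"
have c: "c > 0" by (simp add: c_def)
let ?L = "%w :: complex^1. inverse c *R (w $ 1)"
have "bounded_linear ?L" by (intro bounded_linear_compose[OF bounded_linear_scaleR_right] bounded_linear_vec_nth)
then have "(%xi. ?L (fourier (%z. eta z *R axis 1 1) xi)) : schwartz"
 by (rule schwartz_linear_image) (rule fourier_schwartz[OF scalar_schwartz[OF eta]])
moreover have "?L (fourier (%z. eta z *R axis 1 1) xi) = scalar_fourier eta xi" for xi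
 unfolding fourier_scalar[OF eta] c_def[symmetric] using c by (simp add: axis_def)
ultimately show ?thesis by simp
qed

text \<open>The convolution theorem. If the regular distribution \<open>f\<close> has the Fourier representative
\<open>g\<close>, testing \<open>f\<close> with the translates of a Schwartz function exhibits the convolution as the
inverse Fourier transform of an integrable function.\<close>

lemma convolution_of_rep:
fixes f g :: "('n::finite, 'm::finite) vfun"
assumes f: "integrable lebesgue f" and eta: "eta : schwartz" and g: "g : Lw rho" and fg: "reg f = of_rep g"
shows "reg (convolution eta f) = of_rep (%xi. scalar_fourier eta xi *s g xi)"
proof -
define c where "c = (2 * pi) powr (- real CARD('n) / 2)"
define W where "W xi = scalar_fourier eta xi *s g xi" for xi
have W: "integrable lebesgue W" unfolding W_def by (rule integrable_product_Lw[OF g scalar_fourier_schwartz[OF eta]])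
have conv: "convolution eta f x = fourier W (- x)" for x
proof (rule cdot_eqI)
 fix v :: "complex^'m"
 define E where "E z = eta z *R v" for z
 define psi where "psi y = eta (x - y) *R v" for y
 have E: "E : schwartz" unfolding E_def[abs_def] by (rule scalar_schwartz[OF eta])
 have psi: "psi : schwartz" using schwartz_affine[OF E, of "-1" x] by (simp add: psi_def[abs_def] E_def)
 have Rm: "(%y. E (- y)) : lmeas" by (intro schwartz_measurable schwartz_reflect E)
 have Fpsi: "fourier psi (- xi) = (cis (x \<bullet> xi) * of_real c) *s (scalar_fourier eta xi *s v)" for xi
 proof -
  have "psi = (%y. E (- (y + (- x))))" by (simp add: psi_def[abs_def] E_def)
  then have "fourier psi (- xi) = cis ((- x) \<bullet> (- xi)) *s fourier (%y. E (- y)) (- xi)"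
   using fourier_shift[OF Rm, of "- x" "- xi"] by simp
  also have "fourier (%y. E (- y)) (- xi) = fourier E xi"
   using fourier_reflect[OF schwartz_measurable[OF E], of "- xi"] by simp
  also have "fourier E xi = c *R (scalar_fourier eta xi *s v)" unfolding E_def[abs_def] c_def by (rule fourier_scalar[OF eta])
  finally show ?thesis by (simp add: scaleR_eq_smult)
 qed
 have "cdot (convolution eta f x) v = (INTG y. cdot (eta (x - y) *R f y) v)"
  unfolding convolution_def
  by (rule integral_bounded_linear'[OF bounded_bilinear.bounded_linear_left[OF bilinear_cdot] convolution_integrable[OF f eta], symmetric])
 also have "... = reg f psi"
  by (simp add: regular_dist_def on_tests_def psi psi_def[symmetric])
   (simp add: psi_def bounded_bilinear.scaleR_left[OF bilinear_cdot] bounded_bilinear.scaleR_right[OF bilinear_cdot])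
 also have "... = (INTG xi. cdot (g xi) (fourier psi (- xi)))" unfolding fg by (rule of_rep_schwartz[OF psi])
 also have "... = (INTG xi. of_real c * cdot (cis (- (xi \<bullet> (- x))) *s W xi) v)"
  unfolding Fpsi W_def by (simp add: cdot_smult inner_commute[of x] mult_ac)
 also have "... = of_real c * (INTG xi. cdot (cis (- (xi \<bullet> (- x))) *s W xi) v)" by (rule integral_mult_right_zero)
 also have "(INTG xi. cdot (cis (- (xi \<bullet> (- x))) *s W xi) v) = cdot (INTG xi. cis (- (xi \<bullet> (- x))) *s W xi) v"
  by (rule integral_bounded_linear'[OF bounded_bilinear.bounded_linear_left[OF bilinear_cdot] integrable_cis[OF W]])
 also have "of_real c * ... = cdot (fourier W (- x)) v"
  unfolding fourier_def c_def[symmetric] by (simp add: scaleR_eq_smult cdot_smult)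
 finally show "cdot (convolution eta f x) v = cdot (fourier W (- x)) v" .
qed
show ?thesis
proof
 fix psi :: "('n, 'm) vfun"
 show "reg (convolution eta f) psi = of_rep (%xi. scalar_fourier eta xi *s g xi) psi"
 proof (cases "psi : schwartz")
  case True
  have psi': "(%x. psi (- x)) : schwartz" by (rule schwartz_reflect[OF True])
  have fm: "fourier W : lmeas"
  proof -
   have "(%x. fourier W (- x)) : lmeas"
    unfolding conv[symmetric] by (rule smooth_measurable[OF convolution_smooth[OF f eta]])
   from measurable_lebesgue_affine[OF this, of "-1" 0] show ?thesis by simp
  qed
  have m: "(%x. cdot (fourier W x) (psi (- x))) : lmeas"
   by (rule bilinear_measurable[OF bilinear_cdot fm schwartz_measurable[OF psi']])
  have "reg (convolution eta f) psi = (INTG x. cdot (fourier W (- x)) (psi x))"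
   using True by (simp add: regular_dist_def on_tests_def conv)
  also have "... = (INTG x. cdot (fourier W x) (psi (- x)))" using lebesgue_integral_reflect[OF m] by simp
  also have "... = (INTG x. cdot (W x) (fourier (%x. psi (- x)) x))"
   by (rule fourier_symmetric[OF W schwartz_integrable[OF psi']])
  also have "... = (INTG x. cdot (W x) (fourier psi (- x)))"
   by (simp add: fourier_reflect[OF schwartz_measurable[OF True]])
  finally show ?thesis by (simp add: of_rep_schwartz[OF True] W_def)
 qed (simp add: regular_dist_def of_rep_def on_tests_def)
qed
qed

text \<open>A unit mass concentrated near the origin.\<close>

lemma mollifier_exists:
fixes \<delta> :: real
assumes "\<delta> > 0"
obtains eta :: "real^'n => real" where "eta : schwartz" "!!x. 0 <= eta x" "(INTG x. eta x) = 1" "!!x. eta x ~= 0 ==> norm x <= \<delta>"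
proof -
define eps where "eps = \<delta> / real CARD('n)"
have eps: "eps > 0" using assms by (simp add: eps_def)
define a :: "real^'n" where "a = (\<chi> j. eps)"
define om :: "real^'n => real" where "om = box_bump 1 (- a) a"
have om: "om : schwartz" unfolding om_def using box_bump_test[of 1 "- a" a] test_functions_subset_schwartz by auto
have om0: "0 <= om x" for x unfolding om_def by (rule box_bump_bounds)
have omp: "om x > 0 \<longleftrightarrow> x : box (- a) a" for x unfolding om_def by (rule box_bump_pos) simp
have i: "integrable lebesgue om" by (rule schwartz_integrable[OF om])
have "(INTG x. om x) ~= 0"
proof
 assume "(INTG x. om x) = 0"
 then have "AE x in lebesgue. om x = 0" using integral_nonneg_eq_0_iff_AE[OF i] om0 by simp
 then obtain N where N: "N : null_sets lebesgue" "{x. om x ~= 0} \<subseteq> N" by (auto simp: eventually_ae_filter)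
 have sub: "box (- a) a \<subseteq> {x. om x ~= 0}"
 proof
  fix x assume "x : box (- a) a"
  then have "om x > 0" by (simp only: omp)
  then show "x : {x. om x ~= 0}" by simp
 qed
 have "negligible (box (- a) a)" by (rule negligible_subset[of N]) (use N sub in \<open>auto simp: negligible_iff_null_sets\<close>)
 moreover have "0 : box (- a) a" using eps by (simp add: mem_box_cart a_def)
 ultimately show False using open_not_negligible[OF open_box, of "- a" a] by auto
qed
moreover have "0 <= (INTG x. om x)" by (rule integral_nonneg_AE) (simp add: om0)
ultimately have I: "(INTG x. om x) > 0" by simp
define eta where "eta x = inverse (INTG x. om x) *R om x" for x
show ?thesis
proof (rule that[of eta])
 show "eta : schwartz" unfolding eta_def[abs_def] by (rule schwartz_linear_image[OF bounded_linear_scaleR_right om])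
 show "0 <= eta x" for x using I om0 by (simp add: eta_def)
 show "(INTG x. eta x) = 1" using I by (simp add: eta_def[abs_def])
 show "norm x <= \<delta>" if "eta x ~= 0" for x
 proof -
  have "x : box (- a) a" using that omp[of x] om0[of x] by (auto simp: eta_def less_le)
  then have j: "\<bar>x $ j\<bar> <= eps" for j unfolding mem_box_cart a_def by (simp add: abs_le_iff) (metis less_imp_le minus_le_iff)
  have "norm x <= (\<Sum>j\<in>(UNIV::'n set). \<bar>x $ j\<bar>)" by (rule norm_le_l1_cart)
  also have "... <= (\<Sum>j\<in>(UNIV::'n set). eps)" by (rule sum_mono[OF j])
  finally have "norm x <= (\<Sum>j\<in>(UNIV::'n set). eps)" .
  then show ?thesis by (simp add: eps_def)
 qed
qed
qed

lemma scalar_fourier_near_1: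
fixes eta :: "real^'n => real"
assumes eta: "eta : schwartz" "!!x. 0 <= eta x" "(INTG x. eta x) = 1" "!!x. eta x ~= 0 ==> norm x <= \<delta>"
shows "cmod (scalar_fourier eta xi - 1) <= 2 * \<delta> * norm xi" "cmod (scalar_fourier eta xi) <= 1"
proof -
have ir: "integrable lebesgue eta" by (rule schwartz_integrable[OF eta(1)])
have ic: "integrable lebesgue (%x. of_real (eta x) :: complex)" using ir by (rule integrable_of_real)
have 1: "(INTG x. (of_real (eta x) :: complex)) = 1" using eta(3) by simp
have "(INTG z. (ek z xi - 1) * of_real (eta z)) = (INTG z. ek z xi * of_real (eta z)) - (INTG z. of_real (eta z))"
 unfolding left_diff_distrib mult_1 by (rule Bochner_Integration.integral_diff[OF cis_scalar_integrable[OF eta(1)] ic])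
then have d: "scalar_fourier eta xi - 1 = (INTG z. (ek z xi - 1) * of_real (eta z))"
 by (simp only: 1 scalar_fourier_def)
have "cmod (scalar_fourier eta xi - 1) <= (INTG z. cmod ((ek z xi - 1) * of_real (eta z)))"
 unfolding d by (rule integral_norm_bound)
also have "... <= (INTG z. (2 * \<delta> * norm xi) * eta z)"
proof (rule integral_mono)
 show "integrable lebesgue (%z. cmod ((ek z xi - 1) * of_real (eta z)))"
  unfolding left_diff_distrib mult_1 by (intro integrable_norm Bochner_Integration.integrable_diff cis_scalar_integrable eta ic)
 show "integrable lebesgue (%z. (2 * \<delta> * norm xi) * eta z)" using ir by simp
 show "cmod ((ek z xi - 1) * of_real (eta z)) <= (2 * \<delta> * norm xi) * eta z" for z
 proof (cases "eta z = 0")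
  case False
  have "(cmod (ek z xi - 1))^2 <= 4 * (- (z \<bullet> xi))^2" using cmod_cis_diff_le[of "- (z \<bullet> xi)"] by linarith
  also have "... = (2 * \<bar>z \<bullet> xi\<bar>)^2" by (simp add: power_mult_distrib)
  finally have "cmod (ek z xi - 1) <= 2 * \<bar>z \<bullet> xi\<bar>" by (rule power2_le_imp_le) simp
  also have "... <= 2 * (norm z * norm xi)" using Cauchy_Schwarz_ineq2[of z xi] by simp
  also have "... <= 2 * \<delta> * norm xi" using mult_right_mono[OF eta(4)[OF False] norm_ge_zero[of xi]] by simp
  finally show ?thesis using eta(2)[of z] by (simp add: norm_mult mult_right_mono)
 qed simp
qed
also have "... = 2 * \<delta> * norm xi" using eta(3) by simp
finally show "cmod (scalar_fourier eta xi - 1) <= 2 * \<delta> * norm xi" .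
have "cmod (scalar_fourier eta xi) <= (INTG z. cmod (ek z xi * of_real (eta z)))"
 unfolding scalar_fourier_def by (rule integral_norm_bound)
then show "cmod (scalar_fourier eta xi) <= 1" using eta(2,3) by (simp add: norm_mult)
qed

text \<open>Mollification keeps the support close to the compact support of \<open>f\<close> and multiplies the Fourier
transform by a bounded function that tends to 1.\<close>

lemma compact_support_Hs_tilde:
fixes f g :: "('n::finite, 'm::finite) vfun"
assumes Om: "open Om" and K: "compact K" "K \<subseteq> Om" "!!x. x \<notin> K ==> f x = 0" and f: "integrable lebesgue f"
 and g: "g : Lw rho" and fg: "reg f = of_rep g"
shows "reg f : Hs_tilde Om rho"
proof -
obtain e where e: "e > 0" "(\<Union>x\<in>K. ball x e) \<subseteq> Om" using compact_subset_open_imp_ball_epsilon_subset[OF K(1) Om K(2)] .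
define \<delta> where "\<delta> k = min (e / 2) (inverse (real (Suc k)))" for k
have \<delta>: "\<delta> k > 0" "\<delta> k < e" "\<delta> k <= inverse (real (Suc k))" for k using e(1) by (simp_all add: \<delta>_def)
have "\<exists>eta :: real^'n => real. eta : schwartz & (\<forall>x. 0 <= eta x) & (INTG x. eta x) = 1 & (\<forall>x. eta x ~= 0 --> norm x <= \<delta> k)" for k
 using mollifier_exists[OF \<delta>(1)[of k]] by metis
then obtain eta :: "nat => real^'n => real" where eta: "!!k. eta k : schwartz" "!!k x. 0 <= eta k x" "!!k. (INTG x. eta k x) = 1"
 "!!k x. eta k x ~= 0 ==> norm x <= \<delta> k" by metis
define s where "s k = scalar_fourier (eta k)" for k
have s1: "cmod (s k xi) <= 1" "cmod (s k xi - 1) <= 2 * \<delta> k * norm xi" for k xi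
 unfolding s_def using scalar_fourier_near_1[OF eta(1)[of k] eta(2) eta(3) eta(4)] by blast+
have slim: "(%k. s k xi) ---> 1" for xi
proof -
 have l: "(%k. 2 * inverse (real (Suc k)) * norm xi) ---> 0"
  using tendsto_mult[OF tendsto_mult[OF tendsto_const[of 2] LIMSEQ_inverse_real_of_nat] tendsto_const[of "norm xi"]] by simp
 have b: "cmod (s k xi - 1) <= 2 * inverse (real (Suc k)) * norm xi" for k
  by (rule order_trans[OF s1(2) mult_right_mono[OF mult_left_mono[OF \<delta>(3)]]]) simp_all
 have "(%k. s k xi - 1) ---> 0" by (rule Lim_null_comparison[OF always_eventually[OF allI[OF b]] l])
 then show ?thesis by (simp add: LIM_zero_iff)
qed
have sm: "s k : lmeas" for k unfolding s_def by (rule schwartz_measurable[OF scalar_fourier_schwartz[OF eta(1)]])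
have gm: "g : lmeas" by (rule Lw_measurable[OF g])
have sgm: "(%xi. s k xi *s g xi) : lmeas" for k by (rule bilinear_measurable[OF bilinear_smult sm gm])
have sg: "(%xi. s k xi *s g xi) : Lw rho" for k
proof (rule Lw_bound(1)[OF g sgm, where C=1], rule AE_I2)
 show "(jb xi) powr (rho / 2) * norm (s k xi *s g xi) <= 1 * ((jb xi) powr (rho / 2) * norm (g xi))" for xi
  using mult_right_mono[OF s1(1)[of k xi] norm_ge_zero[of "g xi"]] by (simp add: norm_vector_smult mult_left_mono)
qed simp
have test: "convolution (eta k) f : test_functions Om" for k
proof (rule test_functions_supportI[OF convolution_smooth[OF f eta(1)]])
 show "compact {x + y | x y. x : K & y : cball 0 (\<delta> k)}" by (rule compact_sums[OF K(1) compact_cball])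
 show "{x. convolution (eta k) f x ~= 0} \<subseteq> {x + y | x y. x : K & y : cball 0 (\<delta> k)}"
 proof
  fix x assume "x : {x. convolution (eta k) f x ~= 0}"
  then have "\<exists>y. eta k (x - y) *R f y ~= 0" unfolding convolution_def by (metis (mono_tags, lifting) integral_zero mem_Collect_eq Bochner_Integration.integral_cong)
  then obtain y where y: "eta k (x - y) ~= 0" "f y ~= 0" by auto
  then have "y : K" "x - y : cball 0 (\<delta> k)" using K(3) eta(4) by auto
  then show "x : {x + y | x y. x : K & y : cball 0 (\<delta> k)}" by (intro CollectI exI[of _ y] exI[of _ "x - y"]) simp
 qed
 show "{x + y | x y. x : K & y : cball 0 (\<delta> k)} \<subseteq> Om"
 proof
  fix z assume "z : {x + y | x y. x : K & y : cball 0 (\<delta> k)}"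
  then obtain x y where z: "z = x + y" "x : K" "norm y <= \<delta> k" by auto
  then have "z : ball x e" using \<delta>(2)[of k] by (simp add: dist_norm)
  then show "z : Om" using z e(2) by blast
 qed
qed
have conv: "Hs_norm rho (diff_dist (reg f) (reg (convolution (eta k) f))) = wnorm rho (%xi. g xi - s k xi *s g xi)" for k
proof -
 have "diff_dist (reg f) (reg (convolution (eta k) f)) = of_rep (%xi. g xi - s k xi *s g xi)"
  unfolding convolution_of_rep[OF f eta(1) g fg] fg s_def[symmetric] by (rule of_rep_diff[OF g sg])
 then show ?thesis by (simp add: Hs_norm_of_rep[OF Lw_diff[OF g sg]])
qed
have lim: "(%k. wnorm rho (%xi. g xi - s k xi *s g xi)) ---> 0"
proof -
 have "(%k. INTG xi. (jb xi) powr rho * (norm (g xi - s k xi *s g xi))^2) ---> (\<integral>xi. 0 \<partial>(lebesgue :: (real^'n) measure))"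
 proof (rule integral_dominated_convergence[where w="%xi. 4 * ((jb xi) powr rho * (norm (g xi))^2)"])
  show "integrable lebesgue (%xi. 4 * ((jb xi) powr rho * (norm (g xi))^2))" using g by (simp add: Lw_iff)
  show "(%xi. (jb xi) powr rho * (norm (g xi - s k xi *s g xi))^2) : lmeas" for k
   using Lw_diff[OF g sg[of k]] unfolding Lw_iff by (blast intro: borel_measurable_integrable)
  have e: "norm (g xi - s k xi *s g xi) = cmod (s k xi - 1) * norm (g xi)" for k xi
  proof -
   have "g xi - s k xi *s g xi = (1 - s k xi) *s g xi" by (simp add: vector_sub_rdistrib)
   then show ?thesis unfolding norm_minus_commute[of "s k xi"] by (simp only: norm_vector_smult)
  qed
  show "AE xi in lebesgue. (%k. (jb xi) powr rho * (norm (g xi - s k xi *s g xi))^2) ---> 0"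
  proof (rule AE_I2)
   fix xi :: "real^'n"
   have "(%k. (jb xi) powr rho * (cmod (s k xi - 1) * norm (g xi))^2) ---> (jb xi) powr rho * (cmod (1 - 1) * norm (g xi))^2"
    by (intro tendsto_intros slim)
   then show "(%k. (jb xi) powr rho * (norm (g xi - s k xi *s g xi))^2) ---> 0" by (simp add: e)
  qed
  show "AE xi in lebesgue. norm ((jb xi) powr rho * (norm (g xi - s k xi *s g xi))^2) <= 4 * ((jb xi) powr rho * (norm (g xi))^2)" for k
  proof (rule AE_I2)
   fix xi :: "real^'n"
   have "cmod (s k xi - 1) <= 2" using norm_triangle_ineq4[of "s k xi" 1] s1(1)[of k xi] by simp
   then have "(cmod (s k xi - 1) * norm (g xi))^2 <= (2 * norm (g xi))^2" by (intro power_mono mult_right_mono) auto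
   then have "(norm (g xi - s k xi *s g xi))^2 <= 4 * (norm (g xi))^2" unfolding e by (simp add: power_mult_distrib)
   from mult_left_mono[OF this, of "(jb xi) powr rho"]
   show "norm ((jb xi) powr rho * (norm (g xi - s k xi *s g xi))^2) <= 4 * ((jb xi) powr rho * (norm (g xi))^2)"
    by (simp add: mult_ac)
  qed
 qed simp
 from tendsto_real_sqrt[OF this] show ?thesis by (simp add: wnorm_eq)
qed
show ?thesis unfolding Hs_tilde_def
proof (intro CollectI conjI allI impI)
 show "reg f : Hs rho" unfolding fg by (rule of_rep_Hs[OF g])
 fix eps :: real assume "eps > 0"
 then obtain k where "wnorm rho (%xi. g xi - s k xi *s g xi) < eps"
  using order_tendstoD(2)[OF lim] by (auto simp: eventually_sequentially)
 then show "\<exists>phi\<in>test_functions Om. Hs_norm rho (diff_dist (reg f) (reg phi)) < eps"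
  using test[of k] conv[of k] by (intro bexI[of _ "convolution (eta k) f"]) simp_all
qed
qed

section \<open>The duality pairing on Bessel potential spaces\<close>

text \<open>On the Fourier side the bilinear integral of two functions becomes the bilinear integral of one
transform with the reflection of the other.\<close>

definition pair :: "('n::finite, 'm::finite) vdist => ('n, 'm) vdist => complex" where
"pair U V = (INTG xi. cdot ((SOME g. fourier_rep U g) xi) ((SOME h. fourier_rep V h) (- xi)))"

lemma pair_of_rep:
fixes g h :: "('n::finite, 'm::finite) vfun"
assumes g: "g : Lw s" and h: "h : Lw t"
shows "pair (of_rep g) (of_rep h) = (INTG xi. cdot (g xi) (h (- xi)))"
proof -
have r: "fourier_rep (of_rep k) (SOME k'. fourier_rep (of_rep k) k')" "AE xi in lebesgue. (SOME k'. fourier_rep (of_rep k) k') xi = k xi"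
 if "k : Lw u" for k :: "('n, 'm) vfun" and u
proof -
 note k = fourier_rep_of_rep[OF that]
 show "fourier_rep (of_rep k) (SOME k'. fourier_rep (of_rep k) k')" by (rule someI[of "fourier_rep (of_rep k)", OF k])
 then show "AE xi in lebesgue. (SOME k'. fourier_rep (of_rep k) k') xi = k xi" using k by (rule fourier_rep_unique)
qed
have refl: "(%xi. k (- xi)) : lmeas" if "k : lmeas" for k :: "('n, 'm) vfun"
 using measurable_lebesgue_affine[OF that, of "-1" 0] by simp
note gm = fourier_rep_measurable[OF r(1)[OF g]] and hm = fourier_rep_measurable[OF r(1)[OF h]]
have hae: "AE xi in lebesgue. (SOME k'. fourier_rep (of_rep h) k') (- xi) = h (- xi)"
 using AE_lebesgue_affine[OF r(2)[OF h], of "-1" 0] by simp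
show ?thesis unfolding pair_def
proof (rule integral_cong_AE)
 show "AE xi in lebesgue. cdot ((SOME g'. fourier_rep (of_rep g) g') xi) ((SOME h'. fourier_rep (of_rep h) h') (- xi)) = cdot (g xi) (h (- xi))"
  using r(2)[OF g] hae by eventually_elim simp
qed (intro bilinear_measurable[OF bilinear_cdot] gm refl[OF hm] Lw_measurable[OF g] refl[OF Lw_measurable[OF h]])+
qed

lemma pair_bound:
assumes "U : Hs tau" "V : Hs (- tau)"
shows "cmod (pair U V) <= Hs_norm tau U * Hs_norm (- tau) V"
proof -
obtain g where g: "g : Lw tau" "U = of_rep g" "!!t. Hs_norm t U = wnorm t g" using HsE[OF assms(1)] by blast
obtain h where h: "h : Lw (- tau)" "V = of_rep h" "!!t. Hs_norm t V = wnorm t h" using HsE[OF assms(2)] by blast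
show ?thesis using Lw_cdot(2)[OF g(1) Lw_reflect(1)[OF h(1)]] Lw_reflect(2)[OF h(1)]
 unfolding g(3) h(3) unfolding g(2) h(2) pair_of_rep[OF g(1) h(1)] by simp
qed

lemma pair_commute:
assumes "U : Hs tau" "V : Hs (- tau)"
shows "pair U V = pair V U"
proof -
obtain g where g: "g : Lw tau" "U = of_rep g" using HsE[OF assms(1)] by metis
obtain h where h: "h : Lw (- tau)" "V = of_rep h" using HsE[OF assms(2)] by metis
have "(%xi. cdot (g xi) (h (- xi))) : lmeas"
 by (rule bilinear_measurable[OF bilinear_cdot Lw_measurable[OF g(1)] Lw_measurable[OF Lw_reflect(1)[OF h(1)]]])
from lebesgue_integral_reflect[OF this] show ?thesis
 unfolding g(2) h(2) pair_of_rep[OF g(1) h(1)] pair_of_rep[OF h(1) g(1)] by (simp add: cdot_commute[of "h _"])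
qed

lemma Hs_add:
assumes "U : Hs s" "V : Hs s"
shows "add_dist U V : Hs s" "Hs_norm s (add_dist U V) <= Hs_norm s U + Hs_norm s V"
proof -
obtain g where g: "g : Lw s" "U = of_rep g" "!!t. Hs_norm t U = wnorm t g" using HsE[OF assms(1)] by blast
obtain h where h: "h : Lw s" "V = of_rep h" "!!t. Hs_norm t V = wnorm t h" using HsE[OF assms(2)] by blast
have e: "add_dist U V = of_rep (%xi. g xi + h xi)" unfolding g(2) h(2) by (rule of_rep_add[OF g(1) h(1)])
show "add_dist U V : Hs s" unfolding e by (rule of_rep_Hs[OF Lw_add[OF g(1) h(1)]])
show "Hs_norm s (add_dist U V) <= Hs_norm s U + Hs_norm s V"
 unfolding e g(3) h(3) Hs_norm_of_rep[OF Lw_add[OF g(1) h(1)]] by (rule wnorm_triangle[OF g(1) h(1)])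
qed

lemma Hs_scale:
assumes "U : Hs s"
shows "scale_dist z U : Hs s" "Hs_norm s (scale_dist z U) <= cmod z * Hs_norm s U"
proof -
obtain g where g: "g : Lw s" "U = of_rep g" "!!t. Hs_norm t U = wnorm t g" using HsE[OF assms(1)] by blast
have e: "scale_dist z U = of_rep (%xi. z *s g xi)" unfolding g(2) by (rule of_rep_scale)
show "scale_dist z U : Hs s" unfolding e by (rule of_rep_Hs[OF Lw_smult(1)[OF g(1)]])
show "Hs_norm s (scale_dist z U) <= cmod z * Hs_norm s U"
 unfolding e g(3) Hs_norm_of_rep[OF Lw_smult(1)[OF g(1)]] by (rule Lw_smult(2)[OF g(1)])
qed

lemma diff_dist_eq: "diff_dist U V = add_dist U (scale_dist (- 1) V)"
by (simp add: diff_dist_def add_dist_def scale_dist_def)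

lemma Hs_diff: "U : Hs s ==> V : Hs s ==> diff_dist U V : Hs s"
unfolding diff_dist_eq by (intro Hs_add Hs_scale)

lemma Hs_norm_diff_triangle:
assumes "U : Hs s" "V : Hs s" "W : Hs s"
shows "Hs_norm s (diff_dist U W) <= Hs_norm s (diff_dist U V) + Hs_norm s (diff_dist V W)"
proof -
have "diff_dist U W = add_dist (diff_dist U V) (diff_dist V W)" by (simp add: diff_dist_def add_dist_def)
then show ?thesis using Hs_add(2)[OF Hs_diff[OF assms(1,2)] Hs_diff[OF assms(2,3)]] by simp
qed

lemma Hs_norm_nonneg: "0 <= Hs_norm s U"
unfolding Hs_norm_def by (intro real_sqrt_ge_zero integral_nonneg_AE) simp

lemma Hs_mono:
assumes "U : Hs t" "s <= t"
shows "U : Hs s" "Hs_norm s U <= Hs_norm t U"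
proof -
obtain g where g: "g : Lw t" "U = of_rep g" "!!t. Hs_norm t U = wnorm t g" using HsE[OF assms(1)] by blast
show "U : Hs s" unfolding g(2) by (rule of_rep_Hs[OF Lw_mono(1)[OF g(1) assms(2)]])
show "Hs_norm s U <= Hs_norm t U" unfolding g(3) by (rule Lw_mono(2)[OF g(1) assms(2)])
qed

lemma Hs_partial:
assumes "U : Hs s"
shows "partial_Rn j U : Hs (s - 1)" "Hs_norm (s - 1) (partial_Rn j U) <= Hs_norm s U"
proof -
obtain g where g: "g : Lw s" "U = of_rep g" "!!t. Hs_norm t U = wnorm t g" using HsE[OF assms(1)] by blast
note L = Lw_coord[OF g(1), of j]
show "partial_Rn j U : Hs (s - 1)" unfolding g(2) of_rep_partial by (rule of_rep_Hs[OF L(1)])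
show "Hs_norm (s - 1) (partial_Rn j U) <= Hs_norm s U"
 using L(2) unfolding g(3) unfolding g(2) of_rep_partial Hs_norm_of_rep[OF L(1)] .
qed

lemma Hs_conj:
assumes "U : Hs s"
shows "conj_dist U : Hs s" "Hs_norm s (conj_dist U) = Hs_norm s U"
proof -
obtain g where g: "g : Lw s" "U = of_rep g" "!!t. Hs_norm t U = wnorm t g" using HsE[OF assms(1)] by blast
note r = Lw_reflect[OF g(1)]
have e: "conj_dist U = of_rep (%xi. conj_vec (g (- xi)))" unfolding g(2) by (rule of_rep_conj[OF Lw_measurable[OF g(1)]])
have L: "(%xi. conj_vec (g (- xi))) : Lw s"
 using r(1) linear_measurable[OF bounded_linear_conj_vec Lw_measurable[OF r(1)]] by (simp add: Lw_iff)
show "conj_dist U : Hs s" unfolding e by (rule of_rep_Hs[OF L])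
show "Hs_norm s (conj_dist U) = Hs_norm s U"
 unfolding e g(3) Hs_norm_of_rep[OF L] using r(2) by (simp add: wnorm_eq)
qed

lemma conj_dist_conj_dist [simp]: "conj_dist (conj_dist U) = U"
by (simp add: conj_dist_def)

lemma pair_add_left:
assumes "U : Hs tau" "U' : Hs tau" "V : Hs (- tau)"
shows "pair (add_dist U U') V = pair U V + pair U' V"
proof -
obtain g where g: "g : Lw tau" "U = of_rep g" using HsE[OF assms(1)] by metis
obtain g' where g': "g' : Lw tau" "U' = of_rep g'" using HsE[OF assms(2)] by metis
obtain h where h: "h : Lw (- tau)" "V = of_rep h" using HsE[OF assms(3)] by metis
note i = Lw_cdot(1)[OF _ Lw_reflect(1)[OF h(1)]]
show ?thesis
 unfolding g(2) g'(2) h(2) of_rep_add[OF g(1) g'(1)] pair_of_rep[OF Lw_add[OF g(1) g'(1)] h(1)] pair_of_rep[OF g(1) h(1)] pair_of_rep[OF g'(1) h(1)]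
  bounded_bilinear.add_left[OF bilinear_cdot]
 by (rule Bochner_Integration.integral_add[OF i[OF g(1)] i[OF g'(1)]])
qed

lemma pair_scale_left:
assumes "U : Hs tau" "V : Hs (- tau)"
shows "pair (scale_dist z U) V = z * pair U V"
proof -
obtain g where g: "g : Lw tau" "U = of_rep g" using HsE[OF assms(1)] by metis
obtain h where h: "h : Lw (- tau)" "V = of_rep h" using HsE[OF assms(2)] by metis
show ?thesis
 unfolding g(2) h(2) of_rep_scale pair_of_rep[OF Lw_smult(1)[OF g(1)] h(1)] pair_of_rep[OF g(1) h(1)] by (simp add: cdot_smult)
qed

lemma pair_add_right:
assumes "U : Hs tau" "V : Hs (- tau)" "V' : Hs (- tau)"
shows "pair U (add_dist V V') = pair U V + pair U V'"
using pair_add_left[of V "- tau" V' U] assms pair_commute[of U tau] Hs_add(1)[OF assms(2,3)] by simp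

lemma pair_scale_right:
assumes "U : Hs tau" "V : Hs (- tau)"
shows "pair U (scale_dist z V) = z * pair U V"
using pair_scale_left[of V "- tau" U z] assms pair_commute[of U tau] Hs_scale(1)[OF assms(2)] by simp

lemma pair_diff_right:
assumes "U : Hs tau" "V : Hs (- tau)" "V' : Hs (- tau)"
shows "pair U (diff_dist V V') = pair U V - pair U V'"
unfolding diff_dist_eq by (simp add: pair_add_right[OF assms(1,2) Hs_scale(1)[OF assms(3)]] pair_scale_right[OF assms(1,3)])

lemma pair_partial:
assumes "U : Hs tau" "V : Hs (1 - tau)"
shows "pair (partial_Rn j U) V = - pair U (partial_Rn j V)"
proof -
obtain g where g: "g : Lw tau" "U = of_rep g" using HsE[OF assms(1)] by metis
obtain h where h: "h : Lw (1 - tau)" "V = of_rep h" using HsE[OF assms(2)] by metis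
show ?thesis
 unfolding g(2) h(2) of_rep_partial pair_of_rep[OF Lw_coord(1)[OF g(1)] h(1)] pair_of_rep[OF g(1) Lw_coord(1)[OF h(1)]]
 by (simp add: cdot_smult bounded_bilinear.minus_right[OF bilinear_cdot])
qed

lemma pair_conj:
assumes "U : Hs tau" "V : Hs (- tau)"
shows "pair (conj_dist U) (conj_dist V) = cnj (pair U V)"
proof -
obtain g where g: "g : Lw tau" "U = of_rep g" using HsE[OF assms(1)] by metis
obtain h where h: "h : Lw (- tau)" "V = of_rep h" using HsE[OF assms(2)] by metis
have L: "(%xi. conj_vec (k (- xi))) : Lw s" if "k : Lw s" for k s
 using Lw_reflect(1)[OF that] linear_measurable[OF bounded_linear_conj_vec Lw_measurable[OF Lw_reflect(1)[OF that]]] by (simp add: Lw_iff)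
have "pair (conj_dist U) (conj_dist V) = (INTG xi. cnj (cdot (g (- xi)) (h xi)))"
 unfolding g(2) h(2) of_rep_conj[OF Lw_measurable[OF g(1)]] of_rep_conj[OF Lw_measurable[OF h(1)]] pair_of_rep[OF L[OF g(1)] L[OF h(1)]]
 by (simp add: cdot_conj_vec)
also have "... = cnj (INTG xi. cdot (h xi) (g (- xi)))" by (simp add: cdot_commute[of "h _"])
also have "... = cnj (pair V U)" unfolding g(2) h(2) pair_of_rep[OF h(1) g(1)] ..
finally show ?thesis using pair_commute[OF assms] by simp
qed

lemma regular_schwartz_Hs: "phi : schwartz ==> reg phi : Hs s" for phi :: "('n::finite, 'm::finite) vfun"
unfolding regular_dist_Schwartz by (intro of_rep_Hs schwartz_Lw fourier_schwartz)

lemma pair_regular: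
fixes U :: "('n::finite, 'm::finite) vdist"
assumes "U : Hs tau" "phi : schwartz"
shows "pair U (reg phi) = U phi"
proof -
obtain g where g: "g : Lw tau" "U = of_rep g" using HsE[OF assms(1)] by metis
show ?thesis
 unfolding g(2) regular_dist_Schwartz[OF assms(2)] pair_of_rep[OF g(1) schwartz_Lw[OF fourier_schwartz[OF assms(2)], of 0]]
 by (simp add: of_rep_schwartz[OF assms(2)])
qed

lemma regular_L2_Hs_0: "f : LL ==> reg f : Hs 0"
using regular_dist_Hs_iff(1)[of f 0] ft(1)[of f] by (simp add: Hs_0_L2)

lemma pair_L2:
fixes f h :: "('n::finite, 'm::finite) vfun"
assumes f: "f : LL" and h: "h : LL"
shows "pair (reg f) (reg h) = (INTG x. cdot (f x) (h x))"
proof -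
have "h : Lw 0" using h by (simp add: Hs_0_L2)
then obtain phi where phi: "!!k::nat. phi k : schwartz" "(%k. wnorm 0 (%x. h x - phi k x)) ---> 0" using schwartz_dense_Lw by blast
have L: "(%k. L2n (%x. h x - phi k x)) ---> 0" using phi(2) by (simp add: Hs_0_L2)
note U = regular_L2_Hs_0[OF f] and V = regular_L2_Hs_0[OF h]
have 1: "(%k. INTG x. cdot (f x) (phi k x)) ---> (INTG x. cdot (f x) (h x))"
 unfolding cdot_commute[of "f _"] by (rule L2_cdot_tendsto[OF schwartz_L2[OF phi(1)] h f L])
have e: "(INTG x. cdot (f x) (phi k x)) = pair (reg f) (reg (phi k))" for k
 unfolding pair_regular[OF U phi(1)] by (simp add: regular_dist_def on_tests_def phi(1))
have b: "norm (pair (reg f) (reg h) - pair (reg f) (reg (phi k)))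
  <= Hs_norm 0 (reg f) * L2n (%x. h x - phi k x)" for k
proof -
 note R = regular_schwartz_Hs[OF phi(1)[of k], of 0]
 have d: "(%x. h x - phi k x) : LL" by (intro L2_diff h schwartz_L2 phi)
 have "pair (reg f) (reg h) - pair (reg f) (reg (phi k))
  = pair (reg f) (diff_dist (reg h) (reg (phi k)))"
  using pair_diff_right[OF U] V R by simp
 also have "diff_dist (reg h) (reg (phi k)) = reg (%x. h x - phi k x)"
  by (rule regular_dist_diff[OF h schwartz_L2[OF phi(1)]])
 finally show ?thesis using pair_bound[OF U, of "reg (%x. h x - phi k x)"] regular_L2_Hs_0[OF d]
  regular_dist_Hs_iff(2)[OF d, of 0] L2norm_ft[OF d] by (simp add: Hs_0_L2)
qed
have "(%k. Hs_norm 0 (reg f) * L2n (%x. h x - phi k x)) ---> 0"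
 using tendsto_mult[OF tendsto_const L, of "Hs_norm 0 (reg f)"] by simp
then have "(%k. pair (reg f) (reg h) - pair (reg f) (reg (phi k))) ---> 0"
 by (rule Lim_null_comparison[OF always_eventually[OF allI[OF b]]])
then have "(%k. pair (reg f) (reg h) - (INTG x. cdot (f x) (phi k x))) ---> 0" unfolding e .
from tendsto_diff[OF tendsto_const[of "pair (reg f) (reg h)"] this]
have "(%k. INTG x. cdot (f x) (phi k x)) ---> pair (reg f) (reg h)" by simp
then show ?thesis using 1 by (rule LIMSEQ_unique)
qed

lemma schwartz_dense_Hs:
assumes "U : Hs s"
obtains phi where "!!k::nat. phi k : schwartz" "(%k. Hs_norm s (diff_dist U (reg (phi k)))) ---> 0"
proof -
obtain g where g: "g : Lw s" "U = of_rep g" using HsE[OF assms(1)] by metis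
obtain om where om: "!!k::nat. om k : schwartz" "(%k. wnorm s (%x. g x - om k x)) ---> 0" using schwartz_dense_Lw[OF g(1)] by blast
define phi where "phi k x = fourier (om k) (- x)" for k x
have phi: "phi k : schwartz" "fourier (phi k) = om k" for k unfolding phi_def[abs_def] using fourier_surj[OF om(1)[of k]] by simp_all
show ?thesis
proof (rule that[OF phi(1)])
 have "Hs_norm s (diff_dist U (reg (phi k))) = wnorm s (%x. g x - om k x)" for k
  unfolding g(2) regular_dist_Schwartz[OF phi(1)] phi(2) of_rep_diff[OF g(1) schwartz_Lw[OF om(1)]]
  by (rule Hs_norm_of_rep[OF Lw_diff[OF g(1) schwartz_Lw[OF om(1)]]])
 then show "(%k. Hs_norm s (diff_dist U (reg (phi k)))) ---> 0" using om(2) by simp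
qed
qed

lemma pair_tendsto:
assumes U: "U : Hs tau" and V: "V : Hs (- tau)" and F: "!!k. F k : Hs (- tau)"
 and lim: "(%k. Hs_norm (- tau) (diff_dist V (F k))) ---> 0"
shows "(%k. pair U (F k)) ---> pair U V"
proof -
have l: "(%k. Hs_norm tau U * Hs_norm (- tau) (diff_dist V (F k))) ---> 0" using tendsto_mult[OF tendsto_const lim, of "Hs_norm tau U"] by simp
have b: "norm (pair U V - pair U (F k)) <= Hs_norm tau U * Hs_norm (- tau) (diff_dist V (F k))" for k
 using pair_bound[OF U Hs_diff[OF V F[of k]]] pair_diff_right[OF U V F[of k]] by simp
have "(%k. pair U V - pair U (F k)) ---> 0" by (rule Lim_null_comparison[OF always_eventually[OF allI[OF b]] l])
from tendsto_diff[OF tendsto_const[of "pair U V"] this] show ?thesis by simp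
qed

section \<open>Multiplication operators\<close>

text \<open>A coefficient which, together with its transpose, acts on the Bessel potential spaces of order
\<open>rho\<close> and \<open>- rho\<close>.\<close>

definition coeff_order :: "real => ('n::finite, 'm::finite) mfun => bool" where
"coeff_order rho G \<longleftrightarrow> multiplier \<bar>rho\<bar> G & multiplier \<bar>rho\<bar> (trp G)"

definition mult_dist :: "('n::finite, 'm::finite) mfun => ('n, 'm) vdist => ('n, 'm) vdist" where
"mult_dist G U = on_tests schwartz (%phi. pair U (reg (%x. transpose (G x) *v phi x)))"

declare transpose_matrix_vector [simp del]

lemma coeff_order_transpose: "coeff_order rho G ==> coeff_order rho (trp G)"
by (simp add: coeff_order_def)

lemma coeff_order_minus: "coeff_order (- rho) G \<longleftrightarrow> coeff_order rho G"
by (simp add: coeff_order_def)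

lemma coeff_order_Linfty: "coeff_order rho G ==> G : Linfty"
unfolding coeff_order_def using multiplier_Linfty by blast

lemma cdot_transpose: "cdot u (transpose A *v w) = cdot (A *v u) w"
unfolding cdot_def matrix_vector_mult_def transpose_def
by (simp add: sum_distrib_left sum_distrib_right mult_ac) (rule sum.swap)

lemma multiplier_regular:
fixes G :: "('n::finite, 'm::finite) mfun"
assumes "multiplier t G"
obtains C where "0 <= C" "!!f s. f : LL ==> reg f : Hs t ==>
  reg (%x. G x *v f x) : Hs t & Hs_norm t (reg (%x. G x *v f x)) <= C * Hs_norm t (reg f)"
proof -
obtain C where C: "0 <= C" "!!f. f : LL ==> ft f : Lw t ==> ft (%x. G x *v f x) : Lw t"
 "!!f. f : LL ==> ft f : Lw t ==> wnorm t (ft (%x. G x *v f x)) <= C * wnorm t (ft f)" using multiplierE[OF assms] by blast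
show ?thesis
proof (rule that[OF C(1)])
 fix f :: "('n, 'm) vfun" assume f: "f : LL" "reg f : Hs t"
 have Gf: "(%x. G x *v f x) : LL" by (rule mult_L2[OF multiplier_Linfty[OF assms] f(1)])
 have ff: "ft f : Lw t" using f regular_dist_Hs_iff(1) by blast
 show "reg (%x. G x *v f x) : Hs t & Hs_norm t (reg (%x. G x *v f x)) <= C * Hs_norm t (reg f)"
  unfolding regular_dist_Hs_iff(1)[OF Gf] regular_dist_Hs_iff(2)[OF Gf] regular_dist_Hs_iff(2)[OF f(1)]
  using C(2,3)[OF f(1) ff] by blast
qed
qed

lemma coeff_regular_Hs:
fixes G :: "('n::finite, 'm::finite) mfun"
assumes G: "coeff_order rho G" and phi: "phi : schwartz" and \<sigma>: "\<sigma> <= \<bar>rho\<bar>"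
shows "reg (%x. G x *v phi x) : Hs \<sigma>"
proof -
have m: "multiplier \<bar>rho\<bar> G" using G by (simp add: coeff_order_def)
obtain C where C: "0 <= C" "!!f s. f : LL ==> reg f : Hs \<bar>rho\<bar> ==>
  reg (%x. G x *v f x) : Hs \<bar>rho\<bar> & Hs_norm \<bar>rho\<bar> (reg (%x. G x *v f x)) <= C * Hs_norm \<bar>rho\<bar> (reg f)"
 using multiplier_regular[OF m] by blast
show ?thesis using C(2)[OF schwartz_L2[OF phi] regular_schwartz_Hs[OF phi]] Hs_mono(1)[OF _ \<sigma>] by blast
qed

lemma mult_dist_regular:
fixes G :: "('n::finite, 'm::finite) mfun"
assumes G: "G : Linfty" "(trp G) : Linfty" and f: "f : LL"
shows "mult_dist G (reg f) = reg (%x. G x *v f x)"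
proof
fix phi :: "('n, 'm) vfun"
show "mult_dist G (reg f) phi = reg (%x. G x *v f x) phi"
proof (cases "phi : schwartz")
 case True
 have "mult_dist G (reg f) phi = pair (reg f) (reg (%x. transpose (G x) *v phi x))"
  by (simp only: mult_dist_def on_tests_def True if_True)
 also have "... = (INTG x. cdot (f x) (transpose (G x) *v phi x))" by (rule pair_L2[OF f mult_L2[OF G(2) schwartz_L2[OF True]]])
 also have "... = reg (%x. G x *v f x) phi" by (simp only: cdot_transpose regular_dist_def on_tests_def True if_True)
 finally show ?thesis .
qed (simp add: mult_dist_def regular_dist_def on_tests_def)
qed

text \<open>A distribution that is bounded in the norm of $H^{-s}$ belongs to $H^s$. This is how products of
negative order are recognised.\<close>

lemma Hs_Riesz:
fixes l :: "('n::finite, 'm::finite) vfun => complex"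
assumes add: "!!f g. f : schwartz ==> g : schwartz ==> l (%x. f x + g x) = l f + l g"
 and smult: "!!f z. f : schwartz ==> l (%x. z *s f x) = z * l f"
 and bound: "!!f. f : schwartz ==> cmod (l f) <= K * Hs_norm (- s) (reg f)"
shows "on_tests schwartz l : Hs s" "Hs_norm s (on_tests schwartz l) <= \<bar>K\<bar>"
proof -
define l' where "l' om = l (fourier om)" for om
have a: "l' (%x. f x + g x) = l' f + l' g" if "f : schwartz" "g : schwartz" for f g
proof -
 have "fourier (%x. f x + g x) = (%xi. fourier f xi + fourier g xi)" using that by (intro ext fourier_add schwartz_integrable)
 then show ?thesis unfolding l'_def using add[OF fourier_schwartz[OF that(1)] fourier_schwartz[OF that(2)]] by simp
qed
have b: "l' (%x. z *s f x) = z * l' f" if "f : schwartz" for f z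
proof -
 have "fourier (%x. z *s f x) = (%xi. z *s fourier f xi)" using that by (intro ext fourier_smult schwartz_integrable)
 then show ?thesis unfolding l'_def using smult[OF fourier_schwartz[OF that]] by simp
qed
have c: "cmod (l' f) <= K * wnorm (- s) f" if f: "f : schwartz" for f
proof -
 have "Hs_norm (- s) (reg (fourier f)) = wnorm (- s) (fourier (fourier f))"
  unfolding regular_dist_Schwartz[OF fourier_schwartz[OF f]] by (intro Hs_norm_of_rep[of _ 0] schwartz_Lw fourier_schwartz f)
 also have "... = wnorm (- s) f" using Lw_reflect(2)[OF schwartz_Lw[OF f]] fourier_fourier[OF f] by presburger
 finally show ?thesis unfolding l'_def using bound[OF fourier_schwartz[OF f]] by simp
qed
have "\<exists>g phi. g : Lw (- (- s)) & wnorm (- (- s)) g <= \<bar>K\<bar> & (\<forall>f\<in>schwartz. l' f = (INTG x. cdot (g x) (f x))) &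
 (\<forall>k::nat. phi k : schwartz) & (%k. wnorm (- s) (%x. phi k x - wt (- 2 * (- s)) (%x. conj_vec (g x)) x)) ---> 0"
 by (rule Lw_Riesz; (rule a b c; assumption)?)
then obtain g where g: "g : Lw (- (- s))" "wnorm (- (- s)) g <= \<bar>K\<bar>" "\<forall>f\<in>schwartz. l' f = (INTG x. cdot (g x) (f x))"
 by (elim exE conjE) (rule that)
have e: "on_tests schwartz l = of_rep g"
proof
 fix psi :: "('n, 'm) vfun"
 show "on_tests schwartz l psi = of_rep g psi"
 proof (cases "psi : schwartz")
  case True
  have "l psi = l' (%x. fourier psi (- x))" unfolding l'_def fourier_surj(1)[OF True] ..
  also have "... = (INTG x. cdot (g x) (fourier psi (- x)))" using g(3) fourier_surj(2)[OF True] by blast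
  finally show ?thesis using True by (simp add: of_rep_schwartz on_tests_def)
 qed (simp add: of_rep_def on_tests_def)
qed
have g': "g : Lw s" using g(1) by simp
show "on_tests schwartz l : Hs s" unfolding e by (rule of_rep_Hs[OF g'])
show "Hs_norm s (on_tests schwartz l) <= \<bar>K\<bar>" unfolding e Hs_norm_of_rep[OF g'] using g(2) by simp
qed

text \<open>For nonnegative order multiplication is multiplication of square integrable functions, for
negative order it is the transpose of such a multiplication.\<close>

lemma mult_dist_Hs:
fixes G :: "('n::finite, 'm::finite) mfun"
assumes G: "coeff_order rho G"
obtains C where "0 <= C" "!!U. U : Hs rho ==> mult_dist G U : Hs rho"
 "!!U. U : Hs rho ==> Hs_norm rho (mult_dist G U) <= C * Hs_norm rho U"
proof (cases "0 <= rho")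
case True
have m: "multiplier rho G" using G True by (simp add: coeff_order_def)
have inf: "G : Linfty" "(trp G) : Linfty" using G by (auto simp: coeff_order_def multiplier_Linfty)
obtain C where C: "0 <= C" "!!f s. f : LL ==> reg f : Hs rho ==>
  reg (%x. G x *v f x) : Hs rho & Hs_norm rho (reg (%x. G x *v f x)) <= C * Hs_norm rho (reg f)"
 using multiplier_regular[OF m] by blast
have "mult_dist G U : Hs rho & Hs_norm rho (mult_dist G U) <= C * Hs_norm rho U" if U: "U : Hs rho" for U
proof -
 obtain g where g: "g : Lw rho" "U = of_rep g" using HsE[OF U] by metis
 have "g : LL" using Lw_mono(1)[OF g(1) True] by (simp add: Hs_0_L2)
 then have "\<exists>f. f : LL & reg f = of_rep g" by (rule L2_inverse_fourier_exists) (intro exI conjI)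
 then obtain f where f: "f : LL" "reg f = of_rep g" by blast
 then have Uf: "U = reg f" using g by simp
 show ?thesis unfolding Uf mult_dist_regular[OF inf f(1)] using C(2)[OF f(1)] U Uf by blast
qed
then show ?thesis using that[OF C(1)] by blast
next
case False
have m: "multiplier (- rho) (trp G)" using G False by (simp add: coeff_order_def)
obtain C where C: "0 <= C" "!!f s. f : LL ==> reg f : Hs (- rho) ==>
  reg (%x. transpose (G x) *v f x) : Hs (- rho) & Hs_norm (- rho) (reg (%x. transpose (G x) *v f x)) <= C * Hs_norm (- rho) (reg f)"
 using multiplier_regular[OF m] by blast
have inf: "(trp G) : Linfty" by (rule multiplier_Linfty[OF m])
have "mult_dist G U : Hs rho & Hs_norm rho (mult_dist G U) <= C * Hs_norm rho U" if U: "U : Hs rho" for U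
proof -
 define l where "l phi = pair U (reg (%x. transpose (G x) *v phi x))" for phi
 have R: "reg (%x. transpose (G x) *v phi x) : Hs (- rho)" if "phi : schwartz" for phi
  using C(2)[OF schwartz_L2[OF that] regular_schwartz_Hs[OF that]] by blast
 have 1: "l (%x. f x + g x) = l f + l g" if "f : schwartz" "g : schwartz" for f g
  unfolding l_def matrix_vector_right_distrib
   regular_dist_add[OF mult_L2[OF inf schwartz_L2[OF that(1)]] mult_L2[OF inf schwartz_L2[OF that(2)]], symmetric]
  by (rule pair_add_right[OF U R[OF that(1)] R[OF that(2)]])
 have 2: "l (%x. z *s f x) = z * l f" if "f : schwartz" for f z
 proof -
  have "reg (%x. transpose (G x) *v (z *s f x)) = scale_dist z (reg (%x. transpose (G x) *v f x))"
   by (auto simp: fun_eq_iff regular_dist_def on_tests_def scale_dist_def vector_scalar_commute cdot_smult)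
  then show ?thesis unfolding l_def by (simp only: pair_scale_right[OF U R[OF that]])
 qed
 have 3: "cmod (l f) <= (Hs_norm rho U * C) * Hs_norm (- rho) (reg f)" if "f : schwartz" for f
 proof -
  have "cmod (l f) <= Hs_norm rho U * Hs_norm (- rho) (reg (%x. transpose (G x) *v f x))"
   unfolding l_def by (rule pair_bound[OF U R[OF that]])
  also have "... <= Hs_norm rho U * (C * Hs_norm (- rho) (reg f))"
   using C(2)[OF schwartz_L2[OF that] regular_schwartz_Hs[OF that]] by (intro mult_left_mono Hs_norm_nonneg) blast
  finally show ?thesis by (simp only: mult.assoc)
 qed
 have e: "mult_dist G U = on_tests schwartz l" unfolding mult_dist_def l_def[abs_def] ..
 have "0 <= Hs_norm rho U * C" using C(1) Hs_norm_nonneg[of rho U] by simp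
 have "on_tests schwartz l : Hs rho"
  by (rule Hs_Riesz(1)[where l=l and K="Hs_norm rho U * C" and s=rho]; rule 1 2 3; assumption)
 moreover have "Hs_norm rho (on_tests schwartz l) <= \<bar>Hs_norm rho U * C\<bar>"
  by (rule Hs_Riesz(2)[where l=l and K="Hs_norm rho U * C" and s=rho]; rule 1 2 3; assumption)
 ultimately show ?thesis unfolding e using \<open>0 <= Hs_norm rho U * C\<close> by (simp add: mult.commute)
qed
then show ?thesis using that[OF C(1)] by blast
qed

lemma mult_dist_add:
assumes G: "coeff_order rho G" and U: "U : Hs rho" "U' : Hs rho"
shows "mult_dist G (add_dist U U') = add_dist (mult_dist G U) (mult_dist G U')"
proof
fix phi :: "('a, 'b) vfun"
show "mult_dist G (add_dist U U') phi = add_dist (mult_dist G U) (mult_dist G U') phi"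
proof (cases "phi : schwartz")
 case True
 have "reg (%x. transpose (G x) *v phi x) : Hs (- rho)" by (rule coeff_regular_Hs[OF coeff_order_transpose[OF G] True]) simp
 from pair_add_left[OF U this] show ?thesis using True by (simp add: mult_dist_def on_tests_def add_dist_def)
qed (simp add: mult_dist_def on_tests_def add_dist_def)
qed

lemma mult_dist_scale:
assumes G: "coeff_order rho G" and U: "U : Hs rho"
shows "mult_dist G (scale_dist z U) = scale_dist z (mult_dist G U)"
proof
fix phi :: "('a, 'b) vfun"
show "mult_dist G (scale_dist z U) phi = scale_dist z (mult_dist G U) phi"
proof (cases "phi : schwartz")
 case True
 have "reg (%x. transpose (G x) *v phi x) : Hs (- rho)" by (rule coeff_regular_Hs[OF coeff_order_transpose[OF G] True]) simp
 from pair_scale_left[OF U this] show ?thesis using True by (simp add: mult_dist_def on_tests_def scale_dist_def)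
qed (simp add: mult_dist_def on_tests_def scale_dist_def)
qed

lemma mult_dist_diff:
assumes G: "coeff_order rho G" and U: "U : Hs rho" "U' : Hs rho"
shows "mult_dist G (diff_dist U U') = diff_dist (mult_dist G U) (mult_dist G U')"
unfolding diff_dist_eq by (simp add: mult_dist_add[OF G U(1) Hs_scale(1)[OF U(2)]] mult_dist_scale[OF G U(2)])

lemma mult_dist_tendsto:
assumes G: "coeff_order rho G" and U: "U : Hs rho" and F: "!!k. F k : Hs rho" and lim: "(%k. Hs_norm rho (diff_dist U (F k))) ---> 0"
shows "(%k. Hs_norm rho (diff_dist (mult_dist G U) (mult_dist G (F k)))) ---> 0"
proof -
obtain C where C: "0 <= C" "!!U. U : Hs rho ==> Hs_norm rho (mult_dist G U) <= C * Hs_norm rho U" using mult_dist_Hs[OF G] by metis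
have l: "(%k. C * Hs_norm rho (diff_dist U (F k))) ---> 0" using tendsto_mult[OF tendsto_const lim, of C] by simp
have b: "Hs_norm rho (diff_dist (mult_dist G U) (mult_dist G (F k))) <= C * Hs_norm rho (diff_dist U (F k))" for k
 using C(2)[OF Hs_diff[OF U F[of k]]] mult_dist_diff[OF G U F[of k]] by simp
show ?thesis
 by (rule tendsto_sandwich[OF always_eventually[OF allI[OF Hs_norm_nonneg]] always_eventually[OF allI[OF b]] tendsto_const l])
qed

text \<open>For Schwartz functions in the second factor both sides are the definition of the product; by density
the transposition rule holds for all factors.\<close>

lemma pair_mult_dist:
fixes G :: "('n::finite, 'm::finite) mfun"
assumes G: "coeff_order rho G" and U: "U : Hs rho" and V: "V : Hs (- rho)"
shows "pair (mult_dist G U) V = pair U (mult_dist (trp G) V)"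
proof -
note GT = coeff_order_transpose[OF G]
have GT': "coeff_order (- rho) (trp G)" using GT by (simp add: coeff_order_minus)
have MU: "mult_dist G U : Hs rho" using mult_dist_Hs[OF G] U by metis
have MV: "mult_dist (trp G) W : Hs (- rho)" if "W : Hs (- rho)" for W using mult_dist_Hs[OF GT'] that by metis
obtain phi where phi: "!!k::nat. phi k : schwartz" "(%k. Hs_norm (- rho) (diff_dist V (reg (phi k)))) ---> 0"
 using schwartz_dense_Hs[OF V] by blast
have e: "pair (mult_dist G U) (reg (phi k)) = pair U (mult_dist (trp G) (reg (phi k)))" for k
proof -
 have "mult_dist (trp G) (reg (phi k)) = reg (%x. transpose (G x) *v phi k x)"
  using coeff_order_Linfty[OF G] coeff_order_Linfty[OF GT] by (intro mult_dist_regular schwartz_L2 phi) simp_all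
 then show ?thesis unfolding pair_regular[OF MU phi(1)] by (simp add: mult_dist_def on_tests_def phi(1))
qed
have "(%k. pair (mult_dist G U) (reg (phi k))) ---> pair (mult_dist G U) V"
 by (rule pair_tendsto[OF MU V regular_schwartz_Hs[OF phi(1)] phi(2)])
moreover have "(%k. pair U (mult_dist (trp G) (reg (phi k)))) ---> pair U (mult_dist (trp G) V)"
 by (rule pair_tendsto[OF U MV[OF V] MV[OF regular_schwartz_Hs[OF phi(1)]] mult_dist_tendsto[OF GT' V regular_schwartz_Hs[OF phi(1)] phi(2)]])
ultimately show ?thesis unfolding e by (rule LIMSEQ_unique)
qed

section \<open>Spaces on an open set\<close>

lemma tests_schwartz: "phi : test_functions Om ==> phi : schwartz"
using test_functions_subset_schwartz by blast

lemma borel_measurable_lebesgue_AE: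
fixes f g :: "'a::euclidean_space => 'b::euclidean_space"
assumes f: "f : lmeas" and ae: "AE x in lebesgue. f x = g x"
shows "g : lmeas"
proof (rule measurableI)
obtain N where N: "N : null_sets lebesgue" "{x. f x ~= g x} \<subseteq> N" using ae by (auto simp: eventually_ae_filter)
fix A :: "'b set" assume A: "A : sets borel"
have s: "f -` A : sets lebesgue" using measurable_sets[OF f A] by simp
have n: "{x : N. P x} : sets lebesgue" for P
proof -
 have "negligible {x : N. P x}" by (rule negligible_subset[of N]) (use N(1) in \<open>auto simp: negligible_iff_null_sets\<close>)
 then show ?thesis by (simp add: negligible_iff_null_sets null_sets_def)
qed
have "g -` A \<inter> space lebesgue = (f -` A - {x : N. g x \<notin> A}) \<union> {x : N. g x : A}"
 using N(2) by auto
then show "g -` A \<inter> space lebesgue : sets lebesgue" using s n by auto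
qed simp

lemma on_tests_in: "phi : X ==> on_tests X U phi = U phi"
by (simp add: on_tests_def)

lemma on_tests_add: "on_tests X (add_dist U V) = add_dist (on_tests X U) (on_tests X V)"
by (auto simp: on_tests_def add_dist_def)

lemma on_tests_scale: "on_tests X (scale_dist z U) = scale_dist z (on_tests X U)"
by (auto simp: on_tests_def scale_dist_def)

lemma on_tests_partial: "partial_on Om j (restr Om U) = restr Om (partial_Rn j U)"
by (auto simp: fun_eq_iff partial_dist_def on_tests_def test_functions_partial tests_schwartz)

lemma test_functions_conj: "phi : test_functions Om ==> (%x. conj_vec (phi x)) : test_functions Om"
by (rule test_functions_linear_image[OF bounded_linear_conj_vec])

lemma on_tests_conj: "conj_dist (restr Om U) = restr Om (conj_dist U)"
proof -
have "(%x. conj_vec (phi x)) : test_functions Om \<longleftrightarrow> phi : test_functions Om" for phi :: "('a, 'b) vfun"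
 using test_functions_conj[of phi Om] test_functions_conj[of "%x. conj_vec (phi x)" Om] by auto
then show ?thesis by (auto simp: fun_eq_iff conj_dist_def on_tests_def)
qed

lemma partial_regular: "phi : schwartz ==> partial_Rn j (reg phi) = reg (partial j phi)"
for phi :: "('n::finite, 'm::finite) vfun"
proof -
assume phi: "phi : schwartz"
have "fourier (partial j phi) = (%xi. (dsym j xi) *s fourier phi xi)" by (intro ext fourier_of_partial phi)
then show ?thesis unfolding regular_dist_Schwartz[OF phi] regular_dist_Schwartz[OF schwartz_partial[OF phi]] of_rep_partial by simp
qed

lemma conj_regular: "conj_dist (reg phi) = reg (%x. conj_vec (phi x))"
for phi :: "('n::finite, 'm::finite) vfun"
proof
fix psi :: "('n, 'm) vfun"
have "cnj (INTG x. cdot (phi x) (conj_vec (psi x))) = (INTG x. cnj (cdot (phi x) (conj_vec (psi x))))" by simp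
also have "... = (INTG x. cdot (conj_vec (phi x)) (psi x))" by (simp flip: cdot_conj_vec)
finally show "conj_dist (reg phi) psi = reg (%x. conj_vec (phi x)) psi"
 by (simp add: conj_dist_def regular_dist_def on_tests_def schwartz_conj_iff)
qed

lemma Hs_tilde_Hs: "v : Hs_tilde Om s ==> v : Hs s"
by (simp add: Hs_tilde_def)

lemma Hs_tilde_test:
fixes phi :: "('n::finite, 'm::finite) vfun"
assumes "phi : test_functions Om"
shows "reg phi : Hs_tilde Om s"
proof -
have "diff_dist (reg phi) (reg phi) = scale_dist 0 (reg phi)"
 by (simp add: diff_dist_def scale_dist_def)
then have "Hs_norm s (diff_dist (reg phi) (reg phi)) <= 0"
 using Hs_scale(2)[OF regular_schwartz_Hs[OF tests_schwartz[OF assms]], of s 0] by simp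
then show ?thesis unfolding Hs_tilde_def using regular_schwartz_Hs[OF tests_schwartz[OF assms]] assms
 by (auto intro: bexI[of _ phi] le_less_trans)
qed

lemma Hs_tilde_sequence:
assumes "v : Hs_tilde Om s"
obtains phi where "!!k::nat. phi k : test_functions Om" "(%k. Hs_norm s (diff_dist v (reg (phi k)))) ---> 0"
proof -
have "\<exists>phi\<in>test_functions Om. Hs_norm s (diff_dist v (reg phi)) < inverse (real (Suc k))" for k
 using assms unfolding Hs_tilde_def by simp
then obtain phi where phi: "!!k. phi k : test_functions Om" "!!k. Hs_norm s (diff_dist v (reg (phi k))) < inverse (real (Suc k))"
 by metis
have "(%k. Hs_norm s (diff_dist v (reg (phi k)))) ---> 0"
 by (rule tendsto_sandwich[OF _ _ tendsto_const LIMSEQ_inverse_real_of_nat]) (simp_all add: Hs_norm_nonneg less_imp_le[OF phi(2)] del: of_nat_Suc)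
then show ?thesis using that phi(1) by blast
qed

lemma Hs_tilde_closed:
assumes v: "v : Hs s" and approx: "!!eps. eps > 0 ==> \<exists>w\<in>Hs_tilde Om s. Hs_norm s (diff_dist v w) < eps"
shows "v : Hs_tilde Om s"
unfolding Hs_tilde_def
proof (intro CollectI conjI v allI impI)
fix eps :: real assume eps: "eps > 0"
obtain w where w: "w : Hs_tilde Om s" "Hs_norm s (diff_dist v w) < eps / 2" using approx[of "eps / 2"] eps by auto
obtain phi where phi: "phi : test_functions Om" "Hs_norm s (diff_dist w (reg phi)) < eps / 2"
 using w(1) half_gt_zero[OF eps] unfolding Hs_tilde_def by blast
have "Hs_norm s (diff_dist v (reg phi)) < eps"
 using Hs_norm_diff_triangle[OF v Hs_tilde_Hs[OF w(1)] regular_schwartz_Hs[OF tests_schwartz[OF phi(1)]]] w(2) phi(2) by linarith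
then show "\<exists>phi\<in>test_functions Om. Hs_norm s (diff_dist v (reg phi)) < eps" using phi(1) by blast
qed

text \<open>A bounded map respects these closures if it does so on test functions.\<close>

lemma Hs_tilde_image:
assumes L: "!!U. U : Hs s ==> L U : Hs t" "!!U. U : Hs s ==> Hs_norm t (L U) <= C * Hs_norm s U"
 and diff: "!!U V. U : Hs s ==> V : Hs s ==> L (diff_dist U V) = diff_dist (L U) (L V)"
 and test: "!!phi. phi : test_functions Om ==> L (reg phi) : Hs_tilde Om t"
 and v: "v : Hs_tilde Om s"
shows "L v : Hs_tilde Om t"
proof (rule Hs_tilde_closed)
note vH = Hs_tilde_Hs[OF v]
show "L v : Hs t" by (rule L(1)[OF vH])
fix eps :: real assume eps: "eps > 0"
define \<delta> where "\<delta> = eps / (\<bar>C\<bar> + 1)"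
have C1: "\<bar>C\<bar> + 1 > 0" by simp
have "\<delta> > 0" using eps C1 by (simp add: \<delta>_def)
then obtain phi where phi: "phi : test_functions Om" "Hs_norm s (diff_dist v (reg phi)) < \<delta>"
 using v unfolding Hs_tilde_def by blast
note R = regular_schwartz_Hs[OF tests_schwartz[OF phi(1)]]
have "Hs_norm t (diff_dist (L v) (L (reg phi))) <= C * Hs_norm s (diff_dist v (reg phi))"
 using L(2)[OF Hs_diff[OF vH R]] diff[OF vH R] by simp
also have "... <= (\<bar>C\<bar> + 1) * Hs_norm s (diff_dist v (reg phi))" by (intro mult_right_mono Hs_norm_nonneg) simp
also have "... < (\<bar>C\<bar> + 1) * \<delta>" using phi(2) C1 by (intro mult_strict_left_mono)
also have "... = eps" using C1 by (simp add: \<delta>_def)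
finally show "\<exists>w\<in>Hs_tilde Om t. Hs_norm t (diff_dist (L v) w) < eps" using test[OF phi(1)] by blast
qed

lemma Hs_tilde_mono:
assumes "v : Hs_tilde Om t" "s <= t"
shows "v : Hs_tilde Om s"
by (rule Hs_tilde_image[of t "%U. U" s 1, OF _ _ _ _ assms(1)]) (simp_all add: Hs_mono[OF _ assms(2)] Hs_tilde_test)

lemma Hs_tilde_partial:
assumes "v : Hs_tilde Om s"
shows "partial_Rn j v : Hs_tilde Om (s - 1)"
proof (rule Hs_tilde_image[of s "partial_Rn j" "s - 1" 1, OF _ _ _ _ assms])
show "partial_Rn j (diff_dist U V) = diff_dist (partial_Rn j U) (partial_Rn j V)" for U V :: "('a, 'b) vdist"
 by (auto simp: partial_dist_def diff_dist_def on_tests_def)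
show "partial_Rn j (reg phi) : Hs_tilde Om (s - 1)" if "phi : test_functions Om" for phi :: "('a, 'b) vfun"
 unfolding partial_regular[OF tests_schwartz[OF that]] by (rule Hs_tilde_test[OF test_functions_partial[OF that]])
qed (simp_all add: Hs_partial)

lemma Hs_tilde_conj:
assumes "v : Hs_tilde Om s"
shows "conj_dist v : Hs_tilde Om s"
proof (rule Hs_tilde_image[of s conj_dist s 1, OF _ _ _ _ assms])
show "conj_dist (diff_dist U V) = diff_dist (conj_dist U) (conj_dist V)" for U V :: "('a, 'b) vdist"
 by (simp add: conj_dist_def diff_dist_def)
show "conj_dist (reg phi) : Hs_tilde Om s" if "phi : test_functions Om" for phi :: "('a, 'b) vfun"
 unfolding conj_regular by (rule Hs_tilde_test[OF test_functions_conj[OF that]])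
qed (simp_all add: Hs_conj)

text \<open>Elements of $\tilde H^{-\tau}$ are limits of test functions, on which the pairing is the action of the
distribution.\<close>

lemma dual_prod_pair:
assumes U: "U : Hs tau" and v: "v : Hs_tilde Om (- tau)"
shows "dual_prod Om tau (restr Om U) v = pair U v"
unfolding dual_prod_def
proof (rule the_equality)
have *: "(%k. restr Om U (phi k)) ---> pair U v"
 if phi: "!!k::nat. phi k : test_functions Om" and lim: "(%k. Hs_norm (- tau) (diff_dist v (reg (phi k)))) ---> 0" for phi
proof -
 have "restr Om U (phi k) = pair U (reg (phi k))" for k
  using pair_regular[OF U tests_schwartz[OF phi]] phi by (simp add: on_tests_def)
 then show ?thesis using pair_tendsto[OF U Hs_tilde_Hs[OF v] regular_schwartz_Hs[OF tests_schwartz[OF phi]] lim] by simp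
qed
then show "\<forall>phi. (\<forall>k. phi k : test_functions Om) & (%k. Hs_norm (- tau) (diff_dist v (reg (phi k)))) ---> 0 -->
  (%k. restr Om U (phi k)) ---> pair U v" by blast
fix z assume z: "\<forall>phi. (\<forall>k. phi k : test_functions Om) & (%k. Hs_norm (- tau) (diff_dist v (reg (phi k)))) ---> 0 -->
  (%k. restr Om U (phi k)) ---> z"
obtain phi where phi: "!!k::nat. phi k : test_functions Om" "(%k. Hs_norm (- tau) (diff_dist v (reg (phi k)))) ---> 0"
 using Hs_tilde_sequence[OF v] by blast
have "(%k. restr Om U (phi k)) ---> z" using z phi by blast
then show "z = pair U v" using *[OF phi] by (rule LIMSEQ_unique)
qed

section \<open>Coefficients on an open set\<close>

lemma coeff_regular_Hs_tilde:
fixes G :: "('n::finite, 'm::finite) mfun"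
assumes Om: "open Om" and G: "coeff_order rho G" and phi: "phi : test_functions Om" and \<sigma>: "\<sigma> <= \<bar>rho\<bar>"
shows "reg (%x. G x *v phi x) : Hs_tilde Om \<sigma>"
proof -
note inf = coeff_order_Linfty[OF G] and S = tests_schwartz[OF phi]
obtain K where K: "compact K" "K \<subseteq> Om" "{x. phi x ~= 0} \<subseteq> K" using test_functions_support[OF phi] .
obtain g where g: "g : Lw \<sigma>" "reg (%x. G x *v phi x) = of_rep g"
 using HsE[OF coeff_regular_Hs[OF G S \<sigma>]] by metis
obtain k where k: "k \<ge> 0" "!!(A :: complex^'m^'m) x. norm (A *v x) <= norm A * norm x * k"
 using bounded_bilinear.nonneg_bounded[OF bilinear_matvec] by blast
obtain B where B: "0 <= B" "AE x in lebesgue. norm (G x) <= B" using Linfty_bound[OF inf] .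
have int: "integrable lebesgue (%x. G x *v phi x)"
proof (rule Bochner_Integration.integrable_bound)
 show "integrable lebesgue (%x. (B * k) *R phi x)" by (intro integrable_scaleR_right schwartz_integrable S)
 show "(%x. G x *v phi x) : lmeas" by (rule mult_measurable[OF Linfty_measurable[OF inf] schwartz_measurable[OF S]])
 show "AE x in lebesgue. norm (G x *v phi x) <= norm ((B * k) *R phi x)" using B(2)
 proof eventually_elim
  case (elim x)
  have "norm (G x *v phi x) <= norm (G x) * norm (phi x) * k" by (rule k(2))
  also have "... <= B * norm (phi x) * k" using elim k(1) by (intro mult_right_mono) auto
  finally show ?case using B(1) k(1) by (simp add: mult_ac)
 qed
qed
show ?thesis
proof (rule compact_support_Hs_tilde[OF Om K(1,2) _ int g])
 show "G x *v phi x = 0" if "x \<notin> K" for x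
 proof -
  have "phi x = 0" using K(3) that by blast
  then show ?thesis by simp
 qed
qed
qed

lemma mult_dist_Hs_tilde:
fixes G :: "('n::finite, 'm::finite) mfun"
assumes Om: "open Om" and G: "coeff_order rho G" and w: "w : Hs_tilde Om rho"
shows "mult_dist G w : Hs_tilde Om rho"
proof -
obtain C where C: "!!U. U : Hs rho ==> mult_dist G U : Hs rho" "!!U. U : Hs rho ==> Hs_norm rho (mult_dist G U) <= C * Hs_norm rho U"
 using mult_dist_Hs[OF G] by metis
show ?thesis
proof (rule Hs_tilde_image[OF C mult_dist_diff[OF G] _ w])
 show "mult_dist G (reg phi) : Hs_tilde Om rho" if phi: "phi : test_functions Om" for phi
  unfolding mult_dist_regular[OF coeff_order_Linfty[OF G] coeff_order_Linfty[OF coeff_order_transpose[OF G]] schwartz_L2[OF tests_schwartz[OF phi]]]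
  by (rule coeff_regular_Hs_tilde[OF Om G phi]) simp
qed
qed

text \<open>The product on the open set is defined by the pairing of order \<open>min t 0\<close>. It is the restriction of the
product at the order at which the coefficient is known to be a multiplier, as long as both orders
have the same negative part.\<close>

lemma mult_on_restriction:
fixes G :: "('n::finite, 'm::finite) mfun"
assumes Om: "open Om" and G: "coeff_order rho G" and ae: "AE x in lebesgue. x : Om --> g x = G x"
 and t: "min t 0 = min rho 0" and U: "U : Hs rho"
shows "mult_on Om t g (restr Om U) = restr Om (mult_dist G U)"
proof
fix phi :: "('n, 'm) vfun"
show "mult_on Om t g (restr Om U) phi = restr Om (mult_dist G U) phi"
proof (cases "phi : test_functions Om")
 case True
 note GT = coeff_order_transpose[OF G]
 have m: "(%x. transpose (G x) *v phi x) : lmeas"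
  by (rule mult_measurable[OF Linfty_measurable[OF coeff_order_Linfty[OF GT]] schwartz_measurable[OF tests_schwartz[OF True]]])
 have ae': "AE x in lebesgue. transpose (G x) *v phi x = transpose (g x) *v phi x"
  using ae
 proof eventually_elim
  case (elim x)
  show ?case
  proof (cases "x : Om")
   case False
   then have "phi x = 0" by (rule test_functions_outside[OF True])
   then show ?thesis by simp
  qed (use elim in simp)
 qed
 have e: "reg (%x. transpose (g x) *v phi x) = reg (%x. transpose (G x) *v phi x)"
  by (rule regular_dist_cong_AE[OF m borel_measurable_lebesgue_AE[OF m ae'] ae', symmetric])
 have U': "U : Hs (min t 0)" unfolding t by (rule Hs_mono(1)[OF U]) simp
 have R: "reg (%x. transpose (G x) *v phi x) : Hs_tilde Om (- min t 0)"
  by (rule coeff_regular_Hs_tilde[OF Om GT True]) (unfold t, auto simp: min_def)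
 have "mult_on Om t g (restr Om U) phi = dual_prod Om (min t 0) (restr Om U) (reg (%x. transpose (g x) *v phi x))"
  unfolding mult_on_def by (rule on_tests_in[OF True])
 also have "... = pair U (reg (%x. transpose (G x) *v phi x))" unfolding e by (rule dual_prod_pair[OF U' R])
 also have "... = mult_dist G U phi" unfolding mult_dist_def by (rule on_tests_in[OF tests_schwartz[OF True], symmetric])
 finally show ?thesis unfolding on_tests_in[OF True, of "mult_dist G U"] .
qed (simp add: mult_on_def on_tests_def)
qed

text \<open>By the symmetry of the pairing, the product that uses \<open>w\<close> as second factor of the dual product is the product on $R^n$.\<close>

lemma mult_tilde_eq:
fixes G :: "('n::finite, 'm::finite) mfun"
assumes G: "coeff_order rho G" and ae: "AE x in lebesgue. x : Om --> g x = G x"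
 and t: "min t 0 = min rho 0" and w: "w : Hs_tilde Om rho"
shows "mult_tilde Om t g w = mult_dist G w"
proof
fix phi :: "('n, 'm) vfun"
show "mult_tilde Om t g w phi = mult_dist G w phi"
proof (cases "phi : schwartz")
 case True
 note GT = coeff_order_transpose[OF G]
 have m: "(%x. transpose (G x) *v phi x) : lmeas"
  by (rule mult_measurable[OF Linfty_measurable[OF coeff_order_Linfty[OF GT]] schwartz_measurable[OF True]])
 have e: "regular_dist (test_functions Om) (%x. transpose (g x) *v phi x) = restr Om (reg (%x. transpose (G x) *v phi x))"
 proof
  fix psi :: "('n, 'm) vfun"
  show "regular_dist (test_functions Om) (%x. transpose (g x) *v phi x) psi = restr Om (reg (%x. transpose (G x) *v phi x)) psi"
  proof (cases "psi : test_functions Om")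
   case psi: True
   have m': "(%x. cdot (transpose (G x) *v phi x) (psi x)) : lmeas"
    by (rule bilinear_measurable[OF bilinear_cdot m schwartz_measurable[OF tests_schwartz[OF psi]]])
   have ae': "AE x in lebesgue. cdot (transpose (G x) *v phi x) (psi x) = cdot (transpose (g x) *v phi x) (psi x)"
    using ae
   proof eventually_elim
    case (elim x)
    show ?case
    proof (cases "x : Om")
     case False
     then have "psi x = 0" by (rule test_functions_outside[OF psi])
     then show ?thesis by (simp add: bounded_bilinear.zero_right[OF bilinear_cdot])
    qed (use elim in simp)
   qed
   have "(INTG x. cdot (transpose (G x) *v phi x) (psi x)) = (INTG x. cdot (transpose (g x) *v phi x) (psi x))"
    by (rule integral_cong_AE[OF m' borel_measurable_lebesgue_AE[OF m' ae'] ae'])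
   then show ?thesis using psi tests_schwartz[OF psi] by (simp add: regular_dist_def on_tests_def)
  qed (simp add: regular_dist_def on_tests_def)
 qed
 have R: "reg (%x. transpose (G x) *v phi x) : Hs (- min t 0)"
  by (rule coeff_regular_Hs[OF GT True]) (unfold t, auto simp: min_def)
 have w': "w : Hs_tilde Om (- (- min t 0))" unfolding minus_minus t by (rule Hs_tilde_mono[OF w]) simp
 have "mult_tilde Om t g w phi = dual_prod Om (- min t 0) (restr Om (reg (%x. transpose (G x) *v phi x))) w"
  unfolding mult_tilde_def on_tests_def[of schwartz] e using True by simp
 also have "... = pair (reg (%x. transpose (G x) *v phi x)) w" by (rule dual_prod_pair[OF R w'])
 also have "... = pair w (reg (%x. transpose (G x) *v phi x))" by (rule pair_commute[OF R Hs_tilde_Hs[OF w']])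
 finally show ?thesis using True by (simp add: mult_dist_def on_tests_def[of schwartz])
qed (simp add: mult_tilde_def mult_dist_def on_tests_def)
qed

lemma Cbar_plus_coeff_order:
fixes g :: "('n::finite, 'm::finite) mfun"
assumes g: "g : Cbar_plus Om \<mu>" and rho: "\<bar>rho\<bar> = \<mu>"
shows "\<exists>G. coeff_order rho G & (AE x in lebesgue. x : Om --> g x = G x)"
proof -
obtain nu where nu: "g : Cbar Om nu" "\<bar>rho\<bar> < nu \<or> (\<bar>rho\<bar> = nu & nu : \<int>)"
 using g rho by (auto simp: Cbar_plus_def split: if_splits)
obtain G where G: "G : Winfty nu" "AE x in lebesgue. x : Om --> g x = G x" using nu(1) by (auto simp: Cbar_def)
have "coeff_order rho G" unfolding coeff_order_def
 by (intro conjI Winfty_multiplier[OF _ _ nu(2)] G Winfty_linear_image[OF bounded_linear_transpose]) simp_all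
then show ?thesis using G(2) by blast
qed

section \<open>Bounded operators\<close>

abbreviation Hs_operator :: "real => real => (('n::finite, 'm::finite) vdist => ('n, 'm) vdist) => bool" where
"Hs_operator s t \<equiv> bounded_operator (Hs s) (Hs_norm s) (Hs t) (Hs_norm t)"

lemma Hs_operatorI:
assumes "!!U. U : Hs s ==> T U : Hs t" "!!U V. U : Hs s ==> V : Hs s ==> T (add_dist U V) = add_dist (T U) (T V)"
 "!!z U. U : Hs s ==> T (scale_dist z U) = scale_dist z (T U)" "!!U. U : Hs s ==> Hs_norm t (T U) <= C * Hs_norm s U"
shows "Hs_operator s t T"
unfolding bounded_operator_def using assms by blast

lemma Hs_operatorD:
assumes "Hs_operator s t T"
shows "!!U. U : Hs s ==> T U : Hs t" "!!U V. U : Hs s ==> V : Hs s ==> T (add_dist U V) = add_dist (T U) (T V)"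
 "!!z U. U : Hs s ==> T (scale_dist z U) = scale_dist z (T U)"
using assms unfolding bounded_operator_def by blast+

lemma Hs_operator_bound:
assumes "Hs_operator s t T"
obtains C where "0 < C" "!!U. U : Hs s ==> Hs_norm t (T U) <= C * Hs_norm s U"
proof -
obtain C where C: "\<forall>U\<in>Hs s. Hs_norm t (T U) <= C * Hs_norm s U" using assms unfolding bounded_operator_def by blast
show ?thesis
proof (rule that[of "\<bar>C\<bar> + 1"])
 show "Hs_norm t (T U) <= (\<bar>C\<bar> + 1) * Hs_norm s U" if "U : Hs s" for U
  using C that mult_right_mono[OF _ Hs_norm_nonneg, of C "\<bar>C\<bar> + 1" s U] by fastforce
qed simp
qed

lemma Hs_operator_compose:
assumes T: "Hs_operator s t T" and S: "Hs_operator r s S"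
shows "Hs_operator r t (%U. T (S U))"
proof -
obtain C where C: "0 < C" "!!U. U : Hs s ==> Hs_norm t (T U) <= C * Hs_norm s U" using Hs_operator_bound[OF T] by metis
obtain D where D: "0 < D" "!!U. U : Hs r ==> Hs_norm s (S U) <= D * Hs_norm r U" using Hs_operator_bound[OF S] by metis
show ?thesis
proof (rule Hs_operatorI)
 show "Hs_norm t (T (S U)) <= (C * D) * Hs_norm r U" if U: "U : Hs r" for U
 proof -
  have "Hs_norm t (T (S U)) <= C * Hs_norm s (S U)" by (rule C(2)[OF Hs_operatorD(1)[OF S U]])
  also have "... <= C * (D * Hs_norm r U)" using C(1) by (intro mult_left_mono D(2)[OF U]) simp
  finally show ?thesis by (simp only: mult.assoc)
 qed
qed (simp_all add: Hs_operatorD[OF T] Hs_operatorD[OF S])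
qed

lemma Hs_operator_mono: "Hs_operator s t (%U. U)" if "t <= s"
by (rule Hs_operatorI[where C=1]) (simp_all add: Hs_mono[OF _ that])

lemma Hs_operator_weaken: "Hs_operator s t T ==> s <= s' ==> t' <= t ==> Hs_operator s' t' T"
using Hs_operator_compose[OF Hs_operator_mono Hs_operator_compose[OF _ Hs_operator_mono]] .

lemma Hs_operator_partial: "Hs_operator s (s - 1) (partial_Rn j)"
by (rule Hs_operatorI[where C=1])
 (auto simp: Hs_partial, auto simp: partial_dist_def add_dist_def scale_dist_def on_tests_def)

lemma Hs_operator_mult:
assumes G: "coeff_order rho G"
shows "Hs_operator rho rho (mult_dist G)"
proof -
obtain C where C: "!!U. U : Hs rho ==> mult_dist G U : Hs rho" "!!U. U : Hs rho ==> Hs_norm rho (mult_dist G U) <= C * Hs_norm rho U"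
 using mult_dist_Hs[OF G] by metis
show ?thesis by (rule Hs_operatorI[OF C(1) mult_dist_add[OF G] mult_dist_scale[OF G] C(2)])
qed

lemma Hs_operator_scale:
assumes T: "Hs_operator s t T"
shows "Hs_operator s t (%U. scale_dist z (T U))"
proof -
have "Hs_operator t t (scale_dist z)"
 by (rule Hs_operatorI[where C="cmod z"]) (simp_all add: Hs_scale, simp_all add: add_dist_def scale_dist_def algebra_simps)
from Hs_operator_compose[OF this T] show ?thesis .
qed

lemma Hs_operator_add:
assumes T: "Hs_operator s t T" and S: "Hs_operator s t S"
shows "Hs_operator s t (%U. add_dist (T U) (S U))"
proof -
obtain C where C: "0 < C" "!!U. U : Hs s ==> Hs_norm t (T U) <= C * Hs_norm s U" using Hs_operator_bound[OF T] by metis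
obtain D where D: "0 < D" "!!U. U : Hs s ==> Hs_norm t (S U) <= D * Hs_norm s U" using Hs_operator_bound[OF S] by metis
show ?thesis
proof (rule Hs_operatorI)
 fix U V :: "('a, 'b) vdist" and z
 assume U: "U : Hs s"
 show "add_dist (T U) (S U) : Hs t" by (intro Hs_add Hs_operatorD(1)[OF T U] Hs_operatorD(1)[OF S U])
 show "Hs_norm t (add_dist (T U) (S U)) <= (C + D) * Hs_norm s U"
  using Hs_add(2)[OF Hs_operatorD(1)[OF T U] Hs_operatorD(1)[OF S U]] C(2)[OF U] D(2)[OF U] by (simp add: distrib_right)
 show "add_dist (T (scale_dist z U)) (S (scale_dist z U)) = scale_dist z (add_dist (T U) (S U))"
  unfolding Hs_operatorD(3)[OF T U] Hs_operatorD(3)[OF S U] by (simp add: add_dist_def scale_dist_def distrib_left)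
 assume V: "V : Hs s"
 show "add_dist (T (add_dist U V)) (S (add_dist U V)) = add_dist (add_dist (T U) (S U)) (add_dist (T V) (S V))"
  unfolding Hs_operatorD(2)[OF T U V] Hs_operatorD(2)[OF S U V] by (simp add: add_dist_def add_ac)
qed
qed

lemma zero_dist_Hs: "((%phi. 0) :: ('n::finite, 'm::finite) vdist) : Hs s" "Hs_norm s ((%phi. 0) :: ('n, 'm) vdist) = 0"
proof -
have z: "(%phi. 0 :: complex) = reg (%x :: real^'n. 0 :: complex^'m)"
 by (simp add: regular_dist_def on_tests_def fun_eq_iff bounded_bilinear.zero_left[OF bilinear_cdot])
have H: "((%phi. 0) :: ('n, 'm) vdist) : Hs s" unfolding z by (rule regular_schwartz_Hs[OF schwartz_zero])
then show "((%phi. 0) :: ('n, 'm) vdist) : Hs s" .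
have "Hs_norm s (scale_dist 0 ((%phi. 0) :: ('n, 'm) vdist)) <= 0" using Hs_scale(2)[OF H, of 0] by simp
then show "Hs_norm s ((%phi. 0) :: ('n, 'm) vdist) = 0" using Hs_norm_nonneg[of s "(%phi. 0) :: ('n, 'm) vdist"] by (simp add: scale_dist_def)
qed

lemma Hs_operator_sum:
assumes "!!i. i : I ==> Hs_operator s t (T i)" "finite I"
shows "Hs_operator s t (%U phi. \<Sum>i\<in>I. T i U phi)"
using assms(2,1)
proof (induction I)
case empty
show ?case by (rule Hs_operatorI[where C=0]) (simp_all add: zero_dist_Hs, simp_all add: add_dist_def scale_dist_def)
next
case (insert i I)
have "Hs_operator s t (%U. add_dist (T i U) (%phi. \<Sum>i\<in>I. T i U phi))"
 using insert by (intro Hs_operator_add) auto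
then show ?case using insert(1,2) by (simp add: add_dist_def)
qed

lemma pair_sum_left:
assumes "!!i. i : I ==> U i : Hs tau" "finite I" "V : Hs (- tau)"
shows "pair (%phi. \<Sum>i\<in>I. U i phi) V = (\<Sum>i\<in>I. pair (U i) V) & (%phi. \<Sum>i\<in>I. U i phi) : Hs tau"
using assms(2,1)
proof (induction I)
case empty
have "pair (%phi. 0) V = 0 * pair (%phi. 0) V"
 using pair_scale_left[OF zero_dist_Hs(1) assms(3), of 0] by (simp add: scale_dist_def)
then show ?case by (simp add: zero_dist_Hs)
next
case (insert i I)
have a: "(%phi. \<Sum>i\<in>insert i I. U i phi) = add_dist (U i) (%phi. \<Sum>i\<in>I. U i phi)" using insert(1,2) by (simp add: add_dist_def)
have i: "U i : Hs tau" "(%phi. \<Sum>i\<in>I. U i phi) : Hs tau" using insert by auto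
show ?case unfolding a using pair_add_left[OF i assms(3)] Hs_add(1)[OF i] insert by simp
qed

lemma Hs_operator_conj:
assumes T: "Hs_operator s t T"
shows "Hs_operator s t (%U. conj_dist (T (conj_dist U)))"
proof -
obtain C where C: "0 < C" "!!U. U : Hs s ==> Hs_norm t (T U) <= C * Hs_norm s U" using Hs_operator_bound[OF T] by metis
have a: "conj_dist (add_dist U V) = add_dist (conj_dist U) (conj_dist V)" for U V :: "('a, 'b) vdist"
 by (simp add: conj_dist_def add_dist_def)
have z: "conj_dist (scale_dist z U) = scale_dist (cnj z) (conj_dist U)" for U :: "('a, 'b) vdist" and z
 by (simp add: conj_dist_def scale_dist_def)
show ?thesis
proof (rule Hs_operatorI)
 fix U V :: "('a, 'b) vdist" and w
 assume U: "U : Hs s"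
 note cU = Hs_conj(1)[OF U]
 show "conj_dist (T (conj_dist U)) : Hs t" by (rule Hs_conj(1)[OF Hs_operatorD(1)[OF T cU]])
 show "Hs_norm t (conj_dist (T (conj_dist U))) <= C * Hs_norm s U"
  using C(2)[OF cU] by (simp add: Hs_conj(2)[OF U] Hs_conj(2)[OF Hs_operatorD(1)[OF T cU]])
 show "conj_dist (T (conj_dist (scale_dist w U))) = scale_dist w (conj_dist (T (conj_dist U)))"
  unfolding z Hs_operatorD(3)[OF T cU] by simp
 assume V: "V : Hs s"
 show "conj_dist (T (conj_dist (add_dist U V))) = add_dist (conj_dist (T (conj_dist U))) (conj_dist (T (conj_dist V)))"
  unfolding a Hs_operatorD(2)[OF T cU Hs_conj(1)[OF V]] ..
qed
qed

section \<open>Forms and the operators they define\<close>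

lemma Hs_on_norm_le:
assumes "U : Hs s"
shows "Hs_on_norm Om s (restr Om U) <= Hs_norm s U"
unfolding Hs_on_norm_def
by (rule cInf_lower) (use assms in \<open>auto intro!: bdd_belowI2[where m=0] Hs_norm_nonneg\<close>)

lemma Hs_on_norm_ge:
assumes u: "u : Hs_on Om s" and K: "0 <= K" and le: "!!U. U : Hs s ==> restr Om U = u ==> y <= K * Hs_norm s U"
shows "y <= K * Hs_on_norm Om s u"
proof (cases "K = 0")
case True
then show ?thesis using u le by (auto simp: Hs_on_def)
next
case False
then have K: "K > 0" using K by simp
have "y / K <= Hs_on_norm Om s u" unfolding Hs_on_norm_def
proof (rule cInf_greatest)
 show "Hs_norm s ` {U : Hs s. restr Om U = u} ~= {}" using u by (auto simp: Hs_on_def)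
 show "y / K <= x" if "x : Hs_norm s ` {U : Hs s. restr Om U = u}" for x
  using that le K by (auto simp: field_simps)
qed
then show ?thesis using K by (simp add: field_simps)
qed

text \<open>All continuity claims for a form follow once it is the pairing with a bounded operator on the spaces
over the whole of $R^n$. The quotient norm is an infimum over extensions, and each extension satisfies
the bound. The represented distribution is determined by its values on test functions.\<close>

lemma form_of_operator:
fixes T :: "('n::finite, 'm::finite) vdist => ('n, 'm) vdist" and B :: "('n, 'm) vdist => ('n, 'm) vdist => complex"
assumes T: "Hs_operator s t T" and t': "t' = - t"
 and B: "!!U v. U : Hs s ==> v : Hs_tilde Om t' ==> B (restr Om U) v = pair (T U) v"
shows "bounded_bilinear_form (Hs_on Om s) (Hs_on_norm Om s) (Hs_tilde Om t') (Hs_norm t') B"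
 and "\<forall>u\<in>Hs_on Om s. \<exists>!w. form_represents Om t B u w"
 and "bounded_operator (Hs_on Om s) (Hs_on_norm Om s) (Hs_on Om t) (Hs_on_norm Om t) (form_operator Om t B)"
proof -
let ?R = "restr Om :: ('n, 'm) vdist => ('n, 'm) vdist"
note D = Hs_operatorD[OF T]
obtain C where C: "0 < C" "!!U. U : Hs s ==> Hs_norm t (T U) <= C * Hs_norm s U" using Hs_operator_bound[OF T] by metis
have tilde: "v : Hs (- t)" if "v : Hs_tilde Om t'" for v :: "('n, 'm) vdist" using Hs_tilde_Hs[OF that] t' by simp
have rep: "form_represents Om t B (?R U) (?R (T U))" if U: "U : Hs s" for U
 unfolding form_represents_def Hs_on_def using D(1)[OF U] B[OF U] dual_prod_pair[OF D(1)[OF U]] t' by auto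
have unique: "w = ?R (T U)" if U: "U : Hs s" and w: "form_represents Om t B (?R U) w" for U and w :: "('n, 'm) vdist"
proof -
 obtain W where W: "W : Hs t" "w = ?R W" using w unfolding form_represents_def Hs_on_def by blast
 have "W phi = T U phi" if phi: "phi : test_functions Om" for phi
 proof -
  note v = Hs_tilde_test[OF phi, of "- t"]
  have "pair W (reg phi) = dual_prod Om t w (reg phi)" unfolding W(2) by (rule dual_prod_pair[OF W(1) v, symmetric])
  also have "... = B (?R U) (reg phi)" using w v unfolding form_represents_def by blast
  also have "... = pair (T U) (reg phi)" using B[OF U] v t' by simp
  finally show ?thesis unfolding pair_regular[OF W(1) tests_schwartz[OF phi]] pair_regular[OF D(1)[OF U] tests_schwartz[OF phi]] .
 qed
 then show ?thesis unfolding W(2) by (auto simp: on_tests_def)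
qed
show "\<forall>u\<in>Hs_on Om s. \<exists>!w. form_represents Om t B u w"
proof
 fix u :: "('n, 'm) vdist" assume "u : Hs_on Om s"
 then obtain U where U: "U : Hs s" "u = ?R U" by (auto simp: Hs_on_def)
 show "\<exists>!w. form_represents Om t B u w" unfolding U(2) using rep[OF U(1)] unique[OF U(1)] by blast
qed
have op: "form_operator Om t B (?R U) = ?R (T U)" if U: "U : Hs s" for U
 unfolding form_operator_def by (rule the_equality[of "form_represents Om t B (?R U)", OF rep[OF U] unique[OF U]])
show "bounded_operator (Hs_on Om s) (Hs_on_norm Om s) (Hs_on Om t) (Hs_on_norm Om t) (form_operator Om t B)"
 unfolding bounded_operator_def
proof (intro conjI ballI allI exI[of _ C])
 fix u :: "('n, 'm) vdist" assume u: "u : Hs_on Om s"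
 then obtain U where U: "U : Hs s" "u = ?R U" by (auto simp: Hs_on_def)
 show "form_operator Om t B u : Hs_on Om t" unfolding U(2) op[OF U(1)] Hs_on_def using D(1)[OF U(1)] by blast
 show "form_operator Om t B (scale_dist z u) = scale_dist z (form_operator Om t B u)" for z
  unfolding U(2) on_tests_scale[symmetric] op[OF U(1)] op[OF Hs_scale(1)[OF U(1)]] D(3)[OF U(1)] ..
 show "Hs_on_norm Om t (form_operator Om t B u) <= C * Hs_on_norm Om s u"
 proof (rule Hs_on_norm_ge[OF u])
  fix V assume V: "V : Hs s" "?R V = u"
  show "Hs_on_norm Om t (form_operator Om t B u) <= C * Hs_norm s V"
   unfolding V(2)[symmetric] op[OF V(1)] using Hs_on_norm_le[OF D(1)[OF V(1)]] C(2)[OF V(1)] by (rule order_trans)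
 qed (use C in simp)
 fix u' :: "('n, 'm) vdist" assume "u' : Hs_on Om s"
 then obtain U' where U': "U' : Hs s" "u' = ?R U'" by (auto simp: Hs_on_def)
 show "form_operator Om t B (add_dist u u') = add_dist (form_operator Om t B u) (form_operator Om t B u')"
  unfolding U(2) U'(2) on_tests_add[symmetric] op[OF U(1)] op[OF U'(1)] op[OF Hs_add(1)[OF U(1) U'(1)]] D(2)[OF U(1) U'(1)] ..
qed
have tilde_add: "add_dist v v' : Hs_tilde Om t'" if v: "v : Hs_tilde Om t'" and v': "v' : Hs_tilde Om t'" for v v' :: "('n, 'm) vdist"
 unfolding Hs_tilde_def
proof (intro CollectI conjI allI impI)
 show "add_dist v v' : Hs t'" by (rule Hs_add(1)[OF Hs_tilde_Hs[OF v] Hs_tilde_Hs[OF v']])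
 fix eps :: real assume "eps > 0"
 then have e: "eps / 2 > 0" by simp
 obtain phi where phi: "phi : test_functions Om" "Hs_norm t' (diff_dist v (reg phi)) < eps / 2" using v e unfolding Hs_tilde_def by blast
 obtain psi where psi: "psi : test_functions Om" "Hs_norm t' (diff_dist v' (reg psi)) < eps / 2" using v' e unfolding Hs_tilde_def by blast
 note S = tests_schwartz[OF phi(1)] tests_schwartz[OF psi(1)]
 have "diff_dist (add_dist v v') (reg (%x. phi x + psi x))
  = add_dist (diff_dist v (reg phi)) (diff_dist v' (reg psi))"
  unfolding regular_dist_add[OF schwartz_L2[OF S(1)] schwartz_L2[OF S(2)], symmetric] by (simp add: diff_dist_def add_dist_def algebra_simps)
 then have "Hs_norm t' (diff_dist (add_dist v v') (reg (%x. phi x + psi x))) < eps"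
  using Hs_add(2)[OF Hs_diff[OF Hs_tilde_Hs[OF v] regular_schwartz_Hs[OF S(1)]] Hs_diff[OF Hs_tilde_Hs[OF v'] regular_schwartz_Hs[OF S(2)]]]
   phi(2) psi(2) by simp
 then show "\<exists>phi\<in>test_functions Om. Hs_norm t' (diff_dist (add_dist v v') (reg phi)) < eps"
  using test_functions_add[OF phi(1) psi(1)] by blast
qed
have tilde_scale: "scale_dist z v : Hs_tilde Om t'" if "v : Hs_tilde Om t'" for v :: "('n, 'm) vdist" and z
proof (rule Hs_tilde_image[of t' "scale_dist z" t' "cmod z", OF _ _ _ _ that])
 show "scale_dist z (diff_dist U V) = diff_dist (scale_dist z U) (scale_dist z V)" for U V :: "('n, 'm) vdist"
  by (simp add: scale_dist_def diff_dist_def right_diff_distrib)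
 show "scale_dist z (reg phi) : Hs_tilde Om t'" if phi: "phi : test_functions Om" for phi :: "('n, 'm) vfun"
 proof -
  have "scale_dist z (reg phi) = reg (%x. z *s phi x)"
   by (auto simp: fun_eq_iff scale_dist_def regular_dist_def on_tests_def cdot_smult)
  then show ?thesis using Hs_tilde_test[OF test_functions_linear_image[OF bounded_linear_smult phi]] by simp
 qed
qed (simp_all add: Hs_scale)
show "bounded_bilinear_form (Hs_on Om s) (Hs_on_norm Om s) (Hs_tilde Om t') (Hs_norm t') B"
 unfolding bounded_bilinear_form_def
proof (intro conjI ballI allI exI[of _ C])
 fix u v :: "('n, 'm) vdist" assume u: "u : Hs_on Om s" and v: "v : Hs_tilde Om t'"
 obtain U where U: "U : Hs s" "u = ?R U" using u by (auto simp: Hs_on_def)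
 note TU = D(1)[OF U(1)] and vH = tilde[OF v]
 show "B (scale_dist z u) v = z * B u v" for z
  unfolding U(2) on_tests_scale[symmetric] B[OF U(1) v] B[OF Hs_scale(1)[OF U(1)] v] D(3)[OF U(1)] by (rule pair_scale_left[OF TU vH])
 show "B u (scale_dist z v) = z * B u v" for z
  unfolding U(2) B[OF U(1) v] B[OF U(1) tilde_scale[OF v]] by (rule pair_scale_right[OF TU vH])
 have "cmod (B u v) <= (C * Hs_norm t' v) * Hs_on_norm Om s u"
 proof (rule Hs_on_norm_ge[OF u])
  fix V assume V: "V : Hs s" "?R V = u"
  have "cmod (B u v) <= Hs_norm t (T V) * Hs_norm t' v"
   unfolding V(2)[symmetric] B[OF V(1) v] t' by (rule pair_bound[OF D(1)[OF V(1)] vH])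
  also have "... <= (C * Hs_norm s V) * Hs_norm t' v" by (intro mult_right_mono C(2) V Hs_norm_nonneg)
  finally show "cmod (B u v) <= (C * Hs_norm t' v) * Hs_norm s V" by (simp only: mult_ac)
 qed (use C in \<open>simp add: Hs_norm_nonneg\<close>)
 then show "cmod (B u v) <= C * Hs_on_norm Om s u * Hs_norm t' v" by (simp only: mult_ac)
 show "B u (add_dist v v') = B u v + B u v'" if v': "v' : Hs_tilde Om t'" for v'
  unfolding U(2) B[OF U(1) v] B[OF U(1) v'] B[OF U(1) tilde_add[OF v v']] by (rule pair_add_right[OF TU vH tilde[OF v']])
next
 fix u u' v :: "('n, 'm) vdist" assume u: "u : Hs_on Om s" "u' : Hs_on Om s" and v: "v : Hs_tilde Om t'"
 obtain U where U: "U : Hs s" "u = ?R U" using u by (auto simp: Hs_on_def)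
 obtain U' where U': "U' : Hs s" "u' = ?R U'" using u by (auto simp: Hs_on_def)
 show "B (add_dist u u') v = B u v + B u' v"
  unfolding U(2) U'(2) on_tests_add[symmetric] B[OF U(1) v] B[OF U'(1) v] B[OF Hs_add(1)[OF U(1) U'(1)] v] D(2)[OF U(1) U'(1)]
  by (rule pair_add_left[OF D(1)[OF U(1)] D(1)[OF U'(1)] tilde[OF v]])
qed
qed

section \<open>The operators of the form and of its adjoint\<close>

text \<open>The differential operator in divergence form, between spaces on \<open>R^n\<close>; the second operator is
its transpose.\<close>

definition form_op :: "('n => 'n => ('n::finite, 'm::finite) mfun) => ('n => ('n, 'm) mfun) => ('n, 'm) mfun =>
 ('n, 'm) vdist => ('n, 'm) vdist" where
"form_op A B C U = add_dist (add_dist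
  (%phi. \<Sum>i\<in>UNIV. \<Sum>j\<in>UNIV. scale_dist (- 1) (partial_Rn i (mult_dist (A i j) (partial_Rn j U))) phi)
  (%phi. \<Sum>j\<in>UNIV. mult_dist (B j) (partial_Rn j U) phi)) (mult_dist C U)"

definition form_op_transpose :: "('n => 'n => ('n::finite, 'm::finite) mfun) => ('n => ('n, 'm) mfun) => ('n, 'm) mfun =>
 ('n, 'm) vdist => ('n, 'm) vdist" where
"form_op_transpose A B C V = add_dist (add_dist
  (%phi. \<Sum>i\<in>UNIV. \<Sum>j\<in>UNIV. scale_dist (- 1) (partial_Rn j (mult_dist (trp (A i j)) (partial_Rn i V))) phi)
  (%phi. \<Sum>j\<in>UNIV. scale_dist (- 1) (partial_Rn j (mult_dist (trp (B j)) V)) phi)) (mult_dist (trp C) V)"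

lemma form_op_bounded:
fixes A :: "'n => 'n => ('n::finite, 'm::finite) mfun"
assumes A: "!!i j. coeff_order (s - 1) (A i j)" and B: "!!j. coeff_order \<beta> (B j)" and C: "coeff_order gam C"
 and \<beta>: "s - 2 <= \<beta>" "\<beta> <= s - 1" and gam: "s - 2 <= gam" "gam <= s"
shows "Hs_operator s (s - 2) (form_op A B C)"
proof -
have a: "Hs_operator s (s - 2) (%U. scale_dist (- 1) (partial_Rn i (mult_dist (A i j) (partial_Rn j U))))" for i j
 using Hs_operator_scale[OF Hs_operator_compose[OF Hs_operator_partial[of "s - 1" i] Hs_operator_compose[OF Hs_operator_mult[OF A[of i j]] Hs_operator_partial[of s j]]], of "- 1"]
 by simp
have b: "Hs_operator s (s - 2) (%U. mult_dist (B j) (partial_Rn j U))" for j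
 by (rule Hs_operator_compose[OF Hs_operator_weaken[OF Hs_operator_mult[OF B[of j]] \<beta>(2,1)] Hs_operator_partial[of s j]])
have c: "Hs_operator s (s - 2) (mult_dist C)" by (rule Hs_operator_weaken[OF Hs_operator_mult[OF C] gam(2,1)])
show ?thesis unfolding form_op_def[abs_def]
 by (rule Hs_operator_add[OF Hs_operator_add[OF Hs_operator_sum[OF Hs_operator_sum[OF a finite_class.finite_UNIV] finite_class.finite_UNIV] Hs_operator_sum[OF b finite_class.finite_UNIV]] c])
qed

lemma form_op_transpose_bounded:
fixes A :: "'n => 'n => ('n::finite, 'm::finite) mfun"
assumes A: "!!i j. coeff_order (s - 1) (A i j)" and B: "!!j. coeff_order \<beta> (B j)" and C: "coeff_order gam C"
 and \<beta>: "s - 2 <= \<beta>" "\<beta> <= s - 1" and gam: "s - 2 <= gam" "gam <= s"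
shows "Hs_operator (2 - s) (- s) (form_op_transpose A B C)"
proof -
have AT: "coeff_order (1 - s) (trp (A i j))" for i j
 using coeff_order_transpose[OF A[of i j]] by (simp add: coeff_order_def abs_minus_commute)
have BT: "coeff_order (- \<beta>) (trp (B j))" for j using coeff_order_transpose[OF B[of j]] by (simp add: coeff_order_minus)
have CT: "coeff_order (- gam) (trp C)" using coeff_order_transpose[OF C] by (simp add: coeff_order_minus)
have e: "2 - s - 1 = 1 - s" "1 - s - 1 = - s" by simp_all
have a: "Hs_operator (2 - s) (- s) (%U. scale_dist (- 1) (partial_Rn j (mult_dist (trp (A i j)) (partial_Rn i U))))" for i j
 using Hs_operator_scale[OF Hs_operator_compose[OF Hs_operator_partial[of "1 - s" j] Hs_operator_compose[OF Hs_operator_mult[OF AT[of i j]] Hs_operator_partial[of "2 - s" i, unfolded e]]], of "- 1"]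
 unfolding e .
have b: "Hs_operator (2 - s) (- s) (%U. scale_dist (- 1) (partial_Rn j (mult_dist (trp (B j)) U)))" for j
 by (rule Hs_operator_weaken[OF Hs_operator_scale[OF Hs_operator_compose[OF Hs_operator_partial[of "- \<beta>" j] Hs_operator_mult[OF BT[of j]]]]])
  (use \<beta> in simp_all)
have c: "Hs_operator (2 - s) (- s) (mult_dist (trp C))"
 by (rule Hs_operator_weaken[OF Hs_operator_mult[OF CT]]) (use gam in simp_all)
show ?thesis unfolding form_op_transpose_def[abs_def]
 by (rule Hs_operator_add[OF Hs_operator_add[OF Hs_operator_sum[OF Hs_operator_sum[OF a finite_class.finite_UNIV] finite_class.finite_UNIV] Hs_operator_sum[OF b finite_class.finite_UNIV]] c])
qed

lemma pair_divergence_form: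
assumes a: "!!i j. W i j : Hs tau" and b: "!!j. X j : Hs tau" and c: "Y : Hs tau" and v: "v : Hs (- tau)"
 and fin: "finite I" "finite J"
shows "pair (add_dist (add_dist (%phi. \<Sum>i\<in>I. \<Sum>j\<in>J. W i j phi) (%phi. \<Sum>j\<in>J. X j phi)) Y) v
 = (\<Sum>i\<in>I. \<Sum>j\<in>J. pair (W i j) v) + (\<Sum>j\<in>J. pair (X j) v) + pair Y v"
proof -
have J: "pair (%phi. \<Sum>j\<in>J. W i j phi) v = (\<Sum>j\<in>J. pair (W i j) v)" "(%phi. \<Sum>j\<in>J. W i j phi) : Hs tau" for i
 using pair_sum_left[of J "W i" tau v] a fin v by auto
have I: "pair (%phi. \<Sum>i\<in>I. \<Sum>j\<in>J. W i j phi) v = (\<Sum>i\<in>I. \<Sum>j\<in>J. pair (W i j) v)" "(%phi. \<Sum>i\<in>I. \<Sum>j\<in>J. W i j phi) : Hs tau"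
 using pair_sum_left[of I "%i phi. \<Sum>j\<in>J. W i j phi" tau v] J fin v by auto
have X: "pair (%phi. \<Sum>j\<in>J. X j phi) v = (\<Sum>j\<in>J. pair (X j) v)" "(%phi. \<Sum>j\<in>J. X j phi) : Hs tau"
 using pair_sum_left[of J X tau v] b fin v by auto
show ?thesis
 unfolding pair_add_left[OF Hs_add(1)[OF I(2) X(2)] c v] pair_add_left[OF I(2) X(2) v] I(1) X(1) ..
qed

lemma form_E_eq:
fixes a A :: "'n => 'n => ('n::finite, 'm::finite) mfun"
assumes Om: "open Om"
 and A: "!!i j. coeff_order (s - 1) (A i j)" "!!i j. AE x in lebesgue. x : Om --> a i j x = A i j x"
 and B: "!!j. coeff_order \<beta> (B j)" "!!j. AE x in lebesgue. x : Om --> b j x = B j x"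
 and C: "coeff_order gam C" "AE x in lebesgue. x : Om --> c x = C x"
 and \<beta>: "s - 2 <= \<beta>" "\<beta> <= s - 1" "min (s - 1) 0 = min \<beta> 0" and gam: "s - 2 <= gam" "gam <= s" "min s 0 = min gam 0"
 and U: "U : Hs s" and v: "v : Hs_tilde Om (2 - s)"
shows "form_E_defined Om s a b c (restr Om U) v"
 and "form_E Om s a b c (restr Om U) v = pair (form_op A B C U) v"
proof -
let ?R = "restr Om"
have dU: "partial_Rn j U : Hs (s - 1)" "partial_Rn j U : Hs \<beta>" for j
 using Hs_partial(1)[OF U, of j] Hs_mono(1)[OF Hs_partial(1)[OF U] \<beta>(2), of j] by blast+
have Ugam: "U : Hs gam" by (rule Hs_mono(1)[OF U gam(2)])
have ma: "mult_on Om (s - 1) (a i j) (partial_on Om j (?R U)) = ?R (mult_dist (A i j) (partial_Rn j U))" for i j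
 unfolding on_tests_partial by (rule mult_on_restriction[OF Om A(1) A(2) refl dU(1)])
have mb: "mult_on Om (s - 1) (b j) (partial_on Om j (?R U)) = ?R (mult_dist (B j) (partial_Rn j U))" for j
 unfolding on_tests_partial by (rule mult_on_restriction[OF Om B(1) B(2) \<beta>(3) dU(2)])
have mc: "mult_on Om s c (?R U) = ?R (mult_dist C U)" by (rule mult_on_restriction[OF Om C gam(3) Ugam])
have Wa: "mult_dist (A i j) (partial_Rn j U) : Hs (s - 1)" for i j by (rule Hs_operatorD(1)[OF Hs_operator_mult[OF A(1)] dU(1)])
have Wb: "mult_dist (B j) (partial_Rn j U) : Hs (s - 2)" for j
 by (rule Hs_mono(1)[OF Hs_operatorD(1)[OF Hs_operator_mult[OF B(1)] dU(2)] \<beta>(1)])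
have Wc: "mult_dist C U : Hs (s - 2)" by (rule Hs_mono(1)[OF Hs_operatorD(1)[OF Hs_operator_mult[OF C(1)] Ugam] gam(1)])
have dv: "partial_Rn i v : Hs_tilde Om (1 - s)" for i using Hs_tilde_partial[OF v, of i] by simp
show "form_E_defined Om s a b c (?R U) v"
 unfolding form_E_defined_def ma mb mc Hs_on_def using Wa Wb Wc dv by blast
have vm: "v : Hs_tilde Om (- (s - 2))" "v : Hs (- (s - 2))" "v : Hs (1 - (s - 1))" using v Hs_tilde_Hs[OF v] by simp_all
have dvm: "partial_Rn i v : Hs_tilde Om (- (s - 1))" for i using dv by simp
have sa: "scale_dist (- 1) (partial_Rn i (mult_dist (A i j) (partial_Rn j U))) : Hs (s - 2)" for i j
 using Hs_scale(1)[OF Hs_partial(1)[OF Wa[of i j], of i], of "- 1"] by simp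
have pa: "pair (scale_dist (- 1) (partial_Rn i (mult_dist (A i j) (partial_Rn j U)))) v = pair (mult_dist (A i j) (partial_Rn j U)) (partial_Rn i v)" for i j
proof -
 have "partial_Rn i (mult_dist (A i j) (partial_Rn j U)) : Hs (s - 2)" using Hs_partial(1)[OF Wa[of i j], of i] by simp
 from pair_scale_left[OF this vm(2)] show ?thesis using pair_partial[OF Wa[of i j] vm(3), of i] by simp
qed
show "form_E Om s a b c (?R U) v = pair (form_op A B C U) v"
 unfolding form_E_def ma mb mc dual_prod_pair[OF Wa dvm] dual_prod_pair[OF Wb vm(1)] dual_prod_pair[OF Wc vm(1)]
  form_op_def pair_divergence_form[OF sa Wb Wc vm(2) finite_class.finite_UNIV finite_class.finite_UNIV] pa ..
qed

lemma form_E_tilde_eq: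
fixes a A :: "'n => 'n => ('n::finite, 'm::finite) mfun"
assumes Om: "open Om"
 and A: "!!i j. coeff_order (s - 1) (A i j)" "!!i j. AE x in lebesgue. x : Om --> a i j x = A i j x"
 and B: "!!j. coeff_order \<beta> (B j)" "!!j. AE x in lebesgue. x : Om --> b j x = B j x"
 and C: "coeff_order gam C" "AE x in lebesgue. x : Om --> c x = C x"
 and \<beta>: "s - 2 <= \<beta>" "\<beta> <= s - 1" "min (s - 1) 0 = min \<beta> 0" and gam: "s - 2 <= gam" "gam <= s" "min s 0 = min gam 0"
 and V: "V : Hs (2 - s)" and u: "u : Hs_tilde Om s"
shows "form_E_tilde_defined Om s a b c u (restr Om V)"
 and "form_E_tilde Om s a b c u (restr Om V) = pair (form_op_transpose A B C V) u"
proof -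
let ?R = "restr Om"
have AT: "coeff_order (1 - s) (trp (A i j))" for i j
 using coeff_order_transpose[OF A(1)[of i j]] by (simp add: coeff_order_def abs_minus_commute)
have BT: "coeff_order (- \<beta>) (trp (B j))" for j using coeff_order_transpose[OF B(1)[of j]] by (simp add: coeff_order_minus)
have CT: "coeff_order (- gam) (trp C)" using coeff_order_transpose[OF C(1)] by (simp add: coeff_order_minus)
have du: "partial_Rn j u : Hs_tilde Om (s - 1)" "partial_Rn j u : Hs_tilde Om \<beta>" for j
 using Hs_tilde_partial[OF u, of j] Hs_tilde_mono[OF Hs_tilde_partial[OF u] \<beta>(2), of j] by blast+
have ugam: "u : Hs_tilde Om gam" by (rule Hs_tilde_mono[OF u gam(2)])
have dV: "partial_Rn i V : Hs (1 - s)" for i using Hs_partial(1)[OF V, of i] by simp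
have ma: "mult_tilde Om (s - 1) (a i j) (partial_Rn j u) = mult_dist (A i j) (partial_Rn j u)" for i j
 by (rule mult_tilde_eq[OF A(1) A(2) refl du(1)])
have mb: "mult_tilde Om (s - 1) (b j) (partial_Rn j u) = mult_dist (B j) (partial_Rn j u)" for j
 by (rule mult_tilde_eq[OF B(1) B(2) \<beta>(3) du(2)])
have mc: "mult_tilde Om s c u = mult_dist C u" by (rule mult_tilde_eq[OF C gam(3) ugam])
have Wa: "mult_dist (A i j) (partial_Rn j u) : Hs_tilde Om (s - 1)" for i j by (rule mult_dist_Hs_tilde[OF Om A(1) du(1)])
have Wb: "mult_dist (B j) (partial_Rn j u) : Hs_tilde Om (s - 2)" for j by (rule Hs_tilde_mono[OF mult_dist_Hs_tilde[OF Om B(1) du(2)] \<beta>(1)])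
have Wc: "mult_dist C u : Hs_tilde Om (s - 2)" by (rule Hs_tilde_mono[OF mult_dist_Hs_tilde[OF Om C(1) ugam] gam(1)])
show "form_E_tilde_defined Om s a b c u (?R V)"
 unfolding form_E_tilde_defined_def ma mb mc on_tests_partial Hs_on_def using Wa Wb Wc dV by blast
have Wm: "mult_dist (A i j) (partial_Rn j u) : Hs_tilde Om (- (1 - s))" "mult_dist (B j) (partial_Rn j u) : Hs_tilde Om (- (2 - s))"
 "mult_dist C u : Hs_tilde Om (- (2 - s))" for i j using Wa Wb Wc by simp_all
have uH: "u : Hs (- (- s))" "u : Hs (1 - (1 - s))" "u : Hs (1 - (- \<beta>))" "u : Hs (- (- gam))"
 using Hs_tilde_Hs[OF u] Hs_mono(1)[OF Hs_tilde_Hs[OF u], of "1 + \<beta>"] Hs_tilde_Hs[OF ugam] \<beta>(2) by simp_all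
have duH: "partial_Rn j u : Hs (- (1 - s))" "partial_Rn j u : Hs (- (- \<beta>))" for j using Hs_tilde_Hs[OF du(1)[of j]] Hs_tilde_Hs[OF du(2)[of j]] by simp_all
have V\<beta>: "V : Hs (- \<beta>)" by (rule Hs_mono(1)[OF V]) (use \<beta> in simp)
have Vgam: "V : Hs (- gam)" by (rule Hs_mono(1)[OF V]) (use gam in simp)
have Ma: "mult_dist (trp (A i j)) (partial_Rn i V) : Hs (1 - s)" for i j by (rule Hs_operatorD(1)[OF Hs_operator_mult[OF AT] dV])
have Mb: "mult_dist (trp (B j)) V : Hs (- \<beta>)" for j by (rule Hs_operatorD(1)[OF Hs_operator_mult[OF BT] V\<beta>])
have Mc: "mult_dist (trp C) V : Hs (- s)" by (rule Hs_mono(1)[OF Hs_operatorD(1)[OF Hs_operator_mult[OF CT] Vgam]]) (use gam in simp)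
have da: "partial_Rn j (mult_dist (trp (A i j)) (partial_Rn i V)) : Hs (- s)" for i j using Hs_partial(1)[OF Ma[of i j], of j] by simp
have db: "partial_Rn j (mult_dist (trp (B j)) V) : Hs (- s)" for j by (rule Hs_mono(1)[OF Hs_partial(1)[OF Mb]]) (use \<beta> in simp)
have pa: "pair (scale_dist (- 1) (partial_Rn j (mult_dist (trp (A i j)) (partial_Rn i V)))) u = pair (partial_Rn i V) (mult_dist (A i j) (partial_Rn j u))" for i j
 using pair_scale_left[OF da[of j i] uH(1), of "- 1"] pair_partial[OF Ma[of i j] uH(2), of j] pair_mult_dist[OF AT[of i j] dV[of i] duH(1)[of j]] by simp
have pb: "pair (scale_dist (- 1) (partial_Rn j (mult_dist (trp (B j)) V))) u = pair V (mult_dist (B j) (partial_Rn j u))" for j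
 using pair_scale_left[OF db[of j] uH(1), of "- 1"] pair_partial[OF Mb[of j] uH(3), of j] pair_mult_dist[OF BT[of j] V\<beta> duH(2)[of j]] by simp
have pc: "pair (mult_dist (trp C) V) u = pair V (mult_dist C u)"
 using pair_mult_dist[OF CT Vgam uH(4)] by simp
show "form_E_tilde Om s a b c u (?R V) = pair (form_op_transpose A B C V) u"
 unfolding form_E_tilde_def ma mb mc on_tests_partial dual_prod_pair[OF dV Wm(1)] dual_prod_pair[OF V Wm(2)] dual_prod_pair[OF V Wm(3)]
  form_op_transpose_def pair_divergence_form[OF Hs_scale(1)[OF da] Hs_scale(1)[OF db] Mc uH(1) finite_class.finite_UNIV finite_class.finite_UNIV] pa pb pc ..
qed

section \<open>The theorem\<close>

theorem theorem2p3p4: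
  fixes \<Omega> :: "(real^'n) set" and s :: real
    and a :: "'n \<Rightarrow> 'n \<Rightarrow> real^'n \<Rightarrow> complex^'m^'m"
    and b :: "'n \<Rightarrow> real^'n \<Rightarrow> complex^'m^'m"
    and c :: "real^'n \<Rightarrow> complex^'m^'m"
  assumes "open \<Omega>"
    and "coeff_class \<Omega> (s - 1) a b c"
  shows "(\<forall>u\<in>Hs_on \<Omega> s. \<forall>v\<in>Hs_tilde \<Omega> (2 - s). form_E_defined \<Omega> s a b c u v) \<and>
    bounded_bilinear_form
      (Hs_on \<Omega> s) (Hs_on_norm \<Omega> s) (Hs_tilde \<Omega> (2 - s)) (Hs_norm (2 - s))
      (form_E \<Omega> s a b c) \<and>
    (\<forall>u\<in>Hs_on \<Omega> s. \<exists>!w. form_represents \<Omega> (s - 2) (form_E \<Omega> s a b c) u w) \<and>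
    bounded_operator
      (Hs_on \<Omega> s) (Hs_on_norm \<Omega> s) (Hs_on \<Omega> (s - 2)) (Hs_on_norm \<Omega> (s - 2))
      (form_operator \<Omega> (s - 2) (form_E \<Omega> s a b c)) \<and>
    (\<forall>u\<in>Hs_tilde \<Omega> s. \<forall>v\<in>Hs_on \<Omega> (2 - s).
      form_E_tilde_defined \<Omega> s a b c (conj_dist u) (conj_dist v)) \<and>
    (\<forall>v\<in>Hs_on \<Omega> (2 - s). \<exists>!w. form_represents \<Omega> (- s) (form_E_adj \<Omega> s a b c) v w) \<and>
    bounded_operator
      (Hs_on \<Omega> (2 - s)) (Hs_on_norm \<Omega> (2 - s)) (Hs_on \<Omega> (- s)) (Hs_on_norm \<Omega> (- s))
      (form_operator \<Omega> (- s) (form_E_adj \<Omega> s a b c))"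
proof -
\<comment> \<open>The numbers of least absolute value in $[s - 2, s - 1]$ and in $[s - 2, s]$. Their negative parts are those of
$s - 1$ and $s$, the orders for which the products with derivatives of \<open>u\<close> and with \<open>u\<close> are defined.\<close>
define \<beta> where "\<beta> = (if 2 <= s then s - 2 else if 1 <= s then 0 else s - 1)"
define gam where "gam = (if 2 <= s then s - 2 else if 0 <= s then 0 else s)"
have \<beta>: "s - 2 <= \<beta>" "\<beta> <= s - 1" "min (s - 1) 0 = min \<beta> 0" "\<bar>\<beta>\<bar> = max 0 (\<bar>s - 1 - 1/2\<bar> - 1/2)"
 by (auto simp: \<beta>_def)
have gam: "s - 2 <= gam" "gam <= s" "min s 0 = min gam 0" "\<bar>gam\<bar> = max 0 (\<bar>s - 1\<bar> - 1)"
 by (auto simp: gam_def)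
have cls: "a i j : Cbar_plus \<Omega> \<bar>s - 1\<bar>" "b j : Cbar_plus \<Omega> (max 0 (\<bar>s - 1 - 1/2\<bar> - 1/2))" "c : Cbar_plus \<Omega> (max 0 (\<bar>s - 1\<bar> - 1))" for i j
 using assms(2) unfolding coeff_class_def by blast+
have "\<exists>Ai. \<forall>j. coeff_order (s - 1) (Ai j) & (AE x in lebesgue. x : \<Omega> --> a i j x = Ai j x)" for i
 by (rule choice[OF allI[OF Cbar_plus_coeff_order[OF cls(1) refl]]])
then have "\<exists>A. \<forall>i. \<forall>j. coeff_order (s - 1) (A i j) & (AE x in lebesgue. x : \<Omega> --> a i j x = A i j x)"
 by (rule choice[OF allI])
then obtain A where A: "!!i j. coeff_order (s - 1) (A i j)" "!!i j. AE x in lebesgue. x : \<Omega> --> a i j x = A i j x" by blast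
have "\<exists>B. \<forall>j. coeff_order \<beta> (B j) & (AE x in lebesgue. x : \<Omega> --> b j x = B j x)"
 by (rule choice[OF allI[OF Cbar_plus_coeff_order[OF cls(2) \<beta>(4)]]])
then obtain B where B: "!!j. coeff_order \<beta> (B j)" "!!j. AE x in lebesgue. x : \<Omega> --> b j x = B j x" by blast
obtain C where C: "coeff_order gam C" "AE x in lebesgue. x : \<Omega> --> c x = C x"
 using Cbar_plus_coeff_order[OF cls(3) gam(4)] by blast
note E = form_E_eq[where a=a and A=A and b=b and B=B and c=c and C=C, OF assms(1) A B C \<beta>(1-3) gam(1-3)]
note E' = form_E_tilde_eq[where a=a and A=A and b=b and B=B and c=c and C=C, OF assms(1) A B C \<beta>(1-3) gam(1-3)]
have T: "Hs_operator s (s - 2) (form_op A B C)" by (rule form_op_bounded[OF A(1) B(1) C(1) \<beta>(1,2) gam(1,2)])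
have T': "Hs_operator (2 - s) (- s) (form_op_transpose A B C)" by (rule form_op_transpose_bounded[OF A(1) B(1) C(1) \<beta>(1,2) gam(1,2)])
have minus: "2 - s = - (s - 2)" "s = - (- s)" by simp_all
note F = form_of_operator[OF T minus(1) E(2)]
have adj: "form_E_adj \<Omega> s a b c (restr \<Omega> V) u = pair (conj_dist (form_op_transpose A B C (conj_dist V))) u"
 if V: "V : Hs (2 - s)" and u: "u : Hs_tilde \<Omega> s" for V u
proof -
 have uH: "conj_dist u : Hs (- (- s))" using Hs_conj(1)[OF Hs_tilde_Hs[OF u]] by simp
 have TH: "form_op_transpose A B C (conj_dist V) : Hs (- s)" by (rule Hs_operatorD(1)[OF T' Hs_conj(1)[OF V]])
 have "form_E_adj \<Omega> s a b c (restr \<Omega> V) u = cnj (pair (form_op_transpose A B C (conj_dist V)) (conj_dist u))"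
  unfolding form_E_adj_def on_tests_conj E'(2)[OF Hs_conj(1)[OF V] Hs_tilde_conj[OF u]] ..
 also have "... = pair (conj_dist (form_op_transpose A B C (conj_dist V))) (conj_dist (conj_dist u))"
  by (rule pair_conj[OF TH uH, symmetric])
 finally show ?thesis by simp
qed
note F' = form_of_operator[OF Hs_operator_conj[OF T'] minus(2) adj]
have "\<forall>u\<in>Hs_on \<Omega> s. \<forall>v\<in>Hs_tilde \<Omega> (2 - s). form_E_defined \<Omega> s a b c u v"
 unfolding Hs_on_def using E(1) by blast
moreover have "form_E_tilde_defined \<Omega> s a b c (conj_dist u) (conj_dist v)" if u: "u : Hs_tilde \<Omega> s" and v: "v : Hs_on \<Omega> (2 - s)" for u v
proof -
 obtain V where V: "V : Hs (2 - s)" "v = restr \<Omega> V" using v by (auto simp: Hs_on_def)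
 show ?thesis unfolding V(2) on_tests_conj by (rule E'(1)[OF Hs_conj(1)[OF V(1)] Hs_tilde_conj[OF u]])
qed
ultimately show ?thesis using F F'(2,3) by blast
qed

end
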